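(* Let $f\geq 3$, and for $\alpha\in\mathrm{GF}(2^f)$ let $\Gamma(f,\alpha)=\mathrm{Cos}(G,L,Lg_\alpha L)$. (a) Let $\alpha,\beta\in\mathrm{GF}(2^f)$ be such that $\Gamma(f,\alpha)$ and $\Gamma(f,\beta)$ are connected. Then $\Gamma(f,\alpha)\cong\Gamma(f,\beta)$ if and only if $\beta\in\{\alpha^{2^i}\mid 0\leq i<f\}\cup\{\alpha^{2^i}+1\mid 0\leq i<f\}$. (b) The number of pairwise non-isomorphic connected graphs among the $\Gamma(f,\alpha)$, $\alpha\in\mathrm{GF}(2^f)$, is greater than $2^{f-2}/f$ if $f$ is odd and greater than $(2^{f-2}-2^{f/2-1})/f$ if $f$ is even.
   Context: Let $T=\mathrm{PSL}(2,2^f)$, viewed as the group of permutations $t_{p,q,r,s}:x\mapsto \frac{px+q}{rx+s}$ of $\mathrm{GF}(2^f)\cup\{\infty\}$ with $p,q,r,s\in\mathrm{GF}(2^f)$, $ps-qr\neq0$ (usual conventions for $\infty$). Permutations act on the right, and $x^y=y^{-1}xy$. Put $a=t_{1,1,1,0}$, $b=t_{1,1,0,1}$ (so $\langle a,b\rangle=\mathrm{PSL}(2,2)\cong S_3$) and $u_\alpha=t_{1,\alpha,0,1}$ for $\alpha\in\mathrm{GF}(2^f)$. Let $G=T^2\rtimes\langle\pi\rangle$, where $\pi$ has order $2$ and $(x,y)^\pi=(y,x)$ for $(x,y)\in T^2$; let $L=\langle(a,a),(b,b)\rangle<T^2$ and $g_\alpha=(u_\alpha,bu_\alpha)\pi\in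 G$; then $Lg_\alpha L=Lg_\alpha^{-1}L$. For a group $X$, subgroup $Y$ and $g\in X$ with $YgY=Yg^{-1}Y$, the coset graph $\mathrm{Cos}(X,Y,YgY)$ has as vertices the right cosets of $Y$ in $X$, with $Yx_1,Yx_2$ adjacent iff $x_2x_1^{-1}\in YgY$. *)

theory Defs
  imports "HOL-Algebra.Algebra" "HOL-Library.Cardinality" "Graph_Theory.Graph_Theory"
begin

text \<open>The field \<open>GF(2\<^sup>f)\<close> is a type \<open>'a\<close> of class \<open>field\<close> with \<open>2\<^sup>f\<close> elements; \<open>None\<close> is
  the point \<open>\<infinity>\<close> of the projective line.\<close>

definition moebius :: "'a::field \<Rightarrow> 'a \<Rightarrow> 'a \<Rightarrow> 'a \<Rightarrow> 'a option \<Rightarrow> 'a option" where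
  "moebius p q r s x =
     (case x of
        None \<Rightarrow> if r = 0 then None else Some (p / r)
      | Some y \<Rightarrow> if r * y + s = 0 then None else Some ((p * y + q) / (r * y + s)))"

text \<open>Permutations act on the right: the product \<open>g h\<close> means first \<open>g\<close>, then \<open>h\<close>. Over a finite
  field of characteristic 2 the group of all these maps is \<open>PSL(2, 'a)\<close>.\<close>

definition T_group :: "('a::field option \<Rightarrow> 'a option) monoid" where
  "T_group = \<lparr>carrier = {moebius p q r s | p q r s. p * s - q * r \<noteq> 0},
              monoid.mult = (\<lambda>g h. h \<circ> g), one = id\<rparr>"

definition a_elt :: "'a::field option \<Rightarrow> 'a option" where
  "a_elt = moebius 1 1 1 0"

definition b_elt :: "'a::field option \<Rightarrow> 'a option" where
  "b_elt = moebius 1 1 0 1"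

definition u_elt :: "'a::field \<Rightarrow> 'a option \<Rightarrow> 'a option" where
  "u_elt \<alpha> = moebius 1 \<alpha> 0 1"

text \<open>The pair \<open>(n, k)\<close> stands for the product \<open>n k\<close>, and \<open>act k n\<close> for \<open>n\<^sup>k = k\<inverse> n k\<close>, a right
  action; hence \<open>(n k) (n' k') = n (k n' k\<inverse>) (k k')\<close> where \<open>k n' k\<inverse>\<close> is \<open>act (k\<inverse>) n'\<close>.\<close>

definition semidirect_prod ::
  "('n, 'p) monoid_scheme \<Rightarrow> ('k, 'q) monoid_scheme \<Rightarrow> ('k \<Rightarrow> 'n \<Rightarrow> 'n) \<Rightarrow> ('n \<times> 'k) monoid" where
  "semidirect_prod N K act =
     \<lparr>carrier = carrier N \<times> carrier K,
      monoid.mult = (\<lambda>(n, k) (n', k'). (n \<otimes>\<^bsub>N\<^esub> act (inv\<^bsub>K\<^esub> k) n', k \<otimes>\<^bsub>K\<^esub> k')),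
      one = (\<one>\<^bsub>N\<^esub>, \<one>\<^bsub>K\<^esub>)\<rparr>"

text \<open>The group \<open>\<langle>\<pi>\<rangle>\<close> of order 2 is the additive group of integers modulo 2, with \<open>\<pi>\<close> being \<open>1\<close>.\<close>

type_synonym 'a G_elt =
  "(('a option \<Rightarrow> 'a option) \<times> ('a option \<Rightarrow> 'a option)) \<times> int"

definition G_group :: "'a::field G_elt monoid" where
  "G_group = semidirect_prod (T_group \<times>\<times> T_group) (integer_mod_group 2)
     (\<lambda>k (x, y). if k = 1 then (y, x) else (x, y))"

definition L_subgroup :: "'a::field G_elt set" where
  "L_subgroup = generate G_group {((a_elt, a_elt), 0), ((b_elt, b_elt), 0)}"

definition g_elt :: "'a::field \<Rightarrow> 'a G_elt" where
  "g_elt \<alpha> = ((u_elt \<alpha>, b_elt \<otimes>\<^bsub>T_group\<^esub> u_elt \<alpha>), 1)"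

text \<open>The coset graph \<open>Cos(H, Y, YgY)\<close>, an undirected graph being represented by the digraph with
  both arcs for every edge. The graph is only formed when \<open>YgY = Yg\<inverse>Y\<close>, which makes the arc
  relation symmetric.\<close>

definition coset_graph :: "('g, 'm) monoid_scheme \<Rightarrow> 'g set \<Rightarrow> 'g \<Rightarrow> 'g set pair_pre_digraph" where
  "coset_graph H Y g =
     \<lparr>pverts = rcosets\<^bsub>H\<^esub> Y,
      parcs = {(Y #>\<^bsub>H\<^esub> x1, Y #>\<^bsub>H\<^esub> x2) | x1 x2. x1 \<in> carrier H \<and> x2 \<in> carrier H \<and>
                 x2 \<otimes>\<^bsub>H\<^esub> inv\<^bsub>H\<^esub> x1 \<in> (Y #>\<^bsub>H\<^esub> g) <#>\<^bsub>H\<^esub> Y}\<rparr>"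

definition Gamma :: "'a::field \<Rightarrow> ('a G_elt set, 'a G_elt set \<times> 'a G_elt set) pre_digraph" where
  "Gamma \<alpha> = with_proj (coset_graph G_group L_subgroup (g_elt \<alpha>))"

definition num_iso_classes :: "('v, 'e) pre_digraph set \<Rightarrow> nat" where
  "num_iso_classes S = card (S // {(A, B). A \<in> S \<and> B \<in> S \<and> digraph_iso A B})"

end

(* The graphs are cubic, and right multiplication by G together with Lx |-> L pi x pi gives a
   group G2 acting regularly on 3-arcs.
   By Tutte's theorem (a cubic s-arc-regular graph has s <= 5) G2 has index at most 4 in the full
   automorphism group, so the 24th power of every automorphism is right multiplication by an element
   of T^2. As T^2 is generated by 24th powers, an isomorphism of the graphs for alpha and beta that
   preserves a standard 2-arc conjugates T^2 into itself, fixing (b, b) and the involution of (a, b)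
   acting as x |-> 1/x. Restricted to the translations of one factor this is an additive map of the
   field that preserves braid relations of opposite unipotents, hence inverses, hence (Hua's identity)
   products: a power of Frobenius that carries alpha to beta or beta + 1.
   If alpha lies in no proper subfield, the elements reached from L project onto both factors T, so
   the graph is connected unless these elements form the graph of an automorphism of T; that forces
   alpha^(2^(f/2)) = alpha + 1. Counting such alpha gives the bound in (b). *)
theory Submission
  imports Defs "HOL-Computational_Algebra.Polynomial"
begin

section \<open>Tutte's theorem on cubic graphs\<close>

text \<open>The full automorphism group is never determined, and an isomorphism is not known to
  carry G2 to G2. Only exponents are controlled: by Tutte's bound one of the first four powers of an
  automorphism lies in G2, squares in G2 act as elements of T^2, and 24 is a common multiple of 2,
  4, 6, 8. A fixed exponent is what survives conjugation by an unknown isomorphism. It must not kill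
  T: over GF(4) every dilation has trivial 24th power, while \<open>f \<ge> 3\<close> leaves a
  dilation with a nontrivial one, and simplicity of T does the rest.

  Tutte's bound compares two estimates for the least distance lam of noncommuting involutions along
  a translated line. An involution cannot be central in both vertex stabilizers of an edge, which
  forces 2 lam <= s + 1; commutators of involutions force 3 lam >= 2 s - 2. For s >= 6 this leaves
  only s = 7 with lam = 4, and that case dies at a vertex with three branches.

  In (b), a class of isomorphic graphs has at most 2f parameters, and more than half of the field
  lies in no proper subfield.\<close>

locale cubic_graph =
  fixes V :: "'v set" and adj :: "'v \<Rightarrow> 'v \<Rightarrow> bool"
  assumes finite_V: "finite V"
    and adj_V: "adj x y \<Longrightarrow> x \<in> V"
    and adj_sym: "adj x y \<Longrightarrow> adj y x"
    and cubic: "x \<in> V \<Longrightarrow> card {y. adj x y} = 3"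
    and conn: "\<lbrakk>x \<in> V; y \<in> V\<rbrakk> \<Longrightarrow> adj\<^sup>*\<^sup>* x y"
begin

text \<open>Automorphisms act on the whole type and are the identity off \<open>V\<close>, so that
  composition, inverses and equality with \<open>id\<close> are those of total functions.\<close>

definition Aut :: "('v \<Rightarrow> 'v) set" where
  "Aut = {p. bij p \<and> (\<forall>x. x \<notin> V \<longrightarrow> p x = x) \<and> (\<forall>x y. adj (p x) (p y) \<longleftrightarrow> adj x y)}"

text \<open>An arc is a window of a function on the integers: shifting, reversing and prolonging
  become reindexing or updating, and the same notion covers two-way infinite walks.\<close>

definition arc :: "(int \<Rightarrow> 'v) \<Rightarrow> int \<Rightarrow> int \<Rightarrow> bool" where
  "arc v i j \<longleftrightarrow> (\<forall>k. i \<le> k \<and> k < j \<longrightarrow> adj (v k) (v (k + 1))) \<and>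
     (\<forall>k. i < k \<and> k < j \<longrightarrow> v (k - 1) \<noteq> v (k + 1))"

definition fixes_arc :: "('v \<Rightarrow> 'v) \<Rightarrow> (int \<Rightarrow> 'v) \<Rightarrow> int \<Rightarrow> int \<Rightarrow> bool" where
  "fixes_arc p v i j \<longleftrightarrow> (\<forall>k. i \<le> k \<and> k \<le> j \<longrightarrow> p (v k) = v k)"

definition arc_transitive :: "int \<Rightarrow> bool" where
  "arc_transitive s \<longleftrightarrow> (\<forall>v w. arc v 0 s \<longrightarrow> arc w 0 s \<longrightarrow>
     (\<exists>p\<in>Aut. \<forall>k. 0 \<le> k \<and> k \<le> s \<longrightarrow> p (v k) = w k))"

lemma Aut_id: "id \<in> Aut"
  by (simp add: Aut_def)

lemma Aut_comp: "\<lbrakk>p \<in> Aut; q \<in> Aut\<rbrakk> \<Longrightarrow> p \<circ> q \<in> Aut"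
  by (auto simp: Aut_def intro: bij_comp)

lemma Aut_inv: "p \<in> Aut \<Longrightarrow> inv_into UNIV p \<in> Aut"
  unfolding Aut_def
  by (auto simp: bij_imp_bij_inv bij_inv_eq_iff) (metis bij_inv_eq_iff)+

lemma Aut_inv_simps:
  assumes "p \<in> Aut" shows "p (inv_into UNIV p x) = x" "inv_into UNIV p (p x) = x"
  using assms by (auto simp: Aut_def bij_is_surj surj_f_inv_f bij_is_inj)

lemma Aut_inj: "p \<in> Aut \<Longrightarrow> p x = p y \<longleftrightarrow> x = y"
  by (auto simp: Aut_def bij_def dest: injD)

lemma Aut_adj: "p \<in> Aut \<Longrightarrow> adj (p x) (p y) \<longleftrightarrow> adj x y"
  by (simp add: Aut_def)

lemma Aut_eq_id:
  assumes "p \<in> Aut" "\<And>x. x \<in> V \<Longrightarrow> p x = x" shows "p = id"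
  using assms by (auto simp: Aut_def fun_eq_iff)

lemma adj_V2: "adj x y \<Longrightarrow> y \<in> V"
  using adj_V adj_sym by blast

lemma third:
  assumes "adj z a" "adj z b" "a \<noteq> b"
  obtains c where "adj z c" "c \<noteq> a" "c \<noteq> b" "\<And>y. adj z y \<longleftrightarrow> y = a \<or> y = b \<or> y = c"
proof -
  have "card {y. adj z y} = 3" using assms adj_V cubic by blast
  then obtain x1 x2 x3 where x: "{y. adj z y} = {x1,x2,x3}" "x1 \<noteq> x2" "x2 \<noteq> x3" "x1 \<noteq> x3"
    by (auto simp: card_3_iff)
  then have "\<And>y. adj z y \<longleftrightarrow> y = x1 \<or> y = x2 \<or> y = x3" by auto
  with that assms x(2-) show thesis by metis
qed

lemma other:
  assumes "adj z a" obtains b where "adj z b" "b \<noteq> a"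
proof -
  have "card {y. adj z y} = 3" using assms adj_V cubic by blast
  then obtain x1 x2 x3 where x: "{y. adj z y} = {x1,x2,x3}" "x1 \<noteq> x2" by (auto simp: card_3_iff)
  then have "adj z x1" "adj z x2" by auto
  with that x(2) show thesis by metis
qed

text \<open>The image of the third neighbour is again a neighbour of \<open>z\<close>, different
  from \<open>a\<close> and \<open>b\<close>.\<close>

lemma fix_third:
  assumes p: "p \<in> Aut" and ab: "adj z a" "adj z b" "a \<noteq> b"
    and fx: "p z = z" "p a = a" "p b = b" and c: "adj z c"
  shows "p c = c"
proof -
  obtain d where d: "d \<noteq> a" "d \<noteq> b" "\<And>y. adj z y \<longleftrightarrow> y = a \<or> y = b \<or> y = d"
    using third[OF ab] by metis
  have "adj (p z) (p d)" unfolding Aut_adj[OF p] d(3) by simp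
  then have "adj z (p d)" unfolding fx(1) .
  moreover have "p d \<noteq> p a" "p d \<noteq> p b" unfolding Aut_inj[OF p] using d by auto
  ultimately have "p d = d" unfolding fx d(3) by blast
  with fx c show ?thesis unfolding d(3) by metis
qed

text \<open>Both automorphisms permute the two neighbours of \<open>z\<close> other than
  \<open>u\<close>, and a permutation of two points that moves one of them is the
  transposition.\<close>

lemma moved_swap:
  assumes p: "p \<in> Aut" and q: "q \<in> Aut" and ua: "adj z u" "adj z a"
    and fx: "p z = z" "q z = z" "p u = u" "q u = u" "p a \<noteq> a" "q a \<noteq> a"
  shows "p a = q a" "p (q a) = a"
proof -
  have "u \<noteq> a" using fx by auto
  obtain d where d: "d \<noteq> u" "d \<noteq> a" "\<And>y. adj z y \<longleftrightarrow> y = u \<or> y = a \<or> y = d"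
    using third[OF ua \<open>u \<noteq> a\<close>] by metis
  have *: "r a = d \<and> r d = a" if r: "r \<in> Aut" and rz: "r z = z" "r u = u" "r a \<noteq> a" for r
  proof -
    have "adj (r z) (r a)" "adj (r z) (r d)" unfolding Aut_adj[OF r] d(3) by auto
    then have "adj z (r a)" "adj z (r d)" unfolding rz by auto
    moreover have "r a \<noteq> r u" "r d \<noteq> r u" "r d \<noteq> r a"
      unfolding Aut_inj[OF r] using d \<open>u \<noteq> a\<close> by auto
    ultimately show ?thesis using rz unfolding d(3) by metis
  qed
  show "p a = q a" "p (q a) = a" using *[OF p] *[OF q] fx by auto
qed

text \<open>On the neighbours of \<open>z\<close> both automorphisms act through the group of order
  2 that fixes \<open>u\<close>, which is abelian.\<close>

lemma local_commute:
  assumes p: "p \<in> Aut" and q: "q \<in> Aut" and ua: "adj z u" "adj z a"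
    and fx: "p z = z" "q z = z" "p u = u" "q u = u"
  shows "p (q a) = q (p a)"
proof -
  have "adj (p z) (p a)" "adj (q z) (q a)" unfolding Aut_adj[OF p] Aut_adj[OF q] by (rule ua)+
  then have adj: "adj z (p a)" "adj z (q a)" unfolding fx .
  consider "a = u" | "a \<noteq> u" "p a = a" | "a \<noteq> u" "q a = a" | "p a \<noteq> a" "q a \<noteq> a" by blast
  then show ?thesis
  proof cases
    case 1 then show ?thesis using fx by simp
  next
    case 2 then show ?thesis using fix_third[OF p ua(2) ua(1) _ _ _ _ adj(2)] fx by simp
  next
    case 3 then show ?thesis using fix_third[OF q ua(2) ua(1) _ _ _ _ adj(1)] fx by simp
  next
    case 4
    then show ?thesis using moved_swap[OF p q ua fx] moved_swap[OF q p ua fx(2,1,4,3)] by simp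
  qed
qed

lemma arc_sub: "\<lbrakk>arc v i j; i \<le> i'; j' \<le> j\<rbrakk> \<Longrightarrow> arc v i' j'"
  by (auto simp: arc_def)

lemma arc_shift: "arc (\<lambda>k. v (k + m)) i j \<longleftrightarrow> arc v (i + m) (j + m)"
proof -
  have 1: "(\<forall>k. i \<le> k \<and> k < j \<longrightarrow> P (k + m)) \<longleftrightarrow> (\<forall>k. i + m \<le> k \<and> k < j + m \<longrightarrow> P k)" for P
    by (metis add_le_cancel_right add_less_cancel_right diff_add_cancel)
  have 2: "(\<forall>k. i < k \<and> k < j \<longrightarrow> P (k + m)) \<longleftrightarrow> (\<forall>k. i + m < k \<and> k < j + m \<longrightarrow> P k)" for P
    by (metis add_less_cancel_right diff_add_cancel)
  show ?thesis unfolding arc_def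
    using 1[of "\<lambda>k. adj (v k) (v (k + 1))"] 2[of "\<lambda>k. v (k - 1) \<noteq> v (k + 1)"]
    by (simp add: algebra_simps)
qed

lemma arc_reflect: "arc (\<lambda>k. v (m - k)) i j \<longleftrightarrow> arc v (m - j) (m - i)"
proof -
  have 1: "(\<forall>k. i \<le> k \<and> k < j \<longrightarrow> P (m - k - 1)) \<longleftrightarrow> (\<forall>k. m - j \<le> k \<and> k < m - i \<longrightarrow> P k)" (is "?A = ?B") for P
  proof
    assume ?A
    show ?B
    proof (intro allI impI)
      fix k assume "m - j \<le> k \<and> k < m - i"
      then show "P k" using \<open>?A\<close>[rule_format, of "m - k - 1"] by simp
    qed
  qed auto
  have 2: "(\<forall>k. i < k \<and> k < j \<longrightarrow> P (m - k)) \<longleftrightarrow> (\<forall>k. m - j < k \<and> k < m - i \<longrightarrow> P k)" (is "?A = ?B") for P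
  proof
    assume ?A
    show ?B
    proof (intro allI impI)
      fix k assume "m - j < k \<and> k < m - i"
      then show "P k" using \<open>?A\<close>[rule_format, of "m - k"] by simp
    qed
  qed auto
  have s: "adj x y \<longleftrightarrow> adj y x" for x y using adj_sym by blast
  have d: "v (m - (k - 1)) \<noteq> v (m - (k + 1)) \<longleftrightarrow> v (m - k - 1) \<noteq> v (m - k + 1)" for k
    by (auto simp: algebra_simps)
  have a: "adj (v (m - k)) (v (m - (k + 1))) \<longleftrightarrow> adj (v (m - k - 1)) (v (m - k - 1 + 1))" for k
    using s by (simp add: algebra_simps)
  show ?thesis unfolding arc_def a d
    using 1[of "\<lambda>k. adj (v k) (v (k + 1))"] 2[of "\<lambda>k. v (k - 1) \<noteq> v (k + 1)"]
    by simp
qed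

lemma arc_extend:
  assumes "arc v i j" "i \<le> j" "adj (v j) y" "i < j \<Longrightarrow> v (j - 1) \<noteq> y"
  shows "arc (v(j + 1 := y)) i (j + 1)"
  using assms unfolding arc_def by auto

lemma arc_Aut: "p \<in> Aut \<Longrightarrow> arc (\<lambda>k. p (v k)) i j \<longleftrightarrow> arc v i j"
  by (simp add: arc_def Aut_adj Aut_inj)

lemma arc_trivial: "arc v i i"
  by (auto simp: arc_def)

lemma arc_step: "\<lbrakk>arc v i j; i \<le> k; k < j\<rbrakk> \<Longrightarrow> adj (v k) (v (k + 1))"
  by (simp add: arc_def)

lemma arc_step': "\<lbrakk>arc v i j; i < k; k \<le> j\<rbrakk> \<Longrightarrow> adj (v k) (v (k - 1))"
  using arc_step[of v i j "k - 1"] adj_sym by simp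

lemma arc_noback: "\<lbrakk>arc v i j; i < k; k < j\<rbrakk> \<Longrightarrow> v (k - 1) \<noteq> v (k + 1)"
  by (simp add: arc_def)

lemma arcs_exist:
  assumes "x \<in> V" shows "\<exists>v. v 0 = x \<and> arc v 0 (int n)"
proof (induction n)
  case 0 show ?case by (rule exI[of _ "\<lambda>_. x"]) (simp add: arc_trivial)
next
  case (Suc n)
  then obtain v where v: "v 0 = x" "arc v 0 (int n)" by blast
  show ?case
  proof (cases "n = 0")
    case True
    have "card {y. adj x y} = 3" using assms cubic by blast
    then have "{y. adj x y} \<noteq> {}" by force
    then obtain y where "adj x y" by auto
    then have "arc (v(0 + 1 := y)) 0 (0 + 1)" using v True by (intro arc_extend) auto
    then have "arc (v(0 + 1 := y)) 0 (int (Suc n))" using True by (simp only: of_nat_Suc of_nat_0 add.commute)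
    moreover have "(v(0 + 1 := y)) 0 = x" using v(1) by simp
    ultimately show ?thesis by blast
  next
    case False
    then have "adj (v (int n)) (v (int n - 1))" using arc_step'[OF v(2), of "int n"] by simp
    then obtain y where y: "adj (v (int n)) y" "y \<noteq> v (int n - 1)" by (rule other)
    have "arc (v(int n + 1 := y)) 0 (int n + 1)" by (rule arc_extend[OF v(2) _ y(1)]) (use y in auto)
    then have "arc (v(int n + 1 := y)) 0 (int (Suc n))" by (simp only: of_nat_Suc add.commute)
    moreover have "(v(int n + 1 := y)) 0 = x" using v(1) by simp
    ultimately show ?thesis by blast
  qed
qed

text \<open>In a finite graph a long arc passes some edge twice in the same direction. An
  automorphism that fixes the stretch up to the second passage also fixes the vertex after it, which
  has occurred before, so it cannot send that vertex to another continuation.\<close>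

lemma not_arc_transitive:
  assumes "x \<in> V" shows "\<exists>m\<ge>1. \<not> arc_transitive (int m + 1)"
proof -
  define N where "N = card (V \<times> V) + 2"
  obtain v where v: "v 0 = x" "arc v 0 (int N)" using arcs_exist[OF assms] by blast
  define F where "F k = (v (int k), v (int k + 1))" for k
  have "F k \<in> V \<times> V" if "k < N" for k
    using arc_step[OF v(2), of "int k"] adj_V adj_V2 that unfolding F_def by simp
  then have "F ` {..<N} \<subseteq> V \<times> V" by blast
  then have "card (F ` {..<N}) \<le> card (V \<times> V)"
    by (rule card_mono[rotated]) (simp add: finite_V)
  then have "card (F ` {..<N}) < card {..<N}" by (simp add: N_def)
  then have "\<not> inj_on F {..<N}" by (rule pigeonhole)
  then obtain i j where ij: "i < j" "j < N" "F i = F j"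
    unfolding inj_on_def by (metis lessThan_iff linorder_neqE_nat)
  define m where "m = j - i"
  define u where "u k = v (k + int i)" for k
  have m: "1 \<le> m" "int m = int j - int i" using ij by (auto simp: m_def)
  have arcu: "arc u 0 (int m + 1)"
    unfolding u_def arc_shift using v(2) m ij by (auto intro: arc_sub)
  have um: "u (int m) = u 0" "u (int m + 1) = u 1"
    using ij(3) m(2) by (simp_all add: u_def F_def add.commute)
  have a: "adj (u (int m)) (u (int m - 1))" "adj (u (int m)) (u (int m + 1))"
    using arc_step'[OF arcu, of "int m"] arc_step[OF arcu, of "int m"] m by auto
  have "u (int m - 1) \<noteq> u (int m + 1)" using arc_noback[OF arcu, of "int m"] m by auto
  from third[OF a this] obtain c where c: "adj (u (int m)) c" "c \<noteq> u (int m - 1)" "c \<noteq> u (int m + 1)"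
    by metis
  have "arc u 0 (int m)" using arcu by (rule arc_sub) auto
  then have "arc (u(int m + 1 := c)) 0 (int m + 1)"
    by (rule arc_extend) (use c in auto)
  moreover have False if "p \<in> Aut" "\<forall>k. 0 \<le> k \<and> k \<le> int m + 1 \<longrightarrow> p (u k) = (u(int m + 1 := c)) k" for p
    using that(2)[rule_format, of 1] that(2)[rule_format, of "int m + 1"] m c um by simp
  ultimately have "\<not> arc_transitive (int m + 1)"
    using arcu unfolding arc_transitive_def by blast
  with m show ?thesis by blast
qed

section \<open>Rigidity of arc stabilizers\<close>

definition end_rigid :: "int \<Rightarrow> bool" where
  "end_rigid s \<longleftrightarrow> (\<forall>p v y. p \<in> Aut \<longrightarrow> arc v 0 s \<longrightarrow> fixes_arc p v 0 s \<longrightarrow> adj (v s) y \<longrightarrow> p y = y)"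

text \<open>An automorphism that fixes an \<open>s\<close>-arc but moves a neighbour of its end
  exchanges the two possible prolongations, and this upgrades transitivity on \<open>s\<close>-arcs
  to transitivity on \<open>(s + 1)\<close>-arcs.\<close>

lemma end_rigidI:
  assumes s: "s \<ge> 1" and tr: "arc_transitive s" and ntr: "\<not> arc_transitive (s + 1)"
  shows "end_rigid s"
proof (rule ccontr)
  assume "\<not> end_rigid s"
  then obtain p v y where p: "p \<in> Aut" and v: "arc v 0 s" and fx: "fixes_arc p v 0 s"
    and y: "adj (v s) y" "p y \<noteq> y" unfolding end_rigid_def by blast
  have pv: "p (v s) = v s" "p (v (s - 1)) = v (s - 1)" using fx s by (auto simp: fixes_arc_def)
  have a: "adj (v s) (v (s - 1))" using arc_step'[OF v, of s] s by simp
  have "v (s - 1) \<noteq> y" using pv y by auto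
  then obtain d where d: "\<And>z. adj (v s) z \<longleftrightarrow> z = v (s - 1) \<or> z = y \<or> z = d"
    using third[OF a y(1)] by metis
  have py: "p (p y) = y" using moved_swap[OF p p a y(1) pv(1) pv(1) pv(2) pv(2)] y by simp
  have pyd: "p y = d"
  proof -
    have "adj (p (v s)) (p y)" unfolding Aut_adj[OF p] by fact
    moreover have "p y \<noteq> p (v (s - 1))" unfolding Aut_inj[OF p] using \<open>v (s - 1) \<noteq> y\<close> by auto
    ultimately show ?thesis using pv y d by metis
  qed
  \<comment> \<open>Every longer arc is the image of the single prolongation
    \<open>v 0, ..., v s, y\<close>: if \<open>q\<close> hits the wrong continuation, composing with
    \<open>p\<close> corrects it.\<close>
  have *: "\<exists>q\<in>Aut. (\<forall>k. 0 \<le> k \<and> k \<le> s \<longrightarrow> q (v k) = w k) \<and> q y = w (s + 1)" if w: "arc w 0 (s + 1)" for w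
  proof -
    have "arc w 0 s" using w by (rule arc_sub) auto
    then obtain q where q: "q \<in> Aut" "\<And>k. 0 \<le> k \<Longrightarrow> k \<le> s \<Longrightarrow> q (v k) = w k"
      using tr v unfolding arc_transitive_def by blast
    define z where "z = inv_into UNIV q (w (s + 1))"
    have qz: "q z = w (s + 1)" using q by (simp add: z_def Aut_inv_simps)
    have "adj (q (v s)) (q z)" using q(2)[of s] qz arc_step[OF w, of s] s by simp
    then have "adj (v s) z" unfolding Aut_adj[OF q(1)] .
    moreover have "q z \<noteq> q (v (s - 1))" using q(2)[of "s - 1"] arc_noback[OF w, of s] qz s by auto
    ultimately have "z = y \<or> z = p y" using d pyd by metis
    then show ?thesis
    proof
      assume "z = y" with q qz show ?thesis by auto
    next
      assume "z = p y"
      then have "(q \<circ> p) y = w (s + 1)" using qz by simp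
      moreover have "(q \<circ> p) (v k) = w k" if "0 \<le> k" "k \<le> s" for k
        using fx q(2) that by (simp add: fixes_arc_def)
      ultimately show ?thesis using Aut_comp[OF q(1) p] by blast
    qed
  qed
  have "arc_transitive (s + 1)"
    unfolding arc_transitive_def
  proof (intro allI impI)
    fix w w' assume "arc w 0 (s + 1)" "arc w' 0 (s + 1)"
    from *[OF this(1)] *[OF this(2)] obtain q q' where
      q: "q \<in> Aut" "\<forall>k. 0 \<le> k \<and> k \<le> s \<longrightarrow> q (v k) = w k" "q y = w (s + 1)" and
      q': "q' \<in> Aut" "\<forall>k. 0 \<le> k \<and> k \<le> s \<longrightarrow> q' (v k) = w' k" "q' y = w' (s + 1)" by metis
    have "(q' \<circ> inv_into UNIV q) (w k) = w' k" if "0 \<le> k" "k \<le> s + 1" for k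
    proof (cases "k = s + 1")
      case True then show ?thesis using q(3)[symmetric] q'(3) by (simp add: Aut_inv_simps[OF q(1)])
    next
      case False
      then have "w k = q (v k)" "w' k = q' (v k)" using q q' that by auto
      then show ?thesis by (simp add: Aut_inv_simps[OF q(1)])
    qed
    then show "\<exists>p\<in>Aut. \<forall>k. 0 \<le> k \<and> k \<le> s + 1 \<longrightarrow> p (w k) = w' k"
      using Aut_comp[OF q'(1) Aut_inv[OF q(1)]] by blast
  qed
  with ntr show False ..
qed

text \<open>The last \<open>s\<close> steps of a fixed arc form again a fixed \<open>s\<close>-arc,
  so rigidity applies to each new end.\<close>

lemma rigid_extend:
  assumes s: "s \<ge> 1" and R: "end_rigid s" and p: "p \<in> Aut" and v: "arc v 0 s" "fixes_arc p v 0 s"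
  shows "\<exists>w. (\<forall>k\<le>s. w k = v k) \<and> arc w 0 (s + int n) \<and> fixes_arc p w 0 (s + int n)"
proof (induction n)
  case 0 then show ?case using v by auto
next
  case (Suc n)
  then obtain w where w: "\<forall>k\<le>s. w k = v k" "arc w 0 (s + int n)" "fixes_arc p w 0 (s + int n)" by blast
  have "adj (w (s + int n)) (w (s + int n - 1))" using arc_step'[OF w(2), of "s + int n"] s by simp
  then obtain y where y: "adj (w (s + int n)) y" "y \<noteq> w (s + int n - 1)" by (rule other)
  have "arc (\<lambda>k. w (k + int n)) 0 s" unfolding arc_shift using w(2) by (rule arc_sub) auto
  moreover have "fixes_arc p (\<lambda>k. w (k + int n)) 0 s" using w(3) by (auto simp: fixes_arc_def)
  ultimately have py: "p y = y" using R p y unfolding end_rigid_def by metis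
  let ?w = "w(s + int n + 1 := y)"
  have "arc ?w 0 (s + int n + 1)" by (rule arc_extend[OF w(2) _ y(1)]) (use y s in auto)
  moreover have "fixes_arc p ?w 0 (s + int n + 1)" using w(3) py by (auto simp: fixes_arc_def)
  moreover have "\<forall>k\<le>s. ?w k = v k" using w(1) by auto
  moreover have "s + int n + 1 = s + int (Suc n)" by simp
  ultimately show ?case by metis
qed

text \<open>Lying on a pointwise fixed \<open>s\<close>-arc spreads from a vertex to its neighbours,
  hence to the whole graph.\<close>

lemma rigid_stabilizer:
  assumes s: "s \<ge> 1" and R: "end_rigid s" and p: "p \<in> Aut" and v: "arc v 0 s" "fixes_arc p v 0 s"
  shows "p = id"
proof (rule Aut_eq_id[OF p])
  define good where "good u \<longleftrightarrow> (\<exists>w i. arc w 0 s \<and> fixes_arc p w 0 s \<and> 0 \<le> i \<and> i \<le> s \<and> w i = u)" for u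
  have at_end: "good x" if w: "arc w 0 s" "fixes_arc p w 0 s" and x: "adj (w s) x" for w x
  proof (cases "x = w (s - 1)")
    case True then show ?thesis using w s unfolding good_def by (intro exI[of _ w] exI[of _ "s - 1"]) auto
  next
    case False
    define z where "z k = (w(s + 1 := x)) (k + 1)" for k
    have "arc (w(s + 1 := x)) 0 (s + 1)" by (rule arc_extend[OF w(1) _ x]) (use False s in auto)
    then have "arc z 0 s" unfolding z_def arc_shift by (rule arc_sub) auto
    moreover have "p x = x" using R w x p unfolding end_rigid_def by blast
    then have "fixes_arc p z 0 s" using w by (auto simp: fixes_arc_def z_def)
    moreover have "z s = x" by (simp add: z_def)
    ultimately show ?thesis using s unfolding good_def by (intro exI[of _ z] exI[of _ s]) auto
  qed
  have step: "good x" if "good u" and x: "adj u x" for u x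
  proof -
    obtain w i where w: "arc w 0 s" "fixes_arc p w 0 s" and i: "0 \<le> i" "i \<le> s" "w i = u"
      using \<open>good u\<close> unfolding good_def by blast
    consider "i = s" | "i = 0" | "0 < i" "i < s" using i by linarith
    then show ?thesis
    proof cases
      case 1 then show ?thesis using at_end w x i by blast
    next
      case 2
      show ?thesis
      proof (rule at_end[of "\<lambda>k. w (s - k)"])
        show "arc (\<lambda>k. w (s - k)) 0 s" unfolding arc_reflect using w by simp
        show "fixes_arc p (\<lambda>k. w (s - k)) 0 s" using w by (simp add: fixes_arc_def)
      qed (use x i 2 in simp)
    next
      case 3
      have inr: ?thesis if "x = w j" "0 \<le> j" "j \<le> s" for j using that w unfolding good_def by blast
      show ?thesis
      proof (cases "x = w (i - 1) \<or> x = w (i + 1)")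
        case True then show ?thesis using inr[of "i - 1"] inr[of "i + 1"] 3 by auto
      next
        case False
        have a: "adj u (w (i - 1))" "adj u (w (i + 1))"
          using arc_step'[OF w(1), of i] arc_step[OF w(1), of i] 3 i by auto
        have ne: "w (i - 1) \<noteq> w (i + 1)" using arc_noback[OF w(1), of i] 3 by auto
        have px: "p x = x" by (rule fix_third[OF p a ne _ _ _ x]) (use w(2) i 3 in \<open>auto simp: fixes_arc_def\<close>)
        \<comment> \<open>The third neighbour \<open>x\<close> of an interior vertex begins a new
          fixed arc \<open>x, w i, w (i + 1), ...\<close>; to have enough vertices the old arc is
          first prolonged by \<open>i\<close> steps.\<close>
        obtain W where W: "\<forall>k\<le>s. W k = w k" "arc W 0 (s + int (nat i))" "fixes_arc p W 0 (s + int (nat i))"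
          using rigid_extend[OF s R p w] by blast
        define z where "z k = (W(i - 1 := x)) (k + (i - 1))" for k
        have "arc (W(i - 1 := x)) (i - 1) (s + i - 1)"
          unfolding arc_def
        proof (intro conjI allI impI)
          fix k assume k: "i - 1 \<le> k \<and> k < s + i - 1"
          show "adj ((W(i - 1 := x)) k) ((W(i - 1 := x)) (k + 1))"
          proof (cases "k = i - 1")
            case True then show ?thesis using W(1) i x 3 adj_sym by auto
          next
            case False then show ?thesis using arc_step[OF W(2), of k] k 3 by auto
          qed
        next
          fix k assume k: "i - 1 < k \<and> k < s + i - 1"
          show "(W(i - 1 := x)) (k - 1) \<noteq> (W(i - 1 := x)) (k + 1)"
          proof (cases "k = i")
            case True then show ?thesis using W(1) 3 False by auto
          next
            case F: False then show ?thesis using arc_noback[OF W(2), of k] k 3 by auto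
          qed
        qed
        then have "arc z 0 s" unfolding z_def arc_shift by (simp add: algebra_simps)
        moreover have "fixes_arc p z 0 s"
          using W(3) px 3 by (auto simp: z_def fixes_arc_def)
        moreover have "z 0 = x" by (simp add: z_def)
        ultimately show ?thesis using s unfolding good_def by (intro exI[of _ z] exI[of _ 0]) auto
      qed
    qed
  qed
  have g0: "good (v 0)" using v s unfolding good_def by (intro exI[of _ v] exI[of _ 0]) auto
  have v0: "v 0 \<in> V" using arc_step[OF v(1), of 0] s adj_V by simp
  fix x assume "x \<in> V"
  then have "adj\<^sup>*\<^sup>* (v 0) x" using conn v0 by blast
  then have "good x" by (induction rule: rtranclp_induct) (use g0 step in auto)
  then show "p x = x" unfolding good_def fixes_arc_def by blast
qed

end

text \<open>\<open>L\<close> is a two-way infinite walk without backtracking, translated along itself by an automorphism;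
  \<open>Y i\<close> is the conjugate, by the \<open>i\<close>-th power of that automorphism, of the involution that generates the
  stabilizer of the walk \<open>L 0, \<dots>, L (s - 1)\<close>. The bound on \<open>s\<close> comes from the least
  \<open>k\<close> such that \<open>Y 0\<close> and \<open>Y k\<close> do not commute.\<close>

locale arc_line = cubic_graph V adj for V :: "'v set" and adj +
  fixes s :: int and L :: "int \<Rightarrow> 'v" and Y :: "int \<Rightarrow> 'v \<Rightarrow> 'v"
  assumes s_ge: "s \<ge> 3"
    and L_arc: "arc L i j"
    and Y_Aut: "Y i \<in> Aut"
    and Y_fix: "\<lbrakk>i \<le> k; k \<le> i + s - 1\<rbrakk> \<Longrightarrow> Y i (L k) = L k"
    and Y_move_left: "Y i (L (i - 1)) \<noteq> L (i - 1)"
    and Y_move_right: "Y i (L (i + s)) \<noteq> L (i + s)"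
    and rigid: "\<lbrakk>p \<in> Aut; fixes_arc p L i (i + s)\<rbrakk> \<Longrightarrow> p = id"
    and com_shift: "Y i \<circ> Y j = Y j \<circ> Y i \<Longrightarrow> Y (i + k) \<circ> Y (j + k) = Y (j + k) \<circ> Y (i + k)"
begin

section \<open>Involutions along a two-way infinite walk\<close>

abbreviation com :: "int \<Rightarrow> int \<Rightarrow> bool" where
  "com i j \<equiv> Y i \<circ> Y j = Y j \<circ> Y i"

lemma L_adj: "adj (L k) (L (k + 1))" "adj (L k) (L (k - 1))"
  by (rule arc_step[OF L_arc[of k "k + 1"]], simp, simp)
     (rule arc_step'[OF L_arc[of "k - 1" k]], simp, simp)

lemma L_noback: "L (k - 1) \<noteq> L (k + 1)"
  by (rule arc_noback[OF L_arc[of "k - 1" "k + 1"]], simp, simp)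

lemma move_right_swap:
  assumes "p \<in> Aut" "q \<in> Aut" "fixes_arc p L (k - 1) k" "fixes_arc q L (k - 1) k"
    "p (L (k + 1)) \<noteq> L (k + 1)" "q (L (k + 1)) \<noteq> L (k + 1)"
  shows "p (q (L (k + 1))) = L (k + 1)"
  by (rule moved_swap(2)[OF assms(1,2) L_adj(2)[of k] L_adj(1)[of k]])
     (use assms in \<open>auto simp: fixes_arc_def\<close>)

lemma move_left_swap:
  assumes "p \<in> Aut" "q \<in> Aut" "fixes_arc p L k (k + 1)" "fixes_arc q L k (k + 1)"
    "p (L (k - 1)) \<noteq> L (k - 1)" "q (L (k - 1)) \<noteq> L (k - 1)"
  shows "p (q (L (k - 1))) = L (k - 1)"
  by (rule moved_swap(2)[OF assms(1,2) L_adj(1)[of k] L_adj(2)[of k]])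
     (use assms in \<open>auto simp: fixes_arc_def\<close>)

lemma Y_fixes: "\<lbrakk>i \<le> a; b \<le> i + s - 1\<rbrakk> \<Longrightarrow> fixes_arc (Y i) L a b"
  using Y_fix by (auto simp: fixes_arc_def)

lemma fixes_sub: "\<lbrakk>fixes_arc p v a b; a \<le> a'; b' \<le> b\<rbrakk> \<Longrightarrow> fixes_arc p v a' b'"
  by (auto simp: fixes_arc_def)

lemma fixes_comp: "\<lbrakk>fixes_arc p v a b; fixes_arc q v a b\<rbrakk> \<Longrightarrow> fixes_arc (p \<circ> q) v a b"
  by (auto simp: fixes_arc_def)

lemma fixes_snoc:
  assumes "fixes_arc p v a b" "p (v (b + 1)) = v (b + 1)" shows "fixes_arc p v a (b + 1)"
  unfolding fixes_arc_def
proof (intro allI impI)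
  fix k assume "a \<le> k \<and> k \<le> b + 1"
  then show "p (v k) = v k" using assms by (cases "k = b + 1") (auto simp: fixes_arc_def)
qed

lemma fixes_snoc_minus:
  "\<lbrakk>fixes_arc p v a (b - 1); p (v (b - 1 + 1)) = v (b - 1 + 1)\<rbrakk> \<Longrightarrow> fixes_arc p v a b"
  by (drule fixes_snoc) simp_all

lemma fixes_cons:
  assumes "fixes_arc p v a b" "p (v (a - 1)) = v (a - 1)" shows "fixes_arc p v (a - 1) b"
  unfolding fixes_arc_def
proof (intro allI impI)
  fix k assume "a - 1 \<le> k \<and> k \<le> b"
  then show "p (v k) = v k" using assms by (cases "k = a - 1") (auto simp: fixes_arc_def)
qed

text \<open>By \<open>move_right_swap\<close> the square also fixes \<open>L (i + s)\<close>, hence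
  \<open>s + 1\<close> consecutive vertices, and \<open>rigid\<close> applies.\<close>

lemma Y_involution [simp]: "Y i (Y i x) = x"
proof -
  have "fixes_arc (Y i \<circ> Y i) L i (i + s - 1)" by (intro fixes_comp Y_fixes) auto
  moreover have "(Y i \<circ> Y i) (L (i + s - 1 + 1)) = L (i + s - 1 + 1)"
    unfolding o_apply
    by (rule move_right_swap[OF Y_Aut Y_Aut]) (use s_ge Y_move_right[of i] in \<open>simp_all add: Y_fixes\<close>)
  ultimately have "fixes_arc (Y i \<circ> Y i) L i (i + s)" by (rule fixes_snoc_minus)
  then have "Y i \<circ> Y i = id" by (rule rigid[OF Aut_comp[OF Y_Aut Y_Aut]])
  then show ?thesis by (metis comp_apply id_apply)
qed

text \<open>Generators are peeled off: an automorphism fixing \<open>L j, ..., L (i + s - 1)\<close>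
  fixes \<open>L (i + s)\<close> too, at least after composition with \<open>Y i\<close>, and at the
  end \<open>s + 1\<close> vertices are fixed. \<open>S\<close> is an arbitrary submonoid so that a
  centralizer can be taken for it.\<close>

lemma generated:
  assumes S: "id \<in> S" "\<And>p q. p \<in> S \<Longrightarrow> q \<in> S \<Longrightarrow> p \<circ> q \<in> S"
  shows "\<lbrakk>p \<in> Aut; i - 1 \<le> j; j \<le> i + s - 2; fixes_arc p L j (i + s - 1);
    \<And>k. i \<le> k \<Longrightarrow> k \<le> j \<Longrightarrow> Y k \<in> S\<rbrakk> \<Longrightarrow> p \<in> S"
proof (induction "nat (j - i + 1)" arbitrary: i p)
  case 0
  then have "fixes_arc p L (i - 1) (i - 1 + s)" by (auto simp: fixes_arc_def)
  then show ?case using rigid 0 S by blast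
next
  case (Suc n)
  have IH: "q \<in> S" if "q \<in> Aut" "fixes_arc q L j (i + s)" for q
    using Suc.hyps(1)[of "i + 1" q] Suc.hyps(2) Suc.prems that s_ge by (simp add: add.commute add.left_commute)
  show ?case
  proof (cases "p (L (i + s)) = L (i + s)")
    case True
    then have "fixes_arc p L j (i + s)" using fixes_snoc[OF Suc.prems(4)] by simp
    then show ?thesis using IH Suc.prems by blast
  next
    case False
    have ij: "i \<le> j" using Suc.hyps(2) by simp
    have "Y i (p (L (i + s - 1 + 1))) = L (i + s - 1 + 1)"
      by (rule move_right_swap[OF Y_Aut Suc.prems(1)])
         (use ij False Y_move_right[of i] s_ge Suc.prems fixes_sub[OF Suc.prems(4), of "i + s - 1 - 1" "i + s - 1"]
           in \<open>simp_all add: Y_fixes\<close>)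
    then have "(Y i \<circ> p) (L (i + s - 1 + 1)) = L (i + s - 1 + 1)" by simp
    moreover have "fixes_arc (Y i \<circ> p) L j (i + s - 1)"
      by (rule fixes_comp[OF Y_fixes Suc.prems(4)]) (use ij in auto)
    ultimately have "fixes_arc (Y i \<circ> p) L j (i + s)" by (rule fixes_snoc_minus[rotated])
    then have "Y i \<circ> p \<in> S" using IH Aut_comp Y_Aut Suc.prems by blast
    then have "Y i \<circ> (Y i \<circ> p) \<in> S" using S Suc.prems(5) ij by blast
    then show ?thesis by (simp add: o_def)
  qed
qed

lemma generated_commute:
  assumes "p \<in> Aut" "i - 1 \<le> j" "j \<le> i + s - 2" "fixes_arc p L j (i + s - 1)"
    and "\<And>k. i \<le> k \<Longrightarrow> k \<le> j \<Longrightarrow> Y k \<circ> q = q \<circ> Y k"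
  shows "p \<circ> q = q \<circ> p"
proof -
  have "p \<in> {p. p \<circ> q = q \<circ> p}"
    by (rule generated[OF _ _ assms(1-4)]) (use assms(5) in \<open>auto, metis comp_assoc\<close>)
  then show ?thesis by simp
qed

text \<open>At either end of the common fixed stretch both involutions fix an edge, so by
  \<open>local_commute\<close> they commute on the next vertex: a commutator fixes one more vertex
  on each side.\<close>

lemma commutator_fixes:
  assumes "i < j" "j \<le> i + s - 2"
  shows "fixes_arc (Y i \<circ> Y j \<circ> Y i \<circ> Y j) L (j - 1) (i + s)"
proof -
  let ?c = "Y i \<circ> Y j \<circ> Y i \<circ> Y j"
  have c: "fixes_arc ?c L j (i + s - 1)" using assms by (intro fixes_comp Y_fixes) auto
  have *: "?c a = a" if "adj z u" "adj z a" "Y i z = z" "Y j z = z" "Y i u = u" "Y j u = u" for z u a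
    using local_commute[OF Y_Aut Y_Aut that] by simp
  have "?c (L (j - 1)) = L (j - 1)"
    by (rule *[OF L_adj(1) L_adj(2)]) (use assms in \<open>auto intro!: Y_fix\<close>)
  with c have "fixes_arc ?c L (j - 1) (i + s - 1)" by (rule fixes_cons)
  moreover have "?c (L (i + s - 1 + 1)) = L (i + s - 1 + 1)"
    by (rule *[OF L_adj(2) L_adj(1)]) (use assms in \<open>auto intro!: Y_fix\<close>)
  ultimately show ?thesis by (rule fixes_snoc_minus[of _ _ _ "i + s"])
qed

section \<open>Commutators of involutions along the walk\<close>

lemma commutator_Aut: "Y i \<circ> Y j \<circ> Y i \<circ> Y j \<in> Aut"
  by (intro Aut_comp Y_Aut)

lemma com_diff: "com i j \<longleftrightarrow> com (i + k) (j + k)"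
  using com_shift[of i j k] com_shift[of "i + k" "j + k" "- k"] by auto

lemma com_iff_0: "com i j \<longleftrightarrow> com 0 \<bar>j - i\<bar>"
proof (cases "i \<le> j")
  case True then show ?thesis using com_diff[of 0 "j - i" i] by auto
next
  case False then show ?thesis using com_diff[of 0 "i - j" j] by auto
qed

text \<open>By \<open>rigid\<close> a nontrivial automorphism fixes at most \<open>s\<close>
  consecutive vertices, so enlarging a fixed stretch must stop on both sides.\<close>

lemma maximal_interval:
  assumes p: "p \<in> Aut" "p \<noteq> id" and fx: "fixes_arc p L a b" and ab: "a \<le> b"
  obtains a' b' where "a' \<le> a" "b \<le> b'" "fixes_arc p L a' b'" "b' - a' \<le> s - 1"
    "p (L (a' - 1)) \<noteq> L (a' - 1)" "p (L (b' + 1)) \<noteq> L (b' + 1)"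
proof -
  have short: "d - c \<le> s - 1" if "fixes_arc p L c d" for c d
  proof (rule ccontr)
    assume "\<not> ?thesis"
    then have "fixes_arc p L c (c + s)" using that by (auto simp: fixes_arc_def)
    then show False using rigid p by blast
  qed
  have "\<exists>b'\<ge>b. fixes_arc p L a b' \<and> p (L (b' + 1)) \<noteq> L (b' + 1)"
  proof (rule ccontr)
    assume neg: "\<not> ?thesis"
    have "fixes_arc p L a (b + int n)" for n
    proof (induction n)
      case (Suc n)
      then have "p (L (b + int n + 1)) = L (b + int n + 1)" using neg by auto
      with Suc show ?case using fixes_snoc[of p L a "b + int n"] by (simp add: add.commute add.left_commute)
    qed (use fx in simp)
    from short[OF this[of "nat s"]] ab s_ge show False by simp
  qed
  then obtain b' where b': "b' \<ge> b" "fixes_arc p L a b'" "p (L (b' + 1)) \<noteq> L (b' + 1)" by blast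
  have "\<exists>a'\<le>a. fixes_arc p L a' b' \<and> p (L (a' - 1)) \<noteq> L (a' - 1)"
  proof (rule ccontr)
    assume neg: "\<not> ?thesis"
    have "fixes_arc p L (a - int n) b'" for n
    proof (induction n)
      case (Suc n)
      then have "p (L (a - int n - 1)) = L (a - int n - 1)" using neg by auto
      with Suc show ?case using fixes_cons[of p L "a - int n" b'] by (simp add: algebra_simps)
    qed (use b' in simp)
    from short[OF this[of "nat s"]] ab b' s_ge show False by simp
  qed
  with b' short that show thesis by blast
qed

text \<open>If the fixed stretch of \<open>c\<close> ended too early, then with
  \<open>mu = r - s + 1\<close> the involution \<open>Y (lam + mu)\<close> would commute with
  \<open>c\<close> and with all generators of \<open>Y mu \<circ> c\<close>, hence with
  \<open>Y mu\<close>, although the two indices differ by \<open>lam\<close>.\<close>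

lemma commutator_bound:
  assumes lam: "1 \<le> lam" "lam \<le> s - 3" "\<And>k. 0 < k \<Longrightarrow> k < lam \<Longrightarrow> com 0 k" "\<not> com 0 lam"
    and c_def: "c = Y 0 \<circ> Y lam \<circ> Y 0 \<circ> Y lam"
    and pr: "p \<le> lam - 1" "s \<le> r" "fixes_arc c L p r" "r - p \<le> s - 1" "c (L (r + 1)) \<noteq> L (r + 1)"
  shows "r - s + 1 + lam \<ge> s - 1"
proof (rule ccontr)
  \<comment> \<open>\<open>mu\<close> is chosen so that \<open>Y mu\<close>, like \<open>c\<close>,
    fixes \<open>L r\<close> and moves \<open>L (r + 1)\<close>.\<close>
  define mu where "mu = r - s + 1"
  assume "\<not> ?thesis"
  then have small: "mu + lam \<le> s - 2" by (simp add: mu_def)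
  have mu: "1 \<le> mu" "mu \<le> p" "r = mu + s - 1" using pr by (auto simp: mu_def)
  have near: "com i j" if "\<bar>j - i\<bar> < lam" for i j
    using lam(3)[of "\<bar>j - i\<bar>"] that com_iff_0[of i j] by (cases "i = j") auto
  define y where "y = Y (lam + mu)"
  \<comment> \<open>\<open>e\<close> measures how conjugation by \<open>y\<close> changes
    \<open>Y 0\<close>. It lies in the group generated by \<open>Y 1, ..., Y (lam + mu - 1)\<close>,
    which centralizes both \<open>Y lam\<close> and \<open>c\<close>.\<close>
  define e where "e = Y 0 \<circ> y \<circ> Y 0 \<circ> y"
  have cA: "c \<in> Aut" and eA: "e \<in> Aut" unfolding c_def e_def y_def by (rule commutator_Aut)+
  have efix: "fixes_arc e L (lam + mu - 1) s"
    unfolding e_def y_def using commutator_fixes[of 0 "lam + mu"] small mu lam by simp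
  have el: "e \<circ> Y lam = Y lam \<circ> e"
    by (rule generated_commute[OF eA, of 1 "lam + mu - 1"])
       (use efix small mu lam pr in \<open>auto intro!: near\<close>)
  have ck: "c \<circ> Y k = Y k \<circ> c" if "1 \<le> k" "k \<le> lam + mu - 1" for k
    by (rule generated_commute[OF cA, of mu p])
       (use that small mu lam pr in \<open>auto intro!: near\<close>)
  have ec: "e \<circ> c = c \<circ> e"
    by (rule generated_commute[OF eA, of 1 "lam + mu - 1"])
       (use efix small mu lam pr ck in auto)
  have yl: "y \<circ> Y lam = Y lam \<circ> y" unfolding y_def by (rule near) (use mu lam pr in auto)
  have yy: "y (y x) = x" for x by (simp add: y_def)
  \<comment> \<open>Conjugating \<open>c\<close> by \<open>y\<close> leaves \<open>Y lam\<close>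
    alone and multiplies \<open>Y 0\<close> by \<open>e\<close>; this factor cancels because it
    commutes with \<open>Y lam\<close> and \<open>c\<close>.\<close>
  have yc: "y (c x) = c (y x)" for x
  proof -
    have l: "e (Y lam z) = Y lam (e z)" "y (Y lam z) = Y lam (y z)" "e (c z) = c (e z)" for z
      using el yl ec by (metis comp_apply)+
    have ez: "e z = Y 0 (y (Y 0 (y z)))" "c z = Y 0 (Y lam (Y 0 (Y lam z)))" for z
      by (simp_all add: e_def c_def)
    have "y (c (y x)) = y (Y 0 (Y lam (Y 0 (y (Y lam x)))))" by (simp add: ez l)
    also have "\<dots> = y (Y 0 (y (Y lam (y (Y 0 (y (Y lam x)))))))" by (simp add: l yy)
    also have "\<dots> = y (Y 0 (y (Y lam (Y 0 (e (Y lam x))))))" by (simp add: ez)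
    also have "\<dots> = y (Y 0 (y (Y 0 (Y 0 (Y lam (Y 0 (Y lam (e x))))))))" by (simp add: l)
    also have "\<dots> = y (Y 0 (y (Y 0 (c (e x)))))" by (simp add: ez)
    also have "\<dots> = y (Y 0 (y (Y 0 (e (c x)))))" by (simp add: l)
    also have "\<dots> = c x" by (simp add: ez(1) yy)
    finally show ?thesis by (metis yy)
  qed
  \<comment> \<open>\<open>Y mu\<close> undoes \<open>c\<close> on \<open>L (r + 1)\<close>, so
    \<open>d\<close> fixes \<open>L p, ..., L (r + 1)\<close> and is generated by
    \<open>Y (mu + 1), ..., Y p\<close>, whose indices are at distance less than \<open>lam\<close>
    from \<open>lam + mu\<close>.\<close>
  define d where "d = Y mu \<circ> c"
  have dA: "d \<in> Aut" unfolding d_def by (intro Aut_comp Y_Aut cA)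
  have "Y mu (c (L (r + 1))) = L (r + 1)"
    by (rule move_right_swap[OF Y_Aut cA])
       (use Y_move_right[of mu] pr mu lam s_ge fixes_sub[OF pr(3), of "r - 1" r] in \<open>simp_all add: Y_fixes\<close>)
  moreover have "fixes_arc d L p r" unfolding d_def
    by (rule fixes_comp[OF Y_fixes pr(3)]) (use mu in auto)
  ultimately have "fixes_arc d L p (r + 1)" using fixes_snoc by (simp add: d_def)
  then have dy: "d \<circ> y = y \<circ> d"
    by (intro generated_commute[OF dA, of "mu + 1" p])
       (use small mu lam pr in \<open>auto simp: y_def add.commute intro!: near\<close>)
  have "Y mu \<circ> y = y \<circ> Y mu"
  proof
    fix x
    define z where "z = inv_into UNIV c x"
    have z: "x = c z" by (simp add: z_def Aut_inv_simps[OF cA])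
    show "(Y mu \<circ> y) x = (y \<circ> Y mu) x"
      using fun_cong[OF dy, of z] unfolding z d_def by (simp add: yc)
  qed
  then have "com mu (lam + mu)" unfolding y_def .
  then show False using com_iff_0[of mu "lam + mu"] lam by simp
qed

text \<open>Reversing the walk exchanges the two ends of every fixed stretch, so each one-sided
  bound yields its mirror image.\<close>

lemma reflect: "arc_line V adj s (\<lambda>k. L (m + s - 1 - k)) (\<lambda>i. Y (m - i))"
proof
  show "s \<ge> 3" by (rule s_ge)
  show "arc (\<lambda>k. L (m + s - 1 - k)) i j" for i j
    unfolding arc_reflect by (rule L_arc)
  show "Y (m - i) \<in> Aut" for i by (rule Y_Aut)
  show "Y (m - i) (L (m + s - 1 - k)) = L (m + s - 1 - k)" if "i \<le> k" "k \<le> i + s - 1" for i k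
    using that by (intro Y_fix) auto
  show "Y (m - i) (L (m + s - 1 - (i - 1))) \<noteq> L (m + s - 1 - (i - 1))" for i
    using Y_move_right[of "m - i"] by (simp add: algebra_simps)
  show "Y (m - i) (L (m + s - 1 - (i + s))) \<noteq> L (m + s - 1 - (i + s))" for i
    using Y_move_left[of "m - i"] by (simp add: algebra_simps)
  show "p = id" if p: "p \<in> Aut" and "fixes_arc p (\<lambda>k. L (m + s - 1 - k)) i (i + s)" for p i
  proof (rule rigid[OF p])
    show "fixes_arc p L (m - 1 - i) (m - 1 - i + s)"
      unfolding fixes_arc_def
    proof (intro allI impI)
      fix k assume "m - 1 - i \<le> k \<and> k \<le> m - 1 - i + s"
      then show "p (L k) = L k"
        using that(2)[unfolded fixes_arc_def, rule_format, of "m + s - 1 - k"] by simp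
    qed
  qed
  show "Y (m - (i + k)) \<circ> Y (m - (j + k)) = Y (m - (j + k)) \<circ> Y (m - (i + k))"
    if "com (m - i) (m - j)" for i j k
    using com_shift[OF that, of "- k"] by (simp add: algebra_simps)
qed

text \<open>In the reflected line the commutator becomes its inverse, which has the same fixed
  points, so \<open>commutator_bound\<close> applies at both ends. The three inequalities add up to
  \<open>3 * lam \<ge> 2 * s - 2\<close>.\<close>

lemma commutator_bounds:
  assumes lam: "1 \<le> lam" "lam \<le> s - 3" "\<And>k. 0 < k \<Longrightarrow> k < lam \<Longrightarrow> com 0 k" "\<not> com 0 lam"
    and c_def: "c = Y 0 \<circ> Y lam \<circ> Y 0 \<circ> Y lam"
  obtains p r where "fixes_arc c L p r" "r - p \<le> s - 1" "r + lam \<ge> 2 * s - 2" "2 * lam - p \<ge> s - 1"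
    "c (L (r + 1)) \<noteq> L (r + 1)"
proof -
  have cA: "c \<in> Aut" unfolding c_def by (rule commutator_Aut)
  have "c \<noteq> id"
  proof
    assume "c = id"
    then have "Y 0 (Y lam (Y 0 (Y lam x))) = x" for x by (simp add: c_def fun_eq_iff)
    then have "Y 0 (Y lam x) = Y lam (Y 0 x)" for x by (metis Y_involution)
    then show False using lam by (simp add: fun_eq_iff)
  qed
  then obtain p r where pr: "p \<le> lam - 1" "s \<le> r" "fixes_arc c L p r" "r - p \<le> s - 1"
    "c (L (p - 1)) \<noteq> L (p - 1)" "c (L (r + 1)) \<noteq> L (r + 1)"
  proof (rule maximal_interval[OF cA])
    show "fixes_arc c L (lam - 1) s"
      unfolding c_def using commutator_fixes[of 0 lam] lam by simp
    show "lam - 1 \<le> s" using lam by simp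
  qed
  have 1: "r - s + 1 + lam \<ge> s - 1"
    by (rule commutator_bound[OF lam c_def pr(1-4) pr(6)])
  interpret R: arc_line V adj s "\<lambda>k. L (lam + s - 1 - k)" "\<lambda>i. Y (lam - i)" by (rule reflect)
  define c' where "c' = Y lam \<circ> Y 0 \<circ> Y lam \<circ> Y 0"
  have c'c: "c' (c x) = x" "c (c' x) = x" for x by (simp_all add: c_def c'_def)
  have same: "c' x = x \<longleftrightarrow> c x = x" for x by (metis c'c)
  have com_rev: "com (lam - 0) (lam - k) \<longleftrightarrow> com 0 \<bar>k\<bar>" for k
    using com_iff_0[of lam "lam - k"] by simp
  have "(lam + s - 1 - p) - s + 1 + lam \<ge> s - 1"
  proof (rule R.commutator_bound[of lam c' "lam + s - 1 - r"])
    show "1 \<le> lam" "lam \<le> s - 3" by fact+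
    show "com (lam - 0) (lam - k)" if "0 < k" "k < lam" for k
      unfolding com_rev using lam(3)[OF that] that by simp
    show "\<not> com (lam - 0) (lam - lam)" unfolding com_rev using lam by simp
    show "c' = Y (lam - 0) \<circ> Y (lam - lam) \<circ> Y (lam - 0) \<circ> Y (lam - lam)" by (simp add: c'_def)
    show "fixes_arc c' (\<lambda>k. L (lam + s - 1 - k)) (lam + s - 1 - r) (lam + s - 1 - p)"
      using pr(3) unfolding fixes_arc_def same by auto
    show "c' (L (lam + s - 1 - (lam + s - 1 - p + 1))) \<noteq> L (lam + s - 1 - (lam + s - 1 - p + 1))"
      unfolding same using pr(5) by (simp add: algebra_simps)
  qed (use pr in auto)
  then show thesis using that[of p r] pr 1 by auto
qed

end

section \<open>Translations of the walk and the bound on s\<close>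

context cubic_graph begin

lemma arc_extends:
  assumes "1 \<le> i" "arc v 0 i"
  shows "\<exists>w. (\<forall>k\<le>i. w k = v k) \<and> arc w 0 (i + int n)"
proof (induction n)
  case 0 then show ?case using assms by auto
next
  case (Suc n)
  then obtain w where w: "\<forall>k\<le>i. w k = v k" "arc w 0 (i + int n)" by blast
  have "adj (w (i + int n)) (w (i + int n - 1))" by (rule arc_step'[OF w(2)]) (use assms in auto)
  then obtain y where y: "adj (w (i + int n)) y" "y \<noteq> w (i + int n - 1)" by (rule other)
  let ?w = "w(i + int n + 1 := y)"
  have "arc ?w 0 (i + int n + 1)" by (rule arc_extend[OF w(2) _ y(1)]) (use y assms in auto)
  moreover have "\<forall>k\<le>i. ?w k = v k" using w(1) by auto
  moreover have "i + int n + 1 = i + int (Suc n)" by simp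
  ultimately show ?case by metis
qed

lemma arc_transitive_le:
  assumes "arc_transitive s" "1 \<le> i" "i \<le> s" shows "arc_transitive i"
  unfolding arc_transitive_def
proof (intro allI impI)
  fix v w assume "arc v 0 i" "arc w 0 i"
  then obtain v' w' where "\<forall>k\<le>i. v' k = v k" "arc v' 0 (i + int (nat (s - i)))"
    "\<forall>k\<le>i. w' k = w k" "arc w' 0 (i + int (nat (s - i)))"
    using arc_extends[OF assms(2)] by metis
  then have "\<forall>k\<le>i. v' k = v k" "arc v' 0 s" "\<forall>k\<le>i. w' k = w k" "arc w' 0 s" using assms by auto
  then show "\<exists>p\<in>Aut. \<forall>k. 0 \<le> k \<and> k \<le> i \<longrightarrow> p (v k) = w k"
    using assms(1,3) unfolding arc_transitive_def by (metis order_trans)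
qed

lemma arc_transitive_edges:
  assumes "arc_transitive 1" "adj u w" "adj u' w'"
  obtains g where "g \<in> Aut" "g u = u'" "g w = w'"
proof -
  define a b where "a k = (if k = 0 then u else w)" and "b k = (if k = 0 then u' else w')" for k :: int
  have "arc a 0 1" "arc b 0 1" using assms by (auto simp: arc_def a_def b_def)
  then obtain g where g: "g \<in> Aut" "\<forall>k. 0 \<le> k \<and> k \<le> 1 \<longrightarrow> g (a k) = b k"
    using assms(1) unfolding arc_transitive_def by blast
  show thesis
    using that[OF g(1)] g(2)[rule_format, of 0] g(2)[rule_format, of 1] by (simp add: a_def b_def)
qed

end

text \<open>\<open>arc_line\<close> retains of the translations only their effect on commutation,
  which makes it easy to reflect; here the translations themselves are available.\<close>

locale shunt_line = arc_line V adj s L Y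
  for V :: "'v set" and adj and s :: int and L :: "int \<Rightarrow> 'v" and Y :: "int \<Rightarrow> 'v \<Rightarrow> 'v" +
  fixes H :: "int \<Rightarrow> 'v \<Rightarrow> 'v"
  assumes H_Aut: "H j \<in> Aut"
    and H_L: "H j (L k) = L (k + j)"
    and H_Y: "H j \<circ> Y i = Y (i + j) \<circ> H j"
    and s_trans: "arc_transitive s"
begin

text \<open>\<open>generated\<close> yields the stabilizer of the edge from
  \<open>L (i + s - 1)\<close> to \<open>L (i + s - 2)\<close>, and \<open>Y i\<close> and
  \<open>Y (i + s - 1)\<close> connect the three edges at that vertex.\<close>

lemma vertex_generated:
  assumes S: "id \<in> S" "\<And>p q. p \<in> S \<Longrightarrow> q \<in> S \<Longrightarrow> p \<circ> q \<in> S"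
    and XS: "\<And>k. i \<le> k \<Longrightarrow> k \<le> i + s - 1 \<Longrightarrow> Y k \<in> S"
    and q: "q \<in> Aut" "q (L (i + s - 1)) = L (i + s - 1)"
  shows "q \<in> S"
proof -
  define z where "z = L (i + s - 1)"
  define a where "a = L (i + s - 1 - 1)"
  define b where "b = L (i + s - 1 + 1)"
  have za: "adj z a" and zb: "adj z b" and ab: "a \<noteq> b"
    unfolding z_def a_def b_def by (rule L_adj L_noback)+
  obtain d where d: "d \<noteq> a" "d \<noteq> b" "\<And>y. adj z y \<longleftrightarrow> y = a \<or> y = b \<or> y = d"
    using third[OF za zb ab] by metis
  have Xi: "Y i z = z" "Y i a = a" "Y i b \<noteq> b"
    unfolding z_def a_def b_def using s_ge Y_move_right[of i] by (auto intro!: Y_fix)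
  have Xj: "Y (i + s - 1) z = z" "Y (i + s - 1) b = b" "Y (i + s - 1) a \<noteq> a"
    unfolding z_def a_def b_def using s_ge Y_move_left[of "i + s - 1"]
    by (auto intro!: Y_fix)
  have Xib: "Y i b = d"
  proof -
    have "adj (Y i z) (Y i b)" unfolding Aut_adj[OF Y_Aut] by fact
    moreover have "Y i b \<noteq> Y i a" unfolding Aut_inj[OF Y_Aut] using ab by auto
    ultimately show ?thesis using Xi d by metis
  qed
  have Xja: "Y (i + s - 1) a = d"
  proof -
    have "adj (Y (i + s - 1) z) (Y (i + s - 1) a)" unfolding Aut_adj[OF Y_Aut] by fact
    moreover have "Y (i + s - 1) a \<noteq> Y (i + s - 1) b" unfolding Aut_inj[OF Y_Aut] using ab by auto
    ultimately show ?thesis using Xj d by metis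
  qed
  have base: "p \<in> S" if "p \<in> Aut" "p z = z" "p a = a" for p
  proof (rule generated[OF S that(1), of i "i + s - 2"])
    show "fixes_arc p L (i + s - 2) (i + s - 1)"
      unfolding fixes_arc_def
    proof (intro allI impI)
      fix k assume "i + s - 2 \<le> k \<and> k \<le> i + s - 1"
      then have "k = i + s - 2 \<or> k = i + s - 1" by auto
      then show "p (L k) = L k" using that by (auto simp: z_def a_def)
    qed
  qed (use s_ge XS in auto)
  have base2: "p \<in> S" if p: "p \<in> Aut" "p z = z" "p a = d" for p
  proof -
    have "Y (i + s - 1) \<circ> p \<in> S"
      by (rule base) (use p Xj Xja Y_involution[of "i + s - 1" a] in \<open>auto intro: Aut_comp Y_Aut\<close>)
    then have "Y (i + s - 1) \<circ> (Y (i + s - 1) \<circ> p) \<in> S" using S XS[of "i + s - 1"] s_ge by auto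
    then show ?thesis by (simp add: o_def)
  qed
  have qz: "q z = z" using q by (simp add: z_def)
  have "adj (q z) (q a)" unfolding Aut_adj[OF q(1)] by fact
  then consider "q a = a" | "q a = b" | "q a = d" using qz d by metis
  then show ?thesis
  proof cases
    case 1 then show ?thesis using base q qz by blast
  next
    case 2
    have "Y i \<circ> q \<in> S"
      by (rule base2) (use q qz 2 Xi Xib in \<open>auto intro: Aut_comp Y_Aut\<close>)
    then have "Y i \<circ> (Y i \<circ> q) \<in> S" using S XS[of i] s_ge by auto
    then show ?thesis by (simp add: o_def)
  next
    case 3 then show ?thesis using base2 q qz by blast
  qed
qed

lemma vertex_commute:
  assumes "\<And>k. i \<le> k \<Longrightarrow> k \<le> i + s - 1 \<Longrightarrow> Y k \<circ> y = y \<circ> Y k"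
    and "q \<in> Aut" "q (L (i + s - 1)) = L (i + s - 1)"
  shows "q \<circ> y = y \<circ> q"
proof -
  have "q \<in> {p. p \<circ> y = y \<circ> p}"
    by (rule vertex_generated[OF _ _ _ assms(2,3)]) (use assms(1) in \<open>auto, metis comp_assoc\<close>)
  then show ?thesis by simp
qed

text \<open>By \<open>vertex_generated\<close> such a \<open>y\<close> commutes with the full
  stabilizers of both ends of an edge. This passes to adjacent edges, because an automorphism that
  fixes \<open>u\<close> and moves one neighbour to another commutes with \<open>y\<close>; so
  \<open>y\<close> fixes every vertex.\<close>

lemma edge_central:
  assumes y: "y \<in> Aut" "y (L (s - 1)) = L (s - 1)" "y (L s) = L s"
    and com: "\<And>k. 0 \<le> k \<Longrightarrow> k \<le> s \<Longrightarrow> Y k \<circ> y = y \<circ> Y k"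
  shows "y = id"
proof (rule Aut_eq_id[OF y(1)])
  define central where "central u \<longleftrightarrow> y u = u \<and> (\<forall>q\<in>Aut. q u = u \<longrightarrow> q \<circ> y = y \<circ> q)" for u
  define good where "good u \<longleftrightarrow> central u \<and> (\<exists>w. adj u w \<and> central w)" for u
  have c1: "central (L (s - 1))" "central (L s)"
    unfolding central_def using vertex_commute[of 0 y] vertex_commute[of 1 y] y com by auto
  then have g0: "good (L (s - 1))" unfolding good_def using L_adj(1)[of "s - 1"] by auto
  have step: "good x" if u: "good u" and x: "adj u x" for u x
  proof -
    obtain w where w: "adj u w" "central w" "central u" using u unfolding good_def by blast
    have "arc_transitive 1" using arc_transitive_le[OF s_trans] s_ge by auto
    then obtain g where g: "g \<in> Aut" and gu: "g u = u" "g w = x"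
      using arc_transitive_edges[OF _ w(1) x] by blast
    have "g \<circ> y = y \<circ> g" using w(3) g gu(1) by (simp add: central_def)
    then have gy: "g (y t) = y (g t)" for t by (simp add: fun_eq_iff)
    have "y x = x" using gy[of w] w(2) gu by (simp add: central_def)
    moreover have "q \<circ> y = y \<circ> q" if q: "q \<in> Aut" "q x = x" for q
    proof -
      define q' where "q' = inv_into UNIV g \<circ> q \<circ> g"
      have "q' \<in> Aut" unfolding q'_def by (intro Aut_comp Aut_inv q g)
      moreover have "q' w = w"
        using Aut_inv_simps(2)[OF g, of w] by (simp add: q'_def gu(2) q(2))
      ultimately have "q' \<circ> y = y \<circ> q'" using w(2) by (simp add: central_def)
      then have q'y: "q' (y t) = y (q' t)" for t by (simp add: fun_eq_iff)
      have gq': "g (q' t) = q (g t)" for t by (simp add: q'_def Aut_inv_simps[OF g])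
      have "q (y t) = y (q t)" for t
      proof -
        have t: "t = g (inv_into UNIV g t)" by (simp add: Aut_inv_simps[OF g])
        have "q (y (g (inv_into UNIV g t))) = q (g (y (inv_into UNIV g t)))" by (simp only: gy)
        also have "\<dots> = g (y (q' (inv_into UNIV g t)))" by (simp only: gq'[symmetric] q'y)
        also have "\<dots> = y (q (g (inv_into UNIV g t)))" by (simp only: gy gq')
        finally show ?thesis using t by simp
      qed
      then show ?thesis by (simp add: fun_eq_iff)
    qed
    ultimately have "central x" by (simp add: central_def)
    then show ?thesis unfolding good_def using w x adj_sym by blast
  qed
  have v0: "L (s - 1) \<in> V" using L_adj adj_V by blast
  fix x assume "x \<in> V"
  then have "adj\<^sup>*\<^sup>* (L (s - 1)) x" using conn v0 by blast
  then have "good x" by (induction rule: rtranclp_induct) (use g0 step in auto)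
  then show "y x = x" by (simp add: good_def central_def)
qed

lemma Y_ne_id: "Y i \<noteq> id"
  using Y_move_left[of i] by auto

text \<open>The index \<open>s div 2\<close> is at distance at most \<open>(s + 1) / 2\<close> from
  all of \<open>0, ..., s\<close>. If all pairs within that distance commuted,
  \<open>edge_central\<close> would make \<open>Y (s div 2)\<close> trivial.\<close>

lemma first_noncommuting:
  obtains lam where "1 \<le> lam" "2 * lam \<le> s + 1" "\<And>k. 0 < k \<Longrightarrow> k < lam \<Longrightarrow> com 0 k" "\<not> com 0 lam"
proof -
  have "\<exists>n. 1 \<le> n \<and> 2 * int n \<le> s + 1 \<and> \<not> com 0 (int n)"
  proof (rule ccontr)
    assume neg: "\<not> ?thesis"
    have near: "com i j" if "2 * \<bar>j - i\<bar> \<le> s + 1" for i j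
      using neg[simplified, rule_format, of "nat \<bar>j - i\<bar>"] that com_iff_0[of i j]
      by (cases "i = j") auto
    have "2 * \<bar>s div 2 - k\<bar> \<le> s + 1" if "0 \<le> k" "k \<le> s" for k
      using that unfolding abs_if by (simp split: if_split) presburger
    then have "Y (s div 2) = id"
      by (intro edge_central[OF Y_Aut]) (use s_ge in \<open>auto intro!: Y_fix near\<close>)
    then show False using Y_ne_id by blast
  qed
  then obtain n where n: "1 \<le> n \<and> 2 * int n \<le> s + 1 \<and> \<not> com 0 (int n)"
    and least: "\<And>m. m < n \<Longrightarrow> \<not> (1 \<le> m \<and> 2 * int m \<le> s + 1 \<and> \<not> com 0 (int m))"
    using exists_least_iff[of "\<lambda>n. 1 \<le> n \<and> 2 * int n \<le> s + 1 \<and> \<not> com 0 (int n)"] by auto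
  have "com 0 k" if "0 < k" "k < int n" for k
    using least[of "nat k"] that n by auto
  with that[of "int n"] n show thesis by auto
qed

text \<open>From \<open>3 * lam \<ge> 2 * s - 2\<close> and \<open>2 * lam \<le> s + 1\<close>
  follows \<open>s \<le> 7\<close>, and for \<open>s = 6\<close> there is no integer between
  \<open>10 / 3\<close> and \<open>7 / 2\<close>. In the remaining case the commutator has the fixed
  stretch of \<open>Y 2\<close>.\<close>

lemma six_le_imp_seven:
  assumes "6 \<le> s"
  shows "s = 7" "\<And>k. 0 < k \<Longrightarrow> k < 4 \<Longrightarrow> com 0 k" "\<not> com 0 4" "Y 0 \<circ> Y 4 \<circ> Y 0 \<circ> Y 4 = Y 2"
proof -
  obtain lam where lam: "1 \<le> lam" "2 * lam \<le> s + 1" "\<And>k. 0 < k \<Longrightarrow> k < lam \<Longrightarrow> com 0 k" "\<not> com 0 lam"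
    by (rule first_noncommuting) blast
  define c where "c = Y 0 \<circ> Y lam \<circ> Y 0 \<circ> Y lam"
  have "lam \<le> s - 3" using lam(2) assms by linarith
  from commutator_bounds[OF lam(1) this lam(3,4) c_def] obtain p r
    where pr: "fixes_arc c L p r" "r - p \<le> s - 1" "r + lam \<ge> 2 * s - 2" "2 * lam - p \<ge> s - 1"
    "c (L (r + 1)) \<noteq> L (r + 1)" by metis
  have "s = 7 \<and> lam = 4 \<and> p = 2 \<and> r = 8" using pr lam assms by presburger
  then have eq: "s = 7" "lam = 4" "p = 2" "r = 8" by auto
  show "s = 7" "\<And>k. 0 < k \<Longrightarrow> k < 4 \<Longrightarrow> com 0 k" "\<not> com 0 4" using eq lam by auto
  have cA: "c \<in> Aut" unfolding c_def by (rule commutator_Aut)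
  have "Y 2 (c (L (8 + 1))) = L (8 + 1)"
    by (rule move_right_swap[OF Y_Aut cA])
       (use pr eq Y_move_right[of 2] fixes_sub[OF pr(1), of 7 8] in \<open>simp_all add: Y_fixes\<close>)
  then have "(Y 2 \<circ> c) (L (8 + 1)) = L (8 + 1)" by simp
  moreover have "fixes_arc (Y 2 \<circ> c) L 2 8"
    by (rule fixes_comp[OF Y_fixes]) (use pr eq in auto)
  ultimately have "fixes_arc (Y 2 \<circ> c) L 2 (8 + 1)" by (rule fixes_snoc[rotated])
  then have "fixes_arc (Y 2 \<circ> c) L 2 (2 + s)" using eq by simp
  then have "Y 2 \<circ> c = id" by (rule rigid[OF Aut_comp[OF Y_Aut cA]])
  then have "Y 2 \<circ> (Y 2 \<circ> c) = Y 2" by simp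
  then have "c = Y 2" by (simp add: o_def)
  then show "Y 0 \<circ> Y 4 \<circ> Y 0 \<circ> Y 4 = Y 2" using eq by (simp add: c_def)
qed

text \<open>The stabilizer of \<open>L i\<close> centralizes \<open>Y (i - 3)\<close>, so an
  involution belongs canonically to each vertex, and vertices joined by a 4-arc have noncommuting
  involutions. For the ends of three 2-arcs out of \<open>L 6\<close> this is contradictory: the
  product of their involutions lies in an elementary abelian group that two of them
  centralize.\<close>

lemma not_seven:
  assumes s7: "s = 7" and near0: "\<And>k. 0 < k \<Longrightarrow> k < 4 \<Longrightarrow> com 0 k" and far: "\<not> com 0 4"
  shows False
proof -
  have near: "com i j" if "\<bar>j - i\<bar> < 4" for i j
    using near0[of "\<bar>j - i\<bar>"] that com_iff_0[of i j] by (cases "i = j") auto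
  have far15: "\<not> com 1 5" using far com_iff_0[of 1 5] by simp
  have central: "q \<circ> Y (i - 3) = Y (i - 3) \<circ> q" if "q \<in> Aut" "q (L i) = L i" for q i
    by (rule vertex_commute[of "i - 6"]) (use that s7 in \<open>auto intro!: near\<close>)
  \<comment> \<open>Following \<open>k\<close> by a translation gives an element fixing
    \<open>L i\<close>, to which \<open>central\<close> applies.\<close>
  have transport: "k \<circ> Y (i - 3) = Y (j - 3) \<circ> k" if k: "k \<in> Aut" "k (L i) = L j" for k i j
  proof -
    have "H (i - j) \<circ> k \<in> Aut" by (intro Aut_comp H_Aut k)
    from central[OF this, of i] have "H (i - j) (k (Y (i - 3) x)) = Y (i - 3) (H (i - j) (k x))" for x
      using k H_L[of "i - j" j] by (simp add: fun_eq_iff)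
    moreover have "Y (i - 3) (H (i - j) x) = H (i - j) (Y (j - 3) x)" for x
      using fun_cong[OF H_Y[of "i - j" "j - 3"], of x] by simp
    ultimately have "H (i - j) (k (Y (i - 3) x)) = H (i - j) (Y (j - 3) (k x))" for x by simp
    then show ?thesis unfolding Aut_inj[OF H_Aut] by (simp add: fun_eq_iff)
  qed
  have a65: "adj (L 6) (L 5)" and a67: "adj (L 6) (L 7)" and n57: "L 5 \<noteq> L 7"
    using L_adj[of 6] L_noback[of 6] by simp_all
  obtain w where w: "adj (L 6) w" "w \<noteq> L 5" "w \<noteq> L 7" "\<And>u. adj (L 6) u \<longleftrightarrow> u = L 5 \<or> u = L 7 \<or> u = w"
    by (rule third[OF a65 a67 n57]) (rule that)
  have "arc_transitive 1" using arc_transitive_le[OF s_trans] s_ge by auto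
  then obtain g where g: "g \<in> Aut" and g6: "g (L 6) = L 6" and g5: "g (L 5) = w"
    using arc_transitive_edges[OF _ a65 w(1)] by blast
  \<comment> \<open>\<open>u\<close> ends the third branch \<open>L 6, w, u\<close>, and
    \<open>y\<close> is the involution belonging to it, as \<open>Y 1\<close> belongs to
    \<open>L 4\<close>.\<close>
  define u where "u = g (L 4)"
  define y where "y = g \<circ> Y 1 \<circ> inv_into UNIV g"
  note gi = Aut_inv_simps[OF g]
  have yA: "y \<in> Aut" unfolding y_def by (intro Aut_comp Y_Aut Aut_inv g)
  have yy: "y (y x) = x" for x by (simp add: y_def gi)
  have yg: "y (g x) = g (Y 1 x)" for x by (simp add: y_def gi)
  have X1: "Y 1 (L k) = L k" if "1 \<le> k" "k \<le> 7" for k using that s7 by (intro Y_fix) auto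
  have y6: "y (L 6) = L 6" using yg[of "L 6"] g6 X1 by simp
  have yw: "y w = w" using yg[of "L 5"] g5 X1 by simp
  have y7: "y (g (L 7)) = g (L 7)" using yg[of "L 7"] X1 by simp
  have "adj (g (L 6)) (g (L 7))" unfolding Aut_adj[OF g] by (rule a67)
  then have g7: "adj (L 6) (g (L 7))" by (simp add: g6)
  have "g (L 7) \<noteq> g (L 5)" unfolding Aut_inj[OF g] using n57 by auto
  then have wg7: "w \<noteq> g (L 7)" using g5 by auto
  have y57: "y (L 5) = L 5" "y (L 7) = L 7"
    using fix_third[OF yA w(1) g7 wg7 y6 yw y7] a65 a67 by auto
  have yfix: "fixes_arc y L 5 7"
    unfolding fixes_arc_def
  proof (intro allI impI)
    fix k :: int assume "5 \<le> k \<and> k \<le> 7"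
    then have "k = 5 \<or> k = 6 \<or> k = 7" by auto
    then show "y (L k) = L k" using y6 y57 by auto
  qed
  have u6: "u \<noteq> L 6" "adj w u"
  proof -
    have "g (L 4) \<noteq> g (L 6)" unfolding Aut_inj[OF g] using L_noback[of 5] by auto
    then show "u \<noteq> L 6" by (simp add: u_def g6)
    have "adj (g (L 5)) (g (L 4))" unfolding Aut_adj[OF g] using L_adj(2)[of 5] by simp
    then show "adj w u" by (simp add: u_def g5)
  qed
  \<comment> \<open>The sign \<open>e\<close> selects the branch, \<open>L 4\<close> for
    \<open>j = 1\<close> and \<open>L 8\<close> for \<open>j = 5\<close>; \<open>t\<close> is the
    4-arc from there through \<open>L 6\<close> to \<open>u\<close>.\<close>
  have y_not: "y \<circ> Y j \<noteq> Y j \<circ> y"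
    if j: "j = 1 \<or> j = 5" and e: "e \<in> {1, -1}" "L (6 - 2 * e) = L (j + 3)" for j e
  proof
    assume comm: "y \<circ> Y j = Y j \<circ> y"
    define t where "t k = (if k = 0 then L (6 - 2 * e) else if k = 1 then L (6 - e)
       else if k = 2 then L 6 else if k = 3 then w else u)" for k :: int
    have "arc t 0 4"
      unfolding arc_def
    proof (intro conjI allI impI)
      fix k :: int assume "0 \<le> k \<and> k < 4"
      then have "k = 0 \<or> k = 1 \<or> k = 2 \<or> k = 3" by auto
      then show "adj (t k) (t (k + 1))"
        using e w u6 L_adj[of 4] L_adj[of 5] L_adj[of 8] L_adj[of 7] by (auto simp: t_def)
    next
      fix k :: int assume "0 < k \<and> k < 4"
      then have "k = 1 \<or> k = 2 \<or> k = 3" by auto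
      then show "t (k - 1) \<noteq> t (k + 1)"
        using e w u6 L_noback[of 5] L_noback[of 7] by (auto simp: t_def)
    qed
    moreover have "arc (\<lambda>k. L (k + 4)) 0 4" unfolding arc_shift by (rule L_arc)
    moreover have "arc_transitive 4" using arc_transitive_le[OF s_trans] s7 by auto
    ultimately obtain k where k: "k \<in> Aut" "\<forall>m. 0 \<le> m \<and> m \<le> 4 \<longrightarrow> k (L (m + 4)) = t m"
      unfolding arc_transitive_def by blast
    have k4: "k (L 4) = L (j + 3)" and k8: "k (L 8) = u"
      using k(2)[rule_format, of 0] k(2)[rule_format, of 4] e by (auto simp: t_def)
    have kj: "k \<circ> Y 1 = Y j \<circ> k" using transport[OF k(1) k4] by simp
    have "(inv_into UNIV g \<circ> k) (L 8) = L 4" using k8 by (simp add: u_def gi)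
    from transport[OF Aut_comp[OF Aut_inv[OF g] k(1)] this]
    have "inv_into UNIV g (k (Y 5 x)) = Y 1 (inv_into UNIV g (k x))" for x by (simp add: fun_eq_iff)
    then have ky: "k (Y 5 x) = y (k x)" for x by (simp add: y_def) (metis gi(1))
    have "k (Y 1 (Y 5 x)) = k (Y 5 (Y 1 x))" for x
      using fun_cong[OF kj] fun_cong[OF comm] by (simp add: ky)
    then have "com 1 5" unfolding Aut_inj[OF k(1)] by (simp add: fun_eq_iff)
    then show False using far15 by blast
  qed
  have y1: "y \<circ> Y 1 \<noteq> Y 1 \<circ> y" by (rule y_not[of 1 1]) auto
  have y5: "y \<circ> Y 5 \<noteq> Y 5 \<circ> y" by (rule y_not[of 5 "-1"]) auto
  \<comment> \<open>Otherwise \<open>y\<close> would lie in the group generated by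
    \<open>Y 2, ..., Y 5\<close>, which centralizes \<open>Y 5\<close>. The claim \<open>m4\<close>
    is the mirror image.\<close>
  have m8: "y (L (7 + 1)) \<noteq> L (7 + 1)"
  proof
    assume "y (L (7 + 1)) = L (7 + 1)"
    with yfix have "fixes_arc y L 5 (7 + 1)" by (rule fixes_snoc)
    then have "y \<circ> Y 5 = Y 5 \<circ> y"
      by (intro generated_commute[OF yA, of 2 5]) (use s7 in \<open>auto intro!: near\<close>)
    with y5 show False by blast
  qed
  have m4: "y (L (5 - 1)) \<noteq> L (5 - 1)"
  proof
    assume "y (L (5 - 1)) = L (5 - 1)"
    with yfix have "fixes_arc y L (5 - 1) 7" by (rule fixes_cons)
    then have "y \<circ> Y 1 = Y 1 \<circ> y"
      by (intro generated_commute[OF yA, of 1 4]) (use s7 in \<open>auto intro!: near\<close>)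
    with y1 show False by blast
  qed
  define v where "v = Y 1 \<circ> y"
  have vA: "v \<in> Aut" unfolding v_def by (intro Aut_comp Y_Aut yA)
  have "Y 1 (y (L (7 + 1))) = L (7 + 1)"
    by (rule move_right_swap[OF Y_Aut yA])
       (use s7 m8 Y_move_right[of 1] fixes_sub[OF yfix, of 6 7] in \<open>simp_all add: Y_fixes\<close>)
  then have "v (L (7 + 1)) = L (7 + 1)" by (simp add: v_def)
  moreover have "fixes_arc v L 5 7" unfolding v_def by (rule fixes_comp[OF Y_fixes yfix]) (use s7 in auto)
  ultimately have v58: "fixes_arc v L 5 8" using fixes_snoc[of v L 5 7] by simp
  have v4: "v (L (5 - 1)) \<noteq> L (5 - 1)"
  proof
    assume "v (L (5 - 1)) = L (5 - 1)"
    then have "Y 1 (Y 1 (y (L 4))) = Y 1 (L 4)" by (simp add: v_def)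
    then show False using X1[of 4] m4 by simp
  qed
  \<comment> \<open>\<open>Y 1\<close> has corrected \<open>y\<close> at \<open>L 8\<close>, and
    \<open>Y 5\<close> corrects it at \<open>L 4\<close>.\<close>
  define z where "z = Y 5 \<circ> v"
  have zA: "z \<in> Aut" unfolding z_def by (intro Aut_comp Y_Aut vA)
  have "Y 5 (v (L (5 - 1))) = L (5 - 1)"
    by (rule move_left_swap[OF Y_Aut vA])
       (use s7 v4 Y_move_left[of 5] fixes_sub[OF v58, of 5 6] in \<open>simp_all add: Y_fixes\<close>)
  then have "z (L (5 - 1)) = L (5 - 1)" by (simp add: z_def)
  moreover have "fixes_arc z L 5 8" unfolding z_def by (rule fixes_comp[OF Y_fixes v58]) (use s7 in auto)
  ultimately have z48: "fixes_arc z L 4 8" using fixes_cons[of z L 5 8] by simp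
  have Xcom: "Y k \<circ> q = q \<circ> Y k" if "q \<in> Aut" "fixes_arc q L 4 8" "1 \<le> k" "k \<le> 5" for q k
    by (rule generated_commute[OF that(1), of 2 4, symmetric]) (use that s7 in \<open>auto intro!: near\<close>)
  have zz: "z \<circ> z = id"
  proof -
    \<comment> \<open>The elements of square 1 that are central in the pointwise stabilizer of
      \<open>L 4, ..., L 8\<close>: they form a submonoid containing the generators
      \<open>Y 2\<close>, \<open>Y 3\<close>, \<open>Y 4\<close>.\<close>
    define S where "S = {q \<in> Aut. q \<circ> q = id \<and> fixes_arc q L 4 8 \<and>
      (\<forall>r\<in>Aut. fixes_arc r L 4 8 \<longrightarrow> q \<circ> r = r \<circ> q)}"
    have "z \<in> S"
    proof (rule generated[OF _ _ zA, of S 2 4])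
      show "id \<in> S" by (simp add: S_def Aut_id fixes_arc_def)
      show "Y k \<in> S" if "2 \<le> k" "k \<le> 4" for k
        unfolding S_def using that s7 Xcom by (auto simp: Y_Aut fun_eq_iff intro!: Y_fixes)
      show "p \<circ> q \<in> S" if p: "p \<in> S" and q: "q \<in> S" for p q
      proof -
        have P: "p \<in> Aut" "p \<circ> p = id" "fixes_arc p L 4 8" "\<And>r. r \<in> Aut \<Longrightarrow> fixes_arc r L 4 8 \<Longrightarrow> p \<circ> r = r \<circ> p"
          using p by (simp_all add: S_def)
        have Q: "q \<in> Aut" "q \<circ> q = id" "fixes_arc q L 4 8" "\<And>r. r \<in> Aut \<Longrightarrow> fixes_arc r L 4 8 \<Longrightarrow> q \<circ> r = r \<circ> q"
          using q by (simp_all add: S_def)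
        have pq: "p (q x) = q (p x)" "p (p x) = x" "q (q x) = x" for x
          using fun_cong[OF P(4)[OF Q(1,3)], of x] fun_cong[OF P(2), of x] fun_cong[OF Q(2), of x] by simp_all
        have r: "(p \<circ> q) \<circ> r = r \<circ> (p \<circ> q)" if "r \<in> Aut" "fixes_arc r L 4 8" for r
          using P(4)[OF that] Q(4)[OF that] by (metis comp_assoc)
        have "(p \<circ> q) \<circ> (p \<circ> q) = id" by (rule ext) (simp add: pq)
        then show ?thesis unfolding S_def mem_Collect_eq
          using Aut_comp[OF P(1) Q(1)] fixes_comp[OF P(3) Q(3)] r by blast
      qed
    qed (use s7 z48 in auto)
    then show ?thesis by (simp add: S_def)
  qed
  have zx: "z (z x) = x" "Y 1 (z x) = z (Y 1 x)" "Y 5 (z x) = z (Y 5 x)" for x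
    using fun_cong[OF zz, of x] fun_cong[OF Xcom[OF zA z48, of 1], of x] fun_cong[OF Xcom[OF zA z48, of 5], of x] by auto
  \<comment> \<open>As \<open>z\<close> commutes with \<open>Y 1\<close> and \<open>Y 5\<close> and
    has square 1, the relation \<open>y \<circ> y = id\<close> loses \<open>z\<close> and says that
    \<open>Y 1\<close> and \<open>Y 5\<close> commute.\<close>
  have yx: "y x = Y 1 (Y 5 (z x))" for x by (simp add: z_def v_def)
  have "Y 1 (Y 5 (Y 1 (Y 5 x))) = x" for x
  proof -
    have "x = y (y x)" by (simp add: yy)
    also have "\<dots> = Y 1 (Y 5 (z (Y 1 (Y 5 (z x)))))" by (simp only: yx)
    also have "\<dots> = Y 1 (Y 5 (Y 1 (Y 5 x)))" by (simp add: zx)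
    finally show ?thesis by simp
  qed
  then have "Y 1 (Y 5 x) = Y 5 (Y 1 x)" for x by (metis Y_involution)
  then show False using far15 by (simp add: fun_eq_iff)
qed

lemma less_six: "s < 6"
  using six_le_imp_seven not_seven by (meson linorder_not_le)

end

section \<open>Construction of the walk and Tutte's theorem\<close>

context cubic_graph begin

text \<open>An automorphism \<open>h\<close> that shifts an \<open>s\<close>-arc one step along a
  longer arc spreads it, by its powers, to an infinite walk. \<open>Y 0\<close> fixes
  \<open>s\<close> vertices of the walk and turns aside at the next; rigidity makes it move the
  vertex before them as well.\<close>

lemma shunt_line_exists:
  assumes s: "s \<ge> 3" and tr: "arc_transitive s" and R: "end_rigid s" and x: "x \<in> V"
  shows "\<exists>L Y H. shunt_line V adj s L Y H"
proof -
  obtain v where "arc v 0 (int (nat (s + 1)))" using arcs_exist[OF x] by blast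
  then have v: "arc v 0 (s + 1)" using s by simp
  have "arc v 0 s" "arc (\<lambda>k. v (k + 1)) 0 s"
    unfolding arc_shift using v s by (auto intro: arc_sub)
  then obtain h where h: "h \<in> Aut" "\<forall>k. 0 \<le> k \<and> k \<le> s \<longrightarrow> h (v k) = v (k + 1)"
    using tr unfolding arc_transitive_def by blast
  note hi = Aut_inv_simps[OF h(1)]
  define H where "H k = (if 0 \<le> k then h ^^ nat k else inv_into UNIV h ^^ nat (- k))" for k :: int
  have H_Aut: "H k \<in> Aut" for k
  proof -
    have "q ^^ n \<in> Aut" if "q \<in> Aut" for q n
    proof (induction n)
      case 0 show ?case unfolding funpow.simps(1) by (rule Aut_id)
    next
      case (Suc n) show ?case unfolding funpow.simps(2) by (rule Aut_comp[OF that Suc])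
    qed
    then show ?thesis by (simp add: H_def h Aut_inv)
  qed
  have H_suc: "H (k + 1) y = h (H k y)" for k y
  proof (cases "0 \<le> k")
    case True then show ?thesis by (simp add: H_def nat_add_distrib)
  next
    case False
    then obtain n where n: "k = - int (Suc n)"
      by (metis add.inverse_inverse linorder_not_le negD)
    then have e: "nat (- k) = Suc n" "nat (- (k + 1)) = n" "0 \<le> k + 1 \<longleftrightarrow> n = 0" by auto
    show ?thesis unfolding H_def e using False by (cases "n = 0") (simp_all only: e, simp_all add: hi)
  qed
  have H_add: "H (j + k) y = H j (H k y)" for j k y
  proof (induction j rule: int_induct[of _ 0])
    case base then show ?case by (simp add: H_def)
  next
    case (step1 i)
    have "H (i + 1 + k) y = h (H (i + k) y)" using H_suc[of "i + k" y] by (simp add: algebra_simps)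
    with step1 show ?case by (simp add: H_suc)
  next
    case (step2 i)
    have "h (H (i - 1 + k) y) = h (H (i - 1) (H k y))"
      using H_suc[of "i - 1 + k" y] H_suc[of "i - 1" "H k y"] step2 by (simp add: algebra_simps)
    then show ?case by (simp add: Aut_inj[OF h(1)])
  qed
  have H0: "H 0 = id" by (simp add: H_def)
  define L where "L k = H k (v 0)" for k
  have H_L: "H j (L k) = L (k + j)" for j k by (simp add: L_def H_add[symmetric] add.commute)
  have Lv: "L k = v k" if "0 \<le> k" "k \<le> s + 1" for k
    using that
  proof (induction k rule: int_ge_induct)
    case base then show ?case by (simp add: L_def H0)
  next
    case (step i)
    then have "L (i + 1) = h (v i)" using H_suc[of i "v 0"] by (simp add: L_def)
    then show ?case using h(2) step by simp
  qed
  have L_arc: "arc L i j" for i j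
    unfolding arc_def
  proof (intro conjI allI impI)
    fix k
    have "adj (L 0) (L 1)" using Lv[of 0] Lv[of 1] arc_step[OF v, of 0] s by simp
    then have "adj (H k (L 0)) (H k (L 1))" by (simp add: Aut_adj[OF H_Aut])
    then show "adj (L k) (L (k + 1))" by (simp add: H_L add.commute)
    have "L 0 \<noteq> L 2" using Lv[of 0] Lv[of 2] arc_noback[OF v, of 1] s by simp
    then have "H (k - 1) (L 0) \<noteq> H (k - 1) (L 2)" by (simp add: Aut_inj[OF H_Aut])
    then show "L (k - 1) \<noteq> L (k + 1)" by (simp add: H_L add.commute)
  qed
  have rigid: "p = id" if p: "p \<in> Aut" "fixes_arc p L i (i + s)" for p i
  proof (rule rigid_stabilizer[OF _ R p(1), of "\<lambda>k. L (k + i)"])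
    show "arc (\<lambda>k. L (k + i)) 0 s" unfolding arc_shift by (rule L_arc)
    show "fixes_arc p (\<lambda>k. L (k + i)) 0 s" using p(2) by (auto simp: fixes_arc_def)
  qed (use s in simp)
  have "adj (L (s - 1)) (L (s - 1 - 1))" "adj (L (s - 1)) (L (s - 1 + 1))" "L (s - 1 - 1) \<noteq> L (s - 1 + 1)"
    using arc_step'[OF L_arc[of 0 s], of "s - 1"] arc_step[OF L_arc[of 0 s], of "s - 1"]
      arc_noback[OF L_arc[of 0 s], of "s - 1"] s by auto
  from third[OF this] obtain d where d: "adj (L (s - 1)) d" "d \<noteq> L (s - 1 - 1)" "d \<noteq> L (s - 1 + 1)" by metis
  have "arc (L(s - 1 + 1 := d)) 0 (s - 1 + 1)"
    by (rule arc_extend[OF L_arc]) (use d s in auto)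
  then have "arc (L(s := d)) 0 s" by simp
  then obtain p where p: "p \<in> Aut" "\<forall>k. 0 \<le> k \<and> k \<le> s \<longrightarrow> p (L k) = (L(s := d)) k"
    using tr L_arc[of 0 s] unfolding arc_transitive_def by blast
  have pL: "p (L k) = L k" if "0 \<le> k" "k < s" for k using p(2) that by auto
  have ps: "p (L s) \<noteq> L s" using p(2)[rule_format, of s] d s by auto
  define Y where "Y i = H i \<circ> p \<circ> H (- i)" for i
  have H_inv: "H i (H (- i) y) = y" "H (- i) (H i y) = y" for i y by (simp_all add: H_add[symmetric] H0)
  have Y_L: "Y i (L k) = L k \<longleftrightarrow> p (L (k - i)) = L (k - i)" for i k
  proof -
    have "Y i (L k) = L k \<longleftrightarrow> H i (p (L (k - i))) = H i (L (k - i))" by (simp add: Y_def H_L)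
    then show ?thesis by (simp only: Aut_inj[OF H_Aut])
  qed
  have H_Y: "H j \<circ> Y i = Y (i + j) \<circ> H j" for i j
  proof
    fix y
    have "H (- (i + j)) (H j y) = H (- i) y" by (simp add: H_add[symmetric])
    then show "(H j \<circ> Y i) y = (Y (i + j) \<circ> H j) y"
      by (simp add: Y_def H_add[symmetric] add.commute)
  qed
  have "shunt_line V adj s L Y H"
  proof
    show "3 \<le> s" "arc_transitive s" by fact+
    show "arc L i j" for i j by (rule L_arc)
    show "Y i \<in> Aut" for i unfolding Y_def by (intro Aut_comp H_Aut p(1))
    show "Y i (L k) = L k" if "i \<le> k" "k \<le> i + s - 1" for i k
      unfolding Y_L using that by (intro pL) auto
    show "Y i (L (i + s)) \<noteq> L (i + s)" for i unfolding Y_L using ps by simp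
    show "Y i (L (i - 1)) \<noteq> L (i - 1)" for i
      unfolding Y_L
    proof
      assume "p (L (i - 1 - i)) = L (i - 1 - i)"
      then have "p (L (- 1)) = L (- 1)" by simp
      then have "p (L k) = L k" if "- 1 \<le> k" "k \<le> -1 + s" for k
        using pL[of k] that by (cases "k = -1") auto
      then have "fixes_arc p L (-1) (-1 + s)" by (simp add: fixes_arc_def)
      then have "p = id" by (rule rigid[OF p(1)])
      then show False using ps by simp
    qed
    show "p = id" if "p \<in> Aut" "fixes_arc p L i (i + s)" for p i using rigid that by blast
    show "H j \<in> Aut" "H j (L k) = L (k + j)" "H j \<circ> Y i = Y (i + j) \<circ> H j" for i j k
      by (rule H_Aut H_L H_Y)+
    show "Y (i + k) \<circ> Y (j + k) = Y (j + k) \<circ> Y (i + k)" if c: "Y i \<circ> Y j = Y j \<circ> Y i" for i j k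
    proof
      fix y
      define t where "t = H (- k) y"
      have y: "y = H k t" by (simp add: t_def H_inv)
      have hx: "Y (i + k) (H k u) = H k (Y i u)" for i u using fun_cong[OF H_Y[of k i], of u] by simp
      show "(Y (i + k) \<circ> Y (j + k)) y = (Y (j + k) \<circ> Y (i + k)) y"
        using fun_cong[OF c, of t] by (simp add: y hx)
    qed
  qed
  then show ?thesis by blast
qed

text \<open>At the least \<open>s \<ge> 1\<close> for which transitivity on
  \<open>(s + 1)\<close>-arcs fails, stabilizers of \<open>s\<close>-arcs are trivial, and
  \<open>less_six\<close> gives \<open>s \<le> 5\<close>.\<close>

theorem tutte:
  assumes "arc_transitive 1" "p \<in> Aut" "arc v 0 5" "fixes_arc p v 0 5"
  shows "p = id"
proof -
  have v0: "v 0 \<in> V" using arc_step[OF assms(3), of 0] adj_V by simp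
  define P where "P n \<longleftrightarrow> 1 \<le> n \<and> \<not> arc_transitive (int n + 1)" for n
  have "\<exists>n. P n" using not_arc_transitive[OF v0] unfolding P_def by blast
  then obtain n where n: "P n" and least: "\<And>m. m < n \<Longrightarrow> \<not> P m"
    using exists_least_iff[of P] by auto
  define s where "s = int n"
  have s: "s \<ge> 1" using n by (simp add: s_def P_def)
  have tr: "arc_transitive s"
  proof (cases "n = 1")
    case True then show ?thesis using assms(1) by (simp add: s_def)
  next
    case False
    then obtain m where m: "n = Suc m" "1 \<le> m" using n by (cases n) (auto simp: P_def)
    then show ?thesis using least[of m] by (simp add: P_def s_def add.commute)
  qed
  have R: "end_rigid s" by (rule end_rigidI[OF s tr]) (use n in \<open>simp add: P_def s_def\<close>)
  have "s < 6"
  proof (rule ccontr)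
    assume "\<not> s < 6"
    then obtain L Y H where "shunt_line V adj s L Y H"
      using shunt_line_exists[OF _ tr R v0] by auto
    then show False using shunt_line.less_six \<open>\<not> s < 6\<close> by blast
  qed
  then have "arc v 0 s" "fixes_arc p v 0 s" using assms(3,4) by (auto simp: fixes_arc_def intro: arc_sub)
  then show ?thesis using rigid_stabilizer[OF s R assms(2)] by blast
qed

text \<open>Modulo \<open>Y\<close> each power of \<open>p\<close> fixes a 3-arc and is then
  determined, by \<open>tutte\<close>, by the images of the next two vertices. These have four
  possibilities, so two of the powers with exponents \<open>0, ..., 4\<close> agree modulo
  \<open>Y\<close>.\<close>

lemma arc_transitive_power:
  assumes tr: "arc_transitive 1" and V: "x0 \<in> V"
    and Y: "Y \<subseteq> Aut" "\<And>x y. x \<in> Y \<Longrightarrow> y \<in> Y \<Longrightarrow> x \<circ> y \<in> Y" "\<And>x. x \<in> Y \<Longrightarrow> inv_into UNIV x \<in> Y"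
    and X3: "\<And>v w. arc v 0 3 \<Longrightarrow> arc w 0 3 \<Longrightarrow> \<exists>x\<in>Y. \<forall>k. 0 \<le> k \<and> k \<le> 3 \<longrightarrow> x (v k) = w k"
    and p: "p \<in> Aut"
  obtains k where "1 \<le> k" "k \<le> 4" "p ^^ k \<in> Y"
proof -
  obtain w where "arc w 0 (int 5)" using arcs_exist[OF V] by blast
  then have w: "arc w 0 5" by simp
  have pA: "p ^^ n \<in> Aut" for n
    by (induction n) (simp_all only: funpow.simps Aut_id Aut_comp[OF p])
  have "\<exists>x\<in>Y. \<forall>k. 0 \<le> k \<and> k \<le> 3 \<longrightarrow> x (w k) = (p ^^ n) (w k)" for n
    by (rule X3) (use arc_sub[OF w, of 0 3] arc_Aut[OF pA] in auto)
  then obtain x where x: "\<And>n. x n \<in> Y" "\<And>n k. 0 \<le> k \<Longrightarrow> k \<le> 3 \<Longrightarrow> x n (w k) = (p ^^ n) (w k)" by metis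
  have xA: "x n \<in> Aut" for n using x(1) Y(1) by blast
  note xi = Aut_inv_simps[OF xA]
  define q where "q n = inv_into UNIV (x n) \<circ> p ^^ n" for n
  have qA: "q n \<in> Aut" for n unfolding q_def by (intro Aut_comp Aut_inv xA pA)
  have qw: "q n (w k) = w k" if "0 \<le> k" "k \<le> 3" for n k
    using x(2)[OF that] by (simp add: q_def xi flip: x(2)[OF that])
  have two: "\<exists>e1 e2. \<forall>y. adj z y \<and> y \<noteq> a \<longrightarrow> y = e1 \<or> y = e2" if za: "adj z a" for z a
  proof -
    obtain b where b: "adj z b" "b \<noteq> a" by (rule other[OF za])
    show ?thesis using third[OF za b(1) b(2)[symmetric]] by metis
  qed
  have a: "adj (w 3) (w 2)" "adj (w 3) (w 4)" "w 4 \<noteq> w 2" "adj (w 4) (w 5)" "w 5 \<noteq> w 3"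
    using arc_step'[OF w, of 3] arc_step[OF w, of 3] arc_step[OF w, of 4]
      arc_noback[OF w, of 3] arc_noback[OF w, of 4] by auto
  obtain e1 e2 where e: "\<And>y. adj (w 3) y \<Longrightarrow> y \<noteq> w 2 \<Longrightarrow> y = e1 \<or> y = e2" using two[OF a(1)] by blast
  have "\<exists>c1 c2. \<forall>y. adj z y \<and> y \<noteq> w 3 \<longrightarrow> adj (w 3) z \<longrightarrow> y = c1 \<or> y = c2" for z
    using two[of z "w 3"] adj_sym by blast
  then obtain c1 c2 where c: "\<And>z y. adj z y \<Longrightarrow> y \<noteq> w 3 \<Longrightarrow> adj (w 3) z \<Longrightarrow> y = c1 z \<or> y = c2 z" by metis
  define F where "F n = (q n (w 4), q n (w 5))" for n
  define S where "S = {(e1, c1 e1), (e1, c2 e1), (e2, c1 e2), (e2, c2 e2)}"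
  have "F n \<in> S" for n
  proof -
    have "adj (q n (w 3)) (q n (w 4))" "adj (q n (w 4)) (q n (w 5))" unfolding Aut_adj[OF qA] by (rule a)+
    moreover have "q n (w 4) \<noteq> q n (w 2)" "q n (w 5) \<noteq> q n (w 3)" unfolding Aut_inj[OF qA] by (rule a)+
    ultimately have h: "adj (w 3) (q n (w 4))" "adj (q n (w 4)) (q n (w 5))" "q n (w 4) \<noteq> w 2" "q n (w 5) \<noteq> w 3"
      using qw by simp_all
    show ?thesis using e[OF h(1,3)] c[OF h(2,4,1)] by (auto simp: F_def S_def)
  qed
  then have "F ` {..<5::nat} \<subseteq> S" by blast
  then have "card (F ` {..<5::nat}) \<le> card S" by (rule card_mono[rotated]) (simp add: S_def)
  also have "card S \<le> 4" unfolding S_def by (simp add: card_insert_if)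
  finally have "card (F ` {..<5::nat}) < card {..<5::nat}" by simp
  then have "\<not> inj_on F {..<5}" by (rule pigeonhole)
  then obtain i j where ij: "i < j" "j < 5" "F i = F j"
    unfolding inj_on_def by (metis lessThan_iff linorder_neqE_nat)
  define t where "t = inv_into UNIV (q i) \<circ> q j"
  have tA: "t \<in> Aut" unfolding t_def by (intro Aut_comp Aut_inv qA)
  have qq: "q i (w k) = q j (w k)" if "0 \<le> k" "k \<le> 5" for k
  proof -
    have "k \<le> 3 \<or> k = 4 \<or> k = 5" using that by auto
    then show ?thesis using qw that ij(3) by (auto simp: F_def)
  qed
  have "t (w k) = w k" if "0 \<le> k" "k \<le> 5" for k
    by (simp add: t_def qq[OF that, symmetric] Aut_inv_simps[OF qA])
  then have "t = id" using tutte[OF tr tA w] by (simp add: fixes_arc_def)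
  then have "inv_into UNIV (q i) (q j y) = y" for y by (simp add: t_def fun_eq_iff)
  then have "q j y = q i y" for y by (metis Aut_inv_simps(1)[OF qA])
  then have e1: "inv_into UNIV (x j) ((p ^^ j) y) = inv_into UNIV (x i) ((p ^^ i) y)" for y by (simp add: q_def)
  have pj: "(p ^^ j) y = x j (inv_into UNIV (x i) ((p ^^ i) y))" for y by (simp add: e1[symmetric] xi)
  have "p ^^ (j - i) = x j \<circ> inv_into UNIV (x i)"
  proof
    fix y
    define z where "z = inv_into UNIV (p ^^ i) y"
    have y: "y = (p ^^ i) z" by (simp add: z_def Aut_inv_simps[OF pA])
    have "p ^^ j = p ^^ (j - i) \<circ> p ^^ i" using ij by (simp flip: funpow_add)
    then have "(p ^^ (j - i)) y = (p ^^ j) z" by (simp add: y)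
    also have "\<dots> = x j (inv_into UNIV (x i) y)" by (simp add: pj y)
    finally show "(p ^^ (j - i)) y = (x j \<circ> inv_into UNIV (x i)) y" by simp
  qed
  then have "p ^^ (j - i) \<in> Y" using Y(2,3) x(1) by simp
  with that[of "j - i"] ij show thesis by simp
qed

end

section \<open>Finite fields of characteristic 2\<close>

locale binary_field =
  fixes ty :: "'a::{field,finite} itself" and f :: nat
  assumes card_field: "CARD('a) = 2 ^ f" and f_ge: "f \<ge> 3"
begin

text \<open>The sum over all field elements is invariant under translation by 1, so
  \<open>2 ^ f\<close> vanishes in the field.\<close>

lemma add_self [simp]: "x + x = 0" for x :: 'a
proof -
  have "(\<Sum>x::'a\<in>UNIV. x + 1) = (\<Sum>x\<in>UNIV. x)"
    by (rule sum.reindex_bij_witness[of _ "\<lambda>x. x - 1" "\<lambda>x. x + 1"]) auto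
  then have "of_nat CARD('a) = (0::'a)" by (simp add: sum.distrib)
  then have "(2::'a) ^ f = 0" by (simp add: card_field)
  then have "(2::'a) = 0" by simp
  then show ?thesis by (metis mult_2 mult_zero_left)
qed

lemma minus_eq [simp]: "- x = x" for x :: 'a
  by (metis add_self minus_unique)

lemma diff_eq [simp]: "x - y = x + y" for x y :: 'a
  by (metis minus_eq diff_conv_add_uminus)

lemma add_self_left [simp]: "x + (x + y) = y" for x y :: 'a
  by (metis add_self add.assoc add_0)

lemma add_eq_0 [simp]: "x + y = 0 \<longleftrightarrow> x = y" for x y :: 'a
  by (metis diff_eq right_minus_eq)

lemma add_eq_iff: "x + y = z \<longleftrightarrow> x = z + y" for x y z :: 'a
  by (metis diff_eq eq_diff_eq)

text \<open>Fermat's argument: multiplication by \<open>x\<close> permutes \<open>S\<close>, so the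
  factor \<open>x ^ card S\<close> does not change the product over \<open>S\<close>.\<close>

lemma one_mult_power_card:
  fixes S :: "'a set"
  assumes S: "0 \<notin> S" "\<And>x y. x \<in> S \<Longrightarrow> y \<in> S \<Longrightarrow> x * y \<in> S" and x: "x \<in> S"
  shows "x ^ card S = 1"
proof -
  have x0: "x \<noteq> 0" using S x by auto
  have inj: "inj_on ((*) x) S" using x0 by (auto simp: inj_on_def)
  have "(*) x ` S \<subseteq> S" using S x by auto
  then have "(*) x ` S = S" using inj by (simp add: endo_inj_surj)
  then have "(\<Prod>y\<in>S. y) = (\<Prod>y\<in>S. x * y)" by (metis (no_types, lifting) inj prod.reindex_cong)
  also have "\<dots> = x ^ card S * (\<Prod>y\<in>S. y)" by (simp add: prod.distrib)
  finally have "(x ^ card S - 1) * (\<Prod>y\<in>S. y) = 0" by (simp only: left_diff_distrib) simp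
  moreover have "(\<Prod>y\<in>S. y) \<noteq> 0" using S by (simp add: prod_zero_iff)
  ultimately have "x ^ card S - 1 = 0" by (metis mult_eq_0_iff)
  then show ?thesis by (metis right_minus_eq)
qed

lemma subfield_power:
  fixes S :: "'a set"
  assumes "0 \<in> S" "\<And>x y. x \<in> S \<Longrightarrow> y \<in> S \<Longrightarrow> x * y \<in> S" "x \<in> S"
  shows "x ^ card S = x"
proof (cases "x = 0")
  case True then show ?thesis using assms by (auto simp: card_gt_0_iff power_0_left)
next
  case False
  then have "x ^ card (S - {0}) = 1" using assms by (intro one_mult_power_card) auto
  moreover have "card S = Suc (card (S - {0}))" using assms by (metis card.remove finite)
  ultimately show ?thesis by simp
qed

lemma frobenius_card: "x ^ 2 ^ f = x" for x :: 'a
  using subfield_power[of UNIV x] by (simp add: card_field)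

lemma power2_add: "(x + y) ^ 2 = x ^ 2 + y ^ 2" for x y :: 'a
  by (simp add: power2_eq_square algebra_simps)

lemma frobenius_add: "(x + y) ^ 2 ^ n = x ^ 2 ^ n + y ^ 2 ^ n" for x y :: 'a
proof (induction n)
  case (Suc n)
  have "(x + y) ^ 2 ^ Suc n = ((x + y) ^ 2 ^ n) ^ 2" by (simp add: power_mult[symmetric] mult.commute)
  also have "\<dots> = x ^ 2 ^ Suc n + y ^ 2 ^ Suc n"
    by (simp add: Suc power2_add) (simp add: power_mult[symmetric] mult.commute)
  finally show ?case .
qed simp

lemma frobenius_frobenius: "(x ^ 2 ^ m) ^ 2 ^ n = x ^ 2 ^ (m + n)" for x :: 'a
  by (simp add: power_mult[symmetric] power_add)

lemma square_root: obtains y :: 'a where "y ^ 2 = x"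
proof -
  have "(x ^ 2 ^ (f - 1)) ^ 2 ^ 1 = x"
    unfolding frobenius_frobenius using frobenius_card f_ge by simp
  with that show thesis by simp
qed

lemma frobenius_inj: "x ^ 2 ^ n = y ^ 2 ^ n \<longleftrightarrow> x = y" for x y :: 'a
proof
  assume "x ^ 2 ^ n = y ^ 2 ^ n"
  then have "(x + y) ^ 2 ^ n = 0" by (simp add: frobenius_add)
  then show "x = y" by simp
qed simp

lemma card_field_ge: "CARD('a) \<ge> 8"
proof -
  have "(2::nat) ^ 3 \<le> 2 ^ f" using f_ge by (rule power_increasing) simp
  then show ?thesis by (simp add: card_field)
qed

lemma avoid_two: obtains z :: 'a where "z \<noteq> x" "z \<noteq> y"
proof -
  have "card {x, y} < CARD('a)" using card_field_ge by (simp add: card_insert_if)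
  then have "{x, y} \<noteq> UNIV" by auto
  with that show thesis by auto
qed

text \<open>The eighth power is injective, so \<open>x ^ 24 = 1\<close> means
  \<open>x ^ 3 = 1\<close>. Besides 1 only the roots of \<open>x ^ 2 + x + 1\<close> satisfy this,
  which are some \<open>z\<close> and \<open>z + 1\<close>, and the field has at least eight
  elements.\<close>

lemma power_24_ne_1: obtains l :: 'a where "l \<noteq> 0" "l ^ 24 \<noteq> 1"
proof -
  obtain z :: 'a where z: "z \<noteq> 0" "z \<noteq> 1" by (rule avoid_two)
  have "{0, 1, z, z + 1} \<noteq> (UNIV :: 'a set)"
  proof
    assume eq: "{0, 1, z, z + 1} = (UNIV :: 'a set)"
    have "card {0, 1, z, z + 1} \<le> 4" by (simp add: card_insert_if)
    then show False unfolding eq using card_field_ge by linarith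
  qed
  then obtain y where y: "y \<noteq> 0" "y \<noteq> 1" "y \<noteq> z" "y \<noteq> z + 1" by blast
  have cube: "x ^ 3 = 1" if "x ^ 24 = 1" for x :: 'a
  proof -
    have "(x ^ 3) ^ 2 ^ 3 = 1 ^ 2 ^ 3" using that by (simp add: power_mult[symmetric])
    then show ?thesis unfolding frobenius_inj .
  qed
  have quad: "x ^ 2 + x + 1 = 0" if "x \<noteq> 1" "x ^ 24 = 1" for x :: 'a
  proof -
    have "(x + 1) * (x ^ 2 + x + 1) = x ^ 3 + 1" by (simp add: algebra_simps power2_eq_square power3_eq_cube)
    also have "\<dots> = 0" using cube[OF that(2)] by simp
    finally show ?thesis using that by simp
  qed
  show thesis
  proof (rule ccontr)
    assume "\<not> thesis"
    then have "z ^ 24 = 1" "y ^ 24 = 1" using that z y by blast+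
    then have "(z ^ 2 + z + 1) + (y ^ 2 + y + 1) = 0" using quad z y by simp
    moreover have "(z ^ 2 + z + 1) + (y ^ 2 + y + 1) = (z + y) * (z + y + 1)"
      by (simp add: algebra_simps power2_eq_square)
    ultimately have "z + y = 0 \<or> z + y + 1 = 0" by (simp only: mult_eq_0_iff)
    then have "z = y \<or> z + y = 1" by simp
    then show False using y by (metis add_self_left)
  qed
qed

text \<open>Hua's identity \<open>x + (x\<inverse> + (y\<inverse> + x)\<inverse>)\<inverse> = x y x\<close>; in a perfect field of characteristic 2 it
  turns preservation of inverses into multiplicativity.\<close>

lemma additive_inverse_preserving_mult:
  fixes \<sigma> :: "'a \<Rightarrow> 'a"
  assumes add: "\<And>x y. \<sigma> (x + y) = \<sigma> x + \<sigma> y" and one: "\<sigma> 1 = 1"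
    and inv: "\<And>x. x \<noteq> 0 \<Longrightarrow> \<sigma> x * \<sigma> (1 / x) = 1"
  shows "\<sigma> (x * y) = \<sigma> x * \<sigma> y"
proof -
  have zero: "\<sigma> 0 = 0" using add[of 0 0] by simp
  have ne: "\<sigma> x \<noteq> 0" if "x \<noteq> 0" for x using inv[OF that] by auto
  have inv': "\<sigma> (1 / x) = 1 / \<sigma> x" for x
    using inv[of x] ne[of x] zero by (cases "x = 0") (auto simp: field_simps)
  have hua: "x + 1 / (1 / x + 1 / (1 / y + x)) = x * y * x"
    if "x \<noteq> 0" "y \<noteq> 0" "1 / y + x \<noteq> 0" for x y :: 'a
  proof -
    have "1 / y + x = (1 + x * y) / y" using that by (simp add: field_simps)
    then have nz: "1 + x * y \<noteq> 0" and e: "1 / (1 / y + x) = y / (1 + x * y)" using that by auto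
    have "1 / x + y / (1 + x * y) = 1 / (x * (1 + x * y))"
      using that nz by (simp add: field_simps)
    then have "x + 1 / (1 / x + 1 / (1 / y + x)) = x + x * (1 + x * y)"
      using e by simp
    also have "\<dots> = x * y * x" by (simp add: algebra_simps)
    finally show ?thesis .
  qed
  have triple: "\<sigma> (x * y * x) = \<sigma> x * \<sigma> y * \<sigma> x" for x y
  proof -
    consider "x = 0" | "y = 0" | "x \<noteq> 0" "y \<noteq> 0" "1 / y + x = 0" | "x \<noteq> 0" "y \<noteq> 0" "1 / y + x \<noteq> 0" by blast
    then show ?thesis
    proof cases
      case 3
      then have "y = 1 / x" by (auto simp: field_simps)
      then show ?thesis using 3 inv[of x] by simp
    next
      case 4
      have "1 / \<sigma> y + \<sigma> x = \<sigma> (1 / y + x)" by (simp add: add inv')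
      then have "1 / \<sigma> y + \<sigma> x \<noteq> 0" using ne[OF 4(3)] by simp
      with hua[of "\<sigma> x" "\<sigma> y"] hua[of x y] 4 ne show ?thesis by (metis add inv')
    qed (auto simp: zero)
  qed
  have sq: "\<sigma> (x ^ 2) = \<sigma> x ^ 2" for x using triple[of x 1] one by (simp add: power2_eq_square)
  obtain z where z: "z ^ 2 = x" by (rule square_root)
  have "\<sigma> (x * y) = \<sigma> (z * y * z)" using z by (simp add: power2_eq_square mult_ac)
  also have "\<dots> = \<sigma> z ^ 2 * \<sigma> y" by (simp add: triple power2_eq_square)
  also have "\<dots> = \<sigma> x * \<sigma> y" by (simp flip: sq add: z)
  finally show ?thesis .
qed

lemma fixed_by_frobenius: "x ^ 2 = x \<longleftrightarrow> x = 0 \<or> x = 1" for x :: 'a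
proof -
  have "x ^ 2 = x \<longleftrightarrow> x * (x + 1) = 0" by (simp add: power2_eq_square algebra_simps)
  then show ?thesis by simp
qed

text \<open>The minimal polynomial over the prime field divides \<open>\<Prod>i<f. (X - \<alpha>^(2^i))\<close>, whose coefficients
  lie in the prime field, so an automorphism permutes the Frobenius conjugates.\<close>

lemma automorphism_conjugate:
  fixes \<sigma> :: "'a \<Rightarrow> 'a"
  assumes add: "\<And>x y. \<sigma> (x + y) = \<sigma> x + \<sigma> y" and mult: "\<And>x y. \<sigma> (x * y) = \<sigma> x * \<sigma> y" and one: "\<sigma> 1 = 1"
  shows "\<exists>i<f. \<sigma> \<alpha> = \<alpha> ^ 2 ^ i"
proof -
  define P where "P = (\<Prod>i<f. [:\<alpha> ^ 2 ^ i, 1:])"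
  have zero: "\<sigma> 0 = 0" using add[of 0 0] by simp
  have pow: "\<sigma> (x ^ n) = \<sigma> x ^ n" for x n by (induction n) (simp_all add: mult one)
  have sumh: "\<tau> (\<Sum>i\<in>I. g i) = (\<Sum>i\<in>I. \<tau> (g i))"
    if "\<And>x y. \<tau> (x + y) = \<tau> x + \<tau> y" "\<tau> 0 = (0::'a)" "finite I" for \<tau> :: "'a \<Rightarrow> 'a" and g and I :: "nat set"
    using that(3) by induction (simp_all add: that(1,2))
  have map_mult: "map_poly \<tau> (p * q) = map_poly \<tau> p * map_poly \<tau> q"
    if "\<And>x y. \<tau> (x + y) = \<tau> x + \<tau> y" "\<And>x y. \<tau> (x * y) = \<tau> x * \<tau> y" "\<tau> 0 = 0" for \<tau> :: "'a \<Rightarrow> 'a" and p q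
    by (rule poly_eqI) (simp add: coeff_map_poly coeff_mult sumh that)
  define \<phi> :: "'a \<Rightarrow> 'a" where "\<phi> x = x ^ 2" for x
  have \<phi>: "\<phi> (x + y) = \<phi> x + \<phi> y" "\<phi> (x * y) = \<phi> x * \<phi> y" "\<phi> 0 = 0" "\<phi> 1 = 1" for x y
    by (simp_all add: \<phi>_def power2_add power_mult_distrib)
  have "map_poly \<phi> (\<Prod>i<n. [:\<alpha> ^ 2 ^ i, 1:]) = (\<Prod>i<n. [:\<alpha> ^ 2 ^ Suc i, 1:])" for n
  proof (induction n)
    case 0 then show ?case by (simp add: \<phi> map_poly_1')
  next
    case (Suc n)
    have "\<phi> (\<alpha> ^ 2 ^ n) = \<alpha> ^ 2 ^ Suc n" using frobenius_frobenius[of \<alpha> n 1] by (simp add: \<phi>_def)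
    then have "map_poly \<phi> [:\<alpha> ^ 2 ^ n, 1:] = [:\<alpha> ^ 2 ^ Suc n, 1:]" by (simp add: map_poly_pCons \<phi>)
    then show ?case by (simp only: prod.lessThan_Suc map_mult[OF \<phi>(1-3)] Suc)
  qed
  then have "map_poly \<phi> P = (\<Prod>i<f. [:\<alpha> ^ 2 ^ Suc i, 1:])" by (simp add: P_def)
  also have "\<dots> = P"
  proof -
    define g where "g i = [:\<alpha> ^ 2 ^ i, 1:]" for i
    have "g f = g 0" by (simp add: g_def frobenius_card)
    obtain m where m: "f = Suc m" using f_ge by (cases f) auto
    have "(\<Prod>i<f. g (Suc i)) = (\<Prod>i<m. g (Suc i)) * g f" by (simp add: m)
    also have "\<dots> = g 0 * (\<Prod>i<m. g (Suc i))" using \<open>g f = g 0\<close> by simp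
    also have "\<dots> = (\<Prod>i<f. g i)" unfolding m by (rule prod.lessThan_Suc_shift[symmetric])
    finally show ?thesis by (simp add: g_def P_def)
  qed
  finally have "\<phi> (coeff P n) = coeff P n" for n by (metis coeff_map_poly \<phi>(3))
  then have "coeff P n = 0 \<or> coeff P n = 1" for n by (simp add: \<phi>_def fixed_by_frobenius)
  then have fixed: "\<sigma> (coeff P n) = coeff P n" for n using zero one by metis
  have "poly P (\<sigma> \<alpha>) = (\<Sum>i\<le>degree P. coeff P i * \<sigma> \<alpha> ^ i)" by (rule poly_altdef)
  also have "\<dots> = \<sigma> (poly P \<alpha>)"
    by (simp add: poly_altdef sumh[of \<sigma>] add zero mult pow fixed)
  also have "poly P \<alpha> = 0"
    unfolding P_def poly_prod using f_ge by (auto simp: prod_zero_iff intro!: bexI[of _ 0])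
  finally have "poly P (\<sigma> \<alpha>) = 0" by (simp add: zero)
  then obtain i where "i < f" "\<alpha> ^ 2 ^ i + \<sigma> \<alpha> = 0"
    unfolding P_def poly_prod by (auto simp: prod_zero_iff)
  then show ?thesis by (metis add_eq_0)
qed

end

section \<open>Moebius maps and generators of T\<close>

lemma moebius_comp:
  fixes p q r s p' q' r' s' :: "'a::field"
  assumes "p * s - q * r \<noteq> 0" "p' * s' - q' * r' \<noteq> 0"
  shows "moebius p' q' r' s' \<circ> moebius p q r s =
    moebius (p' * p + q' * r) (p' * q + q' * s) (r' * p + s' * r) (r' * q + s' * s)"
proof
  fix x
  show "(moebius p' q' r' s' \<circ> moebius p q r s) x =
    moebius (p' * p + q' * r) (p' * q + q' * s) (r' * p + s' * r) (r' * q + s' * s) x"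
  proof (cases x)
    case None
    show ?thesis
    proof (cases "r = 0")
      case True
      then have "p \<noteq> 0" using assms by auto
      then show ?thesis using True None by (simp add: moebius_def)
    next
      case False
      have "r' * (p / r) + s' = (r' * p + s' * r) / r" "p' * (p / r) + q' = (p' * p + q' * r) / r"
        using False by (simp_all add: field_simps)
      then show ?thesis using False None by (simp add: moebius_def)
    qed
  next
    case (Some y)
    have den: "(r' * p + s' * r) * y + (r' * q + s' * s) = r' * (p * y + q) + s' * (r * y + s)"
      and num: "(p' * p + q' * r) * y + (p' * q + q' * s) = p' * (p * y + q) + q' * (r * y + s)"
      by (simp_all add: algebra_simps)
    show ?thesis
    proof (cases "r * y + s = 0")
      case True
      \<comment> \<open>If both vanished, \<open>(y, 1)\<close> would be a nonzero kernel vector of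
        the matrix.\<close>
      have "p * y + q \<noteq> 0"
      proof
        assume "p * y + q = 0"
        then have "q = - (p * y)" "s = - (r * y)" using True by (simp_all add: eq_neg_iff_add_eq_0 add.commute)
        then show False using assms by simp
      qed
      then show ?thesis using True Some by (simp add: moebius_def den num)
    next
      case False
      define t where "t = r * y + s"
      have t: "t \<noteq> 0" using False by (simp add: t_def)
      have "r' * ((p * y + q) / t) + s' = (r' * (p * y + q) + s' * t) / t"
        "p' * ((p * y + q) / t) + q' = (p' * (p * y + q) + q' * t) / t"
        using t by (simp_all add: field_simps)
      then show ?thesis using t Some by (simp add: moebius_def den num t_def)
    qed
  qed
qed

lemma moebius_id: "moebius 1 0 0 1 = id"
  by (rule ext) (simp add: moebius_def split: option.split)

lemma moebius_scale:
  assumes "c \<noteq> (0::'a::field)" shows "moebius (c * p) (c * q) (c * r) (c * s) = moebius p q r s"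
proof (rule ext)
  fix x
  have "c * r * y + c * s = c * (r * y + s)" "c * p * y + c * q = c * (p * y + q)" for y
    by (simp_all add: algebra_simps)
  then show "moebius (c * p) (c * q) (c * r) (c * s) x = moebius p q r s x"
    using assms by (simp add: moebius_def split: option.split)
qed

lemma T_comp:
  assumes "g \<in> carrier T_group" "h \<in> carrier T_group"
  shows "g \<circ> h \<in> carrier (T_group :: ('a::field option \<Rightarrow> 'a option) monoid)"
proof -
  obtain p q r s p' q' r' s' where g: "g = moebius p' q' r' s'" "p' * s' - q' * r' \<noteq> 0"
    and h: "h = moebius p q r s" "p * s - q * r \<noteq> 0"
    using assms unfolding T_group_def by auto
  have "(p' * p + q' * r) * (r' * q + s' * s) - (p' * q + q' * s) * (r' * p + s' * r)
      = (p' * s' - q' * r') * (p * s - q * r)"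
    by (simp add: algebra_simps)
  then have "(p' * p + q' * r) * (r' * q + s' * s) - (p' * q + q' * s) * (r' * p + s' * r) \<noteq> 0"
    using g h by simp
  then show ?thesis unfolding g(1) h(1) moebius_comp[OF h(2) g(2)] by (auto simp: T_group_def)
qed

lemma T_id: "id \<in> carrier T_group"
  by (auto simp: T_group_def moebius_id[symmetric]) (rule exI[of _ 1], rule exI[of _ 0], rule exI[of _ 0], rule exI[of _ 1], simp)

lemma T_left_inverse:
  assumes "g \<in> carrier (T_group :: ('a::field option \<Rightarrow> 'a option) monoid)"
  shows "\<exists>h\<in>carrier T_group. h \<circ> g = id \<and> g \<circ> h = id"
proof -
  obtain p q r s where g: "g = moebius p q r s" and det: "p * s - q * r \<noteq> 0"
    using assms unfolding T_group_def by auto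
  let ?D = "p * s - q * r"
  have det': "s * p - (- q) * (- r) \<noteq> 0" using det by (simp add: algebra_simps)
  have id: "moebius ?D 0 0 ?D = id" using moebius_scale[OF det, of 1 0 0 1] by (simp add: moebius_id)
  have "moebius s (- q) (- r) p \<circ> g = moebius ?D 0 0 ?D"
    unfolding g moebius_comp[OF det det'] by (simp add: algebra_simps)
  moreover have "g \<circ> moebius s (- q) (- r) p = moebius ?D 0 0 ?D"
    unfolding g moebius_comp[OF det' det] by (simp add: algebra_simps)
  moreover have "moebius s (- q) (- r) p \<in> carrier T_group" using det' unfolding T_group_def by force
  ultimately show ?thesis using id by auto
qed

lemma T_mult: "g \<otimes>\<^bsub>T_group\<^esub> h = h \<circ> g"
  by (simp add: T_group_def)

lemma T_one: "\<one>\<^bsub>T_group\<^esub> = id"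
  by (simp add: T_group_def)

lemma T_group: "group (T_group :: ('a::field option \<Rightarrow> 'a option) monoid)"
proof (rule groupI)
  show "\<one>\<^bsub>T_group\<^esub> \<in> carrier T_group" using T_id by (simp add: T_group_def)
next
  fix x y :: "'a option \<Rightarrow> 'a option" assume "x \<in> carrier T_group" "y \<in> carrier T_group"
  then show "x \<otimes>\<^bsub>T_group\<^esub> y \<in> carrier T_group" using T_comp[of y x] by (simp add: T_group_def)
next
  fix x y z :: "'a option \<Rightarrow> 'a option" show "x \<otimes>\<^bsub>T_group\<^esub> y \<otimes>\<^bsub>T_group\<^esub> z = x \<otimes>\<^bsub>T_group\<^esub> (y \<otimes>\<^bsub>T_group\<^esub> z)"
    by (simp add: T_group_def comp_assoc)
next
  fix x :: "'a option \<Rightarrow> 'a option" show "\<one>\<^bsub>T_group\<^esub> \<otimes>\<^bsub>T_group\<^esub> x = x" by (simp add: T_group_def)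
next
  fix x :: "'a option \<Rightarrow> 'a option" assume "x \<in> carrier T_group"
  then show "\<exists>y\<in>carrier T_group. y \<otimes>\<^bsub>T_group\<^esub> x = \<one>\<^bsub>T_group\<^esub>"
    using T_left_inverse[of x] unfolding T_mult T_one by blast
qed

lemma T_bij: "g \<in> carrier T_group \<Longrightarrow> bij g"
  using T_left_inverse[of g] by (metis o_bij)

lemma T_inv: "g \<in> carrier T_group \<Longrightarrow> inv_into UNIV g \<in> carrier T_group"
  using T_left_inverse[of g] by (metis inv_unique_comp)

lemma T_inv_comp:
  assumes "g \<in> carrier T_group" shows "g \<circ> inv_into UNIV g = id" "inv_into UNIV g \<circ> g = id"
  using T_bij[OF assms] by (simp_all add: bij_is_inj bij_is_surj surj_iff[symmetric])

definition inversion :: "'a::field option \<Rightarrow> 'a option" where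
  "inversion = moebius 0 1 1 0"

definition dilation :: "'a::field \<Rightarrow> 'a option \<Rightarrow> 'a option" where
  "dilation c = moebius c 0 0 1"

lemma u_simps [simp]: "u_elt t None = None" "u_elt t (Some y) = Some (y + t)"
  by (simp_all add: u_elt_def moebius_def)

lemma dilation_simps [simp]: "dilation c None = None" "dilation c (Some y) = Some (c * y)"
  by (simp_all add: dilation_def moebius_def)

lemma inversion_simps [simp]: "inversion None = Some 0" "inversion (Some y) = (if y = 0 then None else Some (1 / y))"
  by (simp_all add: inversion_def moebius_def)

lemma in_T [simp]: "u_elt t \<in> carrier T_group" "inversion \<in> carrier T_group"
  "c \<noteq> 0 \<Longrightarrow> dilation c \<in> carrier T_group"
proof -
  show "u_elt t \<in> carrier T_group" unfolding u_elt_def T_group_def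
    by (simp, rule exI[of _ 1], rule exI[of _ t], rule exI[of _ 0], rule exI[of _ 1]) simp
  show "inversion \<in> carrier T_group" unfolding inversion_def T_group_def
    by (simp, rule exI[of _ 0], rule exI[of _ 1], rule exI[of _ 1], rule exI[of _ 0]) simp
  show "c \<noteq> 0 \<Longrightarrow> dilation c \<in> carrier T_group" unfolding dilation_def T_group_def
    by (simp, rule exI[of _ c], rule exI[of _ 0], rule exI[of _ 0], rule exI[of _ 1]) simp
qed

lemma option_ext: "\<lbrakk>g None = h None; \<And>y. g (Some y) = h (Some y)\<rbrakk> \<Longrightarrow> g = h"
  by (rule ext) (metis option.exhaust)

lemma u_comp: "u_elt s \<circ> u_elt t = u_elt (s + t)"
  by (rule option_ext) (simp_all add: add_ac)

lemma u_0: "u_elt 0 = id"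
  by (rule option_ext) simp_all

lemma u_eq_iff [simp]: "u_elt s = u_elt t \<longleftrightarrow> s = t"
  by (metis u_simps(2) add_0 option.inject)

lemma dilation_comp: "dilation c \<circ> dilation e = dilation (c * e)"
  by (rule option_ext) (simp_all add: mult_ac)

lemma dilation_1: "dilation 1 = id"
  by (rule option_ext) simp_all

lemma dilation_u: "dilation c \<circ> u_elt t = u_elt (c * t) \<circ> dilation c"
  by (rule option_ext) (simp_all add: algebra_simps)

lemma inversion_inversion: "inversion \<circ> inversion = id"
  by (rule option_ext) simp_all

lemma inversion_dilation: "c \<noteq> 0 \<Longrightarrow> inversion \<circ> dilation c = dilation (1 / c) \<circ> inversion"
  by (rule option_ext) simp_all

lemma T_fixing_infinity:
  assumes "h \<in> carrier T_group" "h None = None"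
  obtains l m where "l \<noteq> 0" "h = u_elt m \<circ> dilation l"
proof -
  obtain p q r s where h: "h = moebius p q r s" "p * s - q * r \<noteq> 0"
    using assms unfolding T_group_def by auto
  have r: "r = 0" using assms(2) h by (auto simp: moebius_def split: if_splits)
  have "h = u_elt (q / s) \<circ> dilation (p / s)"
    by (rule option_ext) (use h r in \<open>auto simp: moebius_def add_divide_distrib\<close>)
  moreover have "p / s \<noteq> 0" using h r by auto
  ultimately show thesis using that by blast
qed

lemma T_double_cancel: "h \<circ> h = id \<Longrightarrow> h \<circ> (h \<circ> k) = k"
  by (simp add: comp_assoc[symmetric])

section \<open>Involutions of T and what they generate\<close>

context binary_field begin

abbreviation T :: "('a option \<Rightarrow> 'a option) set" where "T \<equiv> carrier T_group"

lemma u_u: "u_elt t \<circ> u_elt t = (id :: 'a option \<Rightarrow> _)"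
  by (simp add: u_comp u_0)

lemma two_eq_0 [simp]: "(2::'a) = 0"
  by (metis add_self one_add_one)

lemma involutions:
  "inversion (inversion x) = x" "u_elt t (u_elt t y) = y" for x y :: "'a option"
  using fun_cong[OF inversion_inversion] fun_cong[OF u_u] by auto

text \<open>The big Bruhat cell: composing with \<open>inversion \<circ> u_elt p\<close> brings
  infinity back to itself, where \<open>T_fixing_infinity\<close> applies.\<close>

lemma T_moving_infinity:
  assumes "h \<in> T" "h None = Some p"
  obtains l m where "l \<noteq> 0" "h = u_elt p \<circ> inversion \<circ> u_elt m \<circ> dilation l"
proof -
  have "inversion \<circ> u_elt p \<circ> h \<in> T" by (intro T_comp assms in_T)
  moreover have "(inversion \<circ> u_elt p \<circ> h) None = None" using assms by simp
  ultimately obtain l m where lm: "l \<noteq> 0" "inversion \<circ> u_elt p \<circ> h = u_elt m \<circ> dilation l"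
    by (rule T_fixing_infinity)
  then have "u_elt p \<circ> inversion \<circ> (inversion \<circ> u_elt p \<circ> h) = u_elt p \<circ> inversion \<circ> (u_elt m \<circ> dilation l)"
    by simp
  moreover have "u_elt p \<circ> inversion \<circ> (inversion \<circ> u_elt p \<circ> h) = h"
    by (simp add: fun_eq_iff involutions)
  ultimately have "h = u_elt p \<circ> inversion \<circ> u_elt m \<circ> dilation l" by (simp add: comp_assoc)
  with lm(1) show thesis by (rule that)
qed

text \<open>The involution \<open>parabolic p t\<close> fixes only \<open>p\<close>; the involution \<open>swapping p c\<close> maps \<open>x\<close> to
  \<open>p + c / (x + p)\<close> and exchanges \<open>p\<close> with \<open>\<infinity>\<close>.\<close>

definition parabolic :: "'a \<Rightarrow> 'a \<Rightarrow> 'a option \<Rightarrow> 'a option" where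
  "parabolic p t = u_elt p \<circ> inversion \<circ> u_elt t \<circ> inversion \<circ> u_elt p"

definition swapping :: "'a \<Rightarrow> 'a \<Rightarrow> 'a option \<Rightarrow> 'a option" where
  "swapping p c = u_elt p \<circ> dilation c \<circ> inversion \<circ> u_elt p"

lemma parabolic_involution: "parabolic p t \<circ> parabolic p t = id"
  by (simp add: parabolic_def fun_eq_iff involutions)

lemma parabolic_T: "parabolic p t \<in> T"
  unfolding parabolic_def by (intro T_comp in_T)

lemma swapping_simps [simp]: "swapping p c None = Some p" "swapping p c (Some p) = None"
  by (simp_all add: swapping_def)

lemma swapping_involution: "c \<noteq> 0 \<Longrightarrow> swapping p c \<circ> swapping p c = id"
  by (rule option_ext) (auto simp: swapping_def add.assoc)

lemma u_fix_iff: "t \<noteq> 0 \<Longrightarrow> u_elt t x = x \<longleftrightarrow> x = None" for t :: 'a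
  by (cases x) (auto simp: add_eq_iff)

lemma parabolic_fix_iff:
  assumes "t \<noteq> 0" shows "parabolic p t x = x \<longleftrightarrow> x = Some p"
proof -
  have "parabolic p t x = x \<longleftrightarrow> u_elt t (inversion (u_elt p x)) = inversion (u_elt p x)"
    unfolding parabolic_def by (simp, metis involutions)
  also have "\<dots> \<longleftrightarrow> inversion (u_elt p x) = None" by (rule u_fix_iff[OF assms])
  also have "\<dots> \<longleftrightarrow> x = Some p" by (cases x) (auto simp: add_eq_iff)
  finally show ?thesis .
qed

text \<open>An involution that sends infinity to \<open>p\<close> sends \<open>p\<close> to
  infinity, which forces the translation part \<open>m\<close> of the Bruhat form to be
  \<open>l * p\<close>.\<close>

lemma swapping_form:
  assumes r: "r \<in> T" "r \<circ> r = id" "r None = Some p"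
  obtains c where "c \<noteq> 0" "r = swapping p c"
proof -
  obtain l m where lm: "l \<noteq> 0" "r = u_elt p \<circ> inversion \<circ> u_elt m \<circ> dilation l"
    by (rule T_moving_infinity[OF r(1,3)])
  have "r (Some p) = None" using fun_cong[OF r(2), of None] r(3) by simp
  then have "l * p + m = 0" using lm by (auto split: if_splits)
  then have "m = l * p" by simp
  then have "u_elt m \<circ> dilation l = dilation l \<circ> u_elt p" by (simp add: dilation_u)
  then have "r = u_elt p \<circ> (inversion \<circ> dilation l) \<circ> u_elt p" using lm(2) by (simp add: comp_assoc)
  then have "r = swapping p (1 / l)"
    using lm(1) by (simp add: inversion_dilation swapping_def comp_assoc)
  with that[of "1 / l"] lm show thesis by simp
qed

lemma swapping_conj:
  assumes "c \<noteq> 0" shows "swapping p c \<circ> u_elt s \<circ> swapping p c = parabolic p (s / c)"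
proof -
  have "swapping p c (u_elt s (swapping p c (Some y))) = parabolic p (s / c) (Some y)" for y
  proof (cases "y = p")
    case True then show ?thesis by (simp add: parabolic_def)
  next
    case False
    then have yp: "y + p \<noteq> 0" by simp
    have e: "c / (y + p) + s = (c + s * (y + p)) / (y + p)" "1 / (y + p) + s / c = (c + s * (y + p)) / (c * (y + p))"
      using yp assms by (simp_all add: field_simps)
    have "p + (s + (p + c / (y + p))) = c / (y + p) + s"
      by (metis add.assoc add.commute add_self_left)
    then show ?thesis using yp assms e
      by (auto simp: swapping_def parabolic_def add_ac)
  qed
  moreover have "swapping p c (u_elt s (swapping p c None)) = parabolic p (s / c) None"
    using assms by (simp add: swapping_def parabolic_def add_ac)
  ultimately show ?thesis by (intro option_ext) simp_all
qed

text \<open>If the order were even, the involution among the powers would commute with both factors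
  and so fix their fixed points, infinity and \<open>p\<close>. It would be a dilation about
  \<open>p\<close>, but in characteristic 2 a dilation of square 1 is trivial.\<close>

lemma odd_order:
  assumes s: "s \<noteq> 0" and t: "t \<noteq> 0"
  obtains k where "(u_elt s \<circ> parabolic p t) ^^ (2 * k + 1) = id"
proof -
  define x where "x = (u_elt s :: 'a option \<Rightarrow> _)"
  define y where "y = parabolic p t"
  define g where "g = x \<circ> y"
  have xx: "x \<circ> x = id" and yy: "y \<circ> y = id" by (simp_all add: x_def y_def u_u parabolic_involution)
  have gT: "g \<in> T" unfolding g_def x_def y_def by (intro T_comp in_T parabolic_T)
  have pT: "g ^^ n \<in> T" for n by (induction n) (simp_all only: funpow.simps T_id T_comp[OF gT])
  have bg: "bij g" by (rule T_bij[OF gT])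
  have "finite (UNIV :: ('a option \<Rightarrow> 'a option) set)" by simp
  then have "\<not> inj (\<lambda>n::nat. g ^^ n)" using finite_imageD infinite_UNIV_nat by (metis finite_subset subset_UNIV)
  then obtain i j :: nat where ij: "i < j" "g ^^ i = g ^^ j" unfolding inj_def by (metis linorder_neqE_nat)
  then have "g ^^ i \<circ> g ^^ (j - i) = g ^^ i" by (metis funpow_add le_add_diff_inverse less_imp_le)
  then have "(g ^^ i) ((g ^^ (j - i)) z) = (g ^^ i) z" for z by (metis comp_apply)
  moreover have "inj (g ^^ i)" using bg by (simp add: bij_is_inj inj_fn)
  ultimately have "(g ^^ (j - i)) z = z" for z by (meson injD)
  then have "g ^^ (j - i) = id" by (simp add: fun_eq_iff)
  then have "\<exists>n. 0 < n \<and> g ^^ n = id" using ij by (intro exI[of _ "j - i"]) simp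
  then obtain n where n: "0 < n" "g ^^ n = id" and least: "\<And>m. m < n \<Longrightarrow> \<not> (0 < m \<and> g ^^ m = id)"
    using exists_least_iff[of "\<lambda>n. 0 < n \<and> g ^^ n = id"] by auto
  have "odd n"
  proof
    assume "even n"
    then obtain m where m: "n = m + m" by (metis evenE mult_2)
    define k where "k = g ^^ m"
    have kk: "k \<circ> k = id" using n m by (simp add: k_def funpow_add)
    have kid: "k \<noteq> id" using least[of m] n m by (auto simp: k_def)
    have xg: "x \<circ> g ^^ i \<circ> x \<circ> g ^^ i = id" for i
    proof (induction i)
      case 0 then show ?case by (simp add: xx)
    next
      case (Suc i)
      have c: "g ^^ Suc i = g ^^ i \<circ> g" by (rule funpow_Suc_right)
      have "x \<circ> g ^^ Suc i \<circ> x \<circ> g ^^ Suc i = x \<circ> (g ^^ i \<circ> g) \<circ> x \<circ> (g \<circ> g ^^ i)" by (simp add: c[symmetric])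
      also have "\<dots> = x \<circ> g ^^ i \<circ> (x \<circ> y \<circ> x \<circ> (x \<circ> y)) \<circ> g ^^ i" by (simp add: g_def comp_assoc)
      also have "x \<circ> y \<circ> x \<circ> (x \<circ> y) = x" using xx yy by (metis comp_assoc comp_id)
      finally show ?case using Suc by simp
    qed
    have "x \<circ> k = k \<circ> x"
    proof -
      have "x \<circ> k \<circ> x \<circ> k = id" using xg by (simp add: k_def)
      then show ?thesis using kk xx by (metis comp_assoc comp_id id_comp)
    qed
    then have "x (k None) = k (x None)" by (metis comp_apply)
    then have kN: "k None = None" using u_fix_iff[OF s, of "k None"] by (simp add: x_def)
    have "y = x \<circ> g" using xx by (simp add: g_def comp_assoc[symmetric])
    moreover have "k \<circ> g = g \<circ> k" by (simp add: k_def funpow_swap1 fun_eq_iff)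
    ultimately have "y \<circ> k = k \<circ> y" using \<open>x \<circ> k = k \<circ> x\<close> by (metis comp_assoc)
    then have "y (k (Some p)) = k (y (Some p))" by (metis comp_apply)
    moreover have "y (Some p) = Some p" using parabolic_fix_iff[OF t, of p "Some p"] by (simp add: y_def)
    ultimately have "y (k (Some p)) = k (Some p)" by simp
    then have kp: "k (Some p) = Some p" using parabolic_fix_iff[OF t] by (simp add: y_def)
    obtain l m where lm: "l \<noteq> 0" "k = u_elt m \<circ> dilation l"
      using T_fixing_infinity[of k] kN pT[of m] by (metis k_def)
    have m: "l * p + m = p" using kp lm by simp
    have "k (k (Some (p + 1))) = Some (p + 1)" using kk by (metis comp_apply id_apply)
    moreover have k1: "k (Some (p + e)) = Some (p + l * e)" for e
      using lm m by (simp add: algebra_simps)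
    ultimately have "l * l = 1" using k1[of l] by simp
    then have "(l + 1) ^ 2 = 0" by (simp add: power2_eq_square algebra_simps)
    then have "l = 1" by simp
    then have "k = id" using lm m by (simp add: dilation_1 u_0)
    with kid show False ..
  qed
  then obtain k where "n = 2 * k + 1" by (rule oddE)
  with n that show thesis by (simp add: g_def x_def y_def)
qed

text \<open>The two involutions generate a dihedral group of twice odd order, in which
  \<open>q = g ^^ (k + 1)\<close> is a square root of \<open>g\<close> and the involution
  \<open>x \<circ> q\<close> conjugates \<open>x\<close> to \<open>y\<close>. It exchanges the two
  fixed points, so it is a \<open>swapping\<close>, and comparing images of infinity gives its
  parameter \<open>s / t\<close>. Being a positive word in \<open>x\<close> and \<open>y\<close>, it
  lies in \<open>H\<close>.\<close>

lemma swapping_in: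
  assumes H: "\<And>g h. g \<in> H \<Longrightarrow> h \<in> H \<Longrightarrow> g \<circ> h \<in> H"
    and xy: "u_elt s \<in> H" "parabolic p t \<in> H" and nz: "s \<noteq> 0" "t \<noteq> 0"
  shows "swapping p (s / t) \<in> H"
proof -
  define x where "x = (u_elt s :: 'a option \<Rightarrow> _)"
  define y where "y = parabolic p t"
  define g where "g = x \<circ> y"
  have xx: "x \<circ> x = id" and yy: "y \<circ> y = id" by (simp_all add: x_def y_def u_u parabolic_involution)
  obtain k where k: "g ^^ (2 * k + 1) = id" using odd_order[OF nz] by (metis g_def x_def y_def)
  define q where "q = g ^^ (k + 1)"
  have gH: "g \<in> H" unfolding g_def x_def y_def by (intro H xy)
  have powH: "g ^^ Suc n \<in> H" for n
  proof (induction n)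
    case 0 show ?case by (simp only: funpow.simps comp_id gH)
  next
    case (Suc n) show ?case unfolding funpow.simps(2)[of "Suc n"] by (rule H[OF gH Suc])
  qed
  have gT: "g \<in> T" unfolding g_def x_def y_def by (intro T_comp in_T parabolic_T)
  have powT: "g ^^ n \<in> T" for n by (induction n) (simp_all only: funpow.simps T_id T_comp[OF gT])
  have qH: "q \<in> H" using powH[of k] by (simp add: q_def)
  have "q \<circ> q = g ^^ ((k + 1) + (k + 1))" by (simp only: q_def funpow_add)
  also have "(k + 1) + (k + 1) = Suc (2 * k + 1)" by simp
  also have "g ^^ Suc (2 * k + 1) = g \<circ> g ^^ (2 * k + 1)" by (rule funpow.simps)
  finally have qq: "q \<circ> q = g" unfolding k comp_id .
  have xg: "x \<circ> g ^^ i \<circ> x \<circ> g ^^ i = id" for i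
  proof (induction i)
    case 0 then show ?case by (simp add: xx)
  next
    case (Suc i)
    have c: "g ^^ Suc i = g ^^ i \<circ> g" by (rule funpow_Suc_right)
    have "x \<circ> g ^^ Suc i \<circ> x \<circ> g ^^ Suc i = x \<circ> (g ^^ i \<circ> g) \<circ> x \<circ> (g \<circ> g ^^ i)" by (simp add: c[symmetric])
    also have "\<dots> = x \<circ> g ^^ i \<circ> (x \<circ> y \<circ> x \<circ> (x \<circ> y)) \<circ> g ^^ i" by (simp add: g_def comp_assoc)
    also have "x \<circ> y \<circ> x \<circ> (x \<circ> y) = x" using xx yy by (metis comp_assoc comp_id)
    finally show ?case using Suc by simp
  qed
  define r where "r = x \<circ> q"
  have rr: "r \<circ> r = id" using xg[of "k + 1"] by (simp add: r_def q_def comp_assoc)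
  have "r \<circ> x \<circ> r = (x \<circ> q \<circ> x) \<circ> x \<circ> q" by (simp add: r_def comp_assoc)
  also have "\<dots> = x \<circ> q \<circ> q" using xx by (metis comp_assoc comp_id)
  also have "\<dots> = x \<circ> (x \<circ> y)" by (simp add: comp_assoc qq g_def)
  also have "\<dots> = y" using xx by (simp add: comp_assoc[symmetric])
  finally have rxr: "r \<circ> x \<circ> r = y" .
  have rT: "r \<in> T" unfolding r_def q_def x_def by (intro T_comp in_T powT)
  have "y (r None) = r None"
  proof -
    have "y (r None) = r (x (r (r None)))" using fun_cong[OF rxr, of "r None"] by simp
    also have "r (r None) = None" using fun_cong[OF rr, of None] by simp
    finally show ?thesis by (simp add: x_def)
  qed
  then have rN: "r None = Some p" using parabolic_fix_iff[OF nz(2)] by (simp add: y_def)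
  obtain c where c: "c \<noteq> 0" "r = swapping p c" by (rule swapping_form[OF rT rr rN])
  have "parabolic p (s / c) = parabolic p t"
    using rxr swapping_conj[OF c(1), of p s] by (simp add: c(2) x_def y_def)
  then have "parabolic p (s / c) None = parabolic p t None" by simp
  then have "c / s + p = 1 / t + p" using nz c by (simp add: parabolic_def)
  then have "c / s = 1 / t" by (simp only: add_right_cancel)
  then have "c = s / t" using nz by (simp add: field_simps)
  moreover have "r \<in> H" unfolding r_def x_def by (rule H[OF xy(1) qH])
  ultimately show ?thesis using c(2) by simp
qed

text \<open>Dilations arise from the swappings about 0 that \<open>swapping_in\<close> supplies; the
  Bruhat decomposition gives the rest.\<close>

lemma T_all_of_unipotents:
  assumes H: "\<And>g h. g \<in> H \<Longrightarrow> h \<in> H \<Longrightarrow> g \<circ> h \<in> H"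
    and u: "\<And>t. u_elt t \<in> H" and w: "inversion \<in> H"
  shows "T \<subseteq> H"
proof
  have d: "dilation c \<in> H" if "c \<noteq> 0" for c
  proof -
    have "parabolic 0 1 \<in> H" unfolding parabolic_def by (intro H u w)
    from swapping_in[OF H u this that] have "swapping 0 c \<in> H" by simp
    then have "swapping 0 c \<circ> inversion \<in> H" by (intro H w)
    moreover have "swapping 0 c \<circ> inversion = dilation c"
      by (simp add: swapping_def u_0 fun_eq_iff involutions)
    ultimately show ?thesis by simp
  qed
  fix h assume h: "h \<in> T"
  show "h \<in> H"
  proof (cases "h None")
    case None
    from T_fixing_infinity[OF h this] show ?thesis using H u d by metis
  next
    case (Some p)
    from T_moving_infinity[OF h this] show ?thesis using H u d w by metis
  qed
qed

section \<open>The subfield of translations in a subgroup\<close>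

definition translation_set :: "('a option \<Rightarrow> 'a option) set \<Rightarrow> 'a set" where
  "translation_set H = {t. u_elt t \<in> H}"

lemma dilation_in:
  assumes H: "\<And>g h. g \<in> H \<Longrightarrow> h \<in> H \<Longrightarrow> g \<circ> h \<in> H" and w: "inversion \<in> H"
    and st: "s \<in> translation_set H" "t \<in> translation_set H" "s \<noteq> 0" "t \<noteq> 0"
  shows "dilation (s / t) \<in> H"
proof -
  have u: "u_elt s \<in> H" "u_elt t \<in> H" using st by (simp_all add: translation_set_def)
  have "inversion \<circ> u_elt t \<circ> inversion \<in> H" by (intro H u w)
  then have "parabolic 0 t \<in> H" by (simp add: parabolic_def u_0)
  from swapping_in[OF H u(1) this st(3,4)] have "swapping 0 (s / t) \<circ> inversion \<in> H" by (intro H w)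
  moreover have "swapping 0 (s / t) \<circ> inversion = dilation (s / t)"
    by (simp add: swapping_def u_0 fun_eq_iff involutions)
  ultimately show ?thesis by simp
qed

text \<open>Conjugation by \<open>dilation (s / t)\<close> multiplies the parameter of a translation
  by \<open>s / t\<close>; the cases \<open>t = 1\<close> and \<open>s = 1\<close> give products and
  inverses.\<close>

lemma translations_subfield:
  assumes H: "\<And>g h. g \<in> H \<Longrightarrow> h \<in> H \<Longrightarrow> g \<circ> h \<in> H" and w: "inversion \<in> H" and u1: "u_elt 1 \<in> H"
  shows "0 \<in> translation_set H" "1 \<in> translation_set H"
    and "\<And>s t. s \<in> translation_set H \<Longrightarrow> t \<in> translation_set H \<Longrightarrow> s + t \<in> translation_set H"
    and "\<And>s t. s \<in> translation_set H \<Longrightarrow> t \<in> translation_set H \<Longrightarrow> s * t \<in> translation_set H"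
    and "\<And>s. s \<in> translation_set H \<Longrightarrow> 1 / s \<in> translation_set H"
proof -
  show one: "1 \<in> translation_set H" using u1 by (simp add: translation_set_def)
  show "s + t \<in> translation_set H" if "s \<in> translation_set H" "t \<in> translation_set H" for s t
    using H[of "u_elt s" "u_elt t"] that by (simp add: translation_set_def u_comp)
  from this[OF one one] show zero: "0 \<in> translation_set H" by simp
  have div: "(s / t) * x \<in> translation_set H"
    if s: "s \<in> translation_set H" and t: "t \<in> translation_set H" and x: "x \<in> translation_set H" and nz: "s \<noteq> 0" "t \<noteq> 0" for s t x
  proof -
    have "dilation (s / t) \<circ> u_elt x \<circ> dilation (t / s) \<in> H"
      using x by (intro H dilation_in[OF H w] s t nz) (simp_all add: translation_set_def)
    moreover have "dilation (s / t) \<circ> u_elt x \<circ> dilation (t / s) = u_elt ((s / t) * x)"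
      using nz by (simp add: dilation_u comp_assoc dilation_comp dilation_1)
    ultimately show ?thesis by (simp add: translation_set_def)
  qed
  show "s * t \<in> translation_set H" if "s \<in> translation_set H" "t \<in> translation_set H" for s t
    using div[OF that(1) one that(2)] zero by (cases "s = 0") simp_all
  show "1 / s \<in> translation_set H" if "s \<in> translation_set H" for s
    using div[OF one that one] zero by (cases "s = 0") simp_all
qed

lemma inversion_conj_parabolic:
  "(u_elt \<alpha> \<circ> inversion \<circ> u_elt \<alpha>) \<circ> u_elt 1 \<circ> (u_elt \<alpha> \<circ> inversion \<circ> u_elt \<alpha>) = parabolic \<alpha> 1"
proof -
  have "u_elt \<alpha> (u_elt 1 (u_elt \<alpha> x)) = u_elt 1 x" for x :: "'a option"
    by (cases x) (simp_all add: add_ac)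
  then show ?thesis by (simp add: parabolic_def fun_eq_iff)
qed

lemma swapping_swapping: "c \<noteq> 0 \<Longrightarrow> swapping p c \<circ> swapping p e = u_elt (p + (c / e) * p) \<circ> dilation (c / e)"
  if "e \<noteq> 0" for c e :: 'a
  by (rule option_ext) (use that in \<open>auto simp: swapping_def field_simps\<close>)

text \<open>The fixed points of \<open>swapping p c\<close> solve \<open>(x + p) ^ 2 = c\<close>,
  which in characteristic 2 has the single solution \<open>p + e\<close>. As squaring is onto, every
  involution of \<open>T\<close> is parabolic.\<close>

lemma swapping_as_parabolic:
  assumes "e \<noteq> 0" shows "swapping p (e ^ 2) = parabolic (p + e) (1 / e)"
proof (rule option_ext)
  show "swapping p (e ^ 2) None = parabolic (p + e) (1 / e) None"
    using assms by (simp add: parabolic_def add_ac)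
  fix y
  show "swapping p (e ^ 2) (Some y) = parabolic (p + e) (1 / e) (Some y)"
  proof (cases "y = p")
    case True
    then show ?thesis using assms by (simp add: parabolic_def add_ac)
  next
    case False
    define z where "z = y + p"
    have z: "z \<noteq> 0" using False by (simp add: z_def)
    have y: "y = z + p" by (simp add: z_def add.assoc)
    show ?thesis
    proof (cases "z = e")
      case True
      then show ?thesis using assms z unfolding y
        by (simp add: parabolic_def swapping_def add_ac power2_eq_square)
    next
      case F: False
      then have ze: "z + e \<noteq> 0" by simp
      have "1 / (z + e) + 1 / e = z / (e * (z + e))" using assms ze by (simp add: field_simps)
      moreover have "(e * (z + e)) / z + e = e ^ 2 / z" using z by (simp add: field_simps power2_eq_square)
      ultimately show ?thesis using assms z ze F unfolding y
        by (simp add: parabolic_def swapping_def add_ac)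
    qed
  qed
qed

text \<open>If \<open>H\<close> has no translation besides \<open>id\<close> and \<open>u_elt 1\<close>, then every element of \<open>H\<close> is an involution or
  an involution times \<open>u_elt 1\<close>; the products of two involutions form an abelian subgroup inverted
  by \<open>u_elt 1\<close>, to which the two elements \<open>a\<close> and \<open>a\<^sup>u\<close> of order 3 belong, but these do not commute.\<close>

lemma more_translations:
  assumes HT: "H \<subseteq> T" and H: "\<And>g h. g \<in> H \<Longrightarrow> h \<in> H \<Longrightarrow> g \<circ> h \<in> H"
    and Hinv: "\<And>h. h \<in> H \<Longrightarrow> \<exists>h'\<in>H. h \<circ> h' = id"
    and w: "inversion \<in> H" and u1: "u_elt 1 \<in> H" and w': "u_elt \<alpha> \<circ> inversion \<circ> u_elt \<alpha> \<in> H"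
    and \<alpha>: "\<alpha> \<noteq> 0" "\<alpha> \<noteq> 1"
  shows "\<exists>s. s \<noteq> 0 \<and> s \<noteq> 1 \<and> u_elt s \<in> H"
proof (rule ccontr)
  assume "\<not> ?thesis"
  then have few: "s = 0 \<or> s = 1" if "u_elt s \<in> H" for s using that by blast
  define b where "b = (u_elt 1 :: 'a option \<Rightarrow> _)"
  have bH: "b \<in> H" and bb: "b \<circ> b = id" and bne: "b \<noteq> id" using u1
    by (simp_all add: b_def u_u) (metis u_0 u_eq_iff zero_neq_one)
  define Inv where "Inv = {h \<in> H. h \<circ> h = id \<and> h \<noteq> id}"
  \<comment> \<open>An element fixing infinity, with dilation part \<open>l\<close>, conjugates
    \<open>b\<close> to \<open>u_elt l\<close>, so \<open>few\<close> forces
    \<open>l = 1\<close>.\<close>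
  have stab: "h = id \<or> h = b" if h: "h \<in> H" "h None = None" for h
  proof -
    obtain l m where lm: "l \<noteq> 0" "h = u_elt m \<circ> dilation l"
      using T_fixing_infinity[of h] h HT by blast
    obtain h' where h': "h' \<in> H" "h \<circ> h' = id" using Hinv h by blast
    have "h \<circ> b = u_elt l \<circ> h"
      unfolding lm b_def by (rule option_ext) (simp_all add: algebra_simps)
    then have "h \<circ> b \<circ> h' = u_elt l" using h'(2) by (simp add: comp_assoc)
    moreover have "h \<circ> b \<circ> h' \<in> H" by (intro H h h' bH)
    ultimately have "l = 1" using few[of l] lm by simp
    then have "h = u_elt m" using lm by (simp add: dilation_1)
    then show ?thesis using few[of m] h by (auto simp: b_def u_0)
  qed
  \<comment> \<open>If \<open>h\<close> sends infinity to \<open>p\<close>, then \<open>H\<close>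
    contains a swapping that does the same, and the two differ by an element of
    \<open>{id, b}\<close>.\<close>
  have decomp: "h \<in> Inv \<or> (\<exists>v\<in>Inv. h = v \<circ> b)" if h: "h \<in> H" for h
  proof (cases "h None")
    case None
    from stab[OF h this] show ?thesis
    proof
      assume "h = id" then show ?thesis using bH bb bne by (auto simp: Inv_def)
    next
      assume "h = b" then show ?thesis using bH bb bne by (auto simp: Inv_def)
    qed
  next
    case (Some p)
    obtain l m where lm: "l \<noteq> 0" "h = u_elt p \<circ> inversion \<circ> u_elt m \<circ> dilation l"
      using T_moving_infinity[of h p] Some h HT by blast
    obtain h' where h': "h' \<in> H" "h \<circ> h' = id" using Hinv h by blast
    have "u_elt m \<circ> dilation l \<circ> b = u_elt l \<circ> (u_elt m \<circ> dilation l)"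
      unfolding b_def by (rule option_ext) (simp_all add: algebra_simps)
    moreover have "parabolic p l \<circ> (u_elt p \<circ> inversion) = u_elt p \<circ> inversion \<circ> u_elt l"
      by (simp add: parabolic_def fun_eq_iff involutions)
    ultimately have "h \<circ> b = parabolic p l \<circ> h" unfolding lm by (metis comp_assoc)
    then have "h \<circ> b \<circ> h' = parabolic p l" using h'(2) by (simp add: comp_assoc)
    moreover have "h \<circ> b \<circ> h' \<in> H" by (intro H h h' bH)
    ultimately have "parabolic p l \<in> H" by simp
    from swapping_in[OF H u1 this _ lm(1)] have rH: "swapping p (1 / l) \<in> H" by simp
    define r where "r = swapping p (1 / l)"
    have rr: "r \<circ> r = id" unfolding r_def using lm by (intro swapping_involution) simp
    have "r None \<noteq> None" by (simp add: r_def)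
    then have "r \<noteq> id" by auto
    then have rI: "r \<in> Inv" using rr rH by (simp add: Inv_def r_def)
    have "(r \<circ> h) None = None" using Some by (simp add: r_def)
    moreover have "r \<circ> h \<in> H" using H rH h by (simp add: r_def)
    ultimately have "r \<circ> h = id \<or> r \<circ> h = b" by (intro stab)
    moreover have "h = r \<circ> (r \<circ> h)" by (rule T_double_cancel[OF rr, symmetric])
    ultimately have "h = r \<or> h = r \<circ> b" by auto
    then show ?thesis using rI by blast
  qed
  \<comment> \<open>An involution moving infinity is parabolic with fixed point
    \<open>p + e\<close>, and \<open>swapping (p + e) e\<close>, which exchanges this point with
    infinity, lies in \<open>H\<close>.\<close>
  have conj_b: "\<exists>r\<in>H. r \<circ> r = id \<and> v = r \<circ> b \<circ> r" if v: "v \<in> Inv" for v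
  proof (cases "v None")
    case None
    then have "v = b" using stab v by (auto simp: Inv_def)
    then show ?thesis using bb bH by (intro bexI[of _ b]) (simp_all add: comp_assoc)
  next
    case (Some p)
    obtain c where c: "c \<noteq> 0" "v = swapping p c"
      using swapping_form[of v p] v HT Some by (auto simp: Inv_def)
    obtain e where e: "e ^ 2 = c" by (rule square_root)
    then have e0: "e \<noteq> 0" using c by auto
    have ve: "v = parabolic (p + e) (1 / e)" using swapping_as_parabolic[OF e0] c e by simp
    then have "parabolic (p + e) (1 / e) \<in> H" using v by (simp add: Inv_def)
    from swapping_in[OF H u1 this] e0 have "swapping (p + e) e \<in> H" by simp
    moreover have "swapping (p + e) e \<circ> b \<circ> swapping (p + e) e = v"
      using swapping_conj[OF e0, of "p + e" 1] by (simp add: ve b_def)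
    ultimately show ?thesis using swapping_involution[OF e0] by metis
  qed
  \<comment> \<open>After conjugating \<open>v1\<close> to \<open>b\<close>, a product of order 2
    makes the conjugate \<open>v\<close> of \<open>v2\<close> commute with \<open>b\<close>; then
    \<open>v\<close> fixes infinity and is \<open>id\<close> or \<open>b\<close>.\<close>
  have no_prod: "v1 \<circ> v2 \<notin> Inv" if v1: "v1 \<in> Inv" and v2: "v2 \<in> Inv" for v1 v2
  proof
    assume v12: "v1 \<circ> v2 \<in> Inv"
    obtain r where r: "r \<in> H" "r \<circ> r = id" "v1 = r \<circ> b \<circ> r" using conj_b v1 by blast
    define v where "v = r \<circ> v2 \<circ> r"
    have rr: "r (r x) = x" and v22: "v2 (v2 x) = x" and b2: "b (b x) = x"
      and v12': "v1 (v2 (v1 (v2 x))) = x" for x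
      using fun_cong[OF r(2)] v2 v12 fun_cong[OF bb] by (auto simp: Inv_def fun_eq_iff)
    have "b (v x) = v (b x)" for x
    proof -
      have "r (b (r (v2 (r (b (r (v2 (r (v (b x)))))))))) = r (v (b x))"
        using v12'[of "r (v (b x))"] by (simp add: r(3))
      then have "b (v (b (v (v (b x))))) = v (b x)" unfolding v_def by (metis rr comp_apply)
      then show ?thesis by (simp add: v_def rr v22 b2)
    qed
    then have "b (v None) = v None" by (metis b_def u_simps(1))
    then have "v None = None" using u_fix_iff[of "1::'a" "v None"] by (simp add: b_def)
    moreover have "v \<in> H" unfolding v_def using H r v2 by (simp add: Inv_def)
    ultimately have "v = id \<or> v = b" by (intro stab)
    moreover have v2v: "v2 = r \<circ> v \<circ> r" by (simp add: v_def fun_eq_iff rr)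
    ultimately have "v2 = id \<or> v2 = v1" using r by auto
    then show False using v1 v2 v12 by (auto simp: Inv_def)
  qed
  \<comment> \<open>By \<open>no_prod\<close>, \<open>v1 \<circ> (b \<circ> v2 \<circ> b)\<close> is
    not an involution, so by \<open>decomp\<close> it becomes one after removing the last
    \<open>b\<close>; inverting that involution reverses its factors.\<close>
  have comm: "v1 \<circ> b \<circ> v2 = v2 \<circ> b \<circ> v1" if v1: "v1 \<in> Inv" and v2: "v2 \<in> Inv" for v1 v2
  proof -
    have i: "v1 (v1 x) = x" "v2 (v2 x) = x" "b (b x) = x" for x
      using v1 v2 fun_cong[OF bb] by (auto simp: Inv_def fun_eq_iff)
    have "b \<circ> v2 \<circ> b \<in> Inv"
      using v2 H bH i by (auto simp: Inv_def fun_eq_iff) (metis i(3))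
    then have "v1 \<circ> (b \<circ> v2 \<circ> b) \<notin> Inv" using no_prod v1 by blast
    moreover have "v1 \<circ> (b \<circ> v2 \<circ> b) \<in> H" using v1 v2 H bH by (simp add: Inv_def)
    ultimately obtain v3 where v3: "v3 \<in> Inv" "v1 \<circ> (b \<circ> v2 \<circ> b) = v3 \<circ> b" using decomp by blast
    have "v1 (b (v2 x)) = v3 x" for x using fun_cong[OF v3(2), of "b x"] by (simp add: i)
    moreover have "v3 (v3 x) = x" for x using v3(1) by (auto simp: Inv_def fun_eq_iff)
    ultimately have "v1 (b (v2 (v1 (b (v2 x))))) = x" for x by simp
    then have "v1 (b (v2 x)) = v2 (b (v1 x))" for x by (metis i)
    then show ?thesis by (simp add: fun_eq_iff)
  qed
  define v where "v = u_elt \<alpha> \<circ> inversion \<circ> (u_elt \<alpha> :: 'a option \<Rightarrow> _)"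
  have wI: "inversion \<in> Inv"
    using w by (auto simp: Inv_def inversion_inversion dest: fun_cong[of _ _ None])
  have vN: "v None = Some \<alpha>" by (simp add: v_def)
  then have "v \<noteq> id" by auto
  moreover have "v \<circ> v = id" by (simp add: v_def fun_eq_iff involutions)
  ultimately have "v \<in> Inv" using w' by (simp add: Inv_def v_def)
  from comm[OF wI this] have "inversion (b (v None)) = v (b (inversion None))" by (metis comp_apply)
  moreover have "\<alpha> + 1 \<noteq> 0" using \<alpha> by simp
  ultimately have "1 / (\<alpha> + 1) = 1 / (\<alpha> + 1) + \<alpha>"
    using \<alpha> by (simp add: v_def b_def add.commute)
  then have "1 / (\<alpha> + 1) + (1 / (\<alpha> + 1) + \<alpha>) = 0" by (metis add_self)
  then show False using \<alpha> by (simp only: add_self_left)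
qed

text \<open>Two swappings about \<open>\<alpha>\<close> with parameters \<open>s\<close> and 1 have
  the product \<open>u_elt ((1 + s) * \<alpha>) \<circ> dilation s\<close>. Removing the dilation
  and dividing by \<open>1 + s\<close> leaves the translation by \<open>\<alpha>\<close>;
  \<open>more_translations\<close> provides an \<open>s\<close> for which this division is
  possible.\<close>

lemma translation_alpha:
  assumes HT: "H \<subseteq> T" and H: "\<And>g h. g \<in> H \<Longrightarrow> h \<in> H \<Longrightarrow> g \<circ> h \<in> H"
    and Hinv: "\<And>h. h \<in> H \<Longrightarrow> \<exists>h'\<in>H. h \<circ> h' = id"
    and w: "inversion \<in> H" and u1: "u_elt 1 \<in> H" and w': "u_elt \<alpha> \<circ> inversion \<circ> u_elt \<alpha> \<in> H"
  shows "\<alpha> \<in> translation_set H"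
proof (cases "\<alpha> = 0 \<or> \<alpha> = 1")
  case True then show ?thesis using translations_subfield[OF H w u1] by auto
next
  case False
  then obtain s where s: "s \<noteq> 0" "s \<noteq> 1" "u_elt s \<in> H" using more_translations[OF assms] by blast
  then have sL: "s \<in> translation_set H" by (simp add: translation_set_def)
  note L = translations_subfield[OF H w u1]
  have "parabolic \<alpha> 1 \<in> H" unfolding inversion_conj_parabolic[symmetric] by (intro H u1 w')
  from swapping_in[OF H s(3) this] swapping_in[OF H u1 this] s
  have "swapping \<alpha> s \<circ> swapping \<alpha> 1 \<in> H" by (intro H) simp_all
  then have "u_elt (\<alpha> + s * \<alpha>) \<circ> dilation s \<in> H" using s by (simp add: swapping_swapping)
  moreover have "dilation (1 / s) \<in> H" by (rule dilation_in[OF H w L(2) sL]) (use s in auto)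
  ultimately have "u_elt (\<alpha> + s * \<alpha>) \<circ> dilation s \<circ> dilation (1 / s) \<in> H" by (rule H)
  then have "u_elt (\<alpha> + s * \<alpha>) \<in> H" using s by (simp add: comp_assoc dilation_comp dilation_1)
  then have "(1 + s) * \<alpha> \<in> translation_set H" by (simp add: translation_set_def algebra_simps)
  moreover have "1 / (1 + s) \<in> translation_set H" using L sL by blast
  ultimately have "1 / (1 + s) * ((1 + s) * \<alpha>) \<in> translation_set H" using L(4) by blast
  moreover have "1 + s \<noteq> 0" using s by simp
  ultimately show ?thesis by simp
qed

text \<open>The element lies in no proper subfield. It generates the field over its prime field, but
  not necessarily the multiplicative group.\<close>

definition primitive :: "'a \<Rightarrow> bool" where
  "primitive \<alpha> \<longleftrightarrow> (\<forall>d. 0 < d \<longrightarrow> d < f \<longrightarrow> \<alpha> ^ 2 ^ d \<noteq> \<alpha>)"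

text \<open>As an additive subgroup \<open>S\<close> has order \<open>2 ^ d\<close> by Lagrange, and
  its elements satisfy \<open>x ^ 2 ^ d = x\<close>; for a primitive element this leaves only
  \<open>d = f\<close>.\<close>

lemma subfield_with_primitive:
  assumes "primitive \<alpha>" "\<alpha> \<in> S" "0 \<in> S" "1 \<in> S"
    and add: "\<And>x y. x \<in> S \<Longrightarrow> y \<in> S \<Longrightarrow> x + y \<in> S" and mult: "\<And>x y. x \<in> S \<Longrightarrow> y \<in> S \<Longrightarrow> x * y \<in> S"
  shows "S = UNIV"
proof -
  define A where "A = \<lparr>carrier = (UNIV :: 'a set), monoid.mult = (+) :: 'a \<Rightarrow> 'a \<Rightarrow> 'a, one = 0\<rparr>"
  interpret A: Group.group A
    by (rule groupI) (auto simp: A_def add.assoc intro: exI[of _ "- x" for x])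
  have "subgroup S A"
  proof (rule A.subgroupI)
    show "S \<subseteq> carrier A" "S \<noteq> {}" using assms by (auto simp: A_def)
    show "inv\<^bsub>A\<^esub> x \<in> S" if "x \<in> S" for x
    proof -
      have "inv\<^bsub>A\<^esub> x = x" by (rule A.inv_equality) (auto simp: A_def)
      with that show ?thesis by simp
    qed
    show "x \<otimes>\<^bsub>A\<^esub> y \<in> S" if "x \<in> S" "y \<in> S" for x y using add[OF that] by (simp add: A_def)
  qed
  then have "card (rcosets\<^bsub>A\<^esub> S) * card S = Coset.order A" by (rule A.lagrange)
  also have "Coset.order A = 2 ^ f" by (simp add: Coset.order_def A_def card_field)
  finally have "card S dvd 2 ^ f" by (metis dvd_triv_right)
  then obtain d where d: "d \<le> f" "card S = 2 ^ d"
    using divides_primepow_nat[of 2 "card S" f] by auto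
  have "card {0, 1 :: 'a} \<le> card S" using assms by (intro card_mono) auto
  then have "d \<noteq> 0" using d by (cases "d = 0") auto
  have "\<alpha> ^ 2 ^ d = \<alpha>" using subfield_power[of S \<alpha>] assms d by simp
  then have "\<not> d < f" using assms(1) \<open>d \<noteq> 0\<close> unfolding primitive_def by blast
  then have "d = f" using d by simp
  then have "card S = CARD('a)" using d card_field by simp
  then show ?thesis by (intro card_subset_eq) simp_all
qed

lemma generates_T:
  assumes "primitive \<alpha>" and HT: "H \<subseteq> T" and H: "\<And>g h. g \<in> H \<Longrightarrow> h \<in> H \<Longrightarrow> g \<circ> h \<in> H"
    and Hinv: "\<And>h. h \<in> H \<Longrightarrow> \<exists>h'\<in>H. h \<circ> h' = id"
    and w: "inversion \<in> H" and u1: "u_elt 1 \<in> H" and w': "u_elt \<alpha> \<circ> inversion \<circ> u_elt \<alpha> \<in> H"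
  shows "H = T"
proof -
  have "translation_set H = UNIV"
  proof (rule subfield_with_primitive[OF assms(1)])
    show "\<alpha> \<in> translation_set H" by (rule translation_alpha[OF assms(2-7)])
  qed (rule translations_subfield[OF H w u1]; assumption)+
  then have u: "u_elt t \<in> H" for t by (auto simp: translation_set_def)
  show ?thesis by (rule equalityI[OF HT T_all_of_unipotents[OF H u w]])
qed

text \<open>Simplicity of \<open>T\<close>. Some conjugate sends infinity to 0, and its commutators
  with translations are lower unipotents times translations. Conjugation by dilations produces all
  such products with nonzero parameters, and a quotient of two of them is an arbitrary
  translation.\<close>

lemma normal_subset_T:
  assumes KT: "K \<subseteq> T" and K: "\<And>g h. g \<in> K \<Longrightarrow> h \<in> K \<Longrightarrow> g \<circ> h \<in> K"
    and Kinv: "\<And>k. k \<in> K \<Longrightarrow> \<exists>k'\<in>K. k \<circ> k' = id"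
    and norm: "\<And>k h h'. k \<in> K \<Longrightarrow> h \<in> T \<Longrightarrow> h' \<in> T \<Longrightarrow> h' \<circ> h = id \<Longrightarrow> h \<circ> k \<circ> h' \<in> K"
    and nontrivial: "k \<in> K" "k \<noteq> id"
  shows "K = T"
proof -
  have "\<exists>k\<in>K. k None \<noteq> None"
  proof (cases "k None = None")
    case True
    obtain y where y: "k (Some y) \<noteq> Some y" using nontrivial(2) True option_ext[of k id] by auto
    define h where "h = u_elt y \<circ> (inversion :: 'a option \<Rightarrow> _)"
    define h' where "h' = inversion \<circ> (u_elt y :: 'a option \<Rightarrow> _)"
    have hh': "h' \<circ> h = id" "h \<circ> h' = id" by (simp_all add: h_def h'_def fun_eq_iff involutions)
    have T: "h \<in> T" "h' \<in> T" unfolding h_def h'_def by (intro T_comp in_T)+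
    have "h' \<circ> k \<circ> h \<in> K" by (rule norm[OF nontrivial(1) T(2,1) hh'(2)])
    moreover have "(h' \<circ> k \<circ> h) None \<noteq> None"
    proof
      assume "(h' \<circ> k \<circ> h) None = None"
      then have "h (h' (k (Some y))) = h None" by (simp add: h_def)
      then have "k (Some y) = h None" using fun_cong[OF hh'(2)] by simp
      then show False using y by (simp add: h_def)
    qed
    ultimately show ?thesis by blast
  qed (use nontrivial in blast)
  then obtain k0 p where k0: "k0 \<in> K" "k0 None = Some p" by auto
  define k1 where "k1 = u_elt p \<circ> k0 \<circ> u_elt p"
  have k1: "k1 \<in> K" unfolding k1_def by (rule norm[OF k0(1) in_T(1) in_T(1) u_u])
  have "k1 None = Some 0" using k0 by (simp add: k1_def)
  then obtain l m where lm: "l \<noteq> 0" "k1 = u_elt 0 \<circ> inversion \<circ> u_elt m \<circ> dilation l"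
    using T_moving_infinity[of k1] k1 KT by blast
  then have k1': "k1 = inversion \<circ> u_elt m \<circ> dilation l" by (simp add: u_0)
  obtain k2 where k2: "k2 \<in> K" "k1 \<circ> k2 = id" using Kinv k1 by blast
  have com: "inversion \<circ> u_elt (l * s) \<circ> inversion \<circ> u_elt s \<in> K" for s
  proof -
    have "u_elt s \<circ> k2 \<circ> u_elt s \<in> K" by (rule norm[OF k2(1) in_T(1) in_T(1) u_u])
    then have "k1 \<circ> (u_elt s \<circ> k2 \<circ> u_elt s) \<in> K" using K k1 by blast
    moreover have "k1 \<circ> u_elt s = inversion \<circ> u_elt (l * s) \<circ> inversion \<circ> k1"
    proof -
      have "u_elt m (u_elt (l * s) x) = u_elt (l * s) (u_elt m x)" for x :: "'a option"
        by (cases x) (simp_all add: add_ac)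
      moreover have "dilation l (u_elt s x) = u_elt (l * s) (dilation l x)" for x :: "'a option"
        using fun_cong[OF dilation_u[of l s], of x] by simp
      ultimately show ?thesis unfolding k1' by (simp add: fun_eq_iff involutions)
    qed
    then have "k1 \<circ> (u_elt s \<circ> k2 \<circ> u_elt s) = inversion \<circ> u_elt (l * s) \<circ> inversion \<circ> (k1 \<circ> k2) \<circ> u_elt s"
      by (metis comp_assoc)
    ultimately show ?thesis using k2(2) by simp
  qed
  have all: "inversion \<circ> u_elt y \<circ> inversion \<circ> u_elt z \<in> K" if yz: "y \<noteq> 0" "z \<noteq> 0" for y z
  proof -
    \<comment> \<open>Conjugation by \<open>dilation c\<close> turns the parameters
      \<open>l * s\<close> and \<open>s\<close> into \<open>l * s / c\<close> and
      \<open>c * s\<close>. Their product \<open>l * s ^ 2\<close> is invariant, so it has to be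
      \<open>y * z\<close>.\<close>
    obtain s where s: "s ^ 2 = y * z / l" by (rule square_root)
    then have s0: "s \<noteq> 0" using yz lm by auto
    define c where "c = z / s"
    have c0: "c \<noteq> 0" using yz s0 by (simp add: c_def)
    have "y * z = l * (s * s)" using s lm by (simp add: power2_eq_square)
    then have e: "c * s = z" "l * s / c = y" using s0 yz by (simp_all add: c_def field_simps)
    have "dilation c \<circ> (inversion \<circ> u_elt (l * s) \<circ> inversion \<circ> u_elt s) \<circ> dilation (1 / c) \<in> K"
      by (rule norm[OF com]) (use c0 in \<open>simp_all add: dilation_comp dilation_1\<close>)
    moreover have "dilation c \<circ> (inversion \<circ> u_elt (l * s) \<circ> inversion \<circ> u_elt s) \<circ> dilation (1 / c)
      = inversion \<circ> u_elt (l * s / c) \<circ> inversion \<circ> u_elt (c * s)"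
    proof -
      have di: "dilation e (inversion x) = inversion (dilation (1 / e) x)" if "e \<noteq> 0" for e and x :: "'a option"
        using that by (cases x) auto
      have du: "dilation e (u_elt t x) = u_elt (e * t) (dilation e x)" for e t and x :: "'a option"
        by (cases x) (simp_all add: algebra_simps)
      have dd: "dilation c (dilation (1 / c) x) = x" for x :: "'a option" using c0 by (cases x) auto
      show ?thesis using c0 by (simp add: fun_eq_iff di du dd)
    qed
    ultimately show ?thesis by (simp add: e)
  qed
  have uK: "u_elt t \<in> K" for t
  proof (cases "t = 0")
    case True
    have "k1 \<circ> k2 \<in> K" using K k1 k2 by blast
    then show ?thesis using k2 True by (simp add: u_0)
  next
    case False
    \<comment> \<open>Both \<open>z\<close> and \<open>z + t\<close> must be nonzero for
      \<open>all\<close> to apply to them.\<close>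
    obtain z where z: "z \<noteq> 0" "z \<noteq> t" by (rule avoid_two)
    have zt: "z + t \<noteq> 0" using z by simp
    obtain k3 where k3: "k3 \<in> K" "inversion \<circ> u_elt 1 \<circ> inversion \<circ> u_elt z \<circ> k3 = id"
      using Kinv[OF all[OF one_neq_zero z(1)]] by blast
    have "u_elt z (inversion (u_elt 1 (inversion (inversion (u_elt 1 (inversion (u_elt z (k3 x)))))))) =
       u_elt z (inversion (u_elt 1 (inversion x)))" for x
      using fun_cong[OF k3(2), of x] by simp
    then have k3': "k3 x = u_elt z (inversion (u_elt 1 (inversion x)))" for x by (simp add: involutions)
    have "k3 \<circ> (inversion \<circ> u_elt 1 \<circ> inversion \<circ> u_elt (z + t)) \<in> K"
      by (rule K[OF k3(1) all[OF one_neq_zero zt]])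
    moreover have "u_elt z (u_elt (z + t) x) = u_elt t x" for x :: "'a option"
      using fun_cong[OF u_comp[of z "z + t"], of x] by simp
    then have "k3 \<circ> (inversion \<circ> u_elt 1 \<circ> inversion \<circ> u_elt (z + t)) = u_elt t"
      by (simp add: fun_eq_iff k3' involutions)
    ultimately show ?thesis by simp
  qed
  have "inversion \<circ> u_elt 1 \<circ> inversion \<in> K"
    by (rule norm[OF uK in_T(2) in_T(2) inversion_inversion])
  then have "u_elt 1 \<circ> (inversion \<circ> u_elt 1 \<circ> inversion) \<circ> u_elt 1 \<in> K"
    by (rule K[OF K[OF uK] uK])
  moreover have "u_elt 1 \<circ> (inversion \<circ> u_elt 1 \<circ> inversion) \<circ> u_elt 1 = (inversion :: 'a option \<Rightarrow> _)"
  proof (rule option_ext)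
    fix y :: 'a
    have "1 / (1 + 1 / (1 + y)) + 1 = 1 / y" if "y \<noteq> 0" "1 + y \<noteq> 0"
    proof -
      have "1 + 1 / (1 + y) = y / (1 + y)" using that by (simp add: field_simps)
      then show ?thesis using that by (simp add: field_simps)
    qed
    then show "(u_elt 1 \<circ> (inversion \<circ> u_elt 1 \<circ> inversion) \<circ> u_elt 1) (Some y) = inversion (Some y)"
      by (auto simp: add.commute)
  qed simp
  ultimately have wK: "inversion \<in> K" by (simp only:)
  show ?thesis by (rule equalityI[OF KT T_all_of_unipotents[OF K uK wK]])
qed

end

section \<open>The semidirect product and coset graphs in general\<close>

lemma semidirect_simps:
  "carrier (semidirect_prod N K act) = carrier N \<times> carrier K"
  "\<one>\<^bsub>semidirect_prod N K act\<^esub> = (\<one>\<^bsub>N\<^esub>, \<one>\<^bsub>K\<^esub>)"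
  "(n, k) \<otimes>\<^bsub>semidirect_prod N K act\<^esub> (n', k') = (n \<otimes>\<^bsub>N\<^esub> act (inv\<^bsub>K\<^esub> k) n', k \<otimes>\<^bsub>K\<^esub> k')"
  by (simp_all add: semidirect_prod_def)

lemma inv_Z2: "k = 0 \<or> k = 1 \<Longrightarrow> inv\<^bsub>integer_mod_group 2\<^esub> k = k"
  by (subst inv_integer_mod_group) (auto simp: carrier_integer_mod_group)

lemma G_carrier: "((x, y), k) \<in> carrier G_group \<longleftrightarrow>
    x \<in> carrier T_group \<and> y \<in> carrier T_group \<and> (k = 0 \<or> k = 1)"
  by (auto simp: G_group_def semidirect_simps carrier_integer_mod_group)

lemma G_one: "\<one>\<^bsub>G_group\<^esub> = ((id, id), 0)"
  by (simp add: G_group_def semidirect_simps T_one)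

lemma G_mult_0: "((x, y), 0) \<otimes>\<^bsub>G_group\<^esub> ((x', y'), k') = ((x' \<circ> x, y' \<circ> y), k' mod 2)"
  by (simp add: G_group_def semidirect_simps inv_Z2 T_mult del: inv_integer_mod_group)

lemma G_mult_1: "((x, y), 1) \<otimes>\<^bsub>G_group\<^esub> ((x', y'), k') = ((y' \<circ> x, x' \<circ> y), (1 + k') mod 2)"
  by (simp add: G_group_def semidirect_simps inv_Z2 T_mult del: inv_integer_mod_group)

lemmas G_mult = G_mult_0 G_mult_1

lemma G_cases:
  assumes "z \<in> carrier G_group"
  obtains (even) x y where "z = ((x, y), 0)" "x \<in> carrier T_group" "y \<in> carrier T_group"
    | (odd) x y where "z = ((x, y), 1)" "x \<in> carrier T_group" "y \<in> carrier T_group"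
proof -
  obtain x y k where "z = ((x, y), k)" by (metis surj_pair)
  with assms that show thesis by (auto simp: G_carrier)
qed

lemma G_group: "group (G_group :: 'a::field G_elt monoid)"
proof (rule groupI)
  fix u v :: "'a G_elt" assume "u \<in> carrier G_group" "v \<in> carrier G_group"
  then show "u \<otimes>\<^bsub>G_group\<^esub> v \<in> carrier G_group"
    by (elim G_cases) (simp_all add: G_mult G_carrier T_comp)
next
  show "\<one>\<^bsub>G_group\<^esub> \<in> carrier (G_group :: 'a G_elt monoid)" by (simp add: G_one G_carrier T_id)
next
  fix u v z :: "'a G_elt"
  assume "u \<in> carrier G_group" "v \<in> carrier G_group" "z \<in> carrier G_group"
  then show "u \<otimes>\<^bsub>G_group\<^esub> v \<otimes>\<^bsub>G_group\<^esub> z = u \<otimes>\<^bsub>G_group\<^esub> (v \<otimes>\<^bsub>G_group\<^esub> z)"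
    by (elim G_cases) (simp_all add: G_mult comp_assoc)
next
  fix u :: "'a G_elt" assume "u \<in> carrier G_group"
  then show "\<one>\<^bsub>G_group\<^esub> \<otimes>\<^bsub>G_group\<^esub> u = u" by (elim G_cases) (simp_all add: G_mult G_one)
next
  fix u :: "'a G_elt" assume u: "u \<in> carrier G_group"
  then show "\<exists>v\<in>carrier G_group. v \<otimes>\<^bsub>G_group\<^esub> u = \<one>\<^bsub>G_group\<^esub>"
  proof (cases rule: G_cases)
    case (even x y)
    obtain x' y' where "x' \<in> carrier T_group" "x \<circ> x' = id" "y' \<in> carrier T_group" "y \<circ> y' = id"
      using T_left_inverse even by meson
    then show ?thesis using even
      by (intro bexI[of _ "((x', y'), 0)"]) (simp_all add: G_mult G_one G_carrier)
  next
    case (odd x y)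
    obtain x' y' where "x' \<in> carrier T_group" "x \<circ> x' = id" "y' \<in> carrier T_group" "y \<circ> y' = id"
      using T_left_inverse odd by meson
    then show ?thesis using odd
      by (intro bexI[of _ "((y', x'), 1)"]) (simp_all add: G_mult G_one G_carrier)
  qed
qed

interpretation G: Group.group "G_group :: 'a::field G_elt monoid"
  by (rule G_group)

lemma (in Group.group) coset_eq_iff:
  assumes "subgroup L G" "x \<in> carrier G" "y \<in> carrier G"
  shows "L #> x = L #> y \<longleftrightarrow> y \<otimes> inv x \<in> L"
proof -
  interpret subgroup L G by fact
  have iff: "y \<in> L #> x \<longleftrightarrow> y \<otimes> inv x \<in> L" by (rule rcos_module[OF is_group assms(2,3)])
  show ?thesis
  proof
    assume "L #> x = L #> y"
    then show "y \<otimes> inv x \<in> L" using rcos_self[OF assms(3,1)] iff by simp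
  next
    assume "y \<otimes> inv x \<in> L"
    then show "L #> x = L #> y" by (intro repr_independence[OF _ assms(2,1)]) (simp add: iff)
  qed
qed

text \<open>The left factor from \<open>L\<close> is absorbed by the coset of the neighbour, and a
  change of the representative \<open>x\<close> only alters the right factor.\<close>

lemma (in Group.group) coset_adjacent_iff:
  assumes L: "subgroup L G" and g: "g \<in> carrier G" and x: "x \<in> carrier G"
  shows "(L #> x, w) \<in> parcs (coset_graph G L g) \<longleftrightarrow> (\<exists>l\<in>L. w = L #> (g \<otimes> l \<otimes> x))"
proof -
  interpret subgroup L G by fact
  have Lc: "l \<in> carrier G" if "l \<in> L" for l using that subset by blast
  show ?thesis
  proof
    assume "(L #> x, w) \<in> parcs (coset_graph G L g)"
    then obtain x1 x2 where h: "L #> x = L #> x1" "w = L #> x2" "x1 \<in> carrier G" "x2 \<in> carrier G"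
      "x2 \<otimes> inv x1 \<in> (L #> g) <#> L" unfolding coset_graph_def by auto
    obtain l1 l2 where l: "l1 \<in> L" "l2 \<in> L" "x2 \<otimes> inv x1 = l1 \<otimes> g \<otimes> l2"
      using h(5) unfolding set_mult_def r_coset_def by auto
    have m: "x1 \<otimes> inv x \<in> L" using coset_eq_iff[OF L x h(3)] h(1) by simp
    define l where "l = l2 \<otimes> (x1 \<otimes> inv x)"
    have lL: "l \<in> L" unfolding l_def using l m by simp
    define z where "z = g \<otimes> l \<otimes> x"
    have zc: "z \<in> carrier G" using lL x g Lc by (simp add: z_def)
    have "x2 = (x2 \<otimes> inv x1) \<otimes> x1" using h by (simp add: m_assoc)
    also have "\<dots> = l1 \<otimes> z"
      unfolding l(3) using l h x g Lc by (simp add: l_def z_def m_assoc)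
    finally have "x2 \<otimes> inv z = l1" using l zc Lc by (simp add: m_assoc)
    then have "L #> z = L #> x2"
      using coset_eq_iff[OF L zc h(4)] l by simp
    then show "\<exists>l\<in>L. w = L #> (g \<otimes> l \<otimes> x)" using lL h by (auto simp: z_def)
  next
    assume "\<exists>l\<in>L. w = L #> (g \<otimes> l \<otimes> x)"
    then obtain l where l: "l \<in> L" "w = L #> (g \<otimes> l \<otimes> x)" by blast
    have "g \<otimes> l \<otimes> x \<otimes> inv x = \<one> \<otimes> g \<otimes> l" using l Lc g x by (simp add: m_assoc)
    then have "g \<otimes> l \<otimes> x \<otimes> inv x \<in> (L #> g) <#> L"
      unfolding set_mult_def r_coset_def using l by auto
    then show "(L #> x, w) \<in> parcs (coset_graph G L g)"
      unfolding coset_graph_def using l Lc[OF l(1)] g x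
      by simp (rule exI[of _ x], simp, rule exI[of _ "g \<otimes> l \<otimes> x"], simp)
  qed
qed

context binary_field begin

text \<open>The group generated by \<open>a_elt\<close> and \<open>b_elt\<close>, written in its two
  involutions \<open>b_elt\<close> and \<open>inversion\<close>; it permutes the three points
  infinity, 0, 1.\<close>

definition S3 :: "('a option \<Rightarrow> 'a option) set" where
  "S3 = {id, u_elt 1, inversion, u_elt 1 \<circ> inversion, inversion \<circ> u_elt 1, u_elt 1 \<circ> inversion \<circ> u_elt 1}"

lemma a_elt_eq: "a_elt = u_elt 1 \<circ> (inversion :: 'a option \<Rightarrow> _)"
  by (rule option_ext) (auto simp: a_elt_def moebius_def field_simps)

lemma b_elt_eq: "b_elt = (u_elt 1 :: 'a option \<Rightarrow> _)"
  by (rule option_ext) (simp_all add: b_elt_def moebius_def)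

lemma braid: "inversion \<circ> u_elt 1 \<circ> inversion = u_elt 1 \<circ> inversion \<circ> (u_elt 1 :: 'a option \<Rightarrow> _)"
proof (rule option_ext)
  fix y :: 'a
  have "1 / (1 / y + 1) = 1 / (y + 1) + 1" if "y \<noteq> 0" "y \<noteq> 1"
  proof -
    have "1 / y + 1 = (y + 1) / y" "1 / (y + 1) + 1 = y / (y + 1)" using that by (simp_all add: field_simps)
    then show ?thesis by simp
  qed
  then show "(inversion \<circ> u_elt 1 \<circ> inversion) (Some y) = (u_elt 1 \<circ> inversion \<circ> u_elt 1) (Some y)"
    by (auto simp: add_eq_iff[of 1])
qed simp

lemma braid': "inversion (u_elt 1 (inversion x)) = u_elt 1 (inversion (u_elt 1 x))" for x :: "'a option"
  using fun_cong[OF braid, of x] by simp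

lemma u1_cancel: "u_elt 1 \<circ> (u_elt 1 \<circ> k) = k" for k :: "'b \<Rightarrow> 'a option"
  by (simp add: fun_eq_iff involutions)

lemma inversion_cancel: "inversion \<circ> (inversion \<circ> k) = k" for k :: "'b \<Rightarrow> 'a option"
  by (simp add: fun_eq_iff involutions)

lemma braid_assoc: "inversion \<circ> (u_elt 1 \<circ> (inversion \<circ> k)) = u_elt 1 \<circ> (inversion \<circ> (u_elt 1 \<circ> k))"
  for k :: "'b \<Rightarrow> 'a option"
  by (simp add: fun_eq_iff braid')

text \<open>Rewriting of words in the two involutions to the six normal forms of
  \<open>S3_eq\<close>. Compositions associate to the right, so each relation also occurs with a
  tail \<open>k\<close>.\<close>

lemmas S3_rules = comp_assoc u_u inversion_inversion u1_cancel inversion_cancel braid[unfolded comp_assoc] braid_assoc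

lemma S3_eq: "S3 = {id, u_elt 1, inversion, u_elt 1 \<circ> inversion, inversion \<circ> u_elt 1, u_elt 1 \<circ> (inversion \<circ> u_elt 1)}"
  by (simp add: S3_def comp_assoc)

lemma S3_left:
  assumes "x \<in> S3" shows "u_elt 1 \<circ> x \<in> S3" "inversion \<circ> x \<in> S3"
  using assms unfolding S3_eq by (elim insertE emptyE; simp add: S3_rules)+

lemma S3_comp:
  assumes "x \<in> S3" "y \<in> S3" shows "x \<circ> y \<in> S3"
proof -
  note l = S3_left
  show ?thesis
    using assms(1) assms(2) l[OF assms(2)] l[OF l(1)[OF assms(2)]] l[OF l(2)[OF assms(2)]]
      l[OF l(2)[OF l(1)[OF assms(2)]]]
    unfolding S3_eq[THEN arg_cong[of _ _ "\<lambda>S. x \<in> S"]] by (elim insertE emptyE) (simp_all add: comp_assoc)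
qed

lemma S3_inverse:
  assumes "x \<in> S3" obtains y where "y \<in> S3" "y \<circ> x = id"
proof -
  have "\<exists>y\<in>S3. y \<circ> x = id"
    using assms unfolding S3_eq by (elim insertE emptyE; simp add: S3_rules)
  then show thesis using that by blast
qed

lemma S3_T: "S3 \<subseteq> T"
  by (auto simp: S3_def T_id intro!: T_comp)

lemma L_eq: "L_subgroup = {((l, l), 0) | l. l \<in> S3}"
proof -
  let ?D = "{((l, l), 0) | l. l \<in> S3} :: 'a G_elt set"
  have id3: "id \<in> S3" and u3: "u_elt 1 \<in> S3" and w3: "inversion \<in> S3" by (simp_all add: S3_def)
  have "subgroup ?D G_group"
  proof (rule G.subgroupI)
    show "?D \<subseteq> carrier G_group" using S3_T by (auto simp: G_carrier)
    show "?D \<noteq> {}" using id3 by blast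
    show "x \<otimes>\<^bsub>G_group\<^esub> y \<in> ?D" if "x \<in> ?D" "y \<in> ?D" for x y
      using that S3_comp by (auto simp: G_mult)
    show "inv\<^bsub>G_group\<^esub> x \<in> ?D" if x: "x \<in> ?D" for x
    proof -
      obtain l where l: "x = ((l, l), 0)" "l \<in> S3" using x by blast
      obtain m where m: "m \<in> S3" "m \<circ> l = id" by (rule S3_inverse[OF l(2)])
      obtain m' where m': "m' \<in> S3" "m' \<circ> m = id" by (rule S3_inverse[OF m(1)])
      have "m' = m' \<circ> (m \<circ> l)" using m by simp
      also have "\<dots> = l" using m' by (simp flip: comp_assoc)
      finally have lm: "l \<circ> m = id" using m' by simp
      have "inv\<^bsub>G_group\<^esub> x = ((m, m), 0)"
        by (rule G.inv_equality) (use l m lm S3_T in \<open>auto simp: G_mult G_one G_carrier\<close>)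
      then show ?thesis using m by blast
    qed
  qed
  moreover have "{((a_elt, a_elt), 0), ((b_elt, b_elt), 0)} \<subseteq> ?D"
    using S3_left(1)[OF w3] u3 by (auto simp: a_elt_eq b_elt_eq)
  ultimately have "L_subgroup \<subseteq> ?D" unfolding L_subgroup_def by (intro G.generate_subgroup_incl)
  moreover have "?D \<subseteq> L_subgroup"
  proof -
    let ?g = "generate G_group {((a_elt, a_elt), 0), ((b_elt, b_elt), 0)} :: 'a G_elt set"
    have b: "((u_elt 1, u_elt 1), 0) \<in> ?g" and a: "((u_elt 1 \<circ> inversion, u_elt 1 \<circ> inversion), 0) \<in> ?g"
      by (auto simp: a_elt_eq b_elt_eq intro: generate.incl)
    have m: "((x \<circ> y, x \<circ> y), 0) \<in> ?g" if "((x, x), 0) \<in> ?g" "((y, y), 0) \<in> ?g" for x y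
      using generate.eng[OF that(2,1)] by (simp add: G_mult)
    have i: "((id, id), 0) \<in> ?g" using generate.one[of G_group] by (simp add: G_one)
    have w: "((inversion, inversion), 0) \<in> ?g"
      using m[OF b a] by (simp add: fun_eq_iff involutions o_def)
    show ?thesis unfolding L_subgroup_def S3_def using i b w m[OF b w] m[OF w b] m[OF m[OF b w] b] by auto
  qed
  ultimately show ?thesis by blast
qed

end

section \<open>The coset graphs\<close>

context binary_field begin

declare T_id [simp]

definition V :: "'a G_elt set set" where "V = rcosets\<^bsub>G_group\<^esub> L_subgroup"

definition vx :: "'a G_elt \<Rightarrow> 'a G_elt set" where "vx z = L_subgroup #>\<^bsub>G_group\<^esub> z"

definition adj :: "'a \<Rightarrow> 'a G_elt set \<Rightarrow> 'a G_elt set \<Rightarrow> bool" where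
  "adj \<alpha> v w \<longleftrightarrow> (v, w) \<in> parcs (coset_graph G_group L_subgroup (g_elt \<alpha>))"

abbreviation GG :: "'a G_elt set" where "GG \<equiv> carrier G_group"

definition diag :: "('a option \<Rightarrow> 'a option) \<Rightarrow> 'a G_elt" where "diag l = ((l, l), 0)"

definition flip :: "'a G_elt" where "flip = ((id, id), 1)"

text \<open>The product of \<open>g_elt \<alpha>\<close> and \<open>diag m\<close>, whose cosets are
  the neighbours of \<open>L\<close>. Permutations act on the right, so the factors of a product
  appear in reverse order of composition.\<close>

definition nb :: "'a \<Rightarrow> ('a option \<Rightarrow> 'a option) \<Rightarrow> 'a G_elt" where
  "nb \<alpha> m = ((m \<circ> u_elt \<alpha>, m \<circ> u_elt \<alpha> \<circ> u_elt 1), 1)"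

abbreviation B1 :: "'a option \<Rightarrow> 'a option" where "B1 \<equiv> u_elt 1"
abbreviation A1 :: "'a option \<Rightarrow> 'a option" where "A1 \<equiv> u_elt 1 \<circ> inversion"
abbreviation A2 :: "'a option \<Rightarrow> 'a option" where "A2 \<equiv> inversion \<circ> u_elt 1"

lemma L_subgroup: "subgroup (L_subgroup :: 'a G_elt set) G_group"
  unfolding L_subgroup_def
  by (rule G.generate_is_subgroup) (auto simp: G_carrier a_elt_eq b_elt_eq intro!: T_comp)

lemma in_L: "x \<in> L_subgroup \<longleftrightarrow> (\<exists>l\<in>S3. x = diag l)"
  by (auto simp: L_eq diag_def)

lemma S3_in_T: "l \<in> S3 \<Longrightarrow> l \<in> T"
  using S3_T by blast

lemma S3_elems: "id \<in> S3" "B1 \<in> S3" "inversion \<in> S3" "A1 \<in> S3" "A2 \<in> S3"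
  by (simp_all add: S3_def)

lemma carriers [simp]:
  "l \<in> T \<Longrightarrow> diag l \<in> GG" "flip \<in> GG" "m \<in> T \<Longrightarrow> nb \<alpha> m \<in> GG"
  by (simp_all add: diag_def flip_def nb_def G_carrier T_id T_comp)

lemma u_commute: "u_elt s \<circ> u_elt t = u_elt t \<circ> (u_elt s :: 'a option \<Rightarrow> _)"
  by (simp add: u_comp add.commute)

lemma u_cancel: "u_elt t \<circ> (u_elt t \<circ> k) = k" for k :: "'b \<Rightarrow> 'a option"
  by (simp add: fun_eq_iff involutions)

lemma g_elt_eq: "g_elt \<alpha> = nb \<alpha> id"
  by (simp add: g_elt_def nb_def b_elt_eq T_mult)

lemma nb_diag: "nb \<alpha> m \<otimes>\<^bsub>G_group\<^esub> diag l = nb \<alpha> (l \<circ> m)"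
  by (simp add: nb_def diag_def G_mult comp_assoc)

lemma diag_nb: "diag B1 \<otimes>\<^bsub>G_group\<^esub> nb \<alpha> m = nb \<alpha> (m \<circ> B1)"
  by (simp add: nb_def diag_def G_mult comp_assoc u_comp add.commute)

lemma flip_nb: "flip \<otimes>\<^bsub>G_group\<^esub> nb \<alpha> m = nb \<alpha> (m \<circ> B1) \<otimes>\<^bsub>G_group\<^esub> flip"
  by (simp add: nb_def flip_def G_mult comp_assoc u_comp add.commute)

lemma flip_flip: "flip \<otimes>\<^bsub>G_group\<^esub> flip = \<one>\<^bsub>G_group\<^esub>"
  by (simp add: flip_def G_mult G_one)

lemma flip_diag: "flip \<otimes>\<^bsub>G_group\<^esub> diag l = diag l \<otimes>\<^bsub>G_group\<^esub> flip"
  by (simp add: flip_def diag_def G_mult)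

text \<open>That the square of \<open>g_elt \<alpha>\<close> lies in \<open>L_subgroup\<close> is
  what makes adjacency symmetric.\<close>

lemma nb_nb: "nb \<alpha> id \<otimes>\<^bsub>G_group\<^esub> nb \<alpha> id = diag B1"
  by (simp add: nb_def diag_def G_mult comp_assoc u_commute[of 1 \<alpha>] u_cancel u_u)

lemma vx_eq_iff:
  assumes "x \<in> GG" "y \<in> GG" shows "vx x = vx y \<longleftrightarrow> (\<exists>l\<in>S3. y = diag l \<otimes>\<^bsub>G_group\<^esub> x)"
proof -
  have "vx x = vx y \<longleftrightarrow> y \<otimes>\<^bsub>G_group\<^esub> inv\<^bsub>G_group\<^esub> x \<in> L_subgroup"
    unfolding vx_def by (rule G.coset_eq_iff[OF L_subgroup assms])
  also have "\<dots> \<longleftrightarrow> (\<exists>l\<in>S3. y \<otimes>\<^bsub>G_group\<^esub> inv\<^bsub>G_group\<^esub> x = diag l)" by (rule in_L)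
  also have "\<dots> \<longleftrightarrow> (\<exists>l\<in>S3. y = diag l \<otimes>\<^bsub>G_group\<^esub> x)"
  proof (rule bex_cong[OF refl])
    fix l assume "l \<in> S3"
    then have "diag l \<in> GG" using S3_in_T by simp
    then show "y \<otimes>\<^bsub>G_group\<^esub> inv\<^bsub>G_group\<^esub> x = diag l \<longleftrightarrow> y = diag l \<otimes>\<^bsub>G_group\<^esub> x"
      using assms by (metis G.inv_solve_right G.inv_solve_right')
  qed
  finally show ?thesis .
qed

lemma vx_diag: "l \<in> S3 \<Longrightarrow> x \<in> GG \<Longrightarrow> vx (diag l \<otimes>\<^bsub>G_group\<^esub> x) = vx x"
  using vx_eq_iff[of x "diag l \<otimes>\<^bsub>G_group\<^esub> x"] S3_in_T by auto

lemma V_iff: "v \<in> V \<longleftrightarrow> (\<exists>x\<in>GG. v = vx x)"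
  by (auto simp: V_def RCOSETS_def vx_def)

lemma vx_V [simp]: "x \<in> GG \<Longrightarrow> vx x \<in> V"
  using V_iff by blast

lemma adj_vx_iff:
  assumes "z \<in> GG" shows "adj \<alpha> (vx z) v \<longleftrightarrow> (\<exists>m\<in>S3. v = vx (nb \<alpha> m \<otimes>\<^bsub>G_group\<^esub> z))"
proof -
  have "adj \<alpha> (vx z) v \<longleftrightarrow> (\<exists>l\<in>L_subgroup. v = vx (g_elt \<alpha> \<otimes>\<^bsub>G_group\<^esub> l \<otimes>\<^bsub>G_group\<^esub> z))"
    unfolding adj_def vx_def
    by (rule G.coset_adjacent_iff[OF L_subgroup _ assms]) (simp add: g_elt_eq T_id)
  also have "\<dots> \<longleftrightarrow> (\<exists>m\<in>S3. v = vx (nb \<alpha> m \<otimes>\<^bsub>G_group\<^esub> z))"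
  proof -
    have "g_elt \<alpha> \<otimes>\<^bsub>G_group\<^esub> diag l = nb \<alpha> l" for l by (simp add: g_elt_eq nb_diag)
    then show ?thesis unfolding Bex_def in_L by metis
  qed
  finally show ?thesis .
qed

lemma vx_nb_B1: "m \<in> T \<Longrightarrow> z \<in> GG \<Longrightarrow> vx (nb \<alpha> (m \<circ> B1) \<otimes>\<^bsub>G_group\<^esub> z) = vx (nb \<alpha> m \<otimes>\<^bsub>G_group\<^esub> z)"
  using vx_diag[OF S3_elems(2), of "nb \<alpha> m \<otimes>\<^bsub>G_group\<^esub> z"] by (simp add: G.m_assoc flip: diag_nb)

text \<open>Grouped into left cosets of \<open>{id, B1}\<close>: left multiplication by
  \<open>diag B1\<close> replaces \<open>m\<close> by \<open>m \<circ> B1\<close> in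
  \<open>nb \<alpha> m\<close>, so each coset gives one neighbour and the valency is 3.\<close>

lemma S3_decomp: "S3 = {id, id \<circ> B1, A1, A1 \<circ> B1, A2, A2 \<circ> B1}"
  by (auto simp: S3_eq S3_rules)

lemma adj_vx_cases:
  assumes "z \<in> GG"
  shows "adj \<alpha> (vx z) v \<longleftrightarrow> v = vx (nb \<alpha> id \<otimes>\<^bsub>G_group\<^esub> z) \<or> v = vx (nb \<alpha> A1 \<otimes>\<^bsub>G_group\<^esub> z) \<or> v = vx (nb \<alpha> A2 \<otimes>\<^bsub>G_group\<^esub> z)"
proof -
  have "adj \<alpha> (vx z) v \<longleftrightarrow> (\<exists>m\<in>{id, id \<circ> B1, A1, A1 \<circ> B1, A2, A2 \<circ> B1}. v = vx (nb \<alpha> m \<otimes>\<^bsub>G_group\<^esub> z))"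
    unfolding adj_vx_iff[OF assms] S3_decomp ..
  then show ?thesis using vx_nb_B1[OF _ assms, of id \<alpha>] vx_nb_B1[OF _ assms, of A1 \<alpha>] vx_nb_B1[OF _ assms, of A2 \<alpha>]
    T_id S3_in_T[OF S3_elems(4)] S3_in_T[OF S3_elems(5)] by auto
qed

lemma S3_fix: "l \<in> S3 \<Longrightarrow> l None = None \<Longrightarrow> l = id \<or> l = B1"
  by (auto simp: S3_def)

lemma commute_B1_fix:
  assumes "l \<circ> B1 = B1 \<circ> l" shows "l None = None"
proof -
  have "B1 (l None) = l None" using fun_cong[OF assms, of None] by simp
  then show ?thesis using u_fix_iff[of "1::'a"] by simp
qed

lemma right_cancel: "m \<circ> u_elt t = m' \<circ> u_elt t \<Longrightarrow> m = m'" for m m' :: "'a option \<Rightarrow> 'a option"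
  by (metis comp_assoc u_u comp_id)

lemma inj_comp_cancel: "inj h \<Longrightarrow> h \<circ> k = h \<circ> k' \<Longrightarrow> k = k'"
  by (simp add: fun_eq_iff inj_eq)

text \<open>Comparing the two components shows that the connecting element \<open>l\<close> of
  \<open>S3\<close> commutes with \<open>B1\<close>; so it fixes infinity and is \<open>id\<close>
  or \<open>B1\<close>.\<close>

lemma vx_nb_eq:
  assumes z: "z \<in> GG" and m: "m \<in> T" "m' \<in> T" and eq: "vx (nb \<alpha> m \<otimes>\<^bsub>G_group\<^esub> z) = vx (nb \<alpha> m' \<otimes>\<^bsub>G_group\<^esub> z)"
  shows "m' = m \<or> m' = m \<circ> B1"
proof -
  obtain l where l: "l \<in> S3" "nb \<alpha> m' \<otimes>\<^bsub>G_group\<^esub> z = diag l \<otimes>\<^bsub>G_group\<^esub> (nb \<alpha> m \<otimes>\<^bsub>G_group\<^esub> z)"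
    using eq vx_eq_iff z m by auto
  then have "nb \<alpha> m' \<otimes>\<^bsub>G_group\<^esub> z = (diag l \<otimes>\<^bsub>G_group\<^esub> nb \<alpha> m) \<otimes>\<^bsub>G_group\<^esub> z" using z m S3_in_T by (simp add: G.m_assoc)
  then have e: "nb \<alpha> m' = diag l \<otimes>\<^bsub>G_group\<^esub> nb \<alpha> m" using z m S3_in_T[OF l(1)] by (metis G.r_cancel carriers(1,3) G.m_closed)
  have e1: "m' \<circ> u_elt \<alpha> = m \<circ> u_elt \<alpha> \<circ> l"
    using arg_cong[OF e, of "fst \<circ> fst"] by (simp add: nb_def diag_def G_mult)
  have e2: "m' \<circ> u_elt \<alpha> \<circ> B1 = m \<circ> u_elt \<alpha> \<circ> B1 \<circ> l"
    using arg_cong[OF e, of "snd \<circ> fst"] by (simp add: nb_def diag_def G_mult)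
  have "m \<circ> u_elt \<alpha> \<circ> (l \<circ> B1) = m \<circ> u_elt \<alpha> \<circ> (B1 \<circ> l)" using e2 unfolding e1 by (simp add: comp_assoc)
  moreover have "inj (m \<circ> u_elt \<alpha>)" by (rule bij_is_inj[OF T_bij[OF T_comp[OF m(1) in_T(1)]]])
  ultimately have "l \<circ> B1 = B1 \<circ> l" by (rule inj_comp_cancel[rotated])
  then have "l = id \<or> l = B1" by (intro S3_fix[OF l(1)] commute_B1_fix)
  then show ?thesis
  proof
    assume "l = id"
    then show ?thesis using e1 right_cancel[of m' \<alpha> m] by simp
  next
    assume "l = B1"
    then have "m' \<circ> u_elt \<alpha> = m \<circ> B1 \<circ> u_elt \<alpha>" using e1 by (simp add: comp_assoc u_commute[of \<alpha> 1])
    then show ?thesis using right_cancel[of m' \<alpha> "m \<circ> B1"] by simp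
  qed
qed

text \<open>A factor \<open>B1\<close> on the right does not change the image of infinity, which
  separates \<open>id\<close>, \<open>A1\<close> and \<open>A2\<close>.\<close>

lemma nb_distinct:
  assumes "z \<in> GG"
  shows "vx (nb \<alpha> id \<otimes>\<^bsub>G_group\<^esub> z) \<noteq> vx (nb \<alpha> A1 \<otimes>\<^bsub>G_group\<^esub> z)" "vx (nb \<alpha> id \<otimes>\<^bsub>G_group\<^esub> z) \<noteq> vx (nb \<alpha> A2 \<otimes>\<^bsub>G_group\<^esub> z)"
    "vx (nb \<alpha> A1 \<otimes>\<^bsub>G_group\<^esub> z) \<noteq> vx (nb \<alpha> A2 \<otimes>\<^bsub>G_group\<^esub> z)"
proof -
  have T: "id \<in> T" "A1 \<in> T" "A2 \<in> T" using S3_in_T S3_elems by blast+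
  have ne: "m' \<noteq> m \<and> m' \<noteq> m \<circ> B1" if "m' None \<noteq> m None" for m m' :: "'a option \<Rightarrow> 'a option"
    using that by auto
  show "vx (nb \<alpha> id \<otimes>\<^bsub>G_group\<^esub> z) \<noteq> vx (nb \<alpha> A1 \<otimes>\<^bsub>G_group\<^esub> z)"
    using vx_nb_eq[OF assms T(1,2), of \<alpha>] ne[of A1 id] by auto
  show "vx (nb \<alpha> id \<otimes>\<^bsub>G_group\<^esub> z) \<noteq> vx (nb \<alpha> A2 \<otimes>\<^bsub>G_group\<^esub> z)"
    using vx_nb_eq[OF assms T(1,3), of \<alpha>] ne[of A2 id] by auto
  show "vx (nb \<alpha> A1 \<otimes>\<^bsub>G_group\<^esub> z) \<noteq> vx (nb \<alpha> A2 \<otimes>\<^bsub>G_group\<^esub> z)"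
    using vx_nb_eq[OF assms T(2,3), of \<alpha>] ne[of A2 A1] by auto
qed

lemma adj_back:
  assumes "y \<in> GG" shows "vx (nb \<alpha> id \<otimes>\<^bsub>G_group\<^esub> (nb \<alpha> id \<otimes>\<^bsub>G_group\<^esub> y)) = vx y"
  using vx_diag[OF S3_elems(2) assms] assms by (simp add: nb_nb flip: G.m_assoc)

lemma adj_sym: assumes a: "adj \<alpha> v w" and "v \<in> V" shows "adj \<alpha> w v"
proof -
  obtain z where z: "z \<in> GG" "v = vx z" using V_iff assms(2) by blast
  obtain m where m: "m \<in> S3" "w = vx (nb \<alpha> m \<otimes>\<^bsub>G_group\<^esub> z)" using a z adj_vx_iff by blast
  have mT: "m \<in> T" using S3_in_T m by blast
  define y where "y = diag m \<otimes>\<^bsub>G_group\<^esub> z"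
  have y: "y \<in> GG" "vx y = vx z" using vx_diag[OF m(1) z(1)] z mT by (simp_all add: y_def)
  have "nb \<alpha> m \<otimes>\<^bsub>G_group\<^esub> z = nb \<alpha> id \<otimes>\<^bsub>G_group\<^esub> y"
    using z mT nb_diag[of \<alpha> id m] by (simp add: y_def flip: G.m_assoc)
  then have "w = vx (nb \<alpha> id \<otimes>\<^bsub>G_group\<^esub> y)" using m by simp
  moreover have "nb \<alpha> id \<otimes>\<^bsub>G_group\<^esub> y \<in> GG" using y by simp
  ultimately have "adj \<alpha> w (vx (nb \<alpha> id \<otimes>\<^bsub>G_group\<^esub> (nb \<alpha> id \<otimes>\<^bsub>G_group\<^esub> y)))" using adj_vx_iff S3_elems(1) by blast
  then show ?thesis using adj_back[OF y(1)] y(2) z by simp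
qed

lemma adj_V:
  assumes "adj \<alpha> v w" shows "v \<in> V"
proof -
  obtain x where "x \<in> GG" "v = L_subgroup #>\<^bsub>G_group\<^esub> x"
    using assms unfolding adj_def coset_graph_def by auto
  then show ?thesis unfolding V_iff vx_def by blast
qed

lemma finite_GG: "finite GG"
proof -
  have "GG \<subseteq> (UNIV \<times> UNIV) \<times> {0, 1}" using G_carrier by auto
  then show ?thesis by (rule finite_subset) simp
qed

lemma finite_V: "finite V"
proof -
  have V: "V = vx ` GG" using V_iff by blast
  show ?thesis unfolding V by (rule finite_imageI[OF finite_GG])
qed

lemma verts_Gamma: "verts (Gamma \<alpha>) = V"
  by (simp add: Gamma_def coset_graph_def V_def)

lemma arcs_Gamma: "(v, w) \<in> arcs (Gamma \<alpha>) \<longleftrightarrow> adj \<alpha> v w"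
  by (simp add: Gamma_def adj_def)

lemma parcs_symmetric: "parcs (mk_symmetric (Gamma \<alpha>)) = {(v, w). adj \<alpha> v w}"
proof -
  have "parcs (mk_symmetric (Gamma \<alpha>)) = (\<Union>e\<in>arcs (Gamma \<alpha>). {(fst e, snd e), (snd e, fst e)})"
    by (simp add: mk_symmetric_def Gamma_def)
  also have "\<dots> = {(v, w). adj \<alpha> v w}"
    using arcs_Gamma adj_sym adj_V by fastforce
  finally show ?thesis .
qed

lemma V_nonempty: "vx \<one>\<^bsub>G_group\<^esub> \<in> V"
  by simp

lemma connected_iff: "Digraph_Component.connected (Gamma \<alpha>) \<longleftrightarrow> (\<forall>v\<in>V. \<forall>w\<in>V. (adj \<alpha>)\<^sup>*\<^sup>* v w)"
proof -
  have "(v, w) \<in> rtrancl_on V {(v, w). adj \<alpha> v w} \<longleftrightarrow> (adj \<alpha>)\<^sup>*\<^sup>* v w" if v: "v \<in> V" for v w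
  proof
    assume "(v, w) \<in> rtrancl_on V {(v, w). adj \<alpha> v w}"
    then show "(adj \<alpha>)\<^sup>*\<^sup>* v w" by (induction rule: rtrancl_on_induct) auto
  next
    assume "(adj \<alpha>)\<^sup>*\<^sup>* v w"
    then show "(v, w) \<in> rtrancl_on V {(v, w). adj \<alpha> v w}"
    proof (induction rule: rtranclp_induct)
      case (step y z)
      have "z \<in> V" by (rule adj_V[OF adj_sym[OF step(2) adj_V[OF step(2)]]])
      then show ?case using step(2) by (intro rtrancl_on_into_rtrancl_on[OF step(3)]) simp_all
    qed (use v in simp)
  qed
  moreover have "V \<noteq> {}" using V_nonempty by blast
  ultimately show ?thesis
    unfolding Digraph_Component.connected_def strongly_connected_def reachable_def
    by (auto simp: parcs_symmetric verts_Gamma)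
qed

lemma cubic_graph_Gamma:
  assumes "Digraph_Component.connected (Gamma \<alpha>)" shows "cubic_graph V (adj \<alpha>)"
proof
  show "finite V" by (rule finite_V)
  show "x \<in> V" if "adj \<alpha> x y" for x y using that by (rule adj_V)
  show "adj \<alpha> y x" if "adj \<alpha> x y" for x y using adj_sym[OF that adj_V[OF that]] .
  show "(adj \<alpha>)\<^sup>*\<^sup>* x y" if "x \<in> V" "y \<in> V" for x y using assms that unfolding connected_iff by blast
  show "card {y. adj \<alpha> x y} = 3" if xV: "x \<in> V" for x
  proof -
    obtain z where z: "z \<in> GG" "x = vx z" using xV unfolding V_iff by blast
    have nbrs: "{y. adj \<alpha> x y} = {vx (nb \<alpha> id \<otimes>\<^bsub>G_group\<^esub> z), vx (nb \<alpha> A1 \<otimes>\<^bsub>G_group\<^esub> z), vx (nb \<alpha> A2 \<otimes>\<^bsub>G_group\<^esub> z)}"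
      unfolding z(2) adj_vx_cases[OF z(1)] by blast
    have three: "card {p, q, r} = 3" if "p \<noteq> q" "p \<noteq> r" "q \<noteq> r" for p q r :: "'a G_elt set"
      using that by simp
    show ?thesis unfolding nbrs by (rule three[OF nb_distinct[OF z(1)]])
  qed
qed

text \<open>The automorphisms \<open>Lx \<mapsto> Lexn\<close>: right multiplications composed with the left multiplication by
  \<open>\<pi>\<close>, which is well defined because \<open>\<pi>\<close> centralizes \<open>L\<close>.\<close>

definition translates :: "'a G_elt \<Rightarrow> 'a G_elt \<Rightarrow> ('a G_elt set \<Rightarrow> 'a G_elt set) \<Rightarrow> bool" where
  "translates e n p \<longleftrightarrow> (e = \<one>\<^bsub>G_group\<^esub> \<or> e = flip) \<and> n \<in> GG \<and> (\<forall>v. v \<notin> V \<longrightarrow> p v = v) \<and>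
     (\<forall>x\<in>GG. p (vx x) = vx (e \<otimes>\<^bsub>G_group\<^esub> x \<otimes>\<^bsub>G_group\<^esub> n))"

definition G2 :: "('a G_elt set \<Rightarrow> 'a G_elt set) set" where
  "G2 = {p. \<exists>e n. translates e n p}"

lemma translates_exists:
  assumes e: "e = \<one>\<^bsub>G_group\<^esub> \<or> e = flip" and n: "n \<in> GG"
  shows "\<exists>p. translates e n p"
proof -
  have eG: "e \<in> GG" using e by auto
  define p where "p v = (if v \<in> V then vx (e \<otimes>\<^bsub>G_group\<^esub> (SOME x. x \<in> GG \<and> v = vx x) \<otimes>\<^bsub>G_group\<^esub> n) else v)" for v
  have "p (vx x) = vx (e \<otimes>\<^bsub>G_group\<^esub> x \<otimes>\<^bsub>G_group\<^esub> n)" if x: "x \<in> GG" for x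
  proof -
    define y where "y = (SOME y. y \<in> GG \<and> vx x = vx y)"
    have y: "y \<in> GG \<and> vx x = vx y" unfolding y_def by (rule someI[of _ x]) (use x in simp)
    then obtain l where l: "l \<in> S3" "y = diag l \<otimes>\<^bsub>G_group\<^esub> x" using vx_eq_iff x by blast
    have lG: "diag l \<in> GG" using S3_in_T[OF l(1)] by simp
    have "e \<otimes>\<^bsub>G_group\<^esub> diag l = diag l \<otimes>\<^bsub>G_group\<^esub> e" using e lG flip_diag by auto
    then have "e \<otimes>\<^bsub>G_group\<^esub> y = diag l \<otimes>\<^bsub>G_group\<^esub> e \<otimes>\<^bsub>G_group\<^esub> x"
      using lG eG x by (simp add: l(2) flip: G.m_assoc)
    then have "e \<otimes>\<^bsub>G_group\<^esub> y \<otimes>\<^bsub>G_group\<^esub> n = diag l \<otimes>\<^bsub>G_group\<^esub> (e \<otimes>\<^bsub>G_group\<^esub> x \<otimes>\<^bsub>G_group\<^esub> n)"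
      using lG eG x n by (simp add: G.m_assoc)
    then have "vx (e \<otimes>\<^bsub>G_group\<^esub> y \<otimes>\<^bsub>G_group\<^esub> n) = vx (e \<otimes>\<^bsub>G_group\<^esub> x \<otimes>\<^bsub>G_group\<^esub> n)" using vx_diag[OF l(1)] eG x n by simp
    then show ?thesis using x by (simp add: p_def y_def)
  qed
  then have "translates e n p" using e n by (simp add: translates_def p_def)
  then show ?thesis by blast
qed

lemma flip_commute_one:
  assumes "e = \<one>\<^bsub>G_group\<^esub> \<or> e = flip" "e' = \<one>\<^bsub>G_group\<^esub> \<or> e' = flip"
  shows "e \<otimes>\<^bsub>G_group\<^esub> e' = \<one>\<^bsub>G_group\<^esub> \<or> e \<otimes>\<^bsub>G_group\<^esub> e' = flip" "e \<in> GG" "e \<otimes>\<^bsub>G_group\<^esub> e = \<one>\<^bsub>G_group\<^esub>"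
  using assms flip_flip by auto

lemma translates_comp:
  assumes p: "translates e n p" and q: "translates e' n' q"
  shows "translates (e \<otimes>\<^bsub>G_group\<^esub> e') (n' \<otimes>\<^bsub>G_group\<^esub> n) (p \<circ> q)"
proof -
  have e: "e = \<one>\<^bsub>G_group\<^esub> \<or> e = flip" "e' = \<one>\<^bsub>G_group\<^esub> \<or> e' = flip" "n \<in> GG" "n' \<in> GG"
    using p q by (auto simp: translates_def)
  have eG: "e \<in> GG" "e' \<in> GG" using e by auto
  have "(p \<circ> q) (vx x) = vx (e \<otimes>\<^bsub>G_group\<^esub> e' \<otimes>\<^bsub>G_group\<^esub> x \<otimes>\<^bsub>G_group\<^esub> (n' \<otimes>\<^bsub>G_group\<^esub> n))" if x: "x \<in> GG" for x
  proof -
    have "(p \<circ> q) (vx x) = vx (e \<otimes>\<^bsub>G_group\<^esub> (e' \<otimes>\<^bsub>G_group\<^esub> x \<otimes>\<^bsub>G_group\<^esub> n') \<otimes>\<^bsub>G_group\<^esub> n)"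
      using p q x eG e by (simp add: translates_def)
    then show ?thesis using x eG e by (simp add: G.m_assoc)
  qed
  moreover have "(p \<circ> q) v = v" if "v \<notin> V" for v using p q that by (simp add: translates_def)
  ultimately show ?thesis using flip_commute_one[OF e(1,2)] e unfolding translates_def by simp
qed

lemma translates_one: "translates \<one>\<^bsub>G_group\<^esub> \<one>\<^bsub>G_group\<^esub> p \<longleftrightarrow> p = id"
proof
  assume p: "translates \<one>\<^bsub>G_group\<^esub> \<one>\<^bsub>G_group\<^esub> p"
  show "p = id"
  proof
    fix v show "p v = id v"
      using p V_iff[of v] by (cases "v \<in> V") (auto simp: translates_def)
  qed
qed (simp add: translates_def)

lemma translates_inverse:
  assumes p: "translates e n p"
  obtains q where "translates e (inv\<^bsub>G_group\<^esub> n) q" "p \<circ> q = id" "q \<circ> p = id"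
proof -
  have e: "e = \<one>\<^bsub>G_group\<^esub> \<or> e = flip" "n \<in> GG" using p by (auto simp: translates_def)
  obtain q where q: "translates e (inv\<^bsub>G_group\<^esub> n) q" using translates_exists[OF e(1)] e by blast
  have "translates (e \<otimes>\<^bsub>G_group\<^esub> e) (inv\<^bsub>G_group\<^esub> n \<otimes>\<^bsub>G_group\<^esub> n) (p \<circ> q)" "translates (e \<otimes>\<^bsub>G_group\<^esub> e) (n \<otimes>\<^bsub>G_group\<^esub> inv\<^bsub>G_group\<^esub> n) (q \<circ> p)"
    by (rule translates_comp[OF p q] translates_comp[OF q p])+
  then have "p \<circ> q = id" "q \<circ> p = id"
    using flip_commute_one(3)[OF e(1) e(1)] e(2) by (simp_all add: translates_one)
  with that q show thesis by blast
qed

lemma translates_adj: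
  assumes p: "translates e n p" and vw: "adj \<alpha> v w" shows "adj \<alpha> (p v) (p w)"
proof -
  have e: "e = \<one>\<^bsub>G_group\<^esub> \<or> e = flip" "n \<in> GG" using p by (auto simp: translates_def)
  have eG: "e \<in> GG" using e by auto
  obtain z where z: "z \<in> GG" "v = vx z" using adj_V[OF vw] V_iff by blast
  obtain m where m: "m \<in> S3" "w = vx (nb \<alpha> m \<otimes>\<^bsub>G_group\<^esub> z)" using vw z adj_vx_iff by blast
  have mT: "m \<in> T" using S3_in_T m by blast
  have "\<exists>m'\<in>S3. e \<otimes>\<^bsub>G_group\<^esub> nb \<alpha> m = nb \<alpha> m' \<otimes>\<^bsub>G_group\<^esub> e"
    using e(1)
  proof
    assume "e = flip"
    then show ?thesis using flip_nb S3_comp[OF m(1) S3_elems(2)] by blast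
  qed (use m mT in \<open>auto intro!: bexI[of _ m]\<close>)
  then obtain m' where m': "m' \<in> S3" "e \<otimes>\<^bsub>G_group\<^esub> nb \<alpha> m = nb \<alpha> m' \<otimes>\<^bsub>G_group\<^esub> e" by blast
  have m'T: "m' \<in> T" using S3_in_T m' by blast
  have "p w = vx (e \<otimes>\<^bsub>G_group\<^esub> (nb \<alpha> m \<otimes>\<^bsub>G_group\<^esub> z) \<otimes>\<^bsub>G_group\<^esub> n)" using p m mT z by (simp add: translates_def)
  also have "e \<otimes>\<^bsub>G_group\<^esub> (nb \<alpha> m \<otimes>\<^bsub>G_group\<^esub> z) \<otimes>\<^bsub>G_group\<^esub> n = nb \<alpha> m' \<otimes>\<^bsub>G_group\<^esub> (e \<otimes>\<^bsub>G_group\<^esub> z \<otimes>\<^bsub>G_group\<^esub> n)"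
    using m'(2) eG mT m'T z e by (simp flip: G.m_assoc)
  finally have "p w = vx (nb \<alpha> m' \<otimes>\<^bsub>G_group\<^esub> (e \<otimes>\<^bsub>G_group\<^esub> z \<otimes>\<^bsub>G_group\<^esub> n))" .
  moreover have "p v = vx (e \<otimes>\<^bsub>G_group\<^esub> z \<otimes>\<^bsub>G_group\<^esub> n)" using p z by (simp add: translates_def)
  ultimately show ?thesis using adj_vx_iff[of "e \<otimes>\<^bsub>G_group\<^esub> z \<otimes>\<^bsub>G_group\<^esub> n"] m' eG z e by auto
qed

lemma G2_inverse:
  assumes "p \<in> G2" obtains q where "q \<in> G2" "p \<circ> q = id" "q \<circ> p = id"
proof -
  obtain e n where p: "translates e n p" using assms unfolding G2_def by blast
  obtain q where q: "translates e (inv\<^bsub>G_group\<^esub> n) q" "p \<circ> q = id" "q \<circ> p = id"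
    by (rule translates_inverse[OF p])
  have "q \<in> G2" using q(1) unfolding G2_def by blast
  then show thesis using that q(2,3) by blast
qed

lemma G2_bij:
  assumes "p \<in> G2" shows "bij p"
proof -
  obtain q where "q \<in> G2" "p \<circ> q = id" "q \<circ> p = id" by (rule G2_inverse[OF assms])
  then show ?thesis by (intro o_bij)
qed

lemma G2_inv:
  assumes "p \<in> G2" shows "inv_into UNIV p \<in> G2"
proof -
  obtain q where q: "q \<in> G2" "p \<circ> q = id" "q \<circ> p = id" by (rule G2_inverse[OF assms])
  have "inv_into UNIV p = q" by (rule inv_unique_comp[OF q(2,3)])
  then show ?thesis using q(1) by simp
qed

lemma G2_comp:
  assumes "p \<in> G2" "q \<in> G2" shows "p \<circ> q \<in> G2"
proof -
  obtain e n e' n' where "translates e n p" "translates e' n' q" using assms unfolding G2_def by blast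
  from translates_comp[OF this] show ?thesis unfolding G2_def by blast
qed

lemma G2_adj_imp: "p \<in> G2 \<Longrightarrow> adj \<alpha> v w \<Longrightarrow> adj \<alpha> (p v) (p w)"
  unfolding G2_def mem_Collect_eq using translates_adj by blast

lemma G2_adj:
  assumes p: "p \<in> G2" shows "adj \<alpha> (p v) (p w) \<longleftrightarrow> adj \<alpha> v w"
proof
  assume "adj \<alpha> (p v) (p w)"
  then have "adj \<alpha> (inv_into UNIV p (p v)) (inv_into UNIV p (p w))" by (rule G2_adj_imp[OF G2_inv[OF p]])
  then show "adj \<alpha> v w" by (simp add: inv_f_f[OF bij_is_inj[OF G2_bij[OF p]]])
qed (rule G2_adj_imp[OF p])

lemma G2_outside: "p \<in> G2 \<Longrightarrow> v \<notin> V \<Longrightarrow> p v = v"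
  unfolding G2_def translates_def by blast

lemma G2_Aut:
  assumes "Digraph_Component.connected (Gamma \<alpha>)" shows "G2 \<subseteq> cubic_graph.Aut V (adj \<alpha>)"
proof -
  interpret cubic_graph V "adj \<alpha>" by (rule cubic_graph_Gamma[OF assms])
  show ?thesis unfolding Aut_def
  proof (rule subsetI, unfold mem_Collect_eq, intro conjI allI impI)
    fix p assume p: "p \<in> G2"
    show "bij p" by (rule G2_bij[OF p])
    show "p x = x" if "x \<notin> V" for x by (rule G2_outside[OF p that])
    show "adj \<alpha> (p x) (p y) \<longleftrightarrow> adj \<alpha> x y" for x y by (rule G2_adj[OF p])
  qed
qed

lemma G2_exists:
  assumes "e = \<one>\<^bsub>G_group\<^esub> \<or> e = flip" "n \<in> GG"
  obtains p where "p \<in> G2" "\<And>x. x \<in> GG \<Longrightarrow> p (vx x) = vx (e \<otimes>\<^bsub>G_group\<^esub> x \<otimes>\<^bsub>G_group\<^esub> n)"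
proof -
  obtain p where p: "translates e n p" using translates_exists[OF assms] by blast
  then have "p \<in> G2" unfolding G2_def by blast
  then show thesis by (rule that) (use p in \<open>simp add: translates_def\<close>)
qed

lemma right_mult_exists:
  assumes "n \<in> GG"
  obtains p where "p \<in> G2" "\<And>x. x \<in> GG \<Longrightarrow> p (vx x) = vx (x \<otimes>\<^bsub>G_group\<^esub> n)"
proof -
  obtain p where p: "p \<in> G2"
    "\<And>x. x \<in> GG \<Longrightarrow> p (vx x) = vx (\<one>\<^bsub>G_group\<^esub> \<otimes>\<^bsub>G_group\<^esub> x \<otimes>\<^bsub>G_group\<^esub> n)"
    by (rule G2_exists[of "\<one>\<^bsub>G_group\<^esub>" n]) (use assms in simp_all)
  show thesis by (rule that[OF p(1)]) (simp add: p(2))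
qed

lemma A_T: "A1 \<in> T" "A2 \<in> T"
  using S3_in_T S3_elems by blast+

text \<open>The standard 3-arc is \<open>(LgA, L, Lg, LgAg)\<close>; its two ends are moved independently by right
  multiplication with \<open>(b, b)\<close> and by \<open>Lx \<mapsto> L\<pi>x\<pi>\<close>.\<close>

lemma std_3arc:
  assumes v: "adj \<alpha> v1 v0" "adj \<alpha> v1 v2" "adj \<alpha> v2 v3" "v0 \<noteq> v2" "v1 \<noteq> v3"
  shows "\<exists>p\<in>G2. p (vx (nb \<alpha> A1)) = v0 \<and> p (vx \<one>\<^bsub>G_group\<^esub>) = v1 \<and> p (vx (nb \<alpha> id)) = v2 \<and>
    p (vx (nb \<alpha> A1 \<otimes>\<^bsub>G_group\<^esub> nb \<alpha> id)) = v3"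
proof -
  define g where "g = nb \<alpha> id"
  define E where "E = \<one>\<^bsub>G_group :: 'a G_elt monoid\<^esub>"
  have gG: "g \<in> GG" and EG: "E \<in> GG" by (simp_all add: g_def E_def)
  have BA: "B1 \<circ> A1 = A2 \<circ> B1" "B1 \<circ> A2 = A1 \<circ> B1" by (simp_all add: S3_rules)
  obtain y where y: "y \<in> GG" "v1 = vx y" using adj_V[OF v(1)] unfolding V_iff by blast
  obtain m where m: "m \<in> S3" "v2 = vx (nb \<alpha> m \<otimes>\<^bsub>G_group\<^esub> y)" using v(2) unfolding y(2) adj_vx_iff[OF y(1)] by blast
  have mT: "m \<in> T" by (rule S3_in_T[OF m(1)])
  \<comment> \<open>\<open>t\<close> carries the standard middle edge to \<open>(v1, v2)\<close>, so
    that only the two outer vertices remain to be adjusted.\<close>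
  obtain t where t: "t \<in> G2" "\<And>x. x \<in> GG \<Longrightarrow> t (vx x) = vx (x \<otimes>\<^bsub>G_group\<^esub> (diag m \<otimes>\<^bsub>G_group\<^esub> y))"
    by (rule right_mult_exists[of "diag m \<otimes>\<^bsub>G_group\<^esub> y"]) (use y mT in simp_all)
  have t1: "t (vx E) = v1" using t(2)[OF EG] y mT vx_diag[OF m(1) y(1)] by (simp add: E_def)
  have "g \<otimes>\<^bsub>G_group\<^esub> (diag m \<otimes>\<^bsub>G_group\<^esub> y) = nb \<alpha> m \<otimes>\<^bsub>G_group\<^esub> y"
    using y mT nb_diag[of \<alpha> id m] by (simp add: g_def flip: G.m_assoc)
  then have t2: "t (vx g) = v2" using t(2)[OF gG] m by simp
  define s where "s = inv_into UNIV t"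
  have sG: "s \<in> G2" unfolding s_def by (rule G2_inv[OF t(1)])
  note bt = G2_bij[OF t(1)]
  have st: "s (t x) = x" "t (s x) = x" for x
    unfolding s_def by (simp_all add: bij_is_inj[OF bt] bij_is_surj[OF bt] surj_f_inv_f)
  have s12: "s v1 = vx E" "s v2 = vx g" unfolding t1[symmetric] t2[symmetric] st by (rule refl)+
  have "adj \<alpha> (s v1) (s v0)" "adj \<alpha> (s v2) (s v3)" unfolding G2_adj[OF sG] by (rule v)+
  moreover have "s v0 \<noteq> s v2" using v(4) by (metis st(2))
  moreover have "s v1 \<noteq> s v3" using v(5) by (metis st(2))
  ultimately have w: "adj \<alpha> (vx E) (s v0)" "adj \<alpha> (vx g) (s v3)" "s v0 \<noteq> vx g" "s v3 \<noteq> vx E"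
    unfolding s12 by simp_all
  have w0: "s v0 = vx (nb \<alpha> A1) \<or> s v0 = vx (nb \<alpha> A2)"
    using w(1,3) unfolding adj_vx_cases[OF EG] using A_T by (auto simp: E_def g_def)
  have "vx (nb \<alpha> id \<otimes>\<^bsub>G_group\<^esub> g) = vx E"
    using adj_back[OF EG, of \<alpha>] by (simp add: E_def g_def)
  then have w3: "s v3 = vx (nb \<alpha> A1 \<otimes>\<^bsub>G_group\<^esub> g) \<or> s v3 = vx (nb \<alpha> A2 \<otimes>\<^bsub>G_group\<^esub> g)"
    using w(2,4) unfolding adj_vx_cases[OF gG] by auto
  have gB: "g \<otimes>\<^bsub>G_group\<^esub> diag B1 = diag B1 \<otimes>\<^bsub>G_group\<^esub> g"
    by (simp add: g_def nb_diag diag_nb)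
  have B: "B1 \<in> S3" "B1 \<in> T" using S3_elems by auto
  have swapB: "vx (nb \<alpha> (B1 \<circ> m) \<otimes>\<^bsub>G_group\<^esub> x) = vx (nb \<alpha> m' \<otimes>\<^bsub>G_group\<^esub> x)"
    if "B1 \<circ> m = m' \<circ> B1" "m' \<in> T" "x \<in> GG" for m m' x
    unfolding that(1) by (rule vx_nb_B1[OF that(2,3)])
  \<comment> \<open>\<open>r\<close> exchanges \<open>A1\<close> and \<open>A2\<close> at both ends
    simultaneously.\<close>
  obtain r where r: "r \<in> G2" "\<And>x. x \<in> GG \<Longrightarrow> r (vx x) = vx (x \<otimes>\<^bsub>G_group\<^esub> diag B1)"
    by (rule right_mult_exists[of "diag B1"]) (use B in simp_all)
  have rE: "r (vx E) = vx E" using r(2)[OF EG] vx_diag[OF B(1) EG] B by (simp add: E_def)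
  have rg: "r (vx g) = vx g" using r(2)[OF gG] vx_diag[OF B(1) gG] by (simp add: gB)
  have r1: "r (vx (nb \<alpha> m)) = vx (nb \<alpha> m')" if "B1 \<circ> m = m' \<circ> B1" "m \<in> T" "m' \<in> T" for m m'
    using r(2)[of "nb \<alpha> m"] swapB[OF that(1,3) EG] that B T_comp[OF B(2) that(2)]
    by (simp add: nb_diag E_def T_comp)
  have r2: "r (vx (nb \<alpha> m \<otimes>\<^bsub>G_group\<^esub> g)) = vx (nb \<alpha> m' \<otimes>\<^bsub>G_group\<^esub> g)" if "B1 \<circ> m = m' \<circ> B1" "m \<in> T" "m' \<in> T" for m m'
  proof -
    have "nb \<alpha> m \<otimes>\<^bsub>G_group\<^esub> g \<otimes>\<^bsub>G_group\<^esub> diag B1 = nb \<alpha> m \<otimes>\<^bsub>G_group\<^esub> diag B1 \<otimes>\<^bsub>G_group\<^esub> g"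
      using gG B that by (simp add: G.m_assoc gB)
    also have "\<dots> = nb \<alpha> (B1 \<circ> m) \<otimes>\<^bsub>G_group\<^esub> g" by (simp add: nb_diag)
    finally show ?thesis using r(2)[of "nb \<alpha> m \<otimes>\<^bsub>G_group\<^esub> g"] that gG swapB[OF that(1,3) gG] by simp
  qed
  \<comment> \<open>\<open>z\<close> exchanges them at the far end only, so \<open>id\<close>,
    \<open>z\<close>, \<open>r\<close> and \<open>z \<circ> r\<close> realise all four
    cases.\<close>
  obtain z where z: "z \<in> G2" "\<And>x. x \<in> GG \<Longrightarrow> z (vx x) = vx (flip \<otimes>\<^bsub>G_group\<^esub> x \<otimes>\<^bsub>G_group\<^esub> flip)"
    by (rule G2_exists[of flip flip]) simp_all
  have zE: "z (vx E) = vx E" using z(2)[OF EG] by (simp add: E_def flip_flip)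
  have fnf: "flip \<otimes>\<^bsub>G_group\<^esub> (nb \<alpha> m \<otimes>\<^bsub>G_group\<^esub> x) \<otimes>\<^bsub>G_group\<^esub> flip = nb \<alpha> (m \<circ> B1) \<otimes>\<^bsub>G_group\<^esub> (flip \<otimes>\<^bsub>G_group\<^esub> x \<otimes>\<^bsub>G_group\<^esub> flip)"
    if "m \<in> T" "x \<in> GG" for m x
  proof -
    have "flip \<otimes>\<^bsub>G_group\<^esub> (nb \<alpha> m \<otimes>\<^bsub>G_group\<^esub> x) \<otimes>\<^bsub>G_group\<^esub> flip = (flip \<otimes>\<^bsub>G_group\<^esub> nb \<alpha> m) \<otimes>\<^bsub>G_group\<^esub> x \<otimes>\<^bsub>G_group\<^esub> flip"
      using that by (simp add: G.m_assoc)
    also have "\<dots> = nb \<alpha> (m \<circ> B1) \<otimes>\<^bsub>G_group\<^esub> (flip \<otimes>\<^bsub>G_group\<^esub> x \<otimes>\<^bsub>G_group\<^esub> flip)"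
      unfolding flip_nb using that B T_comp[OF that(1) B(2)] by (simp add: G.m_assoc)
    finally show ?thesis .
  qed
  have zm: "z (vx (nb \<alpha> m)) = vx (nb \<alpha> m)" if "m \<in> T" for m
    using z(2)[of "nb \<alpha> m"] fnf[OF that EG] vx_nb_B1[OF that EG, of \<alpha>] that T_comp[OF that B(2)]
    by (simp add: E_def flip_flip)
  have zg: "z (vx g) = vx g" unfolding g_def by (rule zm) simp
  have z2: "z (vx (nb \<alpha> m \<otimes>\<^bsub>G_group\<^esub> g)) = vx (nb \<alpha> m' \<otimes>\<^bsub>G_group\<^esub> g)" if "B1 \<circ> m = m' \<circ> B1" "m \<in> T" "m' \<in> T" for m m'
  proof -
    have "flip \<otimes>\<^bsub>G_group\<^esub> g \<otimes>\<^bsub>G_group\<^esub> flip = nb \<alpha> B1"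
      using fnf[OF _ EG, of id] B by (simp add: g_def E_def flip_flip)
    then have "flip \<otimes>\<^bsub>G_group\<^esub> (nb \<alpha> m \<otimes>\<^bsub>G_group\<^esub> g) \<otimes>\<^bsub>G_group\<^esub> flip = nb \<alpha> (m \<circ> B1) \<otimes>\<^bsub>G_group\<^esub> nb \<alpha> B1"
      using fnf[OF that(2) gG] by simp
    moreover have "vx (nb \<alpha> (m \<circ> B1) \<otimes>\<^bsub>G_group\<^esub> nb \<alpha> B1) = vx (nb \<alpha> m \<otimes>\<^bsub>G_group\<^esub> nb \<alpha> B1)"
      by (rule vx_nb_B1[OF that(2)]) (use B in simp)
    moreover have "nb \<alpha> m \<otimes>\<^bsub>G_group\<^esub> nb \<alpha> B1 = nb \<alpha> (B1 \<circ> m) \<otimes>\<^bsub>G_group\<^esub> g"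
    proof -
      have "nb \<alpha> B1 = diag B1 \<otimes>\<^bsub>G_group\<^esub> g" by (simp add: g_def diag_nb)
      then have "nb \<alpha> m \<otimes>\<^bsub>G_group\<^esub> nb \<alpha> B1 = nb \<alpha> m \<otimes>\<^bsub>G_group\<^esub> diag B1 \<otimes>\<^bsub>G_group\<^esub> g"
        using that B gG by (simp add: G.m_assoc)
      then show ?thesis by (simp add: nb_diag)
    qed
    moreover have "nb \<alpha> m \<otimes>\<^bsub>G_group\<^esub> g \<in> GG" using that gG by simp
    ultimately show ?thesis using z(2)[of "nb \<alpha> m \<otimes>\<^bsub>G_group\<^esub> g"] swapB[OF that(1,3) gG] by simp
  qed
  note R = r1[OF BA(1) A_T(1,2)] r2[OF BA(1) A_T(1,2)] r2[OF BA(2) A_T(2,1)]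
  note Z = zm[OF A_T(1)] zm[OF A_T(2)] z2[OF BA(1) A_T(1,2)] z2[OF BA(2) A_T(2,1)]
  have "\<exists>q\<in>G2. q (vx (nb \<alpha> A1)) = s v0 \<and> q (vx E) = vx E \<and> q (vx g) = vx g \<and>
    q (vx (nb \<alpha> A1 \<otimes>\<^bsub>G_group\<^esub> g)) = s v3"
  proof -
    have i: "id \<in> G2" unfolding G2_def using translates_one by blast
    consider "s v0 = vx (nb \<alpha> A1)" "s v3 = vx (nb \<alpha> A1 \<otimes>\<^bsub>G_group\<^esub> g)" | "s v0 = vx (nb \<alpha> A1)" "s v3 = vx (nb \<alpha> A2 \<otimes>\<^bsub>G_group\<^esub> g)"
      | "s v0 = vx (nb \<alpha> A2)" "s v3 = vx (nb \<alpha> A2 \<otimes>\<^bsub>G_group\<^esub> g)" | "s v0 = vx (nb \<alpha> A2)" "s v3 = vx (nb \<alpha> A1 \<otimes>\<^bsub>G_group\<^esub> g)"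
      using w0 w3 by blast
    then show ?thesis
    proof cases
      case 1 then show ?thesis using i by (intro bexI[of _ id]) simp_all
    next
      case 2 then show ?thesis using z(1) zE zg Z by (intro bexI[of _ z] conjI) simp_all
    next
      case 3 then show ?thesis using r(1) rE rg R by (intro bexI[of _ r] conjI) simp_all
    next
      case 4 then show ?thesis using G2_comp[OF z(1) r(1)] rE rg R zE zg Z
        by (intro bexI[of _ "z \<circ> r"] conjI) simp_all
    qed
  qed
  then obtain q where q: "q \<in> G2" "q (vx (nb \<alpha> A1)) = s v0" "q (vx E) = vx E" "q (vx g) = vx g"
    "q (vx (nb \<alpha> A1 \<otimes>\<^bsub>G_group\<^esub> g)) = s v3" by blast
  show ?thesis
    using G2_comp[OF t(1) q(1)] q(2-5) st(2) t1 t2 unfolding E_def g_def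
    by (intro bexI[of _ "t \<circ> q"] conjI) simp_all
qed

section \<open>Braid relations and embeddings of T x T\<close>

definition opposite :: "'a \<Rightarrow> 'a option \<Rightarrow> 'a option" where
  "opposite s = inversion \<circ> u_elt s \<circ> inversion"

lemma opposite_T: "opposite s \<in> T"
  unfolding opposite_def by (intro T_comp in_T)

lemma braid_1: "B1 \<circ> opposite 1 \<circ> B1 = opposite 1 \<circ> B1 \<circ> opposite 1"
  by (simp add: opposite_def S3_rules)

text \<open>\<open>dilation t\<close> conjugates the case \<open>t = 1\<close> to the general one;
  \<open>opposite s\<close> is the lower unipotent taking \<open>x\<close> to
  \<open>x / (s x + 1)\<close>. With the converse below, \<open>s = 1 / t\<close> becomes an
  identity in the group, which homomorphisms respect.\<close>

lemma braid_relation: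
  assumes ts: "t * s = 1" shows "u_elt t \<circ> opposite s \<circ> u_elt t = opposite s \<circ> u_elt t \<circ> opposite s"
proof -
  have t: "t \<noteq> 0" using ts by auto
  then have s: "s = 1 / t" using ts by (simp add: nonzero_eq_divide_eq mult.commute)
  have u: "u_elt t = dilation t \<circ> B1 \<circ> dilation (1 / t)"
    using t by (simp add: dilation_u comp_assoc dilation_comp dilation_1)
  have "dilation t \<circ> opposite 1 = opposite (1 / t) \<circ> dilation t"
  proof (rule option_ext)
    fix y show "(dilation t \<circ> opposite 1) (Some y) = (opposite (1 / t) \<circ> dilation t) (Some y)"
      using t by (auto simp: opposite_def field_simps)
  qed (use t in \<open>simp add: opposite_def\<close>)
  then have "dilation t \<circ> opposite 1 \<circ> dilation (1 / t) = opposite (1 / t) \<circ> (dilation t \<circ> dilation (1 / t))"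
    by (simp add: comp_assoc)
  then have o: "opposite s = dilation t \<circ> opposite 1 \<circ> dilation (1 / t)"
    using t s by (simp add: dilation_comp dilation_1)
  have d: "dilation (1 / t) \<circ> (dilation t \<circ> k) = k" for k :: "'a option \<Rightarrow> 'a option"
    using t by (simp add: comp_assoc[symmetric] dilation_comp dilation_1)
  have "u_elt t \<circ> opposite s \<circ> u_elt t = dilation t \<circ> (B1 \<circ> opposite 1 \<circ> B1) \<circ> dilation (1 / t)"
    unfolding u o by (simp add: comp_assoc d)
  also have "\<dots> = opposite s \<circ> u_elt t \<circ> opposite s"
    unfolding u o braid_1 by (simp add: comp_assoc d)
  finally show ?thesis .
qed

text \<open>The values of both sides at infinity give a rational equation that determines
  \<open>s * t\<close>. For \<open>s = 0\<close> infinity is fixed by both sides, and the point 0 is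
  used instead.\<close>

lemma braid_relation_imp:
  assumes eq: "u_elt t \<circ> opposite s \<circ> u_elt t = opposite s \<circ> u_elt t \<circ> opposite s" and t: "t \<noteq> 0"
  shows "t * s = 1"
proof (rule ccontr)
  assume ne: "t * s \<noteq> 1"
  have e: "u_elt t (opposite s None) = opposite s (u_elt t (opposite s None))"
    using fun_cong[OF eq, of None] by simp
  show False
  proof (cases "s = 0")
    case True
    have "u_elt t (opposite s (u_elt t (Some 0))) = opposite s (u_elt t (opposite s (Some 0)))"
      using fun_cong[OF eq, of "Some 0"] by simp
    moreover have "opposite s x = x" for x by (simp add: opposite_def True u_0 involutions)
    ultimately show False using t by simp
  next
    case False
    have st: "1 + s * t \<noteq> 0" using ne by (simp add: mult.commute)
    have y: "1 / s + t = (1 + s * t) / s" using False by (simp add: field_simps)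
    have z: "s / (1 + s * t) + s = s * s * t / (1 + s * t)"
    proof -
      have "s / (1 + s * t) + s = (s + s * (1 + s * t)) / (1 + s * t)" using st by (simp add: field_simps)
      also have "s + s * (1 + s * t) = s * s * t" by (simp add: algebra_simps)
      finally show ?thesis .
    qed
    have "opposite s None = Some (1 / s)" using False by (simp add: opposite_def)
    moreover have "opposite s (Some ((1 + s * t) / s)) = Some ((1 + s * t) / (s * s * t))"
      using False t st z by (simp add: opposite_def)
    ultimately have "(1 + s * t) / s = (1 + s * t) / (s * s * t)" using e y by simp
    then have "(1 + s * t) * (s * s * t) = (1 + s * t) * s" using False t by (simp add: frac_eq_eq)
    then have "s * (s * t) = s * 1" using st by (simp add: mult_ac)
    then show False using False ne by (simp add: mult.commute)
  qed
qed

lemma sigma_conjugate: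
  fixes \<sigma> :: "'a \<Rightarrow> 'a"
  assumes add: "\<And>x y. \<sigma> (x + y) = \<sigma> x + \<sigma> y" and one: "\<sigma> 1 = 1" and nz: "\<And>t. t \<noteq> 0 \<Longrightarrow> \<sigma> t \<noteq> 0"
    and braid: "\<And>t s. t * s = 1 \<Longrightarrow>
      u_elt (\<sigma> t) \<circ> opposite (\<sigma> s) \<circ> u_elt (\<sigma> t) = opposite (\<sigma> s) \<circ> u_elt (\<sigma> t) \<circ> opposite (\<sigma> s)"
  shows "\<sigma> (x * y) = \<sigma> x * \<sigma> y" "\<exists>i<f. \<sigma> \<alpha> = \<alpha> ^ 2 ^ i"
proof -
  have inv: "\<sigma> t * \<sigma> (1 / t) = 1" if "t \<noteq> 0" for t
    using braid_relation_imp[OF braid nz[OF that]] that by simp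
  have mult: "\<sigma> (x * y) = \<sigma> x * \<sigma> y" for x y
    by (rule additive_inverse_preserving_mult[OF add one inv])
  then show "\<sigma> (x * y) = \<sigma> x * \<sigma> y" by simp
  show "\<exists>i<f. \<sigma> \<alpha> = \<alpha> ^ 2 ^ i" by (rule automorphism_conjugate[OF add mult one])
qed

text \<open>A commuting element fixes the only fixed point of \<open>u_elt s\<close>, so it is
  affine, and its dilation part is 1.\<close>

lemma centralizer_u:
  assumes x: "x \<in> T" and s: "s \<noteq> 0" and com: "x \<circ> u_elt s = u_elt s \<circ> x"
  obtains m where "x = u_elt m"
proof -
  have "u_elt s (x None) = x None" using fun_cong[OF com, of None] by simp
  then have "x None = None" using u_fix_iff[OF s] by simp
  then obtain l m where lm: "l \<noteq> 0" "x = u_elt m \<circ> dilation l" using T_fixing_infinity[of x] x by blast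
  have "l * s + m = m + s" using fun_cong[OF com, of "Some 0"] by (simp add: lm)
  then have "l * s = s" by (simp add: add.commute)
  then have "l = 1" using s by simp
  then have "x = u_elt m" using lm by (simp add: dilation_1)
  then show thesis by (rule that)
qed

text \<open>An injective endomorphism of \<open>T \<times> T\<close>, given by its two components,
  that fixes the diagonal copies of the two involutions generating \<open>S3\<close>.\<close>

definition product_embedding where
  "product_embedding t1 t2 \<longleftrightarrow>
    (\<forall>x\<in>T. \<forall>y\<in>T. t1 x y \<in> T \<and> t2 x y \<in> T) \<and>
    (\<forall>x\<in>T. \<forall>x'\<in>T. \<forall>y\<in>T. \<forall>y'\<in>T. t1 (x \<circ> x') (y \<circ> y') = t1 x y \<circ> t1 x' y' \<and>
      t2 (x \<circ> x') (y \<circ> y') = t2 x y \<circ> t2 x' y') \<and>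
    (\<forall>x\<in>T. \<forall>x'\<in>T. \<forall>y\<in>T. \<forall>y'\<in>T. t1 x y = t1 x' y' \<longrightarrow> t2 x y = t2 x' y' \<longrightarrow> x = x' \<and> y = y') \<and>
    t1 B1 B1 = B1 \<and> t2 B1 B1 = B1 \<and> t1 inversion inversion = inversion \<and> t2 inversion inversion = inversion"

lemma product_embedding_swap: "product_embedding t1 t2 \<Longrightarrow> product_embedding t2 t1"
  unfolding product_embedding_def by blast

lemma product_embedding_flip:
  "product_embedding t1 t2 \<Longrightarrow> product_embedding (\<lambda>x y. t1 y x) (\<lambda>x y. t2 y x)"
  unfolding product_embedding_def by blast

context
  fixes t1 t2 :: "('a option \<Rightarrow> 'a option) \<Rightarrow> ('a option \<Rightarrow> 'a option) \<Rightarrow> ('a option \<Rightarrow> 'a option)"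
  assumes emb: "product_embedding t1 t2"
begin

lemma emb_T: "x \<in> T \<Longrightarrow> y \<in> T \<Longrightarrow> t1 x y \<in> T" "x \<in> T \<Longrightarrow> y \<in> T \<Longrightarrow> t2 x y \<in> T"
  using emb unfolding product_embedding_def by blast+

lemma emb_hom: "\<lbrakk>x \<in> T; x' \<in> T; y \<in> T; y' \<in> T\<rbrakk> \<Longrightarrow> t1 (x \<circ> x') (y \<circ> y') = t1 x y \<circ> t1 x' y'"
    "\<lbrakk>x \<in> T; x' \<in> T; y \<in> T; y' \<in> T\<rbrakk> \<Longrightarrow> t2 (x \<circ> x') (y \<circ> y') = t2 x y \<circ> t2 x' y'"
  using emb unfolding product_embedding_def by blast+

lemma emb_inj: "\<lbrakk>x \<in> T; x' \<in> T; y \<in> T; y' \<in> T; t1 x y = t1 x' y'; t2 x y = t2 x' y'\<rbrakk> \<Longrightarrow> x = x' \<and> y = y'"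
  using emb unfolding product_embedding_def by blast

lemma emb_diag: "t1 B1 B1 = B1" "t2 B1 B1 = B1" "t1 inversion inversion = inversion" "t2 inversion inversion = inversion"
  using emb unfolding product_embedding_def by blast+

lemma emb_hom_1: "\<lbrakk>x \<in> T; x' \<in> T\<rbrakk> \<Longrightarrow> t1 (x \<circ> x') id = t1 x id \<circ> t1 x' id" "\<lbrakk>x \<in> T; x' \<in> T\<rbrakk> \<Longrightarrow> t2 (x \<circ> x') id = t2 x id \<circ> t2 x' id"
  using emb_hom[of x x' id id] by simp_all

lemma emb_id: "t1 id id = id" "t2 id id = id"
proof -
  have *: "h = id" if "h \<in> T" "h \<circ> h = h" for h
    by (rule inj_comp_cancel[OF bij_is_inj[OF T_bij[OF that(1)]]]) (simp add: that(2))
  show "t1 id id = id" by (rule *) (use emb_T[of id id] emb_hom[of id id id id] in simp_all)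
  show "t2 id id = id" by (rule *) (use emb_T[of id id] emb_hom[of id id id id] in simp_all)
qed

lemma emb_commute_1:
  assumes x: "x \<in> T" and y: "y \<in> T"
  shows "t1 x id \<circ> t1 id y = t1 id y \<circ> t1 x id" "t2 x id \<circ> t2 id y = t2 id y \<circ> t2 x id"
  using emb_hom[of x id id y] emb_hom[of id x y id] x y by simp_all

text \<open>The image centralizes \<open>(B1, B1)\<close>, so it is a pair of translations. Were
  both nontrivial, the image of the second factor, which commutes with it, would consist of
  translations and be abelian.\<close>

lemma emb_u_1:
  "\<exists>p q. t1 (u_elt t) id = u_elt p \<and> t2 (u_elt t) id = u_elt q \<and> (p = 0 \<or> q = 0) \<and> (t = 0 \<or> p \<noteq> 0 \<or> q \<noteq> 0)"
proof -
  have c: "t1 (u_elt t) id \<circ> B1 = B1 \<circ> t1 (u_elt t) id" "t2 (u_elt t) id \<circ> B1 = B1 \<circ> t2 (u_elt t) id"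
    using emb_hom[of "u_elt t" B1 id B1] emb_hom[of B1 "u_elt t" B1 id] by (simp_all add: emb_diag u_commute[of t])
  obtain p where p: "t1 (u_elt t) id = u_elt p" by (rule centralizer_u[OF _ one_neq_zero c(1)]) (simp add: emb_T)
  obtain q where q: "t2 (u_elt t) id = u_elt q" by (rule centralizer_u[OF _ one_neq_zero c(2)]) (simp add: emb_T)
  have "p = 0 \<or> q = 0"
  proof (rule ccontr)
    assume nz: "\<not> ?thesis"
    have E: "(\<exists>m. t1 id y = u_elt m) \<and> (\<exists>m. t2 id y = u_elt m)" if y: "y \<in> T" for y
    proof -
      have c1: "t1 id y \<circ> u_elt p = u_elt p \<circ> t1 id y" and c2: "t2 id y \<circ> u_elt q = u_elt q \<circ> t2 id y"
        using emb_commute_1[of "u_elt t" y] y by (simp_all add: p q)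
      have "p \<noteq> 0" "q \<noteq> 0" using nz by auto
      obtain m where "t1 id y = u_elt m" by (rule centralizer_u[OF emb_T(1)[OF T_id y] \<open>p \<noteq> 0\<close> c1])
      moreover obtain m' where "t2 id y = u_elt m'" by (rule centralizer_u[OF emb_T(2)[OF T_id y] \<open>q \<noteq> 0\<close> c2])
      ultimately show ?thesis by blast
    qed
    have "t1 id B1 \<circ> t1 id inversion = t1 id inversion \<circ> t1 id B1" "t2 id B1 \<circ> t2 id inversion = t2 id inversion \<circ> t2 id B1"
      using E[OF in_T(1)[of 1]] E[OF in_T(2)] by (auto simp: u_comp add.commute)
    then have "t1 id (B1 \<circ> inversion) = t1 id (inversion \<circ> B1)" "t2 id (B1 \<circ> inversion) = t2 id (inversion \<circ> B1)"
      using emb_hom[of id id B1 inversion] emb_hom[of id id inversion B1] by simp_all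
    then have "B1 \<circ> inversion = inversion \<circ> B1" using emb_inj[of id id "B1 \<circ> inversion" "inversion \<circ> B1"] A_T by simp
    then have "(B1 \<circ> inversion) None = (inversion \<circ> B1) None" by simp
    then show False by simp
  qed
  moreover have "p \<noteq> 0 \<or> q \<noteq> 0" if "t \<noteq> 0"
  proof (rule ccontr)
    assume "\<not> ?thesis"
    then have "t1 (u_elt t) id = t1 id id" "t2 (u_elt t) id = t2 id id" using p q emb_id by (simp_all add: u_0)
    then have "u_elt t = (id :: 'a option \<Rightarrow> _)" using emb_inj[of "u_elt t" id id id] by simp
    then have "u_elt t (Some 0) = Some (0 :: 'a)" by simp
    then show False using that by simp
  qed
  ultimately show ?thesis using p q by blast
qed

text \<open>If \<open>t\<close> had a nontrivial second component, then \<open>t + 1\<close> would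
  have two nontrivial components, which \<open>emb_u_1\<close> excludes.\<close>

lemma emb_side:
  assumes "t2 B1 id = id" shows "t2 (u_elt t) id = id"
proof -
  obtain p q where pq: "t1 (u_elt t) id = u_elt p" "t2 (u_elt t) id = u_elt q" "p = 0 \<or> q = 0" using emb_u_1[of t] by blast
  obtain p1 q1 where 1: "t1 B1 id = u_elt p1" "t2 B1 id = u_elt q1" "p1 \<noteq> 0 \<or> q1 \<noteq> 0"
    using emb_u_1[of 1] by auto
  have "u_elt q1 = u_elt 0" using 1(2) assms by (simp add: u_0)
  then have "q1 = 0" by simp
  then have "p1 \<noteq> 0" using 1 by simp
  obtain p2 q2 where 2: "t1 (u_elt (t + 1)) id = u_elt p2" "t2 (u_elt (t + 1)) id = u_elt q2" "p2 = 0 \<or> q2 = 0"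
    using emb_u_1[of "t + 1"] by blast
  have s: "u_elt (t + 1) = u_elt t \<circ> B1" by (simp add: u_comp)
  have "u_elt p2 = u_elt (p + p1)" "u_elt q2 = u_elt (q + q1)"
    using emb_hom_1[of "u_elt t" B1] pq 1 2 unfolding s by (simp_all add: u_comp)
  then have "p2 = p + p1" "q2 = q" using \<open>q1 = 0\<close> by simp_all
  then have "q = 0" using pq(3) 2(3) \<open>p1 \<noteq> 0\<close> by auto
  then show ?thesis using pq by (simp add: u_0)
qed

lemma emb_sides: "t2 B1 id = id \<or> t1 B1 id = id"
proof -
  obtain p q where "t1 B1 id = u_elt p" "t2 B1 id = u_elt q" "p = 0 \<or> q = 0" using emb_u_1[of 1] by blast
  then show ?thesis by (auto simp: u_0)
qed

end

text \<open>\<open>t1\<close> kills the translations of the second factor, so \<open>im\<close>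
  becomes an identity between conjugates under the translations by
  \<open>\<sigma> \<alpha> + 1\<close> and \<open>\<beta> + 1\<close>. Evaluated at infinity, which
  \<open>l\<close> sends to infinity, 0 or 1, it leaves only
  \<open>\<beta> = \<sigma> \<alpha>\<close> and
  \<open>\<beta> = \<sigma> \<alpha> + 1\<close>.\<close>

lemma embedding_conjugate:
  assumes emb: "product_embedding t1 t2" and side: "t2 B1 id = id"
    and im: "t1 (u_elt (\<alpha> + 1) \<circ> A1 \<circ> u_elt (\<alpha> + 1)) (u_elt \<alpha> \<circ> A1 \<circ> u_elt \<alpha>) = u_elt (\<beta> + 1) \<circ> l \<circ> u_elt (\<beta> + 1)"
    and l: "l \<in> S3"
  shows "\<exists>i<f. \<beta> = \<alpha> ^ 2 ^ i \<or> \<beta> = \<alpha> ^ 2 ^ i + 1"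
proof -
  note hom = emb_hom[OF emb] note hom1 = emb_hom_1[OF emb] note diag = emb_diag[OF emb]
  have side_t: "t2 (u_elt t) id = id" for t by (rule emb_side[OF emb side])
  have "\<exists>p. t1 (u_elt t) id = u_elt p" for t using emb_u_1[OF emb, of t] by blast
  then obtain \<sigma> where \<sigma>: "t1 (u_elt t) id = u_elt (\<sigma> t)" for t by metis
  have add: "\<sigma> (x + y) = \<sigma> x + \<sigma> y" for x y
  proof -
    have "u_elt (\<sigma> (x + y)) = u_elt (\<sigma> x + \<sigma> y)"
      using hom1(1)[of "u_elt x" "u_elt y"] by (simp add: u_comp \<sigma>)
    then show ?thesis by simp
  qed
  have nz: "\<sigma> t \<noteq> 0" if nz0: "t \<noteq> 0" for t
  proof
    assume "\<sigma> t = 0"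
    moreover obtain p q where "t1 (u_elt t) id = u_elt p" "t2 (u_elt t) id = u_elt q" "p \<noteq> 0 \<or> q \<noteq> 0"
      using emb_u_1[OF emb, of t] nz0 by blast
    ultimately have "u_elt p = u_elt 0" "u_elt q = u_elt 0" "p \<noteq> 0 \<or> q \<noteq> 0"
      using \<sigma>[of t] side_t[of t] by (simp_all add: u_0)
    then show False by simp
  qed
  note femb = product_embedding_flip[OF emb]
  have B11: "t1 B1 id \<circ> t1 id B1 = B1" "t2 B1 id \<circ> t2 id B1 = B1"
    using hom[of B1 id id B1] by (simp_all add: diag)
  \<comment> \<open>As \<open>(B1, B1)\<close> is fixed and \<open>(B1, id)\<close> goes into the
    first factor, \<open>(id, B1)\<close> must go into the second.\<close>
  have "t2 id B1 = B1" using B11(2) side by simp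
  moreover have "B1 \<noteq> (id :: 'a option \<Rightarrow> _)" by (metis u_0 u_eq_iff zero_neq_one)
  ultimately have s1: "t1 id B1 = id" using emb_sides[OF femb] by simp
  have side1: "t1 id (u_elt t) = id" for t
    using emb_side[OF product_embedding_swap[OF femb], of t] s1 by simp
  have one: "\<sigma> 1 = 1" using B11(1) s1 \<sigma>[of 1] by simp
  have opp: "t1 (opposite s) id = opposite (\<sigma> s)" for s
  proof -
    have "t1 (inversion \<circ> u_elt s \<circ> inversion) (inversion \<circ> id \<circ> inversion) = inversion \<circ> u_elt (\<sigma> s) \<circ> inversion"
      using hom(1)[of "inversion \<circ> u_elt s" inversion "inversion \<circ> id" inversion]
        hom(1)[of inversion "u_elt s" inversion id] by (simp add: diag \<sigma> T_comp)
    then show ?thesis by (simp add: opposite_def inversion_inversion)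
  qed
  have braid: "u_elt (\<sigma> t) \<circ> opposite (\<sigma> s) \<circ> u_elt (\<sigma> t) = opposite (\<sigma> s) \<circ> u_elt (\<sigma> t) \<circ> opposite (\<sigma> s)"
    if "t * s = 1" for t s
  proof -
    have "t1 (u_elt t \<circ> opposite s \<circ> u_elt t) id = t1 (opposite s \<circ> u_elt t \<circ> opposite s) id"
      by (simp only: braid_relation[OF that])
    then show ?thesis by (simp add: hom1 T_comp opposite_T \<sigma> opp)
  qed
  obtain i where i: "i < f" "\<sigma> \<alpha> = \<alpha> ^ 2 ^ i" using sigma_conjugate(2)[OF add one nz braid] by blast
  have A1: "t1 A1 A1 = A1" using hom(1)[of B1 inversion B1 inversion] by (simp add: diag)
  have c: "t1 (u_elt (\<alpha> + 1)) (u_elt \<alpha>) = u_elt (\<sigma> \<alpha> + 1)"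
    using hom(1)[of "u_elt (\<alpha> + 1)" id id "u_elt \<alpha>"] by (simp add: \<sigma> side1 add one)
  have "u_elt (\<sigma> \<alpha> + 1) \<circ> A1 \<circ> u_elt (\<sigma> \<alpha> + 1) = u_elt (\<beta> + 1) \<circ> l \<circ> u_elt (\<beta> + 1)"
    unfolding im[symmetric]
    using hom(1)[of "u_elt (\<alpha> + 1) \<circ> A1" "u_elt (\<alpha> + 1)" "u_elt \<alpha> \<circ> A1" "u_elt \<alpha>"]
      hom(1)[of "u_elt (\<alpha> + 1)" A1 "u_elt \<alpha>" A1] A_T by (simp add: T_comp c A1 comp_assoc)
  from fun_cong[OF this, of None]
  have "u_elt (\<sigma> \<alpha> + 1) (A1 (u_elt (\<sigma> \<alpha> + 1) None)) = u_elt (\<beta> + 1) (l (u_elt (\<beta> + 1) None))"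
    by (simp only: comp_apply)
  then have e: "Some (1 + (\<sigma> \<alpha> + 1)) = u_elt (\<beta> + 1) (l None)" by simp
  have "l None = None \<or> l None = Some 0 \<or> l None = Some 1" using l by (auto simp: S3_def)
  then have "1 + (\<sigma> \<alpha> + 1) = \<beta> + 1 \<or> 1 + (\<sigma> \<alpha> + 1) = 1 + (\<beta> + 1)" using e by auto
  then have "\<beta> = \<sigma> \<alpha> \<or> \<beta> = \<sigma> \<alpha> + 1" by (metis add.commute add_self_left)
  then show ?thesis using i by metis
qed

text \<open>If the factors are interchanged, \<open>t2\<close> takes the place of \<open>t1\<close>;
  replacing \<open>l\<close> by \<open>B1 \<circ> l \<circ> B1\<close> brings the second equation
  into the form of the first.\<close>

lemma embedding_conjugate':
  assumes emb: "product_embedding t1 t2" and l: "l \<in> S3"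
    and im: "t1 (u_elt (\<alpha> + 1) \<circ> A1 \<circ> u_elt (\<alpha> + 1)) (u_elt \<alpha> \<circ> A1 \<circ> u_elt \<alpha>) = u_elt (\<beta> + 1) \<circ> l \<circ> u_elt (\<beta> + 1)"
      "t2 (u_elt (\<alpha> + 1) \<circ> A1 \<circ> u_elt (\<alpha> + 1)) (u_elt \<alpha> \<circ> A1 \<circ> u_elt \<alpha>) = u_elt \<beta> \<circ> l \<circ> u_elt \<beta>"
  shows "\<exists>i<f. \<beta> = \<alpha> ^ 2 ^ i \<or> \<beta> = \<alpha> ^ 2 ^ i + 1"
proof (cases "t2 B1 id = id")
  case True then show ?thesis by (rule embedding_conjugate[OF emb _ im(1) l])
next
  case False
  then have side: "t1 B1 id = id" using emb_sides[OF emb] by blast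
  have "u_elt (\<beta> + 1) \<circ> (B1 \<circ> l \<circ> B1) \<circ> u_elt (\<beta> + 1) = u_elt \<beta> \<circ> l \<circ> u_elt \<beta>"
  proof -
    have "u_elt (\<beta> + 1) \<circ> B1 = u_elt \<beta>" "B1 \<circ> u_elt (\<beta> + 1) = u_elt \<beta>"
      by (simp_all add: u_comp add.assoc add.left_commute)
    then have "u_elt (\<beta> + 1) \<circ> B1 \<circ> l \<circ> (B1 \<circ> u_elt (\<beta> + 1)) = u_elt \<beta> \<circ> l \<circ> u_elt \<beta>" by simp
    then show ?thesis by (simp only: comp_assoc)
  qed
  then have "t2 (u_elt (\<alpha> + 1) \<circ> A1 \<circ> u_elt (\<alpha> + 1)) (u_elt \<alpha> \<circ> A1 \<circ> u_elt \<alpha>)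
      = u_elt (\<beta> + 1) \<circ> (B1 \<circ> l \<circ> B1) \<circ> u_elt (\<beta> + 1)" using im(2) by simp
  moreover have "B1 \<circ> l \<circ> B1 \<in> S3" using S3_comp l S3_elems(2) by blast
  ultimately show ?thesis by (rule embedding_conjugate[OF product_embedding_swap[OF emb] side])
qed

section \<open>Right multiplication by T x T and 24th powers\<close>

abbreviation pair :: "('a option \<Rightarrow> 'a option) \<Rightarrow> ('a option \<Rightarrow> 'a option) \<Rightarrow> 'a G_elt" where
  "pair x y \<equiv> ((x, y), 0)"

lemma pair_GG: "x \<in> T \<Longrightarrow> y \<in> T \<Longrightarrow> pair x y \<in> GG"
  by (simp add: G_carrier)

lemma pair_mult: "pair x y \<otimes>\<^bsub>G_group\<^esub> pair x' y' = pair (x' \<circ> x) (y' \<circ> y)"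
  by (simp add: G_mult)

lemma act_vx: "z \<in> GG \<Longrightarrow> n \<in> GG \<Longrightarrow> vx z #>\<^bsub>G_group\<^esub> n = vx (z \<otimes>\<^bsub>G_group\<^esub> n)"
  unfolding vx_def by (rule G.coset_mult_assoc[OF subgroup.subset[OF L_subgroup]])

lemma act_V:
  assumes "v \<in> V" "n \<in> GG" shows "v #>\<^bsub>G_group\<^esub> n \<in> V"
proof -
  obtain z where "z \<in> GG" "v = vx z" using assms(1) unfolding V_iff by blast
  then show ?thesis using assms(2) by (simp add: act_vx)
qed

lemma act_act:
  assumes "v \<in> V" "n \<in> GG" "m \<in> GG"
  shows "v #>\<^bsub>G_group\<^esub> n #>\<^bsub>G_group\<^esub> m = v #>\<^bsub>G_group\<^esub> (n \<otimes>\<^bsub>G_group\<^esub> m)"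
proof -
  obtain z where "z \<in> GG" "v = vx z" using assms(1) unfolding V_iff by blast
  then show ?thesis using assms(2,3) by (simp add: act_vx G.m_assoc)
qed

lemma act_one:
  assumes "v \<in> V" shows "v #>\<^bsub>G_group\<^esub> pair id id = v"
proof -
  obtain z where "z \<in> GG" "v = vx z" using assms unfolding V_iff by blast
  then show ?thesis by (simp add: act_vx G_one[symmetric])
qed

text \<open>On the coset of \<open>(h, id)\<close> the two multiplications differ by a left factor
  from \<open>S3\<close>. The second component shows that it does not depend on \<open>h\<close>, so
  it commutes with all of \<open>T\<close> and is trivial.\<close>

lemma act_faithful:
  assumes T: "x \<in> T" "y \<in> T" "x' \<in> T" "y' \<in> T"
    and eq: "\<And>v. v \<in> V \<Longrightarrow> v #>\<^bsub>G_group\<^esub> pair x y = v #>\<^bsub>G_group\<^esub> pair x' y'"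
  shows "x = x' \<and> y = y'"
proof -
  have e: "\<exists>l\<in>S3. x' \<circ> h = x \<circ> h \<circ> l \<and> y' = y \<circ> l" if h: "h \<in> T" for h
  proof -
    have hG: "pair h id \<in> GG" using h by (simp add: pair_GG)
    have "vx (pair h id \<otimes>\<^bsub>G_group\<^esub> pair x y) = vx (pair h id \<otimes>\<^bsub>G_group\<^esub> pair x' y')"
      using eq[of "vx (pair h id)"] hG T by (simp add: act_vx pair_GG)
    then obtain l where "l \<in> S3" "pair h id \<otimes>\<^bsub>G_group\<^esub> pair x' y' = diag l \<otimes>\<^bsub>G_group\<^esub> (pair h id \<otimes>\<^bsub>G_group\<^esub> pair x y)"
      using vx_eq_iff[of "pair h id \<otimes>\<^bsub>G_group\<^esub> pair x y" "pair h id \<otimes>\<^bsub>G_group\<^esub> pair x' y'"] hG T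
      by (auto simp: pair_GG)
    then show ?thesis by (intro bexI[of _ l]) (simp_all add: G_mult diag_def)
  qed
  have injx: "inj x" and injy: "inj y" using T_bij T bij_is_inj by blast+
  obtain l where l: "l \<in> S3" "x' = x \<circ> l" "y' = y \<circ> l" using e[of id] by auto
  have com: "l \<circ> h = h \<circ> l" if h: "h \<in> T" for h
  proof -
    obtain k where k: "k \<in> S3" "x' \<circ> h = x \<circ> h \<circ> k" "y' = y \<circ> k" using e[OF h] by blast
    have "y \<circ> l = y \<circ> k" using l(3) k(3) by simp
    then have "l = k" by (rule inj_comp_cancel[OF injy])
    then have "x \<circ> (l \<circ> h) = x \<circ> (h \<circ> l)" using k(2) l(2) by (simp add: comp_assoc)
    then show ?thesis by (rule inj_comp_cancel[OF injx])
  qed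
  have "l = id \<or> l = B1" by (rule S3_fix[OF l(1) commute_B1_fix[OF com[OF in_T(1)]]])
  moreover have "l \<noteq> B1"
  proof
    assume "l = B1"
    then have "B1 (inversion None) = inversion (B1 None)" using fun_cong[OF com[OF in_T(2)], of None] by simp
    then show False by simp
  qed
  ultimately show ?thesis using l by simp
qed

lemma three_arc_transitive:
  assumes conn: "Digraph_Component.connected (Gamma \<beta>)"
    and v: "cubic_graph.arc (adj \<beta>) v 0 3" and w: "cubic_graph.arc (adj \<beta>) w 0 3"
  shows "\<exists>x\<in>G2. \<forall>k. 0 \<le> k \<and> k \<le> 3 \<longrightarrow> x (v k) = w k"
proof -
  interpret C: cubic_graph V "adj \<beta>" by (rule cubic_graph_Gamma[OF conn])
  have std: "\<exists>p\<in>G2. p (vx (nb \<beta> A1)) = v 0 \<and> p (vx \<one>\<^bsub>G_group\<^esub>) = v 1 \<and> p (vx (nb \<beta> id)) = v 2 \<and>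
    p (vx (nb \<beta> A1 \<otimes>\<^bsub>G_group\<^esub> nb \<beta> id)) = v 3" if v: "C.arc v 0 3" for v
  proof (rule std_3arc)
    show "adj \<beta> (v 1) (v 0)" using C.arc_step'[OF v, of 1] by simp
    show "adj \<beta> (v 1) (v 2)" "adj \<beta> (v 2) (v 3)" using C.arc_step[OF v, of 1] C.arc_step[OF v, of 2] by simp_all
    show "v 0 \<noteq> v 2" "v 1 \<noteq> v 3" using C.arc_noback[OF v, of 1] C.arc_noback[OF v, of 2] by simp_all
  qed
  obtain p where p: "p \<in> G2" "p (vx (nb \<beta> A1)) = v 0" "p (vx \<one>\<^bsub>G_group\<^esub>) = v 1" "p (vx (nb \<beta> id)) = v 2"
    "p (vx (nb \<beta> A1 \<otimes>\<^bsub>G_group\<^esub> nb \<beta> id)) = v 3" using std[OF v] by blast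
  obtain q where q: "q \<in> G2" "q (vx (nb \<beta> A1)) = w 0" "q (vx \<one>\<^bsub>G_group\<^esub>) = w 1" "q (vx (nb \<beta> id)) = w 2"
    "q (vx (nb \<beta> A1 \<otimes>\<^bsub>G_group\<^esub> nb \<beta> id)) = w 3" using std[OF w] by blast
  have pi: "inv_into UNIV p (p x) = x" for x by (rule inv_f_f[OF bij_is_inj[OF G2_bij[OF p(1)]]])
  show ?thesis
  proof (intro bexI[of _ "q \<circ> inv_into UNIV p"] allI impI)
    fix k :: int assume "0 \<le> k \<and> k \<le> 3"
    then have "k = 0 \<or> k = 1 \<or> k = 2 \<or> k = 3" by auto
    then show "(q \<circ> inv_into UNIV p) (v k) = w k"
      using q(2-5) by (elim disjE) (simp_all add: pi flip: p(2-5))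
  qed (rule G2_comp[OF q(1) G2_inv[OF p(1)]])
qed

definition by_pair :: "('a G_elt set \<Rightarrow> 'a G_elt set) \<Rightarrow> bool" where
  "by_pair p \<longleftrightarrow> (\<exists>x\<in>T. \<exists>y\<in>T. \<forall>v\<in>V. p v = v #>\<^bsub>G_group\<^esub> pair x y)"

lemma by_pair_comp:
  assumes "by_pair p" "by_pair q" shows "by_pair (p \<circ> q)"
proof -
  obtain x y x' y' where x: "x \<in> T" "y \<in> T" "\<And>v. v \<in> V \<Longrightarrow> p v = v #>\<^bsub>G_group\<^esub> pair x y"
    and x': "x' \<in> T" "y' \<in> T" "\<And>v. v \<in> V \<Longrightarrow> q v = v #>\<^bsub>G_group\<^esub> pair x' y'"
    using assms unfolding by_pair_def by blast
  have "(p \<circ> q) v = v #>\<^bsub>G_group\<^esub> pair (x \<circ> x') (y \<circ> y')" if "v \<in> V" for v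
    using x x' that by (simp add: act_V act_act pair_GG pair_mult)
  then show ?thesis unfolding by_pair_def using x x' T_comp by blast
qed

lemma by_pair_id: "by_pair id"
  unfolding by_pair_def using T_id act_one by (intro bexI[of _ id]) auto

text \<open>The left factor \<open>e\<close> has square 1, and squares in a semidirect product with
  a group of order 2 lie in the normal factor.\<close>

lemma G2_square: assumes "p \<in> G2" shows "by_pair (p \<circ> p)"
proof -
  obtain e n where p: "translates e n p" using assms unfolding G2_def by blast
  then have n: "n \<in> GG" and e: "e = \<one>\<^bsub>G_group\<^esub> \<or> e = flip" unfolding translates_def by blast+
  have "translates \<one>\<^bsub>G_group\<^esub> (n \<otimes>\<^bsub>G_group\<^esub> n) (p \<circ> p)"
    using translates_comp[OF p p] flip_commute_one(3)[OF e e] by simp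
  then have pp: "(p \<circ> p) (vx z) = vx (z \<otimes>\<^bsub>G_group\<^esub> (n \<otimes>\<^bsub>G_group\<^esub> n))" if "z \<in> GG" for z
    using that unfolding translates_def by simp
  obtain x y where xy: "n \<otimes>\<^bsub>G_group\<^esub> n = pair x y" "x \<in> T" "y \<in> T"
    using n by (cases rule: G_cases) (auto simp: G_mult T_comp)
  have "(p \<circ> p) v = v #>\<^bsub>G_group\<^esub> pair x y" if vV: "v \<in> V" for v
  proof -
    obtain z where z: "z \<in> GG" "v = vx z" using vV unfolding V_iff by blast
    show ?thesis unfolding z(2) pp[OF z(1)] xy(1) by (rule act_vx[symmetric, OF z(1) pair_GG[OF xy(2,3)]])
  qed
  then show ?thesis unfolding by_pair_def using xy by blast
qed

text \<open>By Tutte's theorem the stabilizer of a 3-arc has order at most 4, so every automorphism has a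
  power of exponent at most 4 in \<open>G2\<close>.\<close>

lemma Aut_power_24:
  assumes conn: "Digraph_Component.connected (Gamma \<beta>)" and p: "p \<in> cubic_graph.Aut V (adj \<beta>)"
  shows "by_pair (p ^^ 24)"
proof -
  interpret C: cubic_graph V "adj \<beta>" by (rule cubic_graph_Gamma[OF conn])
  have "C.arc_transitive 3"
    unfolding C.arc_transitive_def
  proof (intro allI impI)
    fix v w assume "C.arc v 0 3" "C.arc w 0 3"
    from three_arc_transitive[OF conn this]
    obtain x where "x \<in> G2" "\<forall>k. 0 \<le> k \<and> k \<le> 3 \<longrightarrow> x (v k) = w k" by (elim bexE)
    then show "\<exists>x\<in>C.Aut. \<forall>k. 0 \<le> k \<and> k \<le> 3 \<longrightarrow> x (v k) = w k"
      by (intro bexI[OF _ subsetD[OF G2_Aut[OF conn]]])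
  qed
  then have tr: "C.arc_transitive 1" by (rule C.arc_transitive_le) simp_all
  obtain k where k: "1 \<le> k" "k \<le> 4" "p ^^ k \<in> G2"
    by (rule C.arc_transitive_power[OF tr V_nonempty G2_Aut[OF conn] G2_comp G2_inv three_arc_transitive[OF conn] p])
  have "k = 1 \<or> k = 2 \<or> k = 3 \<or> k = 4" using k by auto
  \<comment> \<open>24 is a multiple of \<open>2 * k\<close> for every \<open>k \<le> 4\<close>; the
    factor 2 leads from \<open>G2\<close> to right multiplications by pairs.\<close>
  then have "k * (2 * 12) = 24 \<or> k * (2 * 6) = 24 \<or> k * (2 * 4) = 24 \<or> k * (2 * 3) = 24" by auto
  then obtain j where j: "k * (2 * j) = 24" by blast
  have "p ^^ 24 = ((p ^^ k) ^^ 2) ^^ j" unfolding j[symmetric] funpow_mult by (simp add: mult_ac)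
  also have "(p ^^ k) ^^ 2 = p ^^ k \<circ> p ^^ k" by (simp add: numeral_2_eq_2)
  finally have e: "p ^^ 24 = (p ^^ k \<circ> p ^^ k) ^^ j" .
  show ?thesis unfolding e
  proof (induction j)
    case 0 show ?case unfolding funpow.simps(1) by (rule by_pair_id)
  next
    case (Suc j) show ?case unfolding funpow.simps(2) by (rule by_pair_comp[OF G2_square[OF k(3)] Suc])
  qed
qed

lemma dilation_power: "dilation c ^^ n = dilation (c ^ n)"
  by (induction n) (simp_all only: funpow.simps dilation_1 power.simps dilation_comp)

text \<open>The elements all of whose conjugates satisfy \<open>P\<close> form a normal subgroup. It
  contains the nontrivial \<open>dilation (l ^ 24)\<close>, so by simplicity it is
  \<open>T\<close>.\<close>

lemma generated_by_24th_powers: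
  assumes P: "\<And>x y. x \<in> T \<Longrightarrow> y \<in> T \<Longrightarrow> P x \<Longrightarrow> P y \<Longrightarrow> P (x \<circ> y)"
    and Pinv: "\<And>x y. x \<in> T \<Longrightarrow> y \<in> T \<Longrightarrow> x \<circ> y = id \<Longrightarrow> y \<circ> x = id \<Longrightarrow> P x \<Longrightarrow> P y"
    and P24: "\<And>x. x \<in> T \<Longrightarrow> P (x ^^ 24)" and x: "x \<in> T"
  shows "P x"
proof -
  define K where "K = {k \<in> T. \<forall>h\<in>T. \<forall>h'\<in>T. h' \<circ> h = id \<longrightarrow> P (h \<circ> k \<circ> h')}"
  obtain l :: 'a where l: "l \<noteq> 0" "l ^ 24 \<noteq> 1" by (rule power_24_ne_1)
  have hh: "h \<circ> h' = id" if h: "h \<in> T" "h' \<circ> h = id" for h h'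
  proof (rule ext)
    fix z
    obtain y where y: "z = h y" using bij_is_surj[OF T_bij[OF h(1)]] by blast
    show "(h \<circ> h') z = id z" using fun_cong[OF h(2), of y] by (simp add: y)
  qed
  have pw: "(h \<circ> k \<circ> h') ^^ n = h \<circ> k ^^ n \<circ> h'" if "h \<circ> h' = id" "h' \<circ> h = id" for h k h' :: "'a option \<Rightarrow> 'a option" and n
  proof (induction n)
    case 0 show ?case by (simp add: that(1))
  next
    case (Suc n)
    have "(h \<circ> k \<circ> h') ^^ Suc n = h \<circ> k \<circ> (h' \<circ> h) \<circ> k ^^ n \<circ> h'"
      unfolding funpow.simps(2) Suc by (simp only: comp_assoc)
    then show ?case unfolding that(2) by (simp only: funpow.simps(2) comp_id comp_assoc)
  qed
  have "K = T"
  proof (rule normal_subset_T[of K "dilation (l ^ 24)"])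
    show "K \<subseteq> T" unfolding K_def by blast
    show "g \<circ> k \<in> K" if g: "g \<in> K" and k: "k \<in> K" for g k
      unfolding K_def mem_Collect_eq
    proof (intro conjI ballI impI)
      show "g \<circ> k \<in> T" using g k T_comp unfolding K_def by blast
      fix h h' assume h: "h \<in> T" "h' \<in> T" "h' \<circ> h = id"
      have gk: "g \<in> T" "k \<in> T" "P (h \<circ> g \<circ> h')" "P (h \<circ> k \<circ> h')" using g k h unfolding K_def by blast+
      have "P ((h \<circ> g \<circ> h') \<circ> (h \<circ> k \<circ> h'))" by (rule P) (intro T_comp h gk)+
      moreover have "(h \<circ> g \<circ> h') \<circ> (h \<circ> k \<circ> h') = h \<circ> g \<circ> (h' \<circ> h) \<circ> k \<circ> h'" by (simp only: comp_assoc)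
      ultimately show "P (h \<circ> (g \<circ> k) \<circ> h')" by (simp only: h(3) comp_assoc comp_id)
    qed
    show "\<exists>k'\<in>K. k \<circ> k' = id" if k: "k \<in> K" for k
    proof -
      have kT: "k \<in> T" using k unfolding K_def by blast
      define k' where "k' = inv_into UNIV k"
      have k': "k' \<in> T" "k \<circ> k' = id" "k' \<circ> k = id" unfolding k'_def by (rule T_inv[OF kT] T_inv_comp[OF kT])+
      have "P (h \<circ> k' \<circ> h')" if h: "h \<in> T" "h' \<in> T" "h' \<circ> h = id" for h h'
      proof (rule Pinv[of "h \<circ> k \<circ> h'"])
        show "h \<circ> k \<circ> h' \<in> T" "h \<circ> k' \<circ> h' \<in> T" by (intro T_comp h kT k'(1))+
        show "P (h \<circ> k \<circ> h')" using k h unfolding K_def by blast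
        have "(h \<circ> a \<circ> h') \<circ> (h \<circ> b \<circ> h') = h \<circ> (a \<circ> b) \<circ> h'" for a b
        proof -
          have "(h \<circ> a \<circ> h') \<circ> (h \<circ> b \<circ> h') = h \<circ> a \<circ> (h' \<circ> h) \<circ> b \<circ> h'" by (simp only: comp_assoc)
          then show ?thesis by (simp only: h(3) comp_assoc comp_id)
        qed
        then show "(h \<circ> k \<circ> h') \<circ> (h \<circ> k' \<circ> h') = id" "(h \<circ> k' \<circ> h') \<circ> (h \<circ> k \<circ> h') = id"
          using k' hh[OF h(1,3)] by simp_all
      qed
      then show ?thesis using k' unfolding K_def by blast
    qed
    show "h \<circ> k \<circ> h' \<in> K" if k: "k \<in> K" and h: "h \<in> T" "h' \<in> T" "h' \<circ> h = id" for k h h'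
      unfolding K_def mem_Collect_eq
    proof (intro conjI ballI impI)
      have kT: "k \<in> T" using k unfolding K_def by blast
      show "h \<circ> k \<circ> h' \<in> T" by (intro T_comp kT h)
      fix g g' assume g: "g \<in> T" "g' \<in> T" "g' \<circ> g = id"
      have "(h' \<circ> g') \<circ> (g \<circ> h) = h' \<circ> (g' \<circ> g) \<circ> h" by (simp only: comp_assoc)
      then have "(h' \<circ> g') \<circ> (g \<circ> h) = id" by (simp add: g(3) h(3))
      then have "P ((g \<circ> h) \<circ> k \<circ> (h' \<circ> g'))"
        using k T_comp[OF g(1) h(1)] T_comp[OF h(2) g(2)] unfolding K_def by blast
      then show "P (g \<circ> (h \<circ> k \<circ> h') \<circ> g')" by (simp only: comp_assoc)
    qed
    show "dilation (l ^ 24) \<in> K"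
      unfolding K_def mem_Collect_eq
    proof (intro conjI ballI impI)
      show "dilation (l ^ 24) \<in> T" using l by simp
      fix h h' assume h: "h \<in> T" "h' \<in> T" "h' \<circ> h = id"
      have "P ((h \<circ> dilation l \<circ> h') ^^ 24)" by (rule P24) (intro T_comp h in_T l)
      then show "P (h \<circ> dilation (l ^ 24) \<circ> h')"
        by (simp only: pw[OF hh[OF h(1,3)] h(3)] dilation_power)
    qed
    show "dilation (l ^ 24) \<noteq> id"
    proof
      assume "dilation (l ^ 24) = id"
      then have "dilation (l ^ 24) (Some 1) = Some 1" by simp
      then show False using l by simp
    qed
  qed
  then have "x \<in> K" using x by simp
  then have "\<forall>h\<in>T. \<forall>h'\<in>T. h' \<circ> h = id \<longrightarrow> P (h \<circ> x \<circ> h')" unfolding K_def by blast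
  from bspec[OF bspec[OF this T_id] T_id] show ?thesis by simp
qed

section \<open>Graph isomorphisms and transported right multiplications\<close>

definition graph_iso :: "'a \<Rightarrow> 'a \<Rightarrow> ('a G_elt set \<Rightarrow> 'a G_elt set) \<Rightarrow> bool" where
  "graph_iso \<alpha> \<beta> \<phi> \<longleftrightarrow> bij \<phi> \<and> (\<forall>v. v \<notin> V \<longrightarrow> \<phi> v = v) \<and> (\<forall>v w. adj \<beta> (\<phi> v) (\<phi> w) \<longleftrightarrow> adj \<alpha> v w)"

lemma graph_iso_V:
  assumes "graph_iso \<alpha> \<beta> \<phi>" shows "\<phi> v \<in> V \<longleftrightarrow> v \<in> V"
proof -
  have b: "inj \<phi>" and o: "\<And>v. v \<notin> V \<Longrightarrow> \<phi> v = v" using assms unfolding graph_iso_def by (auto simp: bij_is_inj)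
  show ?thesis
  proof
    assume "v \<in> V"
    show "\<phi> v \<in> V"
    proof (rule ccontr)
      assume "\<phi> v \<notin> V"
      then have "\<phi> (\<phi> v) = \<phi> v" by (rule o)
      then have "\<phi> v = v" by (rule injD[OF b])
      then show False using \<open>v \<in> V\<close> \<open>\<phi> v \<notin> V\<close> by simp
    qed
  next
    assume "\<phi> v \<in> V" then show "v \<in> V" using o[of v] by (cases "v \<in> V") auto
  qed
qed

lemma graph_iso_inv_G2:
  assumes \<phi>: "graph_iso \<alpha> \<beta> \<phi>" and p: "p \<in> G2" shows "graph_iso \<alpha> \<beta> (inv_into UNIV p \<circ> \<phi>)"
  unfolding graph_iso_def
proof (intro conjI allI impI)
  have q: "inv_into UNIV p \<in> G2" by (rule G2_inv[OF p])
  show "bij (inv_into UNIV p \<circ> \<phi>)" using G2_bij[OF q] \<phi> unfolding graph_iso_def by (blast intro: bij_comp)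
  show "(inv_into UNIV p \<circ> \<phi>) v = v" if "v \<notin> V" for v
    using G2_outside[OF q that] \<phi> that unfolding graph_iso_def by simp
  show "adj \<beta> ((inv_into UNIV p \<circ> \<phi>) v) ((inv_into UNIV p \<circ> \<phi>) w) \<longleftrightarrow> adj \<alpha> v w" for v w
    using \<phi> unfolding graph_iso_def comp_apply G2_adj[OF q] by blast
qed

text \<open>Since \<open>G2\<close> is transitive on 3-arcs, an isomorphism may be assumed to preserve a standard 2-arc.\<close>

lemma graph_iso_normalize:
  assumes \<phi>: "graph_iso \<alpha> \<beta> \<phi>"
  obtains \<psi> where "graph_iso \<alpha> \<beta> \<psi>" "\<psi> (vx \<one>\<^bsub>G_group\<^esub>) = vx \<one>\<^bsub>G_group\<^esub>"
    "\<psi> (vx (nb \<alpha> id)) = vx (nb \<beta> id)" "\<psi> (vx (nb \<alpha> A1)) = vx (nb \<beta> A1)"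
proof -
  define E where "E = \<one>\<^bsub>G_group :: 'a G_elt monoid\<^esub>"
  have EG: "E \<in> GG" by (simp add: E_def)
  define g where "g = nb \<alpha> id"
  have gG: "g \<in> GG" by (simp add: g_def)
  have inj: "inj \<phi>" and adj: "\<And>v w. adj \<beta> (\<phi> v) (\<phi> w) \<longleftrightarrow> adj \<alpha> v w"
    using \<phi> unfolding graph_iso_def by (auto simp: bij_is_inj)
  have a: "adj \<alpha> (vx E) (vx (nb \<alpha> A1))" "adj \<alpha> (vx E) (vx g)" "adj \<alpha> (vx g) (vx (nb \<alpha> A1 \<otimes>\<^bsub>G_group\<^esub> g))"
    unfolding adj_vx_cases[OF EG] adj_vx_cases[OF gG] using A_T by (simp_all add: E_def g_def)
  have n: "vx (nb \<alpha> A1) \<noteq> vx g" using nb_distinct(1)[OF EG, of \<alpha>] A_T by (auto simp: E_def g_def)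
  have "vx (g \<otimes>\<^bsub>G_group\<^esub> g) = vx E" using adj_back[OF EG, of \<alpha>] by (simp add: E_def g_def)
  then have n': "vx E \<noteq> vx (nb \<alpha> A1 \<otimes>\<^bsub>G_group\<^esub> g)" using nb_distinct(1)[OF gG, of \<alpha>] by (simp add: g_def)
  have "\<exists>p\<in>G2. p (vx (nb \<beta> A1)) = \<phi> (vx (nb \<alpha> A1)) \<and> p (vx \<one>\<^bsub>G_group\<^esub>) = \<phi> (vx E) \<and> p (vx (nb \<beta> id)) = \<phi> (vx g) \<and>
    p (vx (nb \<beta> A1 \<otimes>\<^bsub>G_group\<^esub> nb \<beta> id)) = \<phi> (vx (nb \<alpha> A1 \<otimes>\<^bsub>G_group\<^esub> g))"
    by (rule std_3arc) (simp_all add: adj a inj_eq[OF inj] n n')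
  then obtain p where p: "p \<in> G2" "p (vx (nb \<beta> A1)) = \<phi> (vx (nb \<alpha> A1))" "p (vx \<one>\<^bsub>G_group\<^esub>) = \<phi> (vx E)"
    "p (vx (nb \<beta> id)) = \<phi> (vx g)" by blast
  have pi: "inv_into UNIV p (p x) = x" for x by (rule inv_f_f[OF bij_is_inj[OF G2_bij[OF p(1)]]])
  show thesis
    by (rule that[OF graph_iso_inv_G2[OF \<phi> p(1)]])
      (simp_all add: pi E_def[symmetric] g_def[symmetric] flip: p(2-4))
qed

lemma T_pow: "x \<in> T \<Longrightarrow> x ^^ n \<in> T"
  by (induction n) (simp_all add: T_comp)

context
  fixes \<alpha> \<beta> :: 'a and \<phi>
  assumes conn: "Digraph_Component.connected (Gamma \<beta>)" and iso: "graph_iso \<alpha> \<beta> \<phi>"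
    and fixed: "\<phi> (vx \<one>\<^bsub>G_group\<^esub>) = vx \<one>\<^bsub>G_group\<^esub>" "\<phi> (vx (nb \<alpha> id)) = vx (nb \<beta> id)"
      "\<phi> (vx (nb \<alpha> A1)) = vx (nb \<beta> A1)"
begin

text \<open>Conjugation by \<open>\<phi>\<close>, kept as a relation because the existence of a
  partner \<open>n'\<close> is known at first only for 24th powers.\<close>

definition transport :: "'a G_elt \<Rightarrow> 'a G_elt \<Rightarrow> bool" where
  "transport n n' \<longleftrightarrow> (\<forall>v\<in>V. \<phi> (v #>\<^bsub>G_group\<^esub> n) = \<phi> v #>\<^bsub>G_group\<^esub> n')"

lemma iso_facts:
  "inj \<phi>" "surj \<phi>" "\<And>v. \<phi> v \<in> V \<longleftrightarrow> v \<in> V" "\<And>v w. adj \<beta> (\<phi> v) (\<phi> w) \<longleftrightarrow> adj \<alpha> v w" "\<And>v. v \<notin> V \<Longrightarrow> \<phi> v = v"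
  using iso graph_iso_V[OF iso] unfolding graph_iso_def by (auto simp: bij_is_inj bij_is_surj)

lemma transportD: "transport n n' \<Longrightarrow> v \<in> V \<Longrightarrow> \<phi> (v #>\<^bsub>G_group\<^esub> n) = \<phi> v #>\<^bsub>G_group\<^esub> n'"
  unfolding transport_def by blast

lemma transport_mult:
  assumes n: "transport n n'" "n \<in> GG" "n' \<in> GG" and m: "transport m m'" "m \<in> GG" "m' \<in> GG"
  shows "transport (n \<otimes>\<^bsub>G_group\<^esub> m) (n' \<otimes>\<^bsub>G_group\<^esub> m')"
  unfolding transport_def
proof
  fix v assume v: "v \<in> V"
  then have \<phi>v: "\<phi> v \<in> V" by (simp add: iso_facts)
  show "\<phi> (v #>\<^bsub>G_group\<^esub> (n \<otimes>\<^bsub>G_group\<^esub> m)) = \<phi> v #>\<^bsub>G_group\<^esub> (n' \<otimes>\<^bsub>G_group\<^esub> m')"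
    using transportD[OF m(1) act_V[OF v n(2)]] transportD[OF n(1) v] act_act[OF v n(2) m(2)]
      act_act[OF \<phi>v n(3) m(3)] by simp
qed

lemma transport_pair_mult:
  assumes "transport (pair x y) (pair x' y')" "transport (pair z w) (pair z' w')"
    "x \<in> T" "y \<in> T" "x' \<in> T" "y' \<in> T" "z \<in> T" "w \<in> T" "z' \<in> T" "w' \<in> T"
  shows "transport (pair (x \<circ> z) (y \<circ> w)) (pair (x' \<circ> z') (y' \<circ> w'))"
  using transport_mult[OF assms(2) pair_GG pair_GG assms(1) pair_GG pair_GG] assms by (simp add: pair_mult)

lemma transport_inverse:
  assumes t: "transport (pair x y) (pair x' y')" and T: "x \<in> T" "y \<in> T" "x' \<in> T" "y' \<in> T" "z \<in> T" "w \<in> T"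
    and i: "x \<circ> z = id" "y \<circ> w = id"
  shows "transport (pair z w) (pair (inv_into UNIV x') (inv_into UNIV y'))"
  unfolding transport_def
proof
  fix v assume v: "v \<in> V"
  define u where "u = v #>\<^bsub>G_group\<^esub> pair z w"
  have u: "u \<in> V" unfolding u_def by (rule act_V[OF v pair_GG[OF T(5,6)]])
  have "u #>\<^bsub>G_group\<^esub> pair x y = v" unfolding u_def act_act[OF v pair_GG[OF T(5,6)] pair_GG[OF T(1,2)]]
    pair_mult i by (rule act_one[OF v])
  then have e: "\<phi> v = \<phi> u #>\<^bsub>G_group\<^esub> pair x' y'" using transportD[OF t u] by simp
  have \<phi>u: "\<phi> u \<in> V" using u by (simp add: iso_facts)
  have ii: "inv_into UNIV x' \<circ> x' = id" "inv_into UNIV y' \<circ> y' = id" using T_inv_comp T by blast+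
  have "\<phi> v #>\<^bsub>G_group\<^esub> pair (inv_into UNIV x') (inv_into UNIV y') = \<phi> u"
    unfolding e act_act[OF \<phi>u pair_GG[OF T(3,4)] pair_GG[OF T_inv[OF T(3)] T_inv[OF T(4)]]] pair_mult ii
      act_one[OF \<phi>u] ..
  then show "\<phi> (v #>\<^bsub>G_group\<^esub> pair z w) = \<phi> v #>\<^bsub>G_group\<^esub> pair (inv_into UNIV x') (inv_into UNIV y')"
    unfolding u_def by (rule sym)
qed

definition transportable where
  "transportable x y \<longleftrightarrow> (\<exists>x'\<in>T. \<exists>y'\<in>T. transport (pair x y) (pair x' y'))"

text \<open>\<open>\<phi>\<close> conjugates right multiplication by \<open>(x, y)\<close> to some
  automorphism of the graph for \<open>\<beta>\<close>, about whose 24th power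
  \<open>Aut_power_24\<close> gives the information.\<close>

lemma transportable_24:
  assumes T: "x \<in> T" "y \<in> T" shows "transportable (x ^^ 24) (y ^^ 24)"
proof -
  interpret C: cubic_graph V "adj \<beta>" by (rule cubic_graph_Gamma[OF conn])
  have n: "pair x y \<in> GG" by (rule pair_GG[OF T])
  obtain R where R: "R \<in> G2" "\<And>z. z \<in> GG \<Longrightarrow> R (vx z) = vx (z \<otimes>\<^bsub>G_group\<^esub> pair x y)"
    by (rule right_mult_exists[OF n]) blast
  have RV: "R v = v #>\<^bsub>G_group\<^esub> pair x y" if v: "v \<in> V" for v
  proof -
    obtain z where z: "z \<in> GG" "v = vx z" using v unfolding V_iff by blast
    show ?thesis unfolding z(2) R(2)[OF z(1)] act_vx[OF z(1) n] ..
  qed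
  have Rk: "(R ^^ k) v = v #>\<^bsub>G_group\<^esub> pair (x ^^ k) (y ^^ k)" if v: "v \<in> V" for v k
  proof (induction k)
    case 0 show ?case unfolding funpow.simps(1) act_one[OF v] by (rule id_apply)
  next
    case (Suc k)
    have k: "pair (x ^^ k) (y ^^ k) \<in> GG" by (intro pair_GG T_pow T)
    show ?case unfolding funpow.simps(2) comp_apply Suc RV[OF act_V[OF v k]] act_act[OF v k n] pair_mult
      by (simp add: comp_def)
  qed
  define \<phi>' where "\<phi>' = inv_into UNIV \<phi>"
  have \<phi>': "\<phi>' (\<phi> v) = v" "\<phi> (\<phi>' v) = v" for v
    unfolding \<phi>'_def by (simp_all add: iso_facts surj_f_inv_f)
  define q where "q = \<phi> \<circ> R \<circ> \<phi>'"
  have \<phi>'V: "\<phi>' v \<in> V \<longleftrightarrow> v \<in> V" for v using iso_facts(3)[of "\<phi>' v"] by (simp add: \<phi>')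
  have "q \<in> C.Aut" unfolding C.Aut_def mem_Collect_eq
  proof (intro conjI allI impI)
    have "bij \<phi>" using iso_facts by (simp add: bij_def)
    then have "bij \<phi>'" unfolding \<phi>'_def by (rule bij_imp_bij_inv)
    then show "bij q" unfolding q_def by (intro bij_comp \<open>bij \<phi>\<close> G2_bij[OF R(1)])
    show "q v = v" if v: "v \<notin> V" for v
    proof -
      have "\<phi>' v \<notin> V" using v by (simp add: \<phi>'V)
      then show ?thesis using G2_outside[OF R(1)] by (simp add: q_def \<phi>')
    qed
    show "adj \<beta> (q v) (q w) \<longleftrightarrow> adj \<beta> v w" for v w
      using iso_facts(4)[of "\<phi>' v" "\<phi>' w"] by (simp add: q_def iso_facts(4) G2_adj[OF R(1)] \<phi>')
  qed
  then have "by_pair (q ^^ 24)" by (rule Aut_power_24[OF conn])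
  then obtain x' y' where x': "x' \<in> T" "y' \<in> T" "\<And>v. v \<in> V \<Longrightarrow> (q ^^ 24) v = v #>\<^bsub>G_group\<^esub> pair x' y'"
    unfolding by_pair_def by blast
  have qk: "(q ^^ k) (\<phi> v) = \<phi> ((R ^^ k) v)" for k v
    by (induction k) (simp_all add: q_def \<phi>')
  have "transport (pair (x ^^ 24) (y ^^ 24)) (pair x' y')" unfolding transport_def
  proof
    fix v assume v: "v \<in> V"
    then have "\<phi> v \<in> V" by (simp add: iso_facts)
    from x'(3)[OF this] show "\<phi> (v #>\<^bsub>G_group\<^esub> pair (x ^^ 24) (y ^^ 24)) = \<phi> v #>\<^bsub>G_group\<^esub> pair x' y'"
      unfolding qk Rk[OF v] .
  qed
  then show ?thesis unfolding transportable_def using x'(1,2) by blast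
qed

lemma transportable_mult:
  assumes "transportable x y" "transportable z w" and T: "x \<in> T" "y \<in> T" "z \<in> T" "w \<in> T"
  shows "transportable (x \<circ> z) (y \<circ> w)"
proof -
  obtain x' y' z' w' where a: "x' \<in> T" "y' \<in> T" "z' \<in> T" "w' \<in> T"
    "transport (pair x y) (pair x' y')" "transport (pair z w) (pair z' w')"
    using assms(1,2) unfolding transportable_def by blast
  have "transport (pair (x \<circ> z) (y \<circ> w)) (pair (x' \<circ> z') (y' \<circ> w'))"
    by (rule transport_pair_mult[OF a(5,6) T(1,2) a(1,2) T(3,4) a(3,4)])
  then show ?thesis unfolding transportable_def using T_comp[OF a(1,3)] T_comp[OF a(2,4)] by blast
qed

lemma transportable_inverse:
  assumes "transportable x y" and T: "x \<in> T" "y \<in> T" "z \<in> T" "w \<in> T" and i: "x \<circ> z = id" "y \<circ> w = id"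
  shows "transportable z w"
proof -
  obtain x' y' where a: "x' \<in> T" "y' \<in> T" "transport (pair x y) (pair x' y')"
    using assms(1) unfolding transportable_def by blast
  from transport_inverse[OF a(3) T(1,2) a(1,2) T(3,4) i] show ?thesis
    unfolding transportable_def using T_inv[OF a(1)] T_inv[OF a(2)] by blast
qed

lemma transportable_all:
  assumes "x \<in> T" "y \<in> T" shows "transportable x y"
proof -
  have "transportable x id" if "x \<in> T" for x
  proof (rule generated_by_24th_powers[of "\<lambda>x. transportable x id"])
    show "transportable (x \<circ> y) id" if "x \<in> T" "y \<in> T" "transportable x id" "transportable y id" for x y
      using transportable_mult[OF that(3,4) that(1) T_id that(2) T_id] by simp
    show "transportable y id" if "x \<in> T" "y \<in> T" "x \<circ> y = id" "y \<circ> x = id" "transportable x id" for x y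
      by (rule transportable_inverse[OF that(5) that(1) T_id that(2) T_id that(3)]) simp
    show "transportable (x ^^ 24) id" if "x \<in> T" for x
      using transportable_24[OF that T_id] by simp
  qed (rule that)
  moreover have "transportable id y" if "y \<in> T" for y
  proof (rule generated_by_24th_powers[of "\<lambda>y. transportable id y"])
    show "transportable id (x \<circ> y)" if "x \<in> T" "y \<in> T" "transportable id x" "transportable id y" for x y
      using transportable_mult[OF that(3,4) T_id that(1) T_id that(2)] by simp
    show "transportable id y" if "x \<in> T" "y \<in> T" "x \<circ> y = id" "y \<circ> x = id" "transportable id x" for x y
      by (rule transportable_inverse[OF that(5) T_id that(1) T_id that(2) _ that(3)]) simp
    show "transportable id (x ^^ 24)" if "x \<in> T" for x
      using transportable_24[OF T_id that] by simp
  qed (rule that)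
  ultimately show ?thesis using transportable_mult[of x id id y] assms by simp
qed

lemma transport_unique:
  assumes "transport n (pair x y)" "transport n (pair x' y')" and T: "x \<in> T" "y \<in> T" "x' \<in> T" "y' \<in> T"
  shows "x = x' \<and> y = y'"
proof (rule act_faithful[OF T])
  fix v assume v: "v \<in> V"
  obtain u where u: "v = \<phi> u" using iso_facts(2) by (metis surjD)
  then have "u \<in> V" using v by (simp add: iso_facts)
  then show "v #>\<^bsub>G_group\<^esub> pair x y = v #>\<^bsub>G_group\<^esub> pair x' y'"
    using transportD[OF assms(1)] transportD[OF assms(2)] by (simp add: u)
qed

lemma transport_inj:
  assumes "transport (pair x y) m" "transport (pair x' y') m" and T: "x \<in> T" "y \<in> T" "x' \<in> T" "y' \<in> T"
  shows "x = x' \<and> y = y'"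
proof (rule act_faithful[OF T])
  fix v assume v: "v \<in> V"
  show "v #>\<^bsub>G_group\<^esub> pair x y = v #>\<^bsub>G_group\<^esub> pair x' y'"
    by (rule injD[OF iso_facts(1)]) (simp add: transportD[OF assms(1) v] transportD[OF assms(2) v])
qed

text \<open>Right multiplication by \<open>diag k\<close> fixes the vertex \<open>L\<close>, and so
  does its transport because \<open>\<phi>\<close> fixes that vertex.\<close>

lemma transport_diag:
  assumes t: "transport (diag k) (pair x y)" and k: "k \<in> S3" and T: "x \<in> T" "y \<in> T"
  shows "x \<in> S3 \<and> y = x"
proof -
  have o: "\<one>\<^bsub>G_group\<^esub> \<in> GG" by simp
  have kG: "diag k \<in> GG" using S3_in_T[OF k] by simp
  have "vx (pair x y) = vx \<one>\<^bsub>G_group\<^esub>"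
    using transportD[OF t V_nonempty] vx_diag[OF k o] kG pair_GG[OF T]
    unfolding act_vx[OF o kG] fixed act_vx[OF o pair_GG[OF T]] by (simp add: fixed)
  then obtain l where l: "l \<in> S3" "pair x y = diag l \<otimes>\<^bsub>G_group\<^esub> \<one>\<^bsub>G_group\<^esub>"
    using vx_eq_iff[OF o pair_GG[OF T]] by auto
  then have "pair x y = diag l" using S3_in_T[OF l(1)] by simp
  then show ?thesis using l(1) by (simp add: diag_def)
qed

lemma transport_id: "transport (pair id id) (pair id id)"
  unfolding transport_def by (simp add: act_one iso_facts)

text \<open>\<open>(B1, B1)\<close> also fixes the vertex of \<open>g_elt \<alpha>\<close>. In the
  stabilizer of \<open>L\<close> only \<open>id\<close> and \<open>B1\<close> fix the vertex of
  \<open>g_elt \<beta>\<close>, and injectivity excludes \<open>id\<close>.\<close>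

lemma transport_B1:
  assumes t: "transport (diag B1) (pair x y)" and T: "x \<in> T" "y \<in> T"
  shows "x = B1 \<and> y = B1"
proof -
  have l: "x \<in> S3" "y = x" using transport_diag[OF t S3_elems(2) T] by blast+
  have p: "pair x y = diag x" using l by (simp add: diag_def)
  have n: "nb \<alpha> id \<in> GG" "nb \<beta> id \<in> GG" "diag B1 \<in> GG" "diag x \<in> GG" using T by simp_all
  have "vx (nb \<alpha> B1) = vx (nb \<alpha> id)" using vx_nb_B1[of id "\<one>\<^bsub>G_group\<^esub>" \<alpha>] by simp
  then have "vx (nb \<beta> x) = vx (nb \<beta> id)"
    using transportD[OF t vx_V[OF n(1)]] unfolding p act_vx[OF n(1,3)] fixed act_vx[OF n(2,4)] nb_diag
    by (simp add: fixed)
  then have "vx (nb \<beta> id \<otimes>\<^bsub>G_group\<^esub> \<one>\<^bsub>G_group\<^esub>) = vx (nb \<beta> x \<otimes>\<^bsub>G_group\<^esub> \<one>\<^bsub>G_group\<^esub>)" using T by simp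
  from vx_nb_eq[OF _ T_id T(1) this] have "x = id \<or> x = B1" by simp
  moreover have "x \<noteq> id"
  proof
    assume "x = id"
    then have "B1 = id" using transport_inj[of B1 B1 "pair id id" id id] t transport_id l by (simp add: diag_def)
    then show False by (metis u_0 u_eq_iff zero_neq_one)
  qed
  ultimately show ?thesis using l by blast
qed

text \<open>The argument for \<open>B1\<close>, applied to the other neighbour in the normalized
  2-arc: \<open>inversion \<circ> A1\<close> equals \<open>A1 \<circ> B1\<close>. This is why the
  normalization prescribes two neighbours.\<close>

lemma transport_inversion:
  assumes t: "transport (diag inversion) (pair x y)" and T: "x \<in> T" "y \<in> T"
  shows "x = inversion \<and> y = inversion"
proof -
  have l: "x \<in> S3" "y = x" using transport_diag[OF t S3_elems(3) T] by blast+
  have p: "pair x y = diag x" using l by (simp add: diag_def)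
  have n: "nb \<alpha> A1 \<in> GG" "nb \<beta> A1 \<in> GG" "diag inversion \<in> GG" "diag x \<in> GG" using T A_T by simp_all
  have IA: "inversion \<circ> A1 = A1 \<circ> B1" by (simp add: S3_rules)
  have "vx (nb \<alpha> (inversion \<circ> A1)) = vx (nb \<alpha> A1)"
    using vx_nb_B1[OF A_T(1), of "\<one>\<^bsub>G_group\<^esub>" \<alpha>] T_comp[OF A_T(1) in_T(1)] A_T unfolding IA by simp
  then have "vx (nb \<beta> (x \<circ> A1)) = vx (nb \<beta> A1)"
    using transportD[OF t vx_V[OF n(1)]] unfolding p act_vx[OF n(1,3)] fixed act_vx[OF n(2,4)] nb_diag
    by (simp add: fixed)
  moreover have xA: "x \<circ> A1 \<in> T" by (rule T_comp[OF T(1) A_T(1)])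
  ultimately have "vx (nb \<beta> A1 \<otimes>\<^bsub>G_group\<^esub> \<one>\<^bsub>G_group\<^esub>) = vx (nb \<beta> (x \<circ> A1) \<otimes>\<^bsub>G_group\<^esub> \<one>\<^bsub>G_group\<^esub>)"
    using A_T by simp
  from vx_nb_eq[OF _ A_T(1) xA this] have "x \<circ> A1 = id \<circ> A1 \<or> x \<circ> A1 = inversion \<circ> A1" unfolding IA by simp
  moreover have c: "k = k'" if e: "k \<circ> A1 = k' \<circ> A1" for k k' :: "'a option \<Rightarrow> 'a option"
  proof
    fix z
    obtain w where "z = A1 w" using bij_is_surj[OF T_bij[OF A_T(1)]] by (metis surjD)
    then show "k z = k' z" using fun_cong[OF e, of w] by simp
  qed
  ultimately have "x = id \<or> x = inversion" using c[of x id] c[of x inversion] by blast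
  moreover have "x \<noteq> id"
  proof
    assume "x = id"
    then have "inversion = (id :: 'a option \<Rightarrow> _)"
      using transport_inj[of inversion inversion "pair id id" id id] t transport_id l by (simp add: diag_def)
    from fun_cong[OF this, of None] show False by simp
  qed
  ultimately show ?thesis using l by blast
qed

lemma conjugate_of_normalized: "\<exists>i<f. \<beta> = \<alpha> ^ 2 ^ i \<or> \<beta> = \<alpha> ^ 2 ^ i + 1"
proof -
  have "\<exists>x' y'. x \<in> T \<longrightarrow> y \<in> T \<longrightarrow> x' \<in> T \<and> y' \<in> T \<and> transport (pair x y) (pair x' y')" for x y
    using transportable_all[of x y] unfolding transportable_def by blast
  then obtain t1 t2 where t: "\<And>x y. x \<in> T \<longrightarrow> y \<in> T \<longrightarrow> t1 x y \<in> T \<and> t2 x y \<in> T \<and> transport (pair x y) (pair (t1 x y) (t2 x y))"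
    by metis
  have tT: "t1 x y \<in> T" "t2 x y \<in> T" and tt: "transport (pair x y) (pair (t1 x y) (t2 x y))"
    if "x \<in> T" "y \<in> T" for x y using t that by blast+
  have emb: "product_embedding t1 t2" unfolding product_embedding_def
  proof (intro conjI ballI impI)
    show "t1 x y \<in> T" "t2 x y \<in> T" if "x \<in> T" "y \<in> T" for x y using tT that by blast+
    have hom: "t1 (x \<circ> x') (y \<circ> y') = t1 x y \<circ> t1 x' y' \<and> t2 (x \<circ> x') (y \<circ> y') = t2 x y \<circ> t2 x' y'"
      if T: "x \<in> T" "x' \<in> T" "y \<in> T" "y' \<in> T" for x x' y y'
      by (rule transport_unique[OF tt transport_pair_mult[OF tt tt]]) (intro T T_comp tT)+
    show "t1 (x \<circ> x') (y \<circ> y') = t1 x y \<circ> t1 x' y'" "t2 (x \<circ> x') (y \<circ> y') = t2 x y \<circ> t2 x' y'"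
      if T: "x \<in> T" "x' \<in> T" "y \<in> T" "y' \<in> T" for x x' y y' using hom[OF T] by blast+
    have inj: "x = x' \<and> y = y'"
      if T: "x \<in> T" "x' \<in> T" "y \<in> T" "y' \<in> T" and e: "t1 x y = t1 x' y'" "t2 x y = t2 x' y'" for x x' y y'
      by (rule transport_inj[OF tt[OF T(1,3)] _ T(1,3) T(2,4)]) (unfold e, rule tt[OF T(2,4)])
    show "x = x'" "y = y'"
      if T: "x \<in> T" "x' \<in> T" "y \<in> T" "y' \<in> T" and e: "t1 x y = t1 x' y'" "t2 x y = t2 x' y'" for x x' y y'
      using inj[OF T e] by blast+
    have "transport (diag B1) (pair (t1 B1 B1) (t2 B1 B1))" unfolding diag_def by (rule tt) simp_all
    from transport_B1[OF this tT[OF in_T(1) in_T(1)]] show "t1 B1 B1 = B1" "t2 B1 B1 = B1" by blast+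
    have "transport (diag inversion) (pair (t1 inversion inversion) (t2 inversion inversion))" unfolding diag_def by (rule tt) simp_all
    from transport_inversion[OF this tT[OF in_T(2) in_T(2)]]
    show "t1 inversion inversion = inversion" "t2 inversion inversion = inversion" by blast+
  qed
  \<comment> \<open>\<open>(x, y)\<close> is the conjugate of \<open>(A1, A1)\<close> by
    \<open>g_elt \<alpha>\<close> and fixes the vertex of \<open>g_elt \<alpha>\<close>. Its
    transport fixes the vertex of \<open>g_elt \<beta>\<close>, hence is the conjugate of some
    \<open>(l, l)\<close> by \<open>g_elt \<beta>\<close>.\<close>
  define x y where "x = u_elt (\<alpha> + 1) \<circ> A1 \<circ> u_elt (\<alpha> + 1)" and "y = u_elt \<alpha> \<circ> A1 \<circ> u_elt \<alpha>"
  have xy: "x \<in> T" "y \<in> T" unfolding x_def y_def by (intro T_comp A_T in_T)+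
  note XY = tT[OF xy]
  have uB: "u_elt t \<circ> B1 = u_elt (t + 1)" for t :: 'a by (simp add: u_comp)
  have n: "nb \<alpha> id \<otimes>\<^bsub>G_group\<^esub> pair x y = diag A1 \<otimes>\<^bsub>G_group\<^esub> nb \<alpha> id"
    unfolding nb_def diag_def x_def y_def by (simp add: G_mult comp_assoc uB u_u)
  have ng: "nb \<alpha> id \<in> GG" "nb \<beta> id \<in> GG" by simp_all
  have "vx (nb \<beta> id \<otimes>\<^bsub>G_group\<^esub> pair (t1 x y) (t2 x y)) = vx (nb \<beta> id)"
    using transportD[OF tt[OF xy] vx_V[OF ng(1)]]
    unfolding act_vx[OF ng(1) pair_GG[OF xy]] n vx_diag[OF S3_elems(4) ng(1)] fixed act_vx[OF ng(2) pair_GG[OF XY]] by simp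
  then obtain l where l: "l \<in> S3" "nb \<beta> id \<otimes>\<^bsub>G_group\<^esub> pair (t1 x y) (t2 x y) = diag l \<otimes>\<^bsub>G_group\<^esub> nb \<beta> id"
    using vx_eq_iff[OF ng(2) G.m_closed[OF ng(2) pair_GG[OF XY]]] by auto
  have "t2 x y \<circ> u_elt \<beta> = u_elt \<beta> \<circ> l" "t1 x y \<circ> u_elt (\<beta> + 1) = u_elt (\<beta> + 1) \<circ> l"
    using arg_cong[OF l(2), of "fst \<circ> fst"] arg_cong[OF l(2), of "snd \<circ> fst"]
    unfolding nb_def diag_def by (simp_all add: G_mult uB)
  then have "t2 x y \<circ> (u_elt \<beta> \<circ> u_elt \<beta>) = u_elt \<beta> \<circ> l \<circ> u_elt \<beta>"
    "t1 x y \<circ> (u_elt (\<beta> + 1) \<circ> u_elt (\<beta> + 1)) = u_elt (\<beta> + 1) \<circ> l \<circ> u_elt (\<beta> + 1)"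
    by (simp_all only: comp_assoc[symmetric])
  then have "t1 x y = u_elt (\<beta> + 1) \<circ> l \<circ> u_elt (\<beta> + 1)" "t2 x y = u_elt \<beta> \<circ> l \<circ> u_elt \<beta>"
    by (simp_all add: u_u)
  then show ?thesis unfolding x_def y_def by (rule embedding_conjugate'[OF emb l(1)])
qed

end

lemma graph_iso_conjugate:
  assumes "Digraph_Component.connected (Gamma \<beta>)" "graph_iso \<alpha> \<beta> \<phi>"
  shows "\<exists>i<f. \<beta> = \<alpha> ^ 2 ^ i \<or> \<beta> = \<alpha> ^ 2 ^ i + 1"
proof -
  obtain \<psi> where "graph_iso \<alpha> \<beta> \<psi>" "\<psi> (vx \<one>\<^bsub>G_group\<^esub>) = vx \<one>\<^bsub>G_group\<^esub>"
    "\<psi> (vx (nb \<alpha> id)) = vx (nb \<beta> id)" "\<psi> (vx (nb \<alpha> A1)) = vx (nb \<beta> A1)"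
    by (rule graph_iso_normalize[OF assms(2)])
  from conjugate_of_normalized[OF assms(1) this] show ?thesis .
qed

section \<open>Digraph isomorphisms, the shift by 1 and Frobenius\<close>

lemma adj_V': "adj \<alpha> v w \<Longrightarrow> w \<in> V"
  by (rule adj_V[OF adj_sym[OF _ adj_V]])

lemma proj_Gamma: "tail (Gamma \<alpha>) = fst" "head (Gamma \<alpha>) = snd"
  by (simp_all add: Gamma_def)

lemma digraph_iso_imp:
  assumes "digraph_iso (Gamma \<alpha>) (Gamma \<beta>)" obtains \<phi> where "graph_iso \<alpha> \<beta> \<phi>"
proof -
  obtain h where h: "pre_digraph.digraph_isomorphism (Gamma \<alpha>) h" "Gamma \<beta> = app_iso h (Gamma \<alpha>)"
    using assms unfolding digraph_iso_def by blast
  define \<phi> where "\<phi> v = (if v \<in> V then iso_verts h v else v)" for v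
  have inj: "inj_on (iso_verts h) V"
    using h(1) unfolding pre_digraph.digraph_isomorphism_def by (simp add: verts_Gamma)
  have im: "iso_verts h ` V = V" using arg_cong[OF h(2), of verts] by (simp add: verts_Gamma)
  \<comment> \<open>Both digraphs use \<open>fst\<close> and \<open>snd\<close> as tail and head, so
    the arc map of \<open>h\<close> is determined by its vertex map.\<close>
  have tl: "iso_tail h = fst" "iso_head h = snd"
    using arg_cong[OF h(2), of tail] arg_cong[OF h(2), of head] by (simp_all add: proj_Gamma)
  have ends: "iso_arcs h (v, w) = (iso_verts h v, iso_verts h w)" if "adj \<alpha> v w" for v w
  proof -
    have "(v, w) \<in> arcs (Gamma \<alpha>)" using that by (simp add: arcs_Gamma)
    then have "iso_verts h v = fst (iso_arcs h (v, w)) \<and> iso_verts h w = snd (iso_arcs h (v, w))"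
      using h(1) unfolding pre_digraph.digraph_isomorphism_def tl proj_Gamma by fastforce
    then show ?thesis by simp
  qed
  have arcs: "arcs (Gamma \<beta>) = iso_arcs h ` arcs (Gamma \<alpha>)"
    using arg_cong[OF h(2), of arcs] by simp
  have bV: "bij_betw \<phi> V V"
    using inj im unfolding bij_betw_def \<phi>_def by (simp add: inj_on_def)
  have "bij_betw \<phi> (- V) (- V)" by (simp add: \<phi>_def bij_betw_def inj_on_def)
  then have bij: "bij \<phi>" using bij_betw_combine[OF bV, of "- V" "- V"] by simp
  have \<phi>V: "v \<in> V" if "\<phi> v \<in> V" for v using that by (simp add: \<phi>_def split: if_splits)
  have "adj \<beta> (\<phi> v) (\<phi> w) \<longleftrightarrow> adj \<alpha> v w" for v w
  proof
    assume a: "adj \<alpha> v w"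
    have "iso_arcs h (v, w) \<in> arcs (Gamma \<beta>)" unfolding arcs using a by (simp add: arcs_Gamma)
    then show "adj \<beta> (\<phi> v) (\<phi> w)"
      using ends[OF a] adj_V[OF a] adj_V'[OF a] by (simp add: \<phi>_def arcs_Gamma)
  next
    assume a: "adj \<beta> (\<phi> v) (\<phi> w)"
    have vw: "v \<in> V" "w \<in> V" using \<phi>V adj_V[OF a] adj_V'[OF a] by blast+
    have "(\<phi> v, \<phi> w) \<in> iso_arcs h ` arcs (Gamma \<alpha>)" using a by (simp add: arcs_Gamma flip: arcs)
    then obtain v' w' where v': "adj \<alpha> v' w'" "(\<phi> v, \<phi> w) = iso_arcs h (v', w')"
      by (auto simp: arcs_Gamma)
    have "iso_verts h v = iso_verts h v'" "iso_verts h w = iso_verts h w'"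
      using v'(2) vw unfolding ends[OF v'(1)] by (simp_all add: \<phi>_def)
    then have "v = v'" "w = w'" using inj vw adj_V[OF v'(1)] adj_V'[OF v'(1)] by (simp_all add: inj_on_eq_iff)
    then show "adj \<alpha> v w" using v'(1) by simp
  qed
  then show thesis using that[of \<phi>] bij unfolding graph_iso_def by (simp add: \<phi>_def)
qed

lemma digraph_isoI:
  assumes inj: "inj \<phi>" and im: "\<phi> ` V = V" and adj: "\<And>v w. adj \<beta> (\<phi> v) (\<phi> w) \<longleftrightarrow> adj \<alpha> v w"
  shows "digraph_iso (Gamma \<alpha>) (Gamma \<beta>)"
proof -
  define h where "h = \<lparr>iso_verts = \<phi>, iso_arcs = map_prod \<phi> \<phi>, iso_head = snd, iso_tail = fst\<rparr>"
  have wf: "wf_digraph (Gamma \<alpha>)"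
    by unfold_locales (auto simp: proj_Gamma verts_Gamma arcs_Gamma intro: adj_V adj_V')
  have "inj (map_prod \<phi> \<phi>)" by (rule prod.inj_map[OF inj inj])
  then have "pre_digraph.digraph_isomorphism (Gamma \<alpha>) h"
    unfolding pre_digraph.digraph_isomorphism_def using wf inj
    by (auto simp: h_def proj_Gamma intro: inj_on_subset)
  moreover have "Gamma \<beta> = app_iso h (Gamma \<alpha>)"
  proof (rule pre_digraph.equality)
    show "arcs (Gamma \<beta>) = arcs (app_iso h (Gamma \<alpha>))"
      unfolding set_eq_iff
    proof (intro allI)
      fix e :: "'a G_elt set \<times> 'a G_elt set"
      obtain v w where e: "e = (v, w)" by fastforce
      have "adj \<beta> v w \<longleftrightarrow> (\<exists>v' w'. adj \<alpha> v' w' \<and> v = \<phi> v' \<and> w = \<phi> w')"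
      proof
        assume a: "adj \<beta> v w"
        have "v \<in> \<phi> ` V" "w \<in> \<phi> ` V" unfolding im by (rule adj_V[OF a], rule adj_V'[OF a])
        then obtain v' w' where "v = \<phi> v'" "w = \<phi> w'" by (elim imageE)
        then show "\<exists>v' w'. adj \<alpha> v' w' \<and> v = \<phi> v' \<and> w = \<phi> w'" using a adj[of v' w'] by auto
      qed (auto simp: adj)
      moreover have "arcs (app_iso h (Gamma \<alpha>)) = map_prod \<phi> \<phi> ` arcs (Gamma \<alpha>)" by (simp add: h_def)
      ultimately show "e \<in> arcs (Gamma \<beta>) \<longleftrightarrow> e \<in> arcs (app_iso h (Gamma \<alpha>))"
        by (simp only: e arcs_Gamma image_iff Bex_def split_paired_Ex map_prod_simp prod.inject)
    qed
  qed (simp_all add: h_def verts_Gamma proj_Gamma im)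
  ultimately show ?thesis unfolding digraph_iso_def by blast
qed

lemma digraph_iso_refl: "digraph_iso (Gamma \<alpha>) (Gamma (\<alpha> :: 'a))"
  by (rule digraph_isoI[of id]) simp_all

text \<open>\<open>g_elt (\<alpha> + 1)\<close> is \<open>g_elt \<alpha>\<close> multiplied by an
  element of \<open>L_subgroup\<close>, so even the adjacency relations coincide.\<close>

lemma Gamma_add_one: "Gamma (\<alpha> + 1) = Gamma (\<alpha> :: 'a)"
proof -
  have nb: "nb (\<alpha> + 1) m = nb \<alpha> (m \<circ> B1)" for m
    by (simp add: nb_def comp_assoc u_comp ac_simps)
  have "adj (\<alpha> + 1) v w \<longleftrightarrow> adj \<alpha> v w" for v w
  proof (cases "v \<in> V")
    case True
    then obtain z where z: "z \<in> GG" "v = vx z" unfolding V_iff by blast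
    have "vx (nb (\<alpha> + 1) m \<otimes>\<^bsub>G_group\<^esub> z) = vx (nb \<alpha> m \<otimes>\<^bsub>G_group\<^esub> z)" if "m \<in> S3" for m
      unfolding nb by (rule vx_nb_B1[OF S3_in_T[OF that] z(1)])
    then show ?thesis unfolding z(2) adj_vx_iff[OF z(1)] by auto
  next
    case False then show ?thesis using adj_V[of "\<alpha> + 1" v w] adj_V[of \<alpha> v w] by blast
  qed
  then have "parcs (coset_graph G_group L_subgroup (g_elt (\<alpha> + 1))) = parcs (coset_graph G_group L_subgroup (g_elt \<alpha>))"
    unfolding adj_def by auto
  then have "coset_graph G_group L_subgroup (g_elt (\<alpha> + 1)) = coset_graph G_group L_subgroup (g_elt \<alpha>)"
    by (simp add: coset_graph_def)
  then show ?thesis by (simp add: Gamma_def)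
qed

text \<open>A power of Frobenius acts on the projective line and by conjugation on \<open>G\<close>;
  it fixes \<open>L_subgroup\<close> elementwise and maps \<open>g_elt \<alpha>\<close> to
  \<open>g_elt (\<alpha> ^ 2 ^ i)\<close>.\<close>

lemma Gamma_frobenius: "digraph_iso (Gamma (\<alpha> :: 'a)) (Gamma (\<alpha> ^ 2 ^ i))"
proof -
  define r :: "'a \<Rightarrow> 'a" where "r x = x ^ 2 ^ i" for x
  have r_add: "r (x + y) = r x + r y" and r_mult: "r (x * y) = r x * r y" and r_0: "r x = 0 \<longleftrightarrow> x = 0" for x y
    by (simp_all add: r_def frobenius_add power_mult_distrib)
  have r_eq: "r x = r y \<longleftrightarrow> x = y" for x y by (simp add: r_def frobenius_inj)
  have r_div: "r (x / y) = r x / r y" for x y by (simp add: r_def power_divide)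
  have r_1: "r 1 = 1" "r 0 = 0" by (simp_all add: r_def)
  have "inj r" by (simp add: inj_def r_def frobenius_inj)
  define F where "F = map_option r"
  have Finj: "inj F" unfolding F_def by (rule option.inj_map[OF \<open>inj r\<close>])
  then have "bij F" by (simp add: bij_def finite_UNIV_inj_surj)
  define F' where "F' = inv_into UNIV F"
  have FF: "F \<circ> F' = id" "F' \<circ> F = id"
    unfolding F'_def using \<open>bij F\<close> by (simp_all add: bij_is_inj bij_is_surj inj_iff[symmetric] surj_iff[symmetric])
  have Fm: "F \<circ> moebius p q s t = moebius (r p) (r q) (r s) (r t) \<circ> F" for p q s t
    by (auto simp: fun_eq_iff F_def moebius_def r_add r_mult r_div r_0 r_eq add_eq_0 split: option.splits simp flip: r_add r_mult)
  have FT: "F \<circ> x \<circ> F' \<in> T" if xT: "x \<in> T" for x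
  proof -
    obtain p q s t where x: "x = moebius p q s t" "p * t - q * s \<noteq> 0" using xT unfolding T_group_def by auto
    have "F \<circ> x \<circ> F' = moebius (r p) (r q) (r s) (r t) \<circ> (F \<circ> F')" unfolding x(1) Fm by (rule comp_assoc)
    moreover have "r p * r t - r q * r s \<noteq> 0"
      using x(2) by (simp add: r_0 flip: r_add r_mult)
    ultimately show ?thesis unfolding FF T_group_def by auto
  qed
  have Fu: "F (u_elt t x) = u_elt (r t) (F x)" for t x
    using fun_cong[OF Fm[of 1 t 0 1], of x] by (simp add: u_elt_def r_1)
  have Fi: "F (inversion x) = inversion (F x)" for x
    using fun_cong[OF Fm[of 0 1 1 0], of x] by (simp add: inversion_def r_1)
  have FS: "F \<circ> m = m \<circ> F" if "m \<in> S3" for m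
    using that by (auto simp: S3_eq fun_eq_iff Fu Fi r_1)
  have FS': "F' \<circ> m = m \<circ> F'" if "m \<in> S3" for m
  proof -
    have "F' \<circ> (F \<circ> m) \<circ> F' = F' \<circ> (m \<circ> F) \<circ> F'" unfolding FS[OF that] ..
    then have "(F' \<circ> F) \<circ> (m \<circ> F') = F' \<circ> m \<circ> (F \<circ> F')" by (simp only: comp_assoc)
    then show ?thesis by (simp add: FF)
  qed
  have Fu': "F' \<circ> u_elt (r t) = u_elt t \<circ> F'" for t
  proof -
    have "F \<circ> u_elt t = u_elt (r t) \<circ> F" by (simp add: fun_eq_iff Fu)
    then have "F' \<circ> (F \<circ> u_elt t) \<circ> F' = F' \<circ> (u_elt (r t) \<circ> F) \<circ> F'" by simp
    then have "(F' \<circ> F) \<circ> (u_elt t \<circ> F') = F' \<circ> u_elt (r t) \<circ> (F \<circ> F')" by (simp only: comp_assoc)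
    then show ?thesis by (simp add: FF)
  qed
  define \<psi> where "\<psi> = map_prod (map_prod (\<lambda>x. F \<circ> x \<circ> F') (\<lambda>x. F \<circ> x \<circ> F')) (id :: int \<Rightarrow> int)"
  have "inj (\<lambda>x. F \<circ> x \<circ> F')"
  proof (rule injI)
    fix x y assume "F \<circ> x \<circ> F' = F \<circ> y \<circ> F'"
    then have "(F' \<circ> F) \<circ> x \<circ> (F' \<circ> F) = (F' \<circ> F) \<circ> y \<circ> (F' \<circ> F)" by (metis comp_assoc)
    then show "x = y" by (simp add: FF)
  qed
  then have "inj \<psi>" unfolding \<psi>_def by (intro prod.inj_map) simp_all
  then have inj: "inj ((`) \<psi>)" by (simp add: inj_def inj_image_eq_iff)
  have \<psi>G: "\<psi> z \<in> GG" if "z \<in> GG" for z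
    using that by (cases rule: G_cases) (simp_all add: \<psi>_def G_carrier FT)
  have \<psi>d: "\<psi> (diag l \<otimes>\<^bsub>G_group\<^esub> z) = diag l \<otimes>\<^bsub>G_group\<^esub> \<psi> z" if l: "l \<in> S3" for l z
  proof -
    obtain x y k where z: "z = ((x, y), k)" by (metis surj_pair)
    have "F \<circ> (x \<circ> l) \<circ> F' = F \<circ> x \<circ> F' \<circ> l" for x using FS'[OF l] by (simp add: comp_assoc)
    then show ?thesis by (simp add: z \<psi>_def diag_def G_mult)
  qed
  have \<psi>n: "\<psi> (nb \<alpha> m \<otimes>\<^bsub>G_group\<^esub> z) = nb (r \<alpha>) m \<otimes>\<^bsub>G_group\<^esub> \<psi> z" if m: "m \<in> S3" for m z
  proof -
    obtain x y k where z: "z = ((x, y), k)" by (metis surj_pair)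
    have "F \<circ> (x \<circ> (m \<circ> u_elt \<alpha>)) \<circ> F' = F \<circ> x \<circ> F' \<circ> (m \<circ> u_elt (r \<alpha>))" for x
    proof -
      have "F' \<circ> (m \<circ> u_elt (r \<alpha>)) = m \<circ> u_elt \<alpha> \<circ> F'"
        by (simp only: comp_assoc[symmetric] FS'[OF m]) (simp only: comp_assoc Fu')
      then show ?thesis by (simp only: comp_assoc)
    qed
    moreover have "F \<circ> (x \<circ> (m \<circ> u_elt \<alpha> \<circ> B1)) \<circ> F' = F \<circ> x \<circ> F' \<circ> (m \<circ> u_elt (r \<alpha>) \<circ> B1)" for x
    proof -
      have "F' \<circ> (m \<circ> (u_elt (r \<alpha>) \<circ> B1)) = m \<circ> (u_elt \<alpha> \<circ> (B1 \<circ> F'))"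
        by (simp only: comp_assoc[symmetric] FS'[OF m]) (simp only: comp_assoc FS'[OF S3_elems(2), symmetric], simp only: comp_assoc[symmetric] Fu')
      then show ?thesis by (simp only: comp_assoc)
    qed
    ultimately show ?thesis by (simp add: z \<psi>_def nb_def G_mult)
  qed
  have L: "L_subgroup = diag ` S3" using in_L by blast
  have vs: "vx z = (\<lambda>l. diag l \<otimes>\<^bsub>G_group\<^esub> z) ` S3" for z
    unfolding vx_def r_coset_def L UNION_singleton_eq_range image_image ..
  have \<psi>v: "\<psi> ` vx z = vx (\<psi> z)" for z
    unfolding vs image_image by (rule image_cong[OF refl \<psi>d])
  have sub: "(`) \<psi> ` V \<subseteq> V"
  proof (rule image_subsetI)
    fix v assume "v \<in> V"
    then obtain z where "z \<in> GG" "v = vx z" unfolding V_iff by blast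
    then show "\<psi> ` v \<in> V" by (simp add: \<psi>v \<psi>G)
  qed
  have im: "(`) \<psi> ` V = V" by (rule endo_inj_surj[OF finite_V sub inj_on_subset[OF inj subset_UNIV]])
  have "adj (r \<alpha>) (\<psi> ` v) (\<psi> ` w) \<longleftrightarrow> adj \<alpha> v w" for v w
  proof (cases "v \<in> V")
    case True
    then obtain z where z: "z \<in> GG" "v = vx z" unfolding V_iff by blast
    have "\<psi> ` w = vx (nb (r \<alpha>) m \<otimes>\<^bsub>G_group\<^esub> \<psi> z) \<longleftrightarrow> w = vx (nb \<alpha> m \<otimes>\<^bsub>G_group\<^esub> z)" if "m \<in> S3" for m
      unfolding \<psi>n[OF that, symmetric] \<psi>v[symmetric] by (rule inj_eq[OF inj])
    then show ?thesis unfolding z(2) \<psi>v adj_vx_iff[OF z(1)] adj_vx_iff[OF \<psi>G[OF z(1)]] by auto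
  next
    case False
    then have "\<psi> ` v \<notin> V" using im inj by (metis inj_image_mem_iff)
    then show ?thesis using False adj_V[of \<alpha> v w] adj_V[of "r \<alpha>" "\<psi> ` v" "\<psi> ` w"] by blast
  qed
  from digraph_isoI[OF inj im this] show ?thesis unfolding r_def .
qed

end

section \<open>Connectivity\<close>

context binary_field begin

context
  fixes \<alpha> :: 'a
begin

text \<open>The subgroup generated by \<open>L_subgroup\<close> and \<open>g_elt \<alpha>\<close>,
  described by reachability instead of words.\<close>

definition reached :: "'a G_elt set" where
  "reached = {x \<in> GG. (adj \<alpha>)\<^sup>*\<^sup>* (vx \<one>\<^bsub>G_group\<^esub>) (vx x)}"

lemma reach_sym: "(adj \<alpha>)\<^sup>*\<^sup>* v w \<Longrightarrow> (adj \<alpha>)\<^sup>*\<^sup>* w v"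
proof (induction rule: rtranclp_induct)
  case (step y z)
  have "adj \<alpha> z y" by (rule adj_sym[OF step(2) adj_V[OF step(2)]])
  then show ?case by (rule converse_rtranclp_into_rtranclp[OF _ step(3)])
qed (rule rtranclp.rtrancl_refl)

lemma reach_translate:
  assumes r: "(adj \<alpha>)\<^sup>*\<^sup>* (vx x) (vx y)" and G: "x \<in> GG" "y \<in> GG" "z \<in> GG"
  shows "(adj \<alpha>)\<^sup>*\<^sup>* (vx (x \<otimes>\<^bsub>G_group\<^esub> z)) (vx (y \<otimes>\<^bsub>G_group\<^esub> z))"
proof -
  obtain p where p: "p \<in> G2" "\<And>x. x \<in> GG \<Longrightarrow> p (vx x) = vx (x \<otimes>\<^bsub>G_group\<^esub> z)"
    by (rule right_mult_exists[OF G(3)]) blast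
  have "(adj \<alpha>)\<^sup>*\<^sup>* (p v) (p w)" if "(adj \<alpha>)\<^sup>*\<^sup>* v w" for v w
    using that
  proof (induction rule: rtranclp_induct)
    case (step w u)
    show ?case by (rule rtranclp.rtrancl_into_rtrancl[OF step(3) G2_adj_imp[OF p(1) step(2)]])
  qed (rule rtranclp.rtrancl_refl)
  from this[OF r] show ?thesis unfolding p(2)[OF G(1)] p(2)[OF G(2)] .
qed

lemma reached_mult:
  assumes "x \<in> reached" "y \<in> reached" shows "y \<otimes>\<^bsub>G_group\<^esub> x \<in> reached"
proof -
  have x: "x \<in> GG" "(adj \<alpha>)\<^sup>*\<^sup>* (vx \<one>\<^bsub>G_group\<^esub>) (vx x)" and y: "y \<in> GG" "(adj \<alpha>)\<^sup>*\<^sup>* (vx \<one>\<^bsub>G_group\<^esub>) (vx y)"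
    using assms unfolding reached_def by blast+
  have "(adj \<alpha>)\<^sup>*\<^sup>* (vx x) (vx (y \<otimes>\<^bsub>G_group\<^esub> x))" using reach_translate[OF y(2) G.one_closed y(1) x(1)] x by simp
  then show ?thesis unfolding reached_def using x y by (auto intro: rtranclp_trans)
qed

lemma reached_inv:
  assumes "x \<in> reached" shows "inv\<^bsub>G_group\<^esub> x \<in> reached"
proof -
  have x: "x \<in> GG" "(adj \<alpha>)\<^sup>*\<^sup>* (vx \<one>\<^bsub>G_group\<^esub>) (vx x)" using assms unfolding reached_def by blast+
  have "(adj \<alpha>)\<^sup>*\<^sup>* (vx (x \<otimes>\<^bsub>G_group\<^esub> inv\<^bsub>G_group\<^esub> x)) (vx (\<one>\<^bsub>G_group\<^esub> \<otimes>\<^bsub>G_group\<^esub> inv\<^bsub>G_group\<^esub> x))"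
    by (rule reach_translate[OF reach_sym[OF x(2)] x(1)]) (use x in simp_all)
  then show ?thesis unfolding reached_def using x by simp
qed

lemma connected_if_reached:
  assumes "GG \<subseteq> reached" shows "Digraph_Component.connected (Gamma \<alpha>)"
  unfolding connected_iff
proof (intro ballI)
  fix v w assume vw: "v \<in> V" "w \<in> V"
  have "(adj \<alpha>)\<^sup>*\<^sup>* (vx \<one>\<^bsub>G_group\<^esub>) u" if u: "u \<in> V" for u
  proof -
    obtain z where z: "z \<in> GG" "u = vx z" using u unfolding V_iff by blast
    have "z \<in> reached" using z(1) assms by blast
    then show ?thesis unfolding z(2) reached_def by blast
  qed
  from reach_sym[OF this[OF vw(1)]] this[OF vw(2)] show "(adj \<alpha>)\<^sup>*\<^sup>* v w" by (rule rtranclp_trans)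
qed

definition related where "related x y \<longleftrightarrow> x \<in> T \<and> y \<in> T \<and> pair x y \<in> reached"

lemma related_T: "related x y \<Longrightarrow> x \<in> T" "related x y \<Longrightarrow> y \<in> T"
  unfolding related_def by blast+

lemma related_comp:
  assumes "related x y" "related x' y'" shows "related (x \<circ> x') (y \<circ> y')"
proof -
  have "pair x' y' \<otimes>\<^bsub>G_group\<^esub> pair x y \<in> reached"
    by (rule reached_mult) (use assms in \<open>simp_all add: related_def\<close>)
  then show ?thesis using assms unfolding related_def pair_mult by (simp add: T_comp)
qed

lemma related_inv:
  assumes "related x y" shows "related (inv_into UNIV x) (inv_into UNIV y)"
proof -
  have T: "x \<in> T" "y \<in> T" and w: "pair x y \<in> reached" using assms unfolding related_def by blast+
  have T': "inv_into UNIV x \<in> T" "inv_into UNIV y \<in> T" using T_inv T by blast+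
  have "x \<circ> inv_into UNIV x = id" "y \<circ> inv_into UNIV y = id" using T_inv_comp T by blast+
  then have "pair (inv_into UNIV x) (inv_into UNIV y) \<otimes>\<^bsub>G_group\<^esub> pair x y = \<one>\<^bsub>G_group\<^esub>"
    unfolding pair_mult by (simp add: G_one)
  then have "inv\<^bsub>G_group\<^esub> (pair x y) = pair (inv_into UNIV x) (inv_into UNIV y)"
    by (rule G.inv_equality[OF _ pair_GG[OF T] pair_GG[OF T']])
  then show ?thesis using reached_inv[OF w] T' unfolding related_def by simp
qed

lemma related_S3: assumes l: "l \<in> S3" shows "related l l"
proof -
  have lT: "l \<in> T" by (rule S3_in_T[OF l])
  have "vx (diag l) = vx \<one>\<^bsub>G_group\<^esub>" using vx_diag[OF l G.one_closed] lT by simp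
  then have "diag l \<in> reached" unfolding reached_def using lT by simp
  then show ?thesis unfolding related_def using lT by (simp add: diag_def)
qed

lemma nb_reached: "nb \<alpha> id \<in> reached"
proof -
  have "adj \<alpha> (vx \<one>\<^bsub>G_group\<^esub>) (vx (nb \<alpha> id))" unfolding adj_vx_cases[OF G.one_closed] by simp
  then show ?thesis unfolding reached_def by simp
qed

lemma uB: "u_elt t \<circ> (B1 \<circ> k) = u_elt (t + 1) \<circ> k" for t :: 'a and k :: "'a option \<Rightarrow> 'a option"
  by (simp add: comp_assoc[symmetric] u_comp)

text \<open>Conjugation by \<open>g_elt \<alpha>\<close> exchanges the components. The product with
  \<open>g_elt \<alpha>\<close> on both sides differs from the conjugate by \<open>(B1, B1)\<close>,
  which is multiplied back.\<close>

lemma related_conj: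
  assumes "related x y"
  shows "related (u_elt (\<alpha> + 1) \<circ> y \<circ> u_elt (\<alpha> + 1)) (u_elt \<alpha> \<circ> x \<circ> u_elt \<alpha>)"
proof -
  have T: "x \<in> T" "y \<in> T" and w: "pair x y \<in> reached" using assms unfolding related_def by blast+
  have "nb \<alpha> id \<otimes>\<^bsub>G_group\<^esub> pair x y \<otimes>\<^bsub>G_group\<^esub> nb \<alpha> id \<in> reached"
    by (rule reached_mult[OF nb_reached reached_mult[OF w nb_reached]])
  moreover have "nb \<alpha> id \<otimes>\<^bsub>G_group\<^esub> pair x y \<otimes>\<^bsub>G_group\<^esub> nb \<alpha> id =
      pair (u_elt (\<alpha> + 1) \<circ> y \<circ> u_elt \<alpha>) (u_elt \<alpha> \<circ> x \<circ> u_elt (\<alpha> + 1))"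
    by (simp add: nb_def G_mult comp_assoc uB) (simp add: u_comp)
  ultimately have "related (u_elt (\<alpha> + 1) \<circ> y \<circ> u_elt \<alpha>) (u_elt \<alpha> \<circ> x \<circ> u_elt (\<alpha> + 1))"
    unfolding related_def using T by (simp add: T_comp)
  from related_comp[OF this related_S3[OF S3_elems(2)]] show ?thesis
    by (simp add: comp_assoc u_comp add.assoc)
qed

lemma related_normal:
  assumes h: "related h g" and k: "related k id" and h': "h' \<circ> h = id"
  shows "related (h \<circ> k \<circ> h') id"
proof -
  have T: "h \<in> T" "g \<in> T" using h by (rule related_T)+
  have "h' = inv_into UNIV h"
  proof -
    have "h' \<circ> (h \<circ> inv_into UNIV h) = inv_into UNIV h" using h' by (simp add: comp_assoc[symmetric])
    then show ?thesis using T_inv_comp(1)[OF T(1)] by simp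
  qed
  then show ?thesis
    using related_comp[OF related_comp[OF h k] related_inv[OF h]] T_inv_comp(1)[OF T(2)] by simp
qed

context
  assumes prim: "primitive \<alpha>"
begin

text \<open>The first components form a subgroup that contains \<open>S3\<close> and, through
  \<open>related_conj\<close>, the conjugate of \<open>inversion\<close> by
  \<open>u_elt \<alpha>\<close>; \<open>generates_T\<close> applies.\<close>

lemma related_first: assumes "x \<in> T" shows "\<exists>y. related x y"
proof -
  define H where "H = {x. \<exists>y. related x y}"
  have "H = T"
  proof (rule generates_T[OF prim])
    show "H \<subseteq> T" unfolding H_def using related_T(1) by blast
    show "g \<circ> h \<in> H" if "g \<in> H" "h \<in> H" for g h
      using that related_comp unfolding H_def by blast
    show "\<exists>h'\<in>H. h \<circ> h' = id" if h: "h \<in> H" for h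
    proof -
      obtain y where y: "related h y" using h unfolding H_def by blast
      show ?thesis
      proof
        show "inv_into UNIV h \<in> H" using related_inv[OF y] unfolding H_def by blast
        show "h \<circ> inv_into UNIV h = id" by (rule T_inv_comp(1)[OF related_T(1)[OF y]])
      qed
    qed
    show "inversion \<in> H" "B1 \<in> H" unfolding H_def using related_S3 S3_elems by blast+
    \<comment> \<open>\<open>related_conj\<close> conjugates by the translation by
      \<open>\<alpha> + 1\<close>; starting from a conjugate under \<open>B1\<close> shifts this to
      \<open>\<alpha>\<close>.\<close>
    have "B1 \<circ> inversion \<circ> B1 \<in> S3" by (intro S3_comp S3_elems)
    from related_conj[OF related_S3[OF this]]
    have "related (u_elt \<alpha> \<circ> inversion \<circ> u_elt \<alpha>) (u_elt \<alpha> \<circ> (B1 \<circ> inversion \<circ> B1) \<circ> u_elt \<alpha>)"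
      by (simp add: comp_assoc uB) (simp add: u_comp add.assoc)
    then show "u_elt \<alpha> \<circ> inversion \<circ> u_elt \<alpha> \<in> H" unfolding H_def by blast
  qed
  then show ?thesis using assms unfolding H_def by blast
qed

text \<open>Goursat's argument: as the first projection is onto, the \<open>x\<close> related to
  \<open>id\<close> form a normal subgroup of \<open>T\<close>. By simplicity it is
  \<open>T\<close>, and \<open>related_conj\<close> carries it to the second factor.\<close>

lemma related_id_imp:
  assumes nt: "related k id" "k \<noteq> id" and T: "x \<in> T" "y \<in> T" shows "related x y"
proof -
  have "{x. related x id} = T"
  proof (rule normal_subset_T)
    show "{x. related x id} \<subseteq> T" using related_T(1) by blast
    show "g \<circ> h \<in> {x. related x id}" if "g \<in> {x. related x id}" "h \<in> {x. related x id}" for g h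
      using related_comp[of g id h id] that by simp
    show "\<exists>k'\<in>{x. related x id}. k \<circ> k' = id" if k: "k \<in> {x. related x id}" for k
    proof
      have k: "related k id" using k by simp
      show "inv_into UNIV k \<in> {x. related x id}" using related_inv[OF k] by (simp add: inv_id[unfolded id_def] id_def)
      show "k \<circ> inv_into UNIV k = id" by (rule T_inv_comp(1)[OF related_T(1)[OF k]])
    qed
    show "h \<circ> k \<circ> h' \<in> {x. related x id}"
      if k: "k \<in> {x. related x id}" and h: "h \<in> T" "h' \<in> T" "h' \<circ> h = id" for k h h'
    proof -
      obtain g where "related h g" using related_first[OF h(1)] by blast
      from related_normal[OF this _ h(3)] show ?thesis using k by simp
    qed
    show "k \<in> {x. related x id}" "k \<noteq> id" using nt by simp_all
  qed
  then have 1: "related x id" if "x \<in> T" for x using that by blast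
  have "related id y" if y: "y \<in> T" for y
  proof -
    have "u_elt \<alpha> \<circ> y \<circ> u_elt \<alpha> \<in> T" using y by (simp add: T_comp)
    from related_conj[OF 1[OF this]] show ?thesis by (simp add: comp_assoc u_u u_cancel)
  qed
  from related_comp[OF 1[OF T(1)] this[OF T(2)]] show ?thesis by simp
qed

lemma reached_all:
  assumes rel: "\<And>x y. x \<in> T \<Longrightarrow> y \<in> T \<Longrightarrow> related x y" shows "GG \<subseteq> reached"
proof
  fix z :: "'a G_elt" assume "z \<in> GG"
  then show "z \<in> reached"
  proof (cases rule: G_cases)
    case (even x y) then show ?thesis using rel[of x y] unfolding related_def by simp
  next
    case (odd x y)
    have "related (y \<circ> B1 \<circ> u_elt \<alpha>) (x \<circ> u_elt \<alpha>)" by (rule rel) (simp_all add: odd T_comp)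
    then have "nb \<alpha> id \<otimes>\<^bsub>G_group\<^esub> pair (y \<circ> B1 \<circ> u_elt \<alpha>) (x \<circ> u_elt \<alpha>) \<in> reached"
      unfolding related_def by (intro reached_mult nb_reached) simp
    also have "nb \<alpha> id \<otimes>\<^bsub>G_group\<^esub> pair (y \<circ> B1 \<circ> u_elt \<alpha>) (x \<circ> u_elt \<alpha>) = ((x, y), 1)"
      by (simp add: nb_def G_mult comp_assoc u_cancel u_u)
    finally show ?thesis unfolding odd .
  qed
qed

text \<open>With trivial kernels on both sides \<open>related\<close> is the graph of an
  automorphism of \<open>T\<close> fixing \<open>S3\<close>, given on translations by a power of
  Frobenius. Compatibility with \<open>related_conj\<close> makes it send \<open>\<alpha>\<close> to
  \<open>\<alpha> + 1\<close>, so its square fixes the primitive \<open>\<alpha>\<close>.\<close>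

lemma functional_exceptional:
  assumes triv: "\<And>k. related k id \<Longrightarrow> k = id"
  shows "even f \<and> \<alpha> ^ 2 ^ (f div 2) = \<alpha> + 1"
proof -
  have triv2: "y = id" if y: "related id y" for y
  proof -
    have "u_elt (\<alpha> + 1) \<circ> y \<circ> u_elt (\<alpha> + 1) = id" by (rule triv) (use related_conj[OF y] in \<open>simp add: u_u\<close>)
    then have "u_elt (\<alpha> + 1) \<circ> (u_elt (\<alpha> + 1) \<circ> y \<circ> u_elt (\<alpha> + 1)) \<circ> u_elt (\<alpha> + 1) = u_elt (\<alpha> + 1) \<circ> id \<circ> u_elt (\<alpha> + 1)"
      by simp
    then show ?thesis by (simp add: comp_assoc u_u u_cancel)
  qed
  have uniq: "y = y'" if y: "related x y" "related x y'" for x y y'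
  proof -
    have "related (x \<circ> inv_into UNIV x) (y' \<circ> inv_into UNIV y)" by (rule related_comp[OF y(2) related_inv[OF y(1)]])
    then have "related id (y' \<circ> inv_into UNIV y)" unfolding T_inv_comp(1)[OF related_T(1)[OF y(1)]] .
    then have e: "y' \<circ> inv_into UNIV y = id" by (rule triv2)
    have "y' \<circ> (inv_into UNIV y \<circ> y) = y" using e by (simp add: comp_assoc[symmetric])
    then show ?thesis unfolding T_inv_comp(2)[OF related_T(2)[OF y(1)]] by simp
  qed
  have "\<exists>p. related (u_elt t) (u_elt p)" for t
  proof -
    obtain y where y: "related (u_elt t) y" using related_first[OF in_T(1)] by blast
    note B = related_S3[OF S3_elems(2)]
    have "y \<circ> B1 = B1 \<circ> y"
      by (rule uniq[OF related_comp[OF y B]]) (use related_comp[OF B y] in \<open>simp add: u_commute[of t 1]\<close>)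
    then obtain p where "y = u_elt p" by (rule centralizer_u[OF related_T(2)[OF y] one_neq_zero])
    then show ?thesis using y by blast
  qed
  then obtain \<sigma> where \<sigma>: "related (u_elt t) (u_elt (\<sigma> t))" for t by metis
  have add: "\<sigma> (x + y) = \<sigma> x + \<sigma> y" for x y
  proof -
    have "u_elt (\<sigma> (x + y)) = u_elt (\<sigma> x + \<sigma> y)"
      by (rule uniq[OF \<sigma>]) (use related_comp[OF \<sigma>[of x] \<sigma>[of y]] in \<open>simp add: u_comp\<close>)
    then show ?thesis by simp
  qed
  have "u_elt (\<sigma> 1) = B1" by (rule uniq[OF \<sigma> related_S3[OF S3_elems(2)]])
  then have one: "\<sigma> 1 = 1" by simp
  have nz: "\<sigma> t \<noteq> 0" if "t \<noteq> 0" for t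
  proof
    assume "\<sigma> t = 0"
    then have "related (u_elt t) id" using \<sigma>[of t] by (simp add: u_0)
    then have "u_elt t = u_elt 0" unfolding u_0 by (rule triv)
    then show False using that by simp
  qed
  note I = related_S3[OF S3_elems(3)]
  have opp: "related (opposite s) (opposite (\<sigma> s))" for s
    unfolding opposite_def by (intro related_comp I \<sigma>)
  have braid: "u_elt (\<sigma> t) \<circ> opposite (\<sigma> s) \<circ> u_elt (\<sigma> t) = opposite (\<sigma> s) \<circ> u_elt (\<sigma> t) \<circ> opposite (\<sigma> s)"
    if "t * s = 1" for t s
  proof (rule uniq)
    show "related (u_elt t \<circ> opposite s \<circ> u_elt t) (u_elt (\<sigma> t) \<circ> opposite (\<sigma> s) \<circ> u_elt (\<sigma> t))"
      by (intro related_comp \<sigma> opp)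
    show "related (u_elt t \<circ> opposite s \<circ> u_elt t) (opposite (\<sigma> s) \<circ> u_elt (\<sigma> t) \<circ> opposite (\<sigma> s))"
      unfolding braid_relation[OF that] by (intro related_comp \<sigma> opp)
  qed
  obtain i where i: "i < f" "\<sigma> \<alpha> = \<alpha> ^ 2 ^ i" using sigma_conjugate(2)[OF add one nz braid] by blast
  have s1: "\<sigma> (\<alpha> + 1) = \<sigma> \<alpha> + 1" by (simp add: add one)
  \<comment> \<open>The same first component is related to one element by the homomorphism property
    and to another by \<open>related_conj\<close> applied to \<open>inversion\<close>.\<close>
  have "u_elt (\<sigma> (\<alpha> + 1)) \<circ> inversion \<circ> u_elt (\<sigma> (\<alpha> + 1)) = u_elt \<alpha> \<circ> inversion \<circ> u_elt \<alpha>"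
    by (rule uniq[OF _ related_conj[OF I]]) (intro related_comp \<sigma> I)
  from fun_cong[OF this, of None] have "\<sigma> \<alpha> + 1 = \<alpha>" by (simp add: s1)
  then have \<alpha>: "\<alpha> ^ 2 ^ i = \<alpha> + 1" by (simp add: i(2) add_eq_iff)
  have "\<alpha> ^ 2 ^ (i + i) = (\<alpha> ^ 2 ^ i) ^ 2 ^ i" by (simp only: frobenius_frobenius)
  also have "\<dots> = \<alpha>" unfolding \<alpha> frobenius_add by (simp add: \<alpha> add.assoc)
  finally have ii: "\<alpha> ^ 2 ^ (i + i) = \<alpha>" .
  have np: "\<alpha> ^ 2 ^ d \<noteq> \<alpha>" if d: "0 < d" "d < f" for d
    using prim d unfolding primitive_def by (elim allE impE)
  have "i \<noteq> 0"
  proof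
    assume "i = 0"
    with \<alpha> have "\<alpha> = \<alpha> + 1" by simp
    then show False by simp
  qed
  moreover have "\<not> (0 < i + i \<and> i + i < f)" using np[of "i + i"] ii by blast
  ultimately have ge: "f \<le> i + i" by simp
  have "\<alpha> ^ 2 ^ (i + i) = (\<alpha> ^ 2 ^ f) ^ 2 ^ (i + i - f)" by (simp only: frobenius_frobenius le_add_diff_inverse[OF ge])
  then have "\<alpha> ^ 2 ^ (i + i - f) = \<alpha>" unfolding frobenius_card ii by (rule sym)
  then have "\<not> (0 < i + i - f \<and> i + i - f < f)" using np[of "i + i - f"] by blast
  \<comment> \<open>By primitivity \<open>i + i\<close> is a multiple of \<open>f\<close>, and it
    lies strictly between 0 and \<open>2 * f\<close>.\<close>
  then have "f = i + i" using ge i(1) by linarith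
  then show ?thesis using \<alpha> by simp
qed

lemma primitive_connected:
  assumes "\<not> (even f \<and> \<alpha> ^ 2 ^ (f div 2) = \<alpha> + 1)"
  shows "Digraph_Component.connected (Gamma \<alpha>)"
proof -
  obtain k where "related k id" "k \<noteq> id" using functional_exceptional assms by blast
  from related_id_imp[OF this] show ?thesis by (intro connected_if_reached reached_all)
qed

end
end
end

section \<open>Counting\<close>

context binary_field begin

text \<open>The elements are roots of \<open>X ^ 2 ^ d - X - c\<close>, which for
  \<open>d > 0\<close> has degree \<open>2 ^ d\<close>.\<close>

lemma card_frobenius_translate:
  assumes "0 < d" shows "card {x :: 'a. x ^ 2 ^ d = x + c} \<le> 2 ^ d"
proof -
  define p where "p = monom (1 :: 'a) (2 ^ d) - [:c, 1:]"
  have d: "(2::nat) ^ d \<ge> 2" using assms by (cases d) simp_all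
  have "coeff [:c, 1:] (2 ^ d) = 0" by (rule coeff_eq_0) (use d in simp)
  then have "coeff p (2 ^ d) = 1" by (simp add: p_def)
  then have p0: "p \<noteq> 0" by auto
  have "degree p \<le> 2 ^ d" unfolding p_def
    by (intro degree_diff_le degree_monom_le) (use d in simp)
  moreover have "{x. x ^ 2 ^ d = x + c} = {x. poly p x = 0}"
    by (auto simp: p_def poly_monom add.commute)
  ultimately show ?thesis using card_poly_roots_bound[OF p0] by simp
qed

text \<open>A nonprimitive element is fixed by the Frobenius powers with exponents \<open>d\<close>
  and \<open>f - d\<close>, one of which is at most \<open>f div 2\<close>. The fixed sets have at
  most \<open>2 ^ (f div 2 + 1) - 2\<close> elements in total, less than half of the field because
  \<open>f \<ge> 3\<close>.\<close>

lemma card_primitive: "card {\<alpha> :: 'a. primitive \<alpha>} > 2 ^ (f - 1)"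
proof -
  have sub: "{\<alpha> :: 'a. \<not> primitive \<alpha>} \<subseteq> (\<Union>d\<in>{1..f div 2}. {x. x ^ 2 ^ d = x + 0})"
  proof
    fix \<alpha> :: 'a assume "\<alpha> \<in> {\<alpha>. \<not> primitive \<alpha>}"
    then obtain d where d: "0 < d" "d < f" "\<alpha> ^ 2 ^ d = \<alpha>" unfolding primitive_def by blast
    have "\<alpha> ^ 2 ^ (f - d) = (\<alpha> ^ 2 ^ d) ^ 2 ^ (f - d)" using d(3) by simp
    also have "\<dots> = \<alpha>" using d(2) by (simp only: frobenius_frobenius) (simp add: frobenius_card)
    finally have e: "\<alpha> ^ 2 ^ (f - d) = \<alpha>" .
    show "\<alpha> \<in> (\<Union>d\<in>{1..f div 2}. {x. x ^ 2 ^ d = x + 0})"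
    proof (cases "d \<le> f div 2")
      case True then show ?thesis using d by (intro UN_I[of d]) simp_all
    next
      case False
      then have "f - d \<le> f div 2" by presburger
      then show ?thesis using d e by (intro UN_I[of "f - d"]) simp_all
    qed
  qed
  have "card {\<alpha> :: 'a. \<not> primitive \<alpha>} \<le> card (\<Union>d\<in>{1..f div 2}. {x :: 'a. x ^ 2 ^ d = x + 0})"
    by (rule card_mono[OF _ sub]) simp
  also have "\<dots> \<le> (\<Sum>d\<in>{1..f div 2}. card {x :: 'a. x ^ 2 ^ d = x + 0})" by (rule card_UN_le) simp
  also have "\<dots> \<le> (\<Sum>d\<in>{1..f div 2}. 2 ^ d)" by (intro sum_mono card_frobenius_translate) simp
  also have "(\<Sum>d\<in>{1..n}. 2 ^ d) + 2 = (2::nat) ^ (n + 1)" for n by (induction n) simp_all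
  then have "(\<Sum>d\<in>{1..f div 2}. 2 ^ d) = (2::nat) ^ (f div 2 + 1) - 2" by (metis add_diff_cancel_right')
  also have "\<dots> < 2 ^ (f - 1)"
  proof -
    have "f div 2 + 1 \<le> f - 1" using f_ge by presburger
    then have "(2::nat) ^ (f div 2 + 1) \<le> 2 ^ (f - 1)" by (rule power_increasing) simp
    moreover have "(2::nat) ^ (f - 1) > 0" by simp
    ultimately show ?thesis by linarith
  qed
  finally have "card {\<alpha> :: 'a. \<not> primitive \<alpha>} < 2 ^ (f - 1)" .
  moreover have "card {\<alpha> :: 'a. primitive \<alpha>} + card {\<alpha> :: 'a. \<not> primitive \<alpha>} = 2 ^ f"
  proof -
    have "card {\<alpha> :: 'a. primitive \<alpha>} + card {\<alpha> :: 'a. \<not> primitive \<alpha>} =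
        card ({\<alpha> :: 'a. primitive \<alpha>} \<union> {\<alpha> :: 'a. \<not> primitive \<alpha>})"
      by (rule card_Un_disjoint[symmetric]) auto
    also have "{\<alpha> :: 'a. primitive \<alpha>} \<union> {\<alpha> :: 'a. \<not> primitive \<alpha>} = UNIV" by blast
    finally show ?thesis using card_field by simp
  qed
  moreover have "(2::nat) ^ f = 2 * 2 ^ (f - 1)" using f_ge by (cases f) simp_all
  ultimately show ?thesis by linarith
qed

lemma digraph_iso_Gamma_iff:
  fixes \<alpha> \<beta> :: 'a
  assumes "Digraph_Component.connected (Gamma \<beta>)"
  shows "digraph_iso (Gamma \<alpha>) (Gamma \<beta>) \<longleftrightarrow>
    \<beta> \<in> {\<alpha> ^ (2 ^ i) | i. 0 \<le> i \<and> i < f} \<union> {\<alpha> ^ (2 ^ i) + 1 | i. 0 \<le> i \<and> i < f}"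
proof
  assume "digraph_iso (Gamma \<alpha>) (Gamma \<beta>)"
  then obtain \<phi> where "graph_iso \<alpha> \<beta> \<phi>" by (rule digraph_iso_imp)
  from graph_iso_conjugate[OF assms this]
  show "\<beta> \<in> {\<alpha> ^ (2 ^ i) | i. 0 \<le> i \<and> i < f} \<union> {\<alpha> ^ (2 ^ i) + 1 | i. 0 \<le> i \<and> i < f}" by auto
next
  assume "\<beta> \<in> {\<alpha> ^ (2 ^ i) | i. 0 \<le> i \<and> i < f} \<union> {\<alpha> ^ (2 ^ i) + 1 | i. 0 \<le> i \<and> i < f}"
  then obtain i where "\<beta> = \<alpha> ^ 2 ^ i \<or> \<beta> = \<alpha> ^ 2 ^ i + 1" by auto
  then have "Gamma \<beta> = Gamma (\<alpha> ^ 2 ^ i)" using Gamma_add_one[of "\<alpha> ^ 2 ^ i"] by auto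
  then show "digraph_iso (Gamma \<alpha>) (Gamma \<beta>)" using Gamma_frobenius[of \<alpha> i] by simp
qed

lemma card_conjugates:
  "card ({\<alpha> ^ (2 ^ i) | i. 0 \<le> i \<and> i < f} \<union> {\<alpha> ^ (2 ^ i) + 1 | i. 0 \<le> i \<and> i < f}) \<le> 2 * f" for \<alpha> :: 'a
proof -
  have "{\<alpha> ^ (2 ^ i) | i. 0 \<le> i \<and> i < f} = (\<lambda>i. \<alpha> ^ (2 ^ i)) ` {..<f}"
    "{\<alpha> ^ (2 ^ i) + 1 | i. 0 \<le> i \<and> i < f} = (\<lambda>i. \<alpha> ^ (2 ^ i) + 1) ` {..<f}" by auto
  moreover have "card ((\<lambda>i. \<alpha> ^ (2 ^ i)) ` {..<f}) \<le> f" "card ((\<lambda>i. \<alpha> ^ (2 ^ i) + 1) ` {..<f}) \<le> f"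
    using card_image_le[of "{..<f}"] by simp_all
  ultimately show ?thesis using card_Un_le[of "{\<alpha> ^ (2 ^ i) | i. 0 \<le> i \<and> i < f}" "{\<alpha> ^ (2 ^ i) + 1 | i. 0 \<le> i \<and> i < f}"] by simp
qed

text \<open>Parameters are counted instead of graphs, since \<open>\<alpha>\<close> and
  \<open>\<alpha> + 1\<close> give the same graph; the fibre over an isomorphism class is bounded by
  \<open>card_conjugates\<close>.\<close>

lemma card_connected_le:
  "card {\<alpha> :: 'a. Digraph_Component.connected (Gamma \<alpha>)} \<le>
    2 * f * num_iso_classes {Gamma \<alpha> | \<alpha> :: 'a. Digraph_Component.connected (Gamma \<alpha>)}"
proof -
  define C where "C = {\<alpha> :: 'a. Digraph_Component.connected (Gamma \<alpha>)}"
  define S where "S = {Gamma \<alpha> | \<alpha> :: 'a. Digraph_Component.connected (Gamma \<alpha>)}"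
  define R where "R = {(A, B). A \<in> S \<and> B \<in> S \<and> digraph_iso A B}"
  define h where "h \<alpha> = R `` {Gamma \<alpha>}" for \<alpha> :: 'a
  have S: "S = Gamma ` C" unfolding S_def C_def by blast
  have quot: "S // R = h ` C" unfolding quotient_def S h_def by blast
  have fiber: "card {\<beta> \<in> C. h \<beta> = c} \<le> 2 * f" if c: "c \<in> h ` C" for c
  proof -
    obtain \<alpha> where \<alpha>: "\<alpha> \<in> C" "c = h \<alpha>" using c by blast
    have "{\<beta> \<in> C. h \<beta> = c} \<subseteq> {\<alpha> ^ (2 ^ i) | i. 0 \<le> i \<and> i < f} \<union> {\<alpha> ^ (2 ^ i) + 1 | i. 0 \<le> i \<and> i < f}"
    proof
      fix \<beta> assume "\<beta> \<in> {\<beta> \<in> C. h \<beta> = c}"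
      then have \<beta>: "\<beta> \<in> C" "h \<beta> = h \<alpha>" using \<alpha>(2) by auto
      have "Gamma \<beta> \<in> h \<beta>" using \<beta>(1) digraph_iso_refl[of \<beta>] by (simp add: h_def R_def S)
      then have "digraph_iso (Gamma \<alpha>) (Gamma \<beta>)" unfolding \<beta>(2) by (simp add: h_def R_def)
      moreover have "Digraph_Component.connected (Gamma \<beta>)" using \<beta>(1) by (simp add: C_def)
      ultimately show "\<beta> \<in> {\<alpha> ^ (2 ^ i) | i. 0 \<le> i \<and> i < f} \<union> {\<alpha> ^ (2 ^ i) + 1 | i. 0 \<le> i \<and> i < f}"
        using digraph_iso_Gamma_iff by blast
    qed
    from card_mono[OF finite this] card_conjugates show ?thesis by (rule le_trans)
  qed
  have "C = (\<Union>c\<in>h ` C. {\<beta> \<in> C. h \<beta> = c})" by blast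
  then have "card C = card (\<Union>c\<in>h ` C. {\<beta> \<in> C. h \<beta> = c})" by simp
  also have "\<dots> \<le> (\<Sum>c\<in>h ` C. card {\<beta> \<in> C. h \<beta> = c})" by (rule card_UN_le) simp
  also have "\<dots> \<le> of_nat (card (h ` C)) * (2 * f)" by (rule sum_bounded_above[OF fiber])
  finally have "card C \<le> 2 * f * card (S // R)" unfolding quot by (simp add: mult.commute)
  then show ?thesis unfolding num_iso_classes_def C_def[symmetric] S_def[symmetric] R_def[symmetric] .
qed

text \<open>The more than \<open>2 ^ (f - 1)\<close> primitive parameters are divided by the class
  size \<open>2 * f\<close>. For even \<open>f\<close> the at most \<open>2 ^ (f div 2)\<close>
  solutions of \<open>x ^ 2 ^ (f div 2) = x + 1\<close> are discarded first.\<close>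

lemma num_iso_classes_bounds:
  fixes N :: nat
  defines "N \<equiv> num_iso_classes {Gamma \<alpha> | \<alpha> :: 'a. Digraph_Component.connected (Gamma \<alpha>)}"
  shows "odd f \<Longrightarrow> 2 ^ (f - 2) / real f < real N"
    and "even f \<Longrightarrow> (2 ^ (f - 2) - 2 ^ (f div 2 - 1)) / real f < real N"
proof -
  define C where "C = {\<alpha> :: 'a. Digraph_Component.connected (Gamma \<alpha>)}"
  define P where "P = {\<alpha> :: 'a. primitive \<alpha>}"
  have "card C \<le> 2 * f * N" unfolding C_def N_def by (rule card_connected_le)
  then have "real (card C) \<le> real (2 * f * N)" by (rule of_nat_mono)
  then have le: "real (card C) \<le> 2 * real f * real N" by simp
  have P: "real (card P) > 2 * 2 ^ (f - 2)"
  proof -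
    have "f - 1 = Suc (f - 2)" using f_ge by simp
    then have "card P > 2 * 2 ^ (f - 2)" using card_primitive unfolding P_def by simp
    then have "real (2 * 2 ^ (f - 2)) < real (card P)" by (simp only: of_nat_less_iff)
    then show ?thesis by simp
  qed
  have f0: "real f > 0" using f_ge by simp
  show "2 ^ (f - 2) / real f < real N" if odd: "odd f"
  proof -
    have "P \<subseteq> C"
    proof
      fix \<alpha> assume "\<alpha> \<in> P"
      then have "primitive \<alpha>" by (simp add: P_def)
      then have "Digraph_Component.connected (Gamma \<alpha>)" by (rule primitive_connected) (simp add: odd)
      then show "\<alpha> \<in> C" by (simp add: C_def)
    qed
    then have "card P \<le> card C" by (intro card_mono) simp_all
    then have "real (card P) \<le> real (card C)" by simp
    then have "2 ^ (f - 2) < real N * real f" using le P by (simp add: mult_ac)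
    then show ?thesis using f0 by (simp add: pos_divide_less_eq)
  qed
  show "(2 ^ (f - 2) - 2 ^ (f div 2 - 1)) / real f < real N" if "even f"
  proof -
    define E where "E = {x :: 'a. x ^ 2 ^ (f div 2) = x + 1}"
    have "P \<subseteq> C \<union> E"
    proof
      fix \<alpha> assume "\<alpha> \<in> P"
      then have "primitive \<alpha>" by (simp add: P_def)
      then have "Digraph_Component.connected (Gamma \<alpha>)" if "\<alpha> \<notin> E"
        by (rule primitive_connected) (use that in \<open>simp add: E_def\<close>)
      then show "\<alpha> \<in> C \<union> E" by (auto simp: C_def)
    qed
    then have "card P \<le> card (C \<union> E)" by (intro card_mono) simp_all
    also have "\<dots> \<le> card C + card E" by (rule card_Un_le)
    also have "card E \<le> 2 ^ (f div 2)" unfolding E_def by (rule card_frobenius_translate) (use f_ge in simp)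
    finally have "card P \<le> card C + 2 ^ (f div 2)" by simp
    then have "real (card P) \<le> real (card C + 2 ^ (f div 2))" by (simp only: of_nat_le_iff)
    then have "real (card P) \<le> real (card C) + 2 ^ (f div 2)" by simp
    moreover have "f div 2 = Suc (f div 2 - 1)" using f_ge by simp
    then have "(2::real) ^ (f div 2) = 2 * 2 ^ (f div 2 - 1)" by (metis power_Suc)
    ultimately have "2 ^ (f - 2) - 2 ^ (f div 2 - 1) < real N * real f" using le P by (simp add: mult_ac)
    then show ?thesis using f0 by (simp add: pos_divide_less_eq)
  qed
qed

end

theorem proposition8p5:
  fixes f :: nat
  assumes "f \<ge> 3"
    and "CARD('a) = 2 ^ f"
  shows "(\<forall>\<alpha> \<beta> :: 'a::{field,finite}.
            Digraph_Component.connected (Gamma \<alpha>) \<longrightarrow> Digraph_Component.connected (Gamma \<beta>) \<longrightarrow>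
            (digraph_iso (Gamma \<alpha>) (Gamma \<beta>) \<longleftrightarrow>
             \<beta> \<in> {\<alpha> ^ (2 ^ i) | i. 0 \<le> i \<and> i < f} \<union> {\<alpha> ^ (2 ^ i) + 1 | i. 0 \<le> i \<and> i < f}))
       \<and> (odd f \<longrightarrow>
            real (num_iso_classes {Gamma \<alpha> | \<alpha> :: 'a. Digraph_Component.connected (Gamma \<alpha>)})
              > 2 ^ (f - 2) / real f)
       \<and> (even f \<longrightarrow>
            real (num_iso_classes {Gamma \<alpha> | \<alpha> :: 'a. Digraph_Component.connected (Gamma \<alpha>)})
              > (2 ^ (f - 2) - 2 ^ (f div 2 - 1)) / real f)"
proof -
  interpret binary_field "TYPE('a)" f by unfold_locales (rule assms)+
  show ?thesis
    by (intro conjI allI impI) (rule digraph_iso_Gamma_iff num_iso_classes_bounds; assumption)+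
qed

end
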